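(* For all $i,j\in\{0,1,2\}$, the second-order Riesz transform $T_{ij}=X_i\Delta^{-1}X_j$ is bounded from $H^1$ to $L^1$.
   Context: **The group.** $G=\mathbb{R}^2\ltimes\mathbb{R}^+$ is the set $\mathbb{R}^2\times(0,\infty)$ with product $(x_1,x_2,a)\cdot(x_1',x_2',a')=(x_1+a x_1',x_2+a x_2',aa')$ and identity $e=(0,0,1)$. The right Haar measure is $d\rho(x_1,x_2,a)=a^{-1}dx_1dx_2da$; $L^p$ and $\|\cdot\|_p$ are taken with respect to $\rho$. The modular function is $\delta(x_1,x_2,a)=a^{-2}$. $d$ is the left-invariant hyperbolic metric on $G$, and $r(x)=d(x,e)$ is given by $\cosh r(x_1,x_2,a)=\frac{a+a^{-1}+a^{-1}(x_1^2+x_2^2)}{2}$. Convolution is $f*g(x)=\int_G f(xy^{-1})g(y)\,d\rho(y)$. **Hardy space.** A Calderón–Zygmund set is a parallelepiped $R=[b_1-L/2,b_1+L/2]\times[b_2-L/2,b_2+L/2]\times[a e^{-r},a e^{r}]$, where $b_1,b_2\in\mathbb{R}$ and $L>0$, $r>0$, $a\in\mathbb{R}^+$ satisfy $e^2ar\le L<e^8ar$ if $r<1$, and $ae^{2r}\le L<ae^{8r}$ if $r\ge1$. An atom is a function $A\in L^1$ supported in a Calderón–Zygmund set $R$ with $\|A\|_\infty\le\rho(R)^{-1}$ and $\int A\,d\rho=0$. $H^1$ is the space of all $f\in L^1$ of the form $f=\sum_j\lambda_jA_j$ with $A_j$ atoms, $\lambda_j\in\mathbb{C}$, $\sum_j|\lambda_j|<\infty$;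 $\|f\|_{H^1}$ is the infimum of $\sum_j|\lambda_j|$ over such decompositions. **Laplacian and Riesz transforms.** Let $X_0=a\partial_a$, $X_1=a\partial_{x_1}$, $X_2=a\partial_{x_2}$ (left-invariant vector fields) and $\Delta=-(X_0^2+X_1^2+X_2^2)$. The operator $\Delta^{-1}$ is regarded as the convolution operator $f\mapsto f*W$ with $W(x)=\frac{1}{4\pi}\delta^{1/2}(x)\frac{1}{\sinh r(x)}$. Thus $T_{ij}f=X_i\big((X_jf)*W\big)$ for $f\in C_c^\infty(G)$; $T_{ij}$ is known to extend to a bounded operator on $L^2$, still denoted $T_{ij}$. A bounded operator $T$ on $L^2$ is said to be bounded from $H^1$ to $L^1$ if there is a constant $C$ such that $\|Tf\|_1\le C\|f\|_{H^1}$ for all $f\in H^1\cap L^2$. *)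

theory Defs
  imports "HOL-Analysis.Analysis"
begin

type_synonym point = "real \<times> real \<times> real"

text \<open>
  The group is the subset \<open>G\<close> of \<open>point\<close>. Functions on it are functions on \<open>point\<close> whose
  values off \<open>G\<close> are irrelevant, and an element of \<open>L\<^sup>p\<close> is a function taken modulo equality
  \<open>\<rho>\<close>-almost everywhere.
\<close>

definition G :: "point set" where
  "G = {(x1, x2, a). 0 < a}"

definition gmult :: "point \<Rightarrow> point \<Rightarrow> point" (infixl "\<odot>" 70) where
  "p \<odot> q = (case p of (x1, x2, a) \<Rightarrow> case q of (y1, y2, b) \<Rightarrow>
     (x1 + a * y1, x2 + a * y2, a * b))"

definition gone :: point where
  "gone = (0, 0, 1)"

definition ginv :: "point \<Rightarrow> point" where
  "ginv p = (case p of (x1, x2, a) \<Rightarrow> (- x1 / a, - x2 / a, 1 / a))"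

lemma gmult_closed: "p \<in> G \<Longrightarrow> q \<in> G \<Longrightarrow> p \<odot> q \<in> G"
  by (auto simp: G_def gmult_def)

lemma gone_closed: "gone \<in> G"
  by (auto simp: G_def gone_def)

lemma ginv_closed: "p \<in> G \<Longrightarrow> ginv p \<in> G"
  by (auto simp: G_def ginv_def)

lemma gmult_assoc: "(p \<odot> q) \<odot> s = p \<odot> (q \<odot> s)"
  by (auto simp: gmult_def algebra_simps split: prod.splits)

lemma gone_left: "gone \<odot> p = p"
  by (auto simp: gmult_def gone_def split: prod.splits)

lemma gone_right: "p \<odot> gone = p"
  by (auto simp: gmult_def gone_def split: prod.splits)

lemma ginv_left: "p \<in> G \<Longrightarrow> ginv p \<odot> p = gone"
  by (auto simp: G_def gmult_def gone_def ginv_def field_simps)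

lemma ginv_right: "p \<in> G \<Longrightarrow> p \<odot> ginv p = gone"
  by (auto simp: G_def gmult_def gone_def ginv_def field_simps)

text \<open>The right Haar measure \<open>a\<^sup>-\<^sup>1 dx\<^sub>1 dx\<^sub>2 da\<close>, as a measure with space \<open>G\<close>.\<close>

definition rho :: "point measure" where
  "rho = density (restrict_space lborel G) (\<lambda>(x1, x2, a). ennreal (1 / a))"

definition modular :: "point \<Rightarrow> real" where
  "modular p = (case p of (x1, x2, a) \<Rightarrow> 1 / a\<^sup>2)"

definition dist_e :: "point \<Rightarrow> real" where
  "dist_e p = (case p of (x1, x2, a) \<Rightarrow> arcosh ((a + 1 / a + (x1\<^sup>2 + x2\<^sup>2) / a) / 2))"

lemma cosh_dist_e:
  assumes "(x1, x2, a) \<in> G"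
  shows "cosh (dist_e (x1, x2, a)) = (a + 1 / a + (x1\<^sup>2 + x2\<^sup>2) / a) / 2"
    and "0 \<le> dist_e (x1, x2, a)"
proof -
  have a: "a > 0" using assms by (simp add: G_def)
  have "0 \<le> (a - 1)\<^sup>2 / a" using a by simp
  also have "(a - 1)\<^sup>2 / a = a + 1 / a - 2"
    using a by (simp add: field_simps power2_eq_square)
  finally have "2 \<le> a + 1 / a" by simp
  moreover have "0 \<le> (x1\<^sup>2 + x2\<^sup>2) / a" using a by simp
  ultimately have "1 \<le> (a + 1 / a + (x1\<^sup>2 + x2\<^sup>2) / a) / 2" by simp
  then show "cosh (dist_e (x1, x2, a)) = (a + 1 / a + (x1\<^sup>2 + x2\<^sup>2) / a) / 2"
    and "0 \<le> dist_e (x1, x2, a)"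
    by (simp_all add: dist_e_def)
qed

definition Lp :: "real \<Rightarrow> (point \<Rightarrow> complex) set" where
  "Lp p = {f. f \<in> borel_measurable rho \<and> integrable rho (\<lambda>x. cmod (f x) powr p)}"

definition Lp_norm :: "real \<Rightarrow> (point \<Rightarrow> complex) \<Rightarrow> real" where
  "Lp_norm p f = (integral\<^sup>L rho (\<lambda>x. cmod (f x) powr p)) powr (1 / p)"

definition conv :: "(point \<Rightarrow> complex) \<Rightarrow> (point \<Rightarrow> complex) \<Rightarrow> point \<Rightarrow> complex" where
  "conv f g x = integral\<^sup>L rho (\<lambda>y. f (x \<odot> ginv y) * g y)"

definition CZ_set :: "point set \<Rightarrow> bool" where
  "CZ_set R \<longleftrightarrow> (\<exists>b1 b2 L r a :: real. 0 < L \<and> 0 < r \<and> 0 < a \<and>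
     (if r < 1 then exp 2 * a * r \<le> L \<and> L < exp 8 * a * r
      else a * exp (2 * r) \<le> L \<and> L < a * exp (8 * r)) \<and>
     R = {b1 - L / 2..b1 + L / 2} \<times> {b2 - L / 2..b2 + L / 2} \<times> {a * exp (- r)..a * exp r})"

definition atom :: "(point \<Rightarrow> complex) \<Rightarrow> bool" where
  "atom A \<longleftrightarrow> A \<in> Lp 1 \<and>
     (\<exists>R. CZ_set R \<and> (AE x in rho. x \<notin> R \<longrightarrow> A x = 0) \<and>
          (AE x in rho. cmod (A x) \<le> 1 / measure rho R)) \<and>
     integral\<^sup>L rho A = 0"

text \<open>
  The series \<open>f = \<Sum>\<^sub>j \<lambda>\<^sub>j A\<^sub>j\<close> is understood in \<open>L\<^sup>1\<close>. Since zero is an atom,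
  finite sums are included.
\<close>

definition atomic_decomp ::
    "(point \<Rightarrow> complex) \<Rightarrow> (nat \<Rightarrow> complex) \<Rightarrow> (nat \<Rightarrow> point \<Rightarrow> complex) \<Rightarrow> bool" where
  "atomic_decomp f l A \<longleftrightarrow> (\<forall>j. atom (A j)) \<and> summable (\<lambda>j. cmod (l j)) \<and>
     (\<lambda>n. Lp_norm 1 (\<lambda>x. f x - (\<Sum>j<n. l j * A j x))) \<longlonglongrightarrow> 0"

definition H1 :: "(point \<Rightarrow> complex) set" where
  "H1 = {f \<in> Lp 1. \<exists>l A. atomic_decomp f l A}"

definition H1_norm :: "(point \<Rightarrow> complex) \<Rightarrow> real" where
  "H1_norm f = Inf {(\<Sum>j. cmod (l j)) | l A. atomic_decomp f l A}"

definition X0 :: "(point \<Rightarrow> complex) \<Rightarrow> point \<Rightarrow> complex" where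
  "X0 f p = (case p of (x1, x2, a) \<Rightarrow> a *\<^sub>R vector_derivative (\<lambda>t. f (x1, x2, t)) (at a))"

definition X1 :: "(point \<Rightarrow> complex) \<Rightarrow> point \<Rightarrow> complex" where
  "X1 f p = (case p of (x1, x2, a) \<Rightarrow> a *\<^sub>R vector_derivative (\<lambda>t. f (t, x2, a)) (at x1))"

definition X2 :: "(point \<Rightarrow> complex) \<Rightarrow> point \<Rightarrow> complex" where
  "X2 f p = (case p of (x1, x2, a) \<Rightarrow> a *\<^sub>R vector_derivative (\<lambda>t. f (x1, t, a)) (at x2))"

text \<open>Only the indices 0, 1, 2 are meaningful.\<close>

definition X :: "nat \<Rightarrow> (point \<Rightarrow> complex) \<Rightarrow> point \<Rightarrow> complex" where
  "X i = [X0, X1, X2] ! i"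

primrec Ck_on_G :: "nat \<Rightarrow> (point \<Rightarrow> complex) \<Rightarrow> bool" where
  "Ck_on_G 0 f \<longleftrightarrow> continuous_on G f"
| "Ck_on_G (Suc k) f \<longleftrightarrow> (\<forall>p\<in>G. f differentiable at p) \<and>
     (\<forall>v. Ck_on_G k (\<lambda>p. frechet_derivative f (at p) v))"

text \<open>\<open>C\<^sub>c\<^sup>\<infinity>(G)\<close>, with test functions extended by zero off \<open>G\<close>.\<close>

definition test_functions :: "(point \<Rightarrow> complex) set" where
  "test_functions = {f. (\<forall>k. Ck_on_G k f) \<and> (\<exists>K. compact K \<and> K \<subseteq> G \<and> (\<forall>p. p \<notin> K \<longrightarrow> f p = 0))}"

text \<open>The value at the identity, where the kernel is singular, is irrelevant for the convolution.\<close>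

definition W :: "point \<Rightarrow> real" where
  "W x = 1 / (4 * pi) * sqrt (modular x) * (1 / sinh (dist_e x))"

definition Delta_inv :: "(point \<Rightarrow> complex) \<Rightarrow> point \<Rightarrow> complex" where
  "Delta_inv f = conv f (\<lambda>x. complex_of_real (W x))"

definition Riesz2 :: "nat \<Rightarrow> nat \<Rightarrow> (point \<Rightarrow> complex) \<Rightarrow> point \<Rightarrow> complex" where
  "Riesz2 i j f = X i (Delta_inv (X j f))"

definition bounded_L2_operator :: "((point \<Rightarrow> complex) \<Rightarrow> point \<Rightarrow> complex) \<Rightarrow> bool" where
  "bounded_L2_operator T \<longleftrightarrow>
     (\<forall>f\<in>Lp 2. T f \<in> Lp 2) \<and>
     (\<forall>f\<in>Lp 2. \<forall>g\<in>Lp 2. AE x in rho. T (\<lambda>y. f y + g y) x = T f x + T g x) \<and>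
     (\<forall>c. \<forall>f\<in>Lp 2. AE x in rho. T (\<lambda>y. c * f y) x = c * T f x) \<and>
     (\<exists>C. \<forall>f\<in>Lp 2. Lp_norm 2 (T f) \<le> C * Lp_norm 2 f)"

text \<open>
  The operator that \<open>Riesz2 i j\<close>, given on test functions, induces on \<open>L\<^sup>2\<close>; by density of the
  test functions there is at most one such \<open>T\<close> modulo equality almost everywhere.
\<close>

definition L2_extension_Riesz2 ::
    "nat \<Rightarrow> nat \<Rightarrow> ((point \<Rightarrow> complex) \<Rightarrow> point \<Rightarrow> complex) \<Rightarrow> bool" where
  "L2_extension_Riesz2 i j T \<longleftrightarrow> bounded_L2_operator T \<and>
     (\<forall>f\<in>test_functions. AE x in rho. T f x = Riesz2 i j f x)"

definition bounded_H1_L1 :: "((point \<Rightarrow> complex) \<Rightarrow> point \<Rightarrow> complex) \<Rightarrow> bool" where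
  "bounded_H1_L1 T \<longleftrightarrow>
     (\<exists>C. \<forall>f \<in> H1 \<inter> Lp 2. T f \<in> Lp 1 \<and> Lp_norm 1 (T f) \<le> C * H1_norm f)"

end

theory Submission
  imports Defs
begin

text \<open>
  The substitution \<open>z = x y\<^sup>-\<^sup>1\<close> turns \<open>f * W\<close> into integration against the Green kernel
  \<open>1 / (2 \<pi> |x - z| |x - z'|)\<close> with respect to \<open>\<rho>\<close>, where \<open>z'\<close> is the reflection of \<open>z\<close> in the
  boundary plane and \<open>|\<cdot>|\<close> is the Euclidean norm. Hence the kernel \<open>K\<close> of \<open>X\<^sub>i \<Delta>\<^sup>-\<^sup>1 X\<^sub>j\<close> satisfies, at
  heights \<open>a\<close> of \<open>x\<close> and \<open>b\<close> of \<open>z\<close>, the bounds \<open>|K| \<le> C a b |x - z|\<^sup>-\<^sup>4\<close> and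
  \<open>|\<nabla>\<^sub>z K| \<le> C a |x - z|\<^sup>-\<^sup>4\<close>. The factor \<open>a\<close> cancels the density of \<open>\<rho>\<close>, so that only Lebesgue
  integrals of \<open>|x - z|\<^sup>-\<^sup>4\<close> outside balls occur. By the first bound \<open>K\<close> is integrable off the hyperbolic
  unit ball, uniformly in \<open>z\<close>; atoms on Calderon-Zygmund sets that are not small therefore need no cancellation.
  Small sets are comparable with Euclidean balls, and the second bound gives the Hoermander condition.

  Convergence of an atomic decomposition in \<open>L\<^sup>1\<close> does not by itself allow \<open>T\<close> to be applied term by
  term. This is justified by pairing with a test function \<open>\<phi>\<close>, because the formal adjoint
  \<open>X\<^sub>j \<Delta>\<^sup>-\<^sup>1 X\<^sub>i \<phi>\<close> is a bounded function.
\<close>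

section \<open>Preliminaries on the measure\<close>

text \<open>The operator \<open>T\<close> is known only through its values on test functions and an
  L^2 bound, both modulo null sets. Every pointwise formula is therefore proved for test functions
  and carried to bounded Borel functions by a monotone class argument. The kernel cannot be obtained
  by differentiating the Green kernel twice across the diagonal, since |x - z|^-3 is not locally
  integrable: the outer derivative is moved onto the compactly supported function, which settles
  differentiability everywhere, and the kernel formula is claimed only off the support. The factor a
  of X_i cancels the density 1/a of \<rho>, so X_i is skew; with the symmetry of the Green kernel
  the transpose of X_i \<Delta>^-1 X_j is X_j \<Delta>^-1 X_i. Near an atom only the L^2 bound is
  available, and it requires an enlargement of R of measure at most a fixed multiple of \<rho>(R).
  Hyperbolic balls of large radius have no such dilates, because \<rho> grows exponentially; the
  conditions on L and r in a Calderon-Zygmund set are what make an enlarged parallelepiped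
  work.\<close>

declare split_paired_All [simp del] split_paired_Ex [simp del]

lemma G_iff: "z \<in> G \<longleftrightarrow> 0 < snd (snd z)"
  by (cases z) (auto simp: G_def)

lemma open_G: "open G"
proof -
  have "open {z::point. 0 < snd (snd z)}"
    by (intro open_Collect_less continuous_intros)
  moreover have "{z::point. 0 < snd (snd z)} = G" by (auto simp: G_iff)
  ultimately show ?thesis by simp
qed

lemma G_borel [measurable]: "G \<in> sets borel"
  using open_G by simp

lemma height_measurable [measurable]: "(\<lambda>z::point. snd (snd z)) \<in> borel_measurable borel"
  by (intro borel_measurable_continuous_onI continuous_intros)

lemma sets_rho: "sets rho = sets (restrict_space borel G)"
  by (simp add: rho_def sets_restrict_space)

lemma sets_rhoI: "S \<in> sets borel \<Longrightarrow> S \<subseteq> G \<Longrightarrow> S \<in> sets rho"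
  unfolding sets_rho sets_restrict_space by (rule image_eqI[of _ _ S]) auto

lemma space_rho [simp]: "space rho = G"
  by (simp add: rho_def space_restrict_space)

lemma measurable_rho: "borel_measurable rho = borel_measurable (restrict_space lborel G)"
  by (rule measurable_cong_sets) (simp_all add: sets_rho sets_restrict_space)

lemma borel_imp_rho: "f \<in> borel_measurable borel \<Longrightarrow> f \<in> borel_measurable rho"
  by (simp add: measurable_rho measurable_restrict_space1)

lemma rho_measurable_iff:
  fixes f :: "point \<Rightarrow> 'a::real_normed_vector"
  shows "f \<in> borel_measurable rho \<longleftrightarrow> (\<lambda>z. indicator G z *\<^sub>R f z) \<in> borel_measurable borel"
  by (simp add: measurable_rho borel_measurable_restrict_space_iff)

text \<open>An element of L^p is constrained on G only. Cutting it down to a Borel set inside G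
  makes it Borel on the whole space, as the function classes on boxes below require.\<close>

lemma rho_measurable_indicator:
  fixes f :: "point \<Rightarrow> 'a::{second_countable_topology, real_normed_vector}"
  assumes f: "f \<in> borel_measurable rho" and S: "S \<in> sets borel" "S \<subseteq> G"
  shows "(\<lambda>z. indicator S z *\<^sub>R f z) \<in> borel_measurable borel"
proof -
  have "(\<lambda>z. indicator S z *\<^sub>R (indicator G z *\<^sub>R f z)) \<in> borel_measurable borel"
    using f[unfolded rho_measurable_iff] S(1)
    by (rule borel_measurable_scaleR[OF borel_measurable_indicator, rotated])
  moreover have "(\<lambda>z. indicator S z *\<^sub>R (indicator G z *\<^sub>R f z)) = (\<lambda>z. indicator S z *\<^sub>R f z)"
  proof
    fix z show "indicator S z *\<^sub>R (indicator G z *\<^sub>R f z) = indicator S z *\<^sub>R f z"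
      using S(2) by (cases "z \<in> S") auto
  qed
  ultimately show ?thesis by simp
qed

lemma rho_density: "rho = density (restrict_space lborel G) (\<lambda>z. ennreal (1 / snd (snd z)))"
  unfolding rho_def by (simp add: case_prod_unfold)

lemma AE_rho: "(AE z in rho. P z) \<longleftrightarrow> (AE z in lborel. z \<in> G \<longrightarrow> P z)"
proof -
  have m: "(\<lambda>z::point. ennreal (1 / snd (snd z))) \<in> borel_measurable (restrict_space lborel G)"
    by (rule measurable_restrict_space1) measurable
  have "(AE z in rho. P z) \<longleftrightarrow> (AE z in restrict_space lborel G. 0 < ennreal (1 / snd (snd z)) \<longrightarrow> P z)"
    unfolding rho_density by (rule AE_density[OF m])
  also have "\<dots> \<longleftrightarrow> (AE z in lborel. z \<in> G \<longrightarrow> (0 < ennreal (1 / snd (snd z)) \<longrightarrow> P z))"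
    by (rule AE_restrict_space_iff) simp
  also have "\<dots> \<longleftrightarrow> (AE z in lborel. z \<in> G \<longrightarrow> P z)"
    by (rule AE_cong) (auto simp: G_iff)
  finally show ?thesis .
qed

lemma nn_integral_rho:
  assumes f: "f \<in> borel_measurable rho"
  shows "(\<integral>\<^sup>+z. f z \<partial>rho) = (\<integral>\<^sup>+z. indicator G z * ennreal (1 / snd (snd z)) * f z \<partial>lborel)"
proof -
  have m: "(\<lambda>z::point. ennreal (1 / snd (snd z))) \<in> borel_measurable (restrict_space lborel G)"
    by (rule measurable_restrict_space1) measurable
  have "(\<integral>\<^sup>+z. f z \<partial>rho) = (\<integral>\<^sup>+z. ennreal (1 / snd (snd z)) * f z \<partial>restrict_space lborel G)"
    unfolding rho_density by (rule nn_integral_density[OF m f[unfolded measurable_rho]])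
  also have "\<dots> = (\<integral>\<^sup>+z. (ennreal (1 / snd (snd z)) * f z) * indicator G z \<partial>lborel)"
    by (rule nn_integral_restrict_space) simp
  finally show ?thesis by (simp add: ac_simps)
qed

text \<open>The density of \<rho> against Lebesgue measure on all of R^3, zero off G. With it an
  integral over \<rho> is a weighted Lebesgue integral on the full space, where translation
  invariance and Fubini apply directly.\<close>

definition wt :: "point \<Rightarrow> real" where
  "wt z = indicator G z / snd (snd z)"

lemma wt_measurable [measurable]: "wt \<in> borel_measurable borel"
  unfolding wt_def by (intro borel_measurable_divide borel_measurable_indicator) auto

lemma wt_nonneg [simp]: "0 \<le> wt z"
  by (cases "z \<in> G") (auto simp: wt_def G_iff)

lemma wt_G: "z \<in> G \<Longrightarrow> wt z = 1 / snd (snd z)"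
  by (simp add: wt_def)

lemma nn_integral_rho_wt:
  assumes f: "f \<in> borel_measurable rho"
  shows "(\<integral>\<^sup>+z. f z \<partial>rho) = (\<integral>\<^sup>+z. ennreal (wt z) * f z \<partial>lborel)"
proof -
  have "indicator G z * ennreal (1 / snd (snd z)) * f z = ennreal (wt z) * f z" for z
    by (cases "z \<in> G") (simp_all add: wt_def)
  then show ?thesis unfolding nn_integral_rho[OF f] by simp
qed

lemma
  fixes f :: "point \<Rightarrow> 'a::{banach, second_countable_topology}"
  assumes f: "f \<in> borel_measurable rho"
  shows integrable_rho: "integrable rho f \<longleftrightarrow> integrable lborel (\<lambda>z. wt z *\<^sub>R f z)"
    and integral_rho: "(\<integral>z. f z \<partial>rho) = (\<integral>z. wt z *\<^sub>R f z \<partial>lborel)"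
proof -
  have "(\<lambda>z::point. 1 / snd (snd z)) \<in> borel_measurable lborel"
    by (intro borel_measurable_divide) auto
  then have m: "(\<lambda>z::point. 1 / snd (snd z)) \<in> borel_measurable (restrict_space lborel G)"
    by (rule measurable_restrict_space1)
  have fm: "f \<in> borel_measurable (restrict_space lborel G)"
    using f by (simp add: measurable_rho)
  have AE: "AE x in restrict_space lborel G. 0 \<le> 1 / snd (snd x)"
    by (rule AE_I2) (simp add: space_restrict_space G_iff)
  show "integrable rho f \<longleftrightarrow> integrable lborel (\<lambda>z. wt z *\<^sub>R f z)"
    unfolding rho_density integrable_density[OF fm m AE]
    by (subst integrable_restrict_space) (simp_all only: scaleR_scaleR wt_def times_divide_eq_right mult_1_right, simp_all)
  show "(\<integral>z. f z \<partial>rho) = (\<integral>z. wt z *\<^sub>R f z \<partial>lborel)"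
    unfolding rho_density integral_density[OF fm m AE]
    by (subst integral_restrict_space) (simp_all only: scaleR_scaleR wt_def times_divide_eq_right mult_1_right, simp_all)
qed

section \<open>Differentiation under the integral sign and integration by parts\<close>

lemma has_vector_derivative_quotient:
  fixes f :: "real \<Rightarrow> 'a::real_normed_vector"
  shows "(f has_vector_derivative D) (at 0) \<longleftrightarrow> ((\<lambda>t. (1 / t) *\<^sub>R (f t - f 0)) \<longlongrightarrow> D) (at 0)"
proof -
  have "(f has_vector_derivative D) (at 0) \<longleftrightarrow>
      ((\<lambda>h. norm (f (0 + h) - f 0 - h *\<^sub>R D) / norm h) \<longlongrightarrow> 0) (at 0)"
    unfolding has_vector_derivative_def has_derivative_at by (simp add: bounded_linear_scaleR_left)
  also have "\<dots> \<longleftrightarrow> ((\<lambda>t. norm ((1 / t) *\<^sub>R (f t - f 0) - D)) \<longlongrightarrow> 0) (at 0)"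
  proof (rule filterlim_cong[OF refl refl])
    have "norm (f (0 + h) - f 0 - h *\<^sub>R D) / norm h = norm ((1 / h) *\<^sub>R (f h - f 0) - D)" if "h \<noteq> 0" for h
    proof -
      have "(1 / h) *\<^sub>R (f h - f 0) - D = (1 / h) *\<^sub>R (f h - f 0 - h *\<^sub>R D)"
        using that by (simp add: scaleR_diff_right)
      then show ?thesis by (simp only: norm_scaleR) simp
    qed
    then show "\<forall>\<^sub>F h in at 0. norm (f (0 + h) - f 0 - h *\<^sub>R D) / norm h = norm ((1 / h) *\<^sub>R (f h - f 0) - D)"
      by (simp add: eventually_at_filter)
  qed
  also have "\<dots> \<longleftrightarrow> ((\<lambda>t. (1 / t) *\<^sub>R (f t - f 0)) \<longlongrightarrow> D) (at 0)"
    by (simp add: tendsto_norm_zero_iff LIM_zero_iff)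
  finally show ?thesis .
qed

text \<open>The mean value inequality bounds the difference quotients by \<open>w\<close>, so
  dominated convergence applies along every sequence tending to 0. Measurability of
  \<open>F' 0\<close> comes from its being a pointwise limit of measurable quotients.\<close>

lemma has_vector_derivative_integral:
  fixes F F' :: "real \<Rightarrow> 'a \<Rightarrow> complex"
  assumes eps: "\<epsilon> > 0"
    and int: "\<And>t. \<bar>t\<bar> < \<epsilon> \<Longrightarrow> integrable M (F t)"
    and der: "\<And>t y. \<bar>t\<bar> < \<epsilon> \<Longrightarrow> y \<in> space M \<Longrightarrow>
                ((\<lambda>s. F s y) has_vector_derivative F' t y) (at t)"
    and bound: "\<And>t y. \<bar>t\<bar> < \<epsilon> \<Longrightarrow> y \<in> space M \<Longrightarrow> cmod (F' t y) \<le> w y"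
    and w: "integrable M w"
  shows "integrable M (F' 0)"
    and "((\<lambda>t. \<integral>y. F t y \<partial>M) has_vector_derivative (\<integral>y. F' 0 y \<partial>M)) (at 0)"
proof -
  have quot: "cmod (F t y - F 0 y) \<le> \<bar>t\<bar> * w y" if t: "\<bar>t\<bar> < \<epsilon>" and y: "y \<in> space M" for t y
  proof -
    have "cmod (F t y - F 0 y) \<le> w y * norm (t - 0)"
    proof (rule differentiable_bound[where S="{-\<bar>t\<bar>..\<bar>t\<bar>}" and f'="\<lambda>s h. h *\<^sub>R F' s y"])
      fix s assume s: "s \<in> {-\<bar>t\<bar>..\<bar>t\<bar>}"
      then have s': "\<bar>s\<bar> < \<epsilon>" using t by auto
      show "((\<lambda>s. F s y) has_derivative (\<lambda>h. h *\<^sub>R F' s y)) (at s within {-\<bar>t\<bar>..\<bar>t\<bar>})"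
        using der[OF s' y] unfolding has_vector_derivative_def
        by (rule has_derivative_at_withinI)
      show "onorm (\<lambda>h. h *\<^sub>R F' s y) \<le> w y"
        using bound[OF s' y] by (intro onorm_le) (simp add: mult.commute mult_left_mono)
    qed auto
    then show ?thesis by (simp add: mult.commute)
  qed
  define D where "D t y = (1 / t) *\<^sub>R (F t y - F 0 y)" for t y
  have Dlim: "((\<lambda>t. D t y) \<longlongrightarrow> F' 0 y) (at 0)" if "y \<in> space M" for y
    using der[of 0 y] eps that unfolding has_vector_derivative_quotient D_def by simp
  have seq: "integrable M (F' 0) \<and> (\<lambda>n. \<integral>y. D (X n) y \<partial>M) \<longlonglongrightarrow> (\<integral>y. F' 0 y \<partial>M)"
    if X: "X \<longlonglongrightarrow> 0" "\<And>n. X n \<noteq> 0" "\<And>n. \<bar>X n\<bar> < \<epsilon>" for X :: "nat \<Rightarrow> real"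
  proof -
    have Xf: "filterlim X (at 0) sequentially" using X by (simp add: filterlim_at)
    have lim: "(\<lambda>n. D (X n) y) \<longlonglongrightarrow> F' 0 y" if "y \<in> space M" for y
      using filterlim_compose[OF Dlim[OF that] Xf] .
    have meas: "D (X n) \<in> borel_measurable M" for n
      using int[OF X(3)[of n]] int[of 0] eps unfolding D_def by auto
    have meas': "F' 0 \<in> borel_measurable M"
      by (rule borel_measurable_LIMSEQ_metric[OF meas lim])
    have le: "cmod (D (X n) y) \<le> w y" if "y \<in> space M" for n y
    proof -
      have "\<bar>X n\<bar> > 0" using X(2) by simp
      then show ?thesis using quot[OF X(3)[of n] that]
        by (simp only: D_def norm_scaleR) (simp add: divide_le_eq mult.commute)
    qed
    show ?thesis
      using integrable_dominated_convergence[where s="\<lambda>n. D (X n)" and f="F' 0" and w=w, OF meas' meas w]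
        integral_dominated_convergence[where s="\<lambda>n. D (X n)" and f="F' 0" and w=w, OF meas' meas w]
        lim le by (auto intro!: AE_I2)
  qed
  \<comment> \<open>One explicit null sequence inside the punctured interval suffices for the
    integrability of \<open>F' 0\<close>; the limit itself is tested on all sequences
    afterwards.\<close>
  define X where "X n = (\<epsilon> / 2) * inverse (real (Suc n))" for n
  have "X \<longlonglongrightarrow> 0"
    unfolding X_def by (rule tendsto_mult_right_zero) (rule LIMSEQ_inverse_real_of_nat)
  moreover have "X n \<noteq> 0" "\<bar>X n\<bar> < \<epsilon>" for n
  proof -
    have "inverse (real (Suc n)) \<le> 1" by (simp add: field_simps)
    then have "X n \<le> (\<epsilon> / 2) * 1" unfolding X_def using eps by (intro mult_left_mono) auto
    moreover have "X n > 0" using eps by (simp add: X_def)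
    ultimately show "X n \<noteq> 0" "\<bar>X n\<bar> < \<epsilon>" using eps by auto
  qed
  ultimately have "integrable M (F' 0)" using seq[of X] by blast
  then show "integrable M (F' 0)" .
  have "((\<lambda>t. \<integral>y. D t y \<partial>M) \<longlongrightarrow> (\<integral>y. F' 0 y \<partial>M)) (at 0 within {-\<epsilon><..<\<epsilon>})"
    unfolding tendsto_at_iff_sequentially comp_def proof (intro allI impI)
    fix X :: "nat \<Rightarrow> real" assume X: "\<forall>i. X i \<in> {-\<epsilon><..<\<epsilon>} - {0}" "X \<longlonglongrightarrow> 0"
    have "X n \<noteq> 0" "\<bar>X n\<bar> < \<epsilon>" for n using X(1)[rule_format, of n] by auto
    then show "(\<lambda>n. \<integral>y. D (X n) y \<partial>M) \<longlonglongrightarrow> (\<integral>y. F' 0 y \<partial>M)" using seq[OF X(2)] by blast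
  qed
  then have "((\<lambda>t. \<integral>y. D t y \<partial>M) \<longlongrightarrow> (\<integral>y. F' 0 y \<partial>M)) (at 0)"
    using eps by (simp add: at_within_open[of 0 "{-\<epsilon><..<\<epsilon>}"])
  moreover have "\<forall>\<^sub>F t in at 0. (\<integral>y. D t y \<partial>M) = (1 / t) *\<^sub>R ((\<integral>y. F t y \<partial>M) - (\<integral>y. F 0 y \<partial>M))"
    unfolding eventually_at using eps int by (intro exI[of _ \<epsilon>]) (auto simp: D_def[abs_def])
  ultimately show "((\<lambda>t. \<integral>y. F t y \<partial>M) has_vector_derivative (\<integral>y. F' 0 y \<partial>M)) (at 0)"
    unfolding has_vector_derivative_quotient by (simp cong: tendsto_cong)
qed

lemma zero_outside_derivative:
  fixes H :: "'a::euclidean_space \<Rightarrow> complex"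
  assumes K: "compact K" and H0: "\<And>z. z \<notin> K \<Longrightarrow> H z = 0" and z: "z \<notin> K"
  shows "((\<lambda>t. H (z + t *\<^sub>R e)) has_vector_derivative 0) (at 0)"
proof -
  have "open (- K)" using K by (simp add: compact_imp_closed open_Compl)
  then have "open ((\<lambda>t::real. z + t *\<^sub>R e) -` (- K))"
    by (rule open_vimage) (intro continuous_intros)
  then show ?thesis
    using z H0
    by (intro has_vector_derivative_transform_within_open[OF has_vector_derivative_const[of 0]]) auto
qed

text \<open>Translation invariance replaces Fubini in the integration by parts.\<close>

lemma integral_directional_derivative_zero:
  fixes H H' :: "'a::euclidean_space \<Rightarrow> complex"
  assumes K: "compact K" and H0: "\<And>z. z \<notin> K \<Longrightarrow> H z = 0"
    and der: "\<And>z. ((\<lambda>t. H (z + t *\<^sub>R e)) has_vector_derivative H' z) (at 0)"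
    and bH: "\<And>z. cmod (H z) \<le> M" and bH': "\<And>z. cmod (H' z) \<le> M"
    and meas: "H \<in> borel_measurable borel"
  shows "integrable lborel H'" "(\<integral>z. H' z \<partial>lborel) = 0"
proof -
  obtain r where r: "r > 0" "\<And>z. z \<in> K \<Longrightarrow> norm z \<le> r"
    using compact_imp_bounded[OF K] unfolding bounded_pos by blast
  \<comment> \<open>\<open>B\<close> contains every z for which z + t e lies in K for some |t| \<le>
    1, so it supports all the shifted integrands at once.\<close>
  define B where "B = cball (0::'a) (r + norm e)"
  have inB: "z \<in> B" if "z + t *\<^sub>R e \<in> K" "\<bar>t\<bar> \<le> 1" for z t
  proof -
    have "norm z \<le> norm (z + t *\<^sub>R e) + norm (t *\<^sub>R e)"
      by (metis add_diff_cancel_right' norm_triangle_ineq4)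
    also have "\<dots> \<le> r + norm e"
      using r(2)[OF that(1)] that(2) by (intro add_mono) (auto simp: mult_left_le_one_le)
    finally show ?thesis by (simp add: B_def)
  qed
  have M: "0 \<le> M" using norm_ge_zero bH order_trans by blast
  have indB: "integrable lborel (\<lambda>z. M * indicator B z)"
    unfolding B_def
    by (intro integrable_mult_right integrable_real_indicator emeasure_bounded_finite) auto
  have der': "((\<lambda>s. H (z + s *\<^sub>R e)) has_vector_derivative H' (z + t *\<^sub>R e)) (at t)" for z t
  proof -
    have "((\<lambda>s. H ((z + t *\<^sub>R e) + (s - t) *\<^sub>R e)) has_vector_derivative 1 *\<^sub>R H' (z + t *\<^sub>R e)) (at t)"
      by (rule vector_diff_chain_at[of "\<lambda>s. s - t" 1 t "\<lambda>s. H ((z + t *\<^sub>R e) + s *\<^sub>R e)", unfolded o_def])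
        (auto intro!: derivative_eq_intros der)
    then show ?thesis by (simp add: algebra_simps)
  qed
  have H'0: "H' z = 0" if "z \<notin> K" for z
  proof -
    have "((\<lambda>t. H (z + t *\<^sub>R e)) has_vector_derivative 0) (at 0)"
      by (rule zero_outside_derivative[OF K H0 that])
    with der show ?thesis by (rule vector_derivative_unique_at)
  qed
  have trans: "(\<integral>z. H (z + t *\<^sub>R e) \<partial>lborel) = (\<integral>z. H z \<partial>lborel)" for t
  proof -
    have "(\<integral>z. H z \<partial>lborel) = (\<integral>z. H z \<partial>distr lborel borel ((+) (t *\<^sub>R e)))"
      by (simp add: lborel_distr_plus)
    also have "\<dots> = (\<integral>z. H (t *\<^sub>R e + z) \<partial>lborel)"
      by (rule integral_distr) (use meas in auto)
    finally show ?thesis by (simp add: add.commute)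
  qed
  have intF: "integrable lborel (\<lambda>z. H (z + t *\<^sub>R e))" if "\<bar>t\<bar> < 1" for t
  proof (rule Bochner_Integration.integrable_bound[OF indB])
    show "(\<lambda>z. H (z + t *\<^sub>R e)) \<in> borel_measurable lborel"
      using meas by (intro measurable_compose[OF _ meas]) auto
    have "cmod (H (z + t *\<^sub>R e)) \<le> norm (M * indicator B z)" for z
      using inB[of z t] that H0[of "z + t *\<^sub>R e"] bH[of "z + t *\<^sub>R e"] M by (cases "z \<in> B") auto
    then show "AE z in lborel. cmod (H (z + t *\<^sub>R e)) \<le> norm (M * indicator B z)" by simp
  qed
  have bnd: "cmod (H' (z + t *\<^sub>R e)) \<le> M * indicator B z" if "\<bar>t\<bar> < 1" for z t
    using inB[of z t] that H'0[of "z + t *\<^sub>R e"] bH'[of "z + t *\<^sub>R e"] M by (cases "z \<in> B") auto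
  note L = has_vector_derivative_integral[where F="\<lambda>t z. H (z + t *\<^sub>R e)" and F'="\<lambda>t z. H' (z + t *\<^sub>R e)"
      and M=lborel and \<epsilon>=1 and w="\<lambda>z. M * indicator B z", OF _ intF der' bnd indB]
  show "integrable lborel H'" using L(1) by simp
  have "((\<lambda>t. \<integral>z. H z \<partial>lborel) has_vector_derivative (\<integral>z. H' z \<partial>lborel)) (at 0)"
    using L(2) by (simp add: trans)
  then show "(\<integral>z. H' z \<partial>lborel) = 0"
    using vector_derivative_unique_at has_vector_derivative_const by blast
qed

text \<open>The product of g and F vanishes off K, so its directional derivative has integral zero,
  and F needs control on K only. This matters because potentials are controlled only on G, with
  bounds that degenerate at the boundary.\<close>

lemma integration_by_parts_directional:
  fixes g g' F F' :: "'a::euclidean_space \<Rightarrow> complex"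
  assumes K: "compact K" and g0: "\<And>z. z \<notin> K \<Longrightarrow> g z = 0"
    and dg: "\<And>z. ((\<lambda>t. g (z + t *\<^sub>R e)) has_vector_derivative g' z) (at 0)"
    and bg: "\<And>z. cmod (g z) \<le> M" and bg': "\<And>z. cmod (g' z) \<le> M"
    and mg: "g \<in> borel_measurable borel" and mg': "g' \<in> borel_measurable borel"
    and dF: "\<And>z. z \<in> K \<Longrightarrow> ((\<lambda>t. F (z + t *\<^sub>R e)) has_vector_derivative F' z) (at 0)"
    and bF: "\<And>z. z \<in> K \<Longrightarrow> cmod (F z) \<le> N" and bF': "\<And>z. z \<in> K \<Longrightarrow> cmod (F' z) \<le> N"
    and mF: "(\<lambda>z. indicator K z *\<^sub>R F z) \<in> borel_measurable borel"
  shows "integrable lborel (\<lambda>z. g' z * F z)" "integrable lborel (\<lambda>z. g z * F' z)"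
    "(\<integral>z. g' z * F z \<partial>lborel) = - (\<integral>z. g z * F' z \<partial>lborel)"
proof -
  have g'0: "g' z = 0" if "z \<notin> K" for z
  proof -
    have "((\<lambda>t. g (z + t *\<^sub>R e)) has_vector_derivative 0) (at 0)"
      by (rule zero_outside_derivative[OF K g0 that])
    with dg show ?thesis by (rule vector_derivative_unique_at)
  qed
  have M0: "0 \<le> M" using norm_ge_zero bg order_trans by blast
  define N' where "N' = max N 0"
  have N: "0 \<le> N'" "\<And>z. z \<in> K \<Longrightarrow> cmod (F z) \<le> N'" "\<And>z. z \<in> K \<Longrightarrow> cmod (F' z) \<le> N'"
    using bF bF' by (auto simp: N'_def intro: max.coboundedI1)
  define H where "H z = g z * F z" for z
  define H' where "H' z = g' z * F z + g z * F' z" for z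
  have der: "((\<lambda>t. H (z + t *\<^sub>R e)) has_vector_derivative H' z) (at 0)" for z
  proof (cases "z \<in> K")
    case True
    show ?thesis using has_vector_derivative_mult[OF dg[of z] dF[OF True]]
      by (simp add: H_def H'_def add.commute)
  next
    case False
    have "((\<lambda>t. H (z + t *\<^sub>R e)) has_vector_derivative 0) (at 0)"
      by (rule zero_outside_derivative[OF K _ False]) (simp add: H_def g0)
    then show ?thesis using False g0 g'0 by (simp add: H'_def)
  qed
  have p: "cmod (u * v) \<le> M * N'" if "cmod u \<le> M" "cmod v \<le> N'" for u v
    unfolding norm_mult using that M0 by (intro mult_mono) auto
  have b1: "cmod (g' z * F z) \<le> M * N'" and b2: "cmod (g z * F' z) \<le> M * N'"
    and b3: "cmod (g z * F z) \<le> M * N'" for z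
    using p[OF bg'[of z] N(2)[of z]] p[OF bg[of z] N(3)[of z]] p[OF bg[of z] N(2)[of z]] g0[of z] g'0[of z] M0 N(1)
    by (cases "z \<in> K"; simp)+
  have bH: "cmod (H z) \<le> 2 * (M * N')" and bH': "cmod (H' z) \<le> 2 * (M * N')" for z
    using b1[of z] b2[of z] b3[of z] M0 N(1) norm_triangle_ineq[of "g' z * F z" "g z * F' z"]
    by (auto simp: H_def H'_def intro: order_trans)
  have "H = (\<lambda>z. g z * (indicator K z *\<^sub>R F z))"
    using g0 by (auto simp: H_def indicator_def)
  then have mH: "H \<in> borel_measurable borel" using borel_measurable_times[OF mg mF] by (simp only:)
  have m1: "(\<lambda>z. g' z * F z) \<in> borel_measurable borel"
  proof -
    have "(\<lambda>z. g' z * F z) = (\<lambda>z. g' z * (indicator K z *\<^sub>R F z))"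
      using g'0 by (auto simp: indicator_def)
    then show ?thesis using borel_measurable_times[OF mg' mF] by (simp only:)
  qed
  have L: "integrable lborel H'" "(\<integral>z. H' z \<partial>lborel) = 0"
    using integral_directional_derivative_zero[OF K, of H e H' "2 * (M * N')"] der bH bH' mH g0
    by (auto simp: H_def)
  show i1: "integrable lborel (\<lambda>z. g' z * F z)"
  proof (rule Bochner_Integration.integrable_bound)
    show "integrable lborel (\<lambda>z. (M * N') * indicator K z)"
      using K by (intro integrable_mult_right integrable_real_indicator) (use emeasure_compact_finite[OF K] in \<open>auto simp: compact_imp_closed\<close>)
    show "AE z in lborel. cmod (g' z * F z) \<le> norm (M * N' * indicator K z)"
    proof (rule AE_I2)
      fix z show "cmod (g' z * F z) \<le> norm (M * N' * indicator K z)"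
        using b1[of z] g'0[of z] by (cases "z \<in> K") auto
    qed
  qed (use m1 in simp)
  have eq: "(\<lambda>z. g z * F' z) = (\<lambda>z. H' z - g' z * F z)" by (auto simp: H'_def)
  show "integrable lborel (\<lambda>z. g z * F' z)" unfolding eq using L(1) i1 by simp
  show "(\<integral>z. g' z * F z \<partial>lborel) = - (\<integral>z. g z * F' z \<partial>lborel)"
    unfolding eq using L i1 by simp
qed

section \<open>Size of the singular integrals\<close>

lemma emeasure_ball_le:
  "\<exists>\<kappa>>0. \<forall>(z::point) s. 0 \<le> s \<longrightarrow> emeasure lborel (cball z s) \<le> ennreal (\<kappa> * s ^ 3)"
proof (intro exI conjI allI impI)
  show "unit_ball_vol 3 > (0::real)" by simp
  fix z :: point and s :: real assume "0 \<le> s"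
  then show "emeasure lborel (cball z s) \<le> ennreal (unit_ball_vol 3 * s ^ 3)"
    by (simp add: emeasure_cball numeral_3_eq_3)
qed

lemma term_le_suminf_ennreal: "f m \<le> suminf f" for f :: "nat \<Rightarrow> ennreal"
  using sum_le_suminf[of f "{m}"] by simp

lemma inverse_norm_measurable [measurable]:
  "(\<lambda>x::point. ennreal (1 / norm (x - z) ^ k)) \<in> borel_measurable borel"
  "(\<lambda>x::point. ennreal (1 / norm (x - z))) \<in> borel_measurable borel"
  by (intro measurable_compose[OF _ measurable_ennreal] borel_measurable_divide borel_measurable_power
      borel_measurable_norm borel_measurable_diff; simp)+

text \<open>Dyadic shells: on 2^-(m+1) < |x - z| \<le> 2^-m the integrand is at most 2 * 2^m, while
  the ball of radius 2^-m has volume of order 2^-3m, so the terms sum like 4^-k. At x = z the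
  integrand is 0, since division by zero gives 0.\<close>

lemma nn_integral_inverse_norm_ball:
  "\<exists>C>0. \<forall>z::point. (\<integral>\<^sup>+x. ennreal (1 / norm (x - z)) * indicator (cball z 1) x \<partial>lborel) \<le> ennreal C"
proof -
  obtain \<kappa> where \<kappa>: "\<kappa> > 0" "\<And>(z::point) s. 0 \<le> s \<Longrightarrow> emeasure lborel (cball z s) \<le> ennreal (\<kappa> * s ^ 3)"
    using emeasure_ball_le by blast
  define c where "c k = 2 * (1 / 4) ^ k * \<kappa>" for k :: nat
  have "summable (\<lambda>k. c k)" unfolding c_def by (intro summable_mult summable_mult2 summable_geometric) auto
  moreover have c0: "0 \<le> c k" for k using \<kappa> by (simp add: c_def)
  ultimately have sumc: "(\<Sum>k. ennreal (c k)) = ennreal (\<Sum>k. c k)" "0 \<le> (\<Sum>k. c k)"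
    by (auto simp: suminf_ennreal2 suminf_nonneg)
  show ?thesis
  proof (intro exI[of _ "(\<Sum>k. c k) + 1"] conjI allI)
    show "0 < (\<Sum>k. c k) + 1" using sumc(2) by simp
    fix z :: point
    have pt: "ennreal (1 / norm (x - z)) * indicator (cball z 1) x
        \<le> (\<Sum>k. ennreal (2 * 2 ^ k) * indicator (cball z ((1/2) ^ k)) x)" for x
    proof (cases "x \<in> cball z 1 \<and> x \<noteq> z")
      case True
      define d where "d = norm (x - z)"
      have d: "0 < d" "d \<le> 1" using True by (auto simp: d_def dist_norm norm_minus_commute)
      have "\<exists>n. (1/2) ^ n < d" using d real_arch_pow_inv[of d "1/2"] by simp
      \<comment> \<open>Minimality of n places |x - z| in the shell with index m = n - 1.\<close>
      define n where "n = (LEAST n. (1/2) ^ n < d)"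
      have n: "(1/2) ^ n < d" unfolding n_def using LeastI_ex[OF \<open>\<exists>n. (1/2) ^ n < d\<close>] .
      have "n \<noteq> 0" using n d by (auto simp: not_less intro: ccontr)
      then obtain m where m: "n = Suc m" by (cases n) auto
      have m': "d \<le> (1/2) ^ m"
        using not_less_Least[of m "\<lambda>n. (1/2) ^ n < d"] m unfolding n_def by (auto simp: not_less)
      have "1 / d \<le> 2 * 2 ^ m"
        using n d m by (simp add: field_simps power_one_over)
      then have "ennreal (1 / norm (x - z)) * indicator (cball z 1) x
          \<le> ennreal (2 * 2 ^ m) * indicator (cball z ((1/2) ^ m)) x"
        using True m' by (auto simp: d_def dist_norm norm_minus_commute indicator_def intro!: ennreal_leI)
      also have "\<dots> \<le> (\<Sum>k. ennreal (2 * 2 ^ k) * indicator (cball z ((1/2) ^ k)) x)"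
        by (rule term_le_suminf_ennreal[where f="\<lambda>k. ennreal (2 * 2 ^ k) * indicator (cball z ((1/2) ^ k)) x"])
      finally show ?thesis .
    qed auto
    have "(\<integral>\<^sup>+x. ennreal (1 / norm (x - z)) * indicator (cball z 1) x \<partial>lborel)
        \<le> (\<integral>\<^sup>+x. (\<Sum>k. ennreal (2 * 2 ^ k) * indicator (cball z ((1/2) ^ k)) x) \<partial>lborel)"
      by (rule nn_integral_mono) (rule pt)
    also have "\<dots> = (\<Sum>k. \<integral>\<^sup>+x. ennreal (2 * 2 ^ k) * indicator (cball z ((1/2) ^ k)) x \<partial>lborel)"
      by (rule nn_integral_suminf)
        (intro borel_measurable_times_ennreal borel_measurable_const borel_measurable_indicator, simp)
    also have "\<dots> = (\<Sum>k. ennreal (2 * 2 ^ k) * emeasure lborel (cball z ((1/2) ^ k)))"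
      by (simp add: nn_integral_cmult_indicator)
    also have "\<dots> \<le> (\<Sum>k. ennreal (c k))"
    proof (rule suminf_le)
      fix k
      have "ennreal (2 * 2 ^ k) * emeasure lborel (cball z ((1/2) ^ k))
          \<le> ennreal (2 * 2 ^ k) * ennreal (\<kappa> * ((1/2) ^ k) ^ 3)"
        by (intro mult_left_mono \<kappa>(2)) auto
      also have "\<dots> = ennreal (c k)"
      proof -
        have "(2::real) ^ k * ((1/2) ^ k) ^ 3 = (2 * (1/2) ^ 3) ^ k"
          by (simp only: power_mult_distrib power_mult[symmetric]) (simp add: mult.commute)
        also have "2 * (1/2) ^ 3 = (1/4 :: real)" by (simp add: power3_eq_cube)
        finally have "(2 * 2 ^ k) * (\<kappa> * ((1/2) ^ k) ^ 3) = c k"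
          by (simp add: c_def mult.assoc mult.left_commute mult.commute)
        then show ?thesis by (simp add: ennreal_mult''[symmetric] \<kappa>(1) less_imp_le)
      qed
      finally show "ennreal (2 * 2 ^ k) * emeasure lborel (cball z ((1/2) ^ k)) \<le> ennreal (c k)" .
    qed auto
    also have "\<dots> \<le> ennreal ((\<Sum>k. c k) + 1)"
      by (simp add: sumc(1) ennreal_leI)
    finally show "(\<integral>\<^sup>+x. ennreal (1 / norm (x - z)) * indicator (cball z 1) x \<partial>lborel) \<le> ennreal ((\<Sum>k. c k) + 1)" .
  qed
qed

text \<open>Dyadic shells again, now outward: up to the constant \<kappa>, the shell starting at 2^k
  s contributes (2^(k+1) s)^3 / (2^k s)^4 = 8 / (2^k s). The exact scaling 1 / s is what later
  cancels the size of the set carrying an atom.\<close>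

lemma nn_integral_inverse_norm_4:
  "\<exists>C>0. \<forall>(z::point) s. 0 < s \<longrightarrow>
     (\<integral>\<^sup>+x. ennreal (1 / norm (x - z) ^ 4) * indicator (- ball z s) x \<partial>lborel) \<le> ennreal (C / s)"
proof -
  obtain \<kappa> where \<kappa>: "\<kappa> > 0" "\<And>(z::point) s. 0 \<le> s \<Longrightarrow> emeasure lborel (cball z s) \<le> ennreal (\<kappa> * s ^ 3)"
    using emeasure_ball_le by blast
  define c where "c k = 8 * (1 / 2) ^ k * \<kappa>" for k :: nat
  have sm: "summable (\<lambda>k. c k)" unfolding c_def by (intro summable_mult summable_mult2 summable_geometric) auto
  moreover have c0: "0 \<le> c k" for k using \<kappa> by (simp add: c_def)
  ultimately have sumc: "0 \<le> (\<Sum>k. c k)"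
    by (auto simp: suminf_nonneg)
  show ?thesis
  proof (intro exI[of _ "(\<Sum>k. c k) + 1"] conjI allI impI)
    show "0 < (\<Sum>k. c k) + 1" using sumc by simp
    fix z :: point and s :: real assume s: "0 < s"
    have sumcs: "(\<Sum>k. ennreal (c k / s)) = ennreal ((\<Sum>k. c k) / s)"
      using s c0 sm by (subst suminf_ennreal2) (auto simp: suminf_divide intro!: summable_divide)
    have pt: "ennreal (1 / norm (x - z) ^ 4) * indicator (- ball z s) x
        \<le> (\<Sum>k. ennreal (1 / (2 ^ k * s) ^ 4) * indicator (cball z (2 ^ Suc k * s)) x)" for x
    proof (cases "x \<in> - ball z s")
      case True
      define d where "d = norm (x - z)"
      have d: "s \<le> d" using True by (auto simp: d_def dist_norm norm_minus_commute not_less)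
      have "\<exists>n. d / s < 2 ^ n" using real_arch_pow[of 2 "d / s"] by simp
      define n where "n = (LEAST n. d / s < 2 ^ n)"
      have n: "d / s < 2 ^ n" unfolding n_def using LeastI_ex[OF \<open>\<exists>n. d / s < 2 ^ n\<close>] .
      have "n \<noteq> 0" using n d s by (auto simp: field_simps intro: ccontr)
      then obtain m where m: "n = Suc m" by (cases n) auto
      have m': "2 ^ m \<le> d / s"
        using not_less_Least[of m "\<lambda>n. d / s < 2 ^ n"] m unfolding n_def by (auto simp: not_less)
      have m'': "2 ^ m * s \<le> d" using m' s by (simp add: field_simps)
      have "1 / d ^ 4 \<le> 1 / (2 ^ m * s) ^ 4"
        using m'' s d by (intro divide_left_mono power_mono mult_pos_pos zero_less_power) auto
      moreover have "d \<le> 2 ^ Suc m * s" using n s m by (simp add: field_simps)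
      ultimately have "ennreal (1 / norm (x - z) ^ 4) * indicator (- ball z s) x
          \<le> ennreal (1 / (2 ^ m * s) ^ 4) * indicator (cball z (2 ^ Suc m * s)) x"
        using True by (auto simp: d_def dist_norm norm_minus_commute indicator_def intro!: ennreal_leI)
      also have "\<dots> \<le> (\<Sum>k. ennreal (1 / (2 ^ k * s) ^ 4) * indicator (cball z (2 ^ Suc k * s)) x)"
        by (rule term_le_suminf_ennreal[where
              f="\<lambda>k. ennreal (1 / (2 ^ k * s) ^ 4) * indicator (cball z (2 ^ Suc k * s)) x"])
      finally show ?thesis .
    qed auto
    have "(\<integral>\<^sup>+x. ennreal (1 / norm (x - z) ^ 4) * indicator (- ball z s) x \<partial>lborel)
        \<le> (\<integral>\<^sup>+x. (\<Sum>k. ennreal (1 / (2 ^ k * s) ^ 4) * indicator (cball z (2 ^ Suc k * s)) x) \<partial>lborel)"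
      by (rule nn_integral_mono) (rule pt)
    also have "\<dots> = (\<Sum>k. \<integral>\<^sup>+x. ennreal (1 / (2 ^ k * s) ^ 4) * indicator (cball z (2 ^ Suc k * s)) x \<partial>lborel)"
      by (rule nn_integral_suminf)
        (intro borel_measurable_times_ennreal borel_measurable_const borel_measurable_indicator, simp)
    also have "\<dots> = (\<Sum>k. ennreal (1 / (2 ^ k * s) ^ 4) * emeasure lborel (cball z (2 ^ Suc k * s)))"
      by (simp add: nn_integral_cmult_indicator)
    also have "\<dots> \<le> (\<Sum>k. ennreal (c k / s))"
    proof (rule suminf_le)
      fix k
      have "ennreal (1 / (2 ^ k * s) ^ 4) * emeasure lborel (cball z (2 ^ Suc k * s))
          \<le> ennreal (1 / (2 ^ k * s) ^ 4) * ennreal (\<kappa> * (2 ^ Suc k * s) ^ 3)"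
        using s by (intro mult_left_mono \<kappa>(2)) auto
      also have "\<dots> = ennreal (c k / s)"
      proof -
        have "1 / (2 ^ k * s) ^ 4 * (\<kappa> * (2 ^ Suc k * s) ^ 3) = c k / s"
          using s by (simp add: c_def field_simps power_mult_distrib eval_nat_numeral)
        then show ?thesis using s by (simp add: ennreal_mult''[symmetric] \<kappa>(1) less_imp_le)
      qed
      finally show "ennreal (1 / (2 ^ k * s) ^ 4) * emeasure lborel (cball z (2 ^ Suc k * s)) \<le> ennreal (c k / s)" .
    qed auto
    also have "\<dots> \<le> ennreal (((\<Sum>k. c k) + 1) / s)"
      using s by (simp add: sumcs ennreal_leI divide_right_mono)
    finally show "(\<integral>\<^sup>+x. ennreal (1 / norm (x - z) ^ 4) * indicator (- ball z s) x \<partial>lborel)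
        \<le> ennreal (((\<Sum>k. c k) + 1) / s)" .
  qed
qed

text \<open>Away from the unit ball about z the integrand is at most 1, so the constant does not
  depend on z, which may lie anywhere.\<close>

lemma nn_integral_inverse_norm_compact:
  assumes K: "compact (K::point set)"
  shows "\<exists>C>0. \<forall>z. (\<integral>\<^sup>+x. ennreal (1 / norm (x - z)) * indicator K x \<partial>lborel) \<le> ennreal C"
proof -
  obtain C where C: "C > 0" "\<And>z::point. (\<integral>\<^sup>+x. ennreal (1 / norm (x - z)) * indicator (cball z 1) x \<partial>lborel) \<le> ennreal C"
    using nn_integral_inverse_norm_ball by blast
  have fin: "emeasure lborel K < \<infinity>" using K by (rule emeasure_compact_finite)
  have [measurable]: "K \<in> sets borel" using K by (simp add: compact_imp_closed)
  show ?thesis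
  proof (intro exI[of _ "C + measure lborel K"] conjI allI)
    show "0 < C + measure lborel K" using C(1) by (simp add: add_pos_nonneg)
    fix z
    have "ennreal (1 / norm (x - z)) * indicator K x
        \<le> ennreal (1 / norm (x - z)) * indicator (cball z 1) x + indicator K x" for x
    proof (cases "x \<in> cball z 1")
      case False
      then have "1 / norm (x - z) \<le> 1" by (auto simp: dist_norm norm_minus_commute divide_le_eq)
      then have "ennreal (1 / norm (x - z)) \<le> 1" by (metis ennreal_1 ennreal_leI)
      then show ?thesis by (auto simp: indicator_def)
    qed (auto simp: indicator_def)
    then have "(\<integral>\<^sup>+x. ennreal (1 / norm (x - z)) * indicator K x \<partial>lborel)
      \<le> (\<integral>\<^sup>+x. ennreal (1 / norm (x - z)) * indicator (cball z 1) x + indicator K x \<partial>lborel)"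
      by (intro nn_integral_mono)
    also have "\<dots> = (\<integral>\<^sup>+x. ennreal (1 / norm (x - z)) * indicator (cball z 1) x \<partial>lborel) + emeasure lborel K"
      by (subst nn_integral_add)
        (simp_all add: borel_measurable_times_ennreal borel_measurable_indicator)
    also have "\<dots> \<le> ennreal C + ennreal (measure lborel K)"
      using C(2)[of z] fin by (intro add_mono) (auto simp: emeasure_eq_ennreal_measure)
    finally show "(\<integral>\<^sup>+x. ennreal (1 / norm (x - z)) * indicator K x \<partial>lborel) \<le> ennreal (C + measure lborel K)"
      using C(1) by simp
  qed
qed

section \<open>The Green kernel\<close>

text \<open>\<open>nphi1\<close>, \<open>nphi2\<close> and \<open>nphi3\<close> are the first three
  directional derivatives of v \<mapsto> 1 / |v|. Being explicit in inner products and |v|, they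
  obey bounds of order |v|^-2, |v|^-3 and |v|^-4 by Cauchy-Schwarz.\<close>

definition nphi1 :: "'a::real_inner \<Rightarrow> 'a \<Rightarrow> real" where
  "nphi1 v e = - (v \<bullet> e) / norm v ^ 3"

definition nphi2 :: "'a::real_inner \<Rightarrow> 'a \<Rightarrow> 'a \<Rightarrow> real" where
  "nphi2 v e f = 3 * (v \<bullet> e) * (v \<bullet> f) / norm v ^ 5 - (e \<bullet> f) / norm v ^ 3"

definition nphi3 :: "'a::real_inner \<Rightarrow> 'a \<Rightarrow> 'a \<Rightarrow> 'a \<Rightarrow> real" where
  "nphi3 v e f g = 3 * ((e \<bullet> f) * (v \<bullet> g) + (e \<bullet> g) * (v \<bullet> f) + (f \<bullet> g) * (v \<bullet> e)) / norm v ^ 5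
     - 15 * (v \<bullet> e) * (v \<bullet> f) * (v \<bullet> g) / norm v ^ 7"

lemma has_real_derivative_inner_left:
  fixes v :: "real \<Rightarrow> 'a::real_inner"
  assumes "(v has_vector_derivative w) (at t)"
  shows "((\<lambda>s. v s \<bullet> e) has_real_derivative (w \<bullet> e)) (at t)"
  using bounded_linear.has_vector_derivative[OF bounded_linear_inner_left assms]
  by (simp add: has_real_derivative_iff_has_vector_derivative)

lemma has_real_derivative_inverse_norm_power:
  fixes v :: "real \<Rightarrow> 'a::real_inner"
  assumes v: "(v has_vector_derivative w) (at t)" and nz: "v t \<noteq> 0"
  shows "((\<lambda>s. 1 / norm (v s) ^ k) has_real_derivative - real k * (v t \<bullet> w) / norm (v t) ^ (k + 2)) (at t)"
proof -
  have "((\<lambda>s. norm (v s)) has_derivative (\<lambda>h. (h *\<^sub>R w) \<bullet> sgn (v t))) (at t)"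
    using has_derivative_compose[OF v[unfolded has_vector_derivative_def] has_derivative_norm[OF nz]]
    by (simp add: inner_commute)
  then have N: "((\<lambda>s. norm (v s)) has_real_derivative (v t \<bullet> w) / norm (v t)) (at t)"
    unfolding has_field_derivative_def
    by (rule has_derivative_eq_rhs) (auto simp: sgn_div_norm inner_commute divide_inverse ac_simps)
  have "((\<lambda>s. inverse (norm (v s) ^ k)) has_real_derivative
      - (inverse (norm (v t) ^ k) * (real k * ((v t \<bullet> w) / norm (v t) * norm (v t) ^ (k - Suc 0))) * inverse (norm (v t) ^ k))) (at t)"
    using nz by (intro DERIV_inverse' DERIV_power N) simp
  then have "((\<lambda>s. 1 / norm (v s) ^ k) has_real_derivative
      - (inverse (norm (v t) ^ k) * (real k * ((v t \<bullet> w) / norm (v t) * norm (v t) ^ (k - Suc 0))) * inverse (norm (v t) ^ k))) (at t)"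
    by (simp add: inverse_eq_divide)
  then show ?thesis
  proof (rule DERIV_cong)
    show "- (inverse (norm (v t) ^ k) * (real k * ((v t \<bullet> w) / norm (v t) * norm (v t) ^ (k - Suc 0))) * inverse (norm (v t) ^ k))
      = - real k * (v t \<bullet> w) / norm (v t) ^ (k + 2)"
      using nz by (cases k) (simp_all add: divide_inverse algebra_simps)
  qed
qed

lemma nphi0_derivative:
  fixes v :: "real \<Rightarrow> 'a::real_inner"
  assumes v: "(v has_vector_derivative w) (at t)" and nz: "v t \<noteq> 0"
  shows "((\<lambda>s. 1 / norm (v s)) has_real_derivative nphi1 (v t) w) (at t)"
  using has_real_derivative_inverse_norm_power[OF assms, of 1]
  by (simp add: nphi1_def numeral_3_eq_3)

lemma nphi1_derivative:
  fixes v :: "real \<Rightarrow> 'a::real_inner"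
  assumes v: "(v has_vector_derivative w) (at t)" and nz: "v t \<noteq> 0"
  shows "((\<lambda>s. nphi1 (v s) e) has_real_derivative nphi2 (v t) e w) (at t)"
proof -
  have "((\<lambda>s. - ((v s \<bullet> e) * (1 / norm (v s) ^ 3))) has_real_derivative nphi2 (v t) e w) (at t)"
    by (rule derivative_eq_intros has_real_derivative_inverse_norm_power[OF v nz]
        has_real_derivative_inner_left[OF v] refl)+
      (simp add: nphi2_def inner_commute algebra_simps)
  then show ?thesis by (simp add: nphi1_def)
qed

lemma nphi2_derivative:
  fixes v :: "real \<Rightarrow> 'a::real_inner"
  assumes v: "(v has_vector_derivative w) (at t)" and nz: "v t \<noteq> 0"
  shows "((\<lambda>s. nphi2 (v s) e f) has_real_derivative nphi3 (v t) e f w) (at t)"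
proof -
  have "((\<lambda>s. 3 * ((v s \<bullet> e) * (v s \<bullet> f)) * (1 / norm (v s) ^ 5) - (e \<bullet> f) * (1 / norm (v s) ^ 3))
      has_real_derivative nphi3 (v t) e f w) (at t)"
    by (rule derivative_eq_intros has_real_derivative_inverse_norm_power[OF v nz]
        has_real_derivative_inner_left[OF v] refl)+
      (simp add: nphi3_def inner_commute add_divide_distrib algebra_simps)
  then show ?thesis by (simp add: nphi2_def mult.assoc)
qed

lemma nphi1_bound:
  assumes "v \<noteq> 0" shows "\<bar>nphi1 v e\<bar> \<le> norm e / norm v ^ 2"
proof -
  have "\<bar>nphi1 v e\<bar> \<le> (norm v * norm e) / norm v ^ 3"
    using Cauchy_Schwarz_ineq2[of v e] by (simp add: nphi1_def abs_mult divide_right_mono)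
  also have "\<dots> = norm e / norm v ^ 2"
    using assms by (simp add: power3_eq_cube power2_eq_square)
  finally show ?thesis .
qed

lemma nphi2_bound:
  assumes "v \<noteq> 0" shows "\<bar>nphi2 v e f\<bar> \<le> 4 * norm e * norm f / norm v ^ 3"
proof -
  have a: "\<bar>(v \<bullet> e) * (v \<bullet> f)\<bar> \<le> (norm v * norm e) * (norm v * norm f)"
    unfolding abs_mult by (intro mult_mono Cauchy_Schwarz_ineq2) auto
  have "\<bar>nphi2 v e f\<bar> \<le> \<bar>3 * (v \<bullet> e) * (v \<bullet> f) / norm v ^ 5\<bar> + \<bar>(e \<bullet> f) / norm v ^ 3\<bar>"
    unfolding nphi2_def by (rule abs_triangle_ineq4)
  also have "\<dots> \<le> 3 * ((norm v * norm e) * (norm v * norm f)) / norm v ^ 5 + (norm e * norm f) / norm v ^ 3"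
    using a Cauchy_Schwarz_ineq2[of e f]
    by (intro add_mono) (simp_all add: abs_mult divide_right_mono mult.assoc)
  also have "\<dots> = 4 * norm e * norm f / norm v ^ 3"
    using assms by (simp add: field_simps eval_nat_numeral)
  finally show ?thesis .
qed

text \<open>Nine from the three terms with the factor 3, and fifteen from the last term, give
  24.\<close>

lemma nphi3_bound:
  assumes "v \<noteq> 0" shows "\<bar>nphi3 v e f g\<bar> \<le> 24 * norm e * norm f * norm g / norm v ^ 4"
proof -
  have t: "\<bar>(a \<bullet> b) * (v \<bullet> c)\<bar> \<le> norm v * (norm a * norm b * norm c)" for a b c :: 'a
  proof -
    have "\<bar>(a \<bullet> b) * (v \<bullet> c)\<bar> \<le> (norm a * norm b) * (norm v * norm c)"
      unfolding abs_mult by (intro mult_mono Cauchy_Schwarz_ineq2) auto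
    then show ?thesis by (simp add: ac_simps)
  qed
  have 1: "\<bar>(e \<bullet> f) * (v \<bullet> g) + (e \<bullet> g) * (v \<bullet> f) + (f \<bullet> g) * (v \<bullet> e)\<bar> \<le> 3 * norm v * (norm e * norm f * norm g)"
    using t[of e f g] t[of e g f] t[of f g e] by (simp add: ac_simps)
  have 2: "\<bar>(v \<bullet> e) * (v \<bullet> f) * (v \<bullet> g)\<bar> \<le> norm v ^ 3 * (norm e * norm f * norm g)"
  proof -
    have "\<bar>(v \<bullet> e) * (v \<bullet> f) * (v \<bullet> g)\<bar> \<le> (norm v * norm e) * (norm v * norm f) * (norm v * norm g)"
      unfolding abs_mult by (intro mult_mono Cauchy_Schwarz_ineq2 mult_nonneg_nonneg) auto
    then show ?thesis by (simp add: ac_simps power3_eq_cube)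
  qed
  have "\<bar>nphi3 v e f g\<bar> \<le> \<bar>3 * ((e \<bullet> f) * (v \<bullet> g) + (e \<bullet> g) * (v \<bullet> f) + (f \<bullet> g) * (v \<bullet> e)) / norm v ^ 5\<bar>
      + \<bar>15 * (v \<bullet> e) * (v \<bullet> f) * (v \<bullet> g) / norm v ^ 7\<bar>"
    unfolding nphi3_def by (rule abs_triangle_ineq4)
  also have "\<dots> = 3 * \<bar>(e \<bullet> f) * (v \<bullet> g) + (e \<bullet> g) * (v \<bullet> f) + (f \<bullet> g) * (v \<bullet> e)\<bar> / norm v ^ 5
      + 15 * \<bar>(v \<bullet> e) * (v \<bullet> f) * (v \<bullet> g)\<bar> / norm v ^ 7"
    by (simp only: abs_mult abs_divide mult.assoc abs_numeral power_abs abs_norm_cancel)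
  also have "\<dots> \<le> 3 * (3 * norm v * (norm e * norm f * norm g)) / norm v ^ 5
      + 15 * (norm v ^ 3 * (norm e * norm f * norm g)) / norm v ^ 7"
    using 1 2 by (intro add_mono divide_right_mono mult_left_mono) auto
  also have "\<dots> = 24 * norm e * norm f * norm g / norm v ^ 4"
    using assms by (simp add: field_simps eval_nat_numeral)
  finally show ?thesis .
qed

definition reflect :: "point \<Rightarrow> point" where
  "reflect z = (fst z, fst (snd z), - snd (snd z))"

lemma reflect_add_scaleR: "reflect (z + t *\<^sub>R e) = reflect z + t *\<^sub>R reflect e"
  by (simp add: reflect_def prod_eq_iff)

lemma norm_reflect [simp]: "norm (reflect z) = norm z"
  by (simp add: reflect_def norm_prod_def)

lemma norm_point: "norm (z::point) ^ 2 = fst z ^ 2 + fst (snd z) ^ 2 + snd (snd z) ^ 2"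
  by (simp add: norm_prod_def)

text \<open>The squares of the two distances differ by 4 a b for the heights a and b, and the last
  coordinate of x - z' is a + b. Hence a factor |x - z'| in a denominator can be traded for |x - z|
  or used to absorb a height; the kernel bounds use both trades.\<close>

lemma reflect_norm_le:
  assumes "x \<in> G" "z \<in> G"
  shows "norm (x - z) \<le> norm (x - reflect z)" "snd (snd x) \<le> norm (x - reflect z)"
    "snd (snd z) \<le> norm (x - reflect z)"
proof -
  have p: "0 < snd (snd x)" "0 < snd (snd z)" using assms by (auto simp: G_iff)
  have "norm (x - z) ^ 2 \<le> norm (x - reflect z) ^ 2"
  proof -
    have "norm (x - reflect z) ^ 2 - norm (x - z) ^ 2 = 4 * snd (snd x) * snd (snd z)"
      unfolding norm_point by (simp add: reflect_def power2_eq_square algebra_simps)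
    moreover have "0 \<le> 4 * snd (snd x) * snd (snd z)" using p by simp
    ultimately show ?thesis by linarith
  qed
  then show "norm (x - z) \<le> norm (x - reflect z)" by (rule power2_le_imp_le) simp
  have "\<bar>snd (snd (x - reflect z))\<bar> \<le> norm (x - reflect z)"
    using norm_snd_le[of "snd (snd (x - reflect z))" "fst (snd (x - reflect z))"]
      norm_snd_le[of "snd (x - reflect z)" "fst (x - reflect z)"]
    by (simp only: prod.collapse real_norm_def)
  then have "snd (snd x) + snd (snd z) \<le> norm (x - reflect z)"
    using p by (simp add: reflect_def)
  then show "snd (snd x) \<le> norm (x - reflect z)" "snd (snd z) \<le> norm (x - reflect z)"
    using p by auto
qed

text \<open>
  The Green kernel of \<open>\<Delta>\<close> with respect to \<open>\<rho>\<close>, that is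
  \<open>\<delta>\<^sup>1\<^sup>/\<^sup>2(x) \<delta>\<^sup>1\<^sup>/\<^sup>2(z) / (4 \<pi> sinh d(x,z))\<close> in Euclidean terms.
\<close>

definition green :: "point \<Rightarrow> point \<Rightarrow> real" where
  "green x z = 1 / (2 * pi) * (1 / norm (x - z) * (1 / norm (x - reflect z)))"

text \<open>Product rule applied to \<open>green\<close>: \<open>green_x\<close> differentiates in x
  along e, \<open>green_xz\<close> then in z along f, and \<open>green_xzz\<close> once more in z
  along g. Each derivative in z changes the sign, and z' moves along the reflected
  direction.\<close>

definition green_x :: "point \<Rightarrow> point \<Rightarrow> point \<Rightarrow> real" where
  "green_x e x z = 1 / (2 * pi) *
     (nphi1 (x - z) e * (1 / norm (x - reflect z)) + 1 / norm (x - z) * nphi1 (x - reflect z) e)"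

definition green_xz :: "point \<Rightarrow> point \<Rightarrow> point \<Rightarrow> point \<Rightarrow> real" where
  "green_xz e f x z = - (1 / (2 * pi)) *
     (nphi2 (x - z) e f * (1 / norm (x - reflect z)) + nphi1 (x - z) e * nphi1 (x - reflect z) (reflect f)
      + nphi1 (x - z) f * nphi1 (x - reflect z) e + 1 / norm (x - z) * nphi2 (x - reflect z) e (reflect f))"

definition green_xzz :: "point \<Rightarrow> point \<Rightarrow> point \<Rightarrow> point \<Rightarrow> point \<Rightarrow> real" where
  "green_xzz e f g x z = 1 / (2 * pi) *
     (nphi3 (x - z) e f g * (1 / norm (x - reflect z)) + nphi2 (x - z) e f * nphi1 (x - reflect z) (reflect g)
      + nphi2 (x - z) e g * nphi1 (x - reflect z) (reflect f)
      + nphi1 (x - z) e * nphi2 (x - reflect z) (reflect f) (reflect g)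
      + nphi2 (x - z) f g * nphi1 (x - reflect z) e + nphi1 (x - z) f * nphi2 (x - reflect z) e (reflect g)
      + nphi1 (x - z) g * nphi2 (x - reflect z) e (reflect f)
      + 1 / norm (x - z) * nphi3 (x - reflect z) e (reflect f) (reflect g))"

lemma nphi_neg:
  "nphi1 v (- e) = - nphi1 v e" "nphi2 v e (- f) = - nphi2 v e f" "nphi2 v (- e) f = - nphi2 v e f"
  "nphi3 v e f (- g) = - nphi3 v e f g" "nphi3 v e (- f) g = - nphi3 v e f g"
  by (simp_all add: nphi1_def nphi2_def nphi3_def divide_inverse algebra_simps)

lemma ne_reflect: "x \<in> G \<Longrightarrow> z \<in> G \<Longrightarrow> x - reflect z \<noteq> 0"
  by (auto simp: G_iff reflect_def prod_eq_iff)

lemma curve_x: "((\<lambda>s. (x + s *\<^sub>R e) - w) has_vector_derivative e) (at t)"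
  by (auto intro!: derivative_eq_intros)

lemma curve_z: "((\<lambda>s. x - (z + s *\<^sub>R e)) has_vector_derivative - e) (at t)"
  by (auto intro!: derivative_eq_intros)

lemma curve_rz: "((\<lambda>s. x - reflect (z + s *\<^sub>R e)) has_vector_derivative - reflect e) (at t)"
  unfolding reflect_add_scaleR by (rule curve_z)

lemma green_x_derivative:
  assumes "x + t *\<^sub>R e \<in> G" "z \<in> G" "x + t *\<^sub>R e \<noteq> z"
  shows "((\<lambda>s. green (x + s *\<^sub>R e) z) has_real_derivative green_x e (x + t *\<^sub>R e) z) (at t)"
proof -
  let ?w = "x + t *\<^sub>R e"
  have nz: "?w - z \<noteq> 0" "?w - reflect z \<noteq> 0" using assms ne_reflect by auto
  have "((\<lambda>s. green (x + s *\<^sub>R e) z) has_real_derivative 1 / (2 * pi) *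
     (1 / norm (?w - z) * nphi1 (?w - reflect z) e + nphi1 (?w - z) e * (1 / norm (?w - reflect z)))) (at t)"
    unfolding green_def by (intro DERIV_cmult DERIV_mult' nphi0_derivative curve_x nz)
  then show ?thesis by (rule DERIV_cong) (simp add: green_x_def algebra_simps)
qed

lemma green_xz_derivative:
  assumes "x \<in> G" "z + t *\<^sub>R f \<in> G" "x \<noteq> z + t *\<^sub>R f"
  shows "((\<lambda>s. green_x e x (z + s *\<^sub>R f)) has_real_derivative green_xz e f x (z + t *\<^sub>R f)) (at t)"
proof -
  let ?w = "z + t *\<^sub>R f"
  have nz: "x - ?w \<noteq> 0" "x - reflect ?w \<noteq> 0" using assms ne_reflect by auto
  note D = DERIV_add DERIV_mult' nphi0_derivative[OF curve_z] nphi0_derivative[OF curve_rz]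
     nphi1_derivative[OF curve_z] nphi1_derivative[OF curve_rz]
  have "((\<lambda>s. green_x e x (z + s *\<^sub>R f)) has_real_derivative 1 / (2 * pi) *
     ((nphi1 (x - ?w) e * nphi1 (x - reflect ?w) (- reflect f) + nphi2 (x - ?w) e (- f) * (1 / norm (x - reflect ?w)))
      + (1 / norm (x - ?w) * nphi2 (x - reflect ?w) e (- reflect f) + nphi1 (x - ?w) (- f) * nphi1 (x - reflect ?w) e))) (at t)"
    unfolding green_x_def by (intro DERIV_cmult D nz)
  then show ?thesis by (rule DERIV_cong) (simp add: green_xz_def nphi_neg algebra_simps)
qed

lemma green_xzz_derivative:
  assumes "x \<in> G" "z + t *\<^sub>R g \<in> G" "x \<noteq> z + t *\<^sub>R g"
  shows "((\<lambda>s. green_xz e f x (z + s *\<^sub>R g)) has_real_derivative green_xzz e f g x (z + t *\<^sub>R g)) (at t)"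
proof -
  let ?w = "z + t *\<^sub>R g"
  let ?p = "x - ?w" and ?q = "x - reflect ?w" and ?r = reflect
  have nz: "x - ?w \<noteq> 0" "x - reflect ?w \<noteq> 0" using assms ne_reflect by auto
  note D = DERIV_add DERIV_mult' nphi0_derivative[OF curve_z] nphi0_derivative[OF curve_rz]
     nphi1_derivative[OF curve_z] nphi1_derivative[OF curve_rz] nphi2_derivative[OF curve_z] nphi2_derivative[OF curve_rz]
  have "((\<lambda>s. green_xz e f x (z + s *\<^sub>R g)) has_real_derivative - (1 / (2 * pi)) *
     ((((nphi2 ?p e f * nphi1 ?q (- ?r g) + nphi3 ?p e f (- g) * (1 / norm ?q))
      + (nphi1 ?p e * nphi2 ?q (?r f) (- ?r g) + nphi2 ?p e (- g) * nphi1 ?q (?r f)))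
      + (nphi1 ?p f * nphi2 ?q e (- ?r g) + nphi2 ?p f (- g) * nphi1 ?q e))
      + (1 / norm ?p * nphi3 ?q e (?r f) (- ?r g) + nphi1 ?p (- g) * nphi2 ?q e (?r f)))) (at t)"
    unfolding green_xz_def by (intro DERIV_cmult D nz)
  then show ?thesis by (rule DERIV_cong) (simp add: green_xzz_def nphi_neg algebra_simps)
qed

text \<open>Since P \<le> Q, all but one of the powers of Q can be turned into powers of P. The one
  factor Q that remains is kept on purpose: it later absorbs a height of x or z.\<close>

lemma product_bound:
  fixes P Q u v :: real
  assumes "0 < P" "P \<le> Q" "\<bar>u\<bar> \<le> A / P ^ (i + 1)" "\<bar>v\<bar> \<le> B / Q ^ (j + 1)" "0 \<le> A" "0 \<le> B" "k = i + j + 1"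
  shows "\<bar>u * v\<bar> \<le> A * B / (P ^ k * Q)"
proof -
  have "\<bar>u * v\<bar> \<le> (A / P ^ (i + 1)) * (B / Q ^ (j + 1))"
    unfolding abs_mult using assms by (intro mult_mono) auto
  also have "\<dots> = A * B / (P ^ (i + 1) * (Q ^ j * Q))" by simp
  also have "\<dots> \<le> A * B / (P ^ (i + 1) * (P ^ j * Q))"
    using assms by (intro divide_left_mono mult_left_mono mult_right_mono power_mono mult_pos_pos zero_less_power mult_nonneg_nonneg) auto
  also have "\<dots> = A * B / (P ^ k * Q)" using assms by (simp add: power_add ac_simps)
  finally show ?thesis .
qed

context
  fixes x z :: point
  assumes xz: "x \<in> G" "z \<in> G" "x \<noteq> z"
begin

text \<open>The exponents are written as i + 1 to match the hypotheses of
  \<open>product_bound\<close>.\<close>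

lemma nphi_bounds:
  "\<bar>1 / norm (x - z)\<bar> \<le> 1 / norm (x - z) ^ (0 + 1)"
  "\<bar>1 / norm (x - reflect z)\<bar> \<le> 1 / norm (x - reflect z) ^ (0 + 1)"
  "\<bar>nphi1 (x - z) e\<bar> \<le> norm e / norm (x - z) ^ (1 + 1)"
  "\<bar>nphi1 (x - reflect z) e\<bar> \<le> norm e / norm (x - reflect z) ^ (1 + 1)"
  "\<bar>nphi2 (x - z) e f\<bar> \<le> (4 * norm e * norm f) / norm (x - z) ^ (2 + 1)"
  "\<bar>nphi2 (x - reflect z) e f\<bar> \<le> (4 * norm e * norm f) / norm (x - reflect z) ^ (2 + 1)"
  "\<bar>nphi3 (x - z) e f g\<bar> \<le> (24 * norm e * norm f * norm g) / norm (x - z) ^ (3 + 1)"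
  "\<bar>nphi3 (x - reflect z) e f g\<bar> \<le> (24 * norm e * norm f * norm g) / norm (x - reflect z) ^ (3 + 1)"
  using xz nphi1_bound[of "x - z"] nphi1_bound[of "x - reflect z"] nphi2_bound[of "x - z"] nphi2_bound[of "x - reflect z"]
    nphi3_bound[of "x - z"] nphi3_bound[of "x - reflect z"] ne_reflect[of x z]
  by (simp_all add: one_add_one eval_nat_numeral)

lemma PQ: "0 < norm (x - z)" "norm (x - z) \<le> norm (x - reflect z)"
  using xz reflect_norm_le by auto

lemmas product_bounds = product_bound[OF PQ]

lemma inverse_2pi_le: "1 / (2 * pi) \<le> 1"
  using pi_gt3 by simp

lemma green_bound: "0 \<le> green x z" "green x z \<le> 1 / (norm (x - z) * norm (x - reflect z))"
proof -
  show "0 \<le> green x z" by (simp add: green_def)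
  have "green x z \<le> 1 * (1 / norm (x - z) * (1 / norm (x - reflect z)))"
    unfolding green_def by (intro mult_right_mono inverse_2pi_le) auto
  then show "green x z \<le> 1 / (norm (x - z) * norm (x - reflect z))" by simp
qed

lemma green_x_bound: "\<bar>green_x e x z\<bar> \<le> 2 * norm e / (norm (x - z) ^ 2 * norm (x - reflect z))"
proof -
  have "\<bar>nphi1 (x - z) e * (1 / norm (x - reflect z)) + 1 / norm (x - z) * nphi1 (x - reflect z) e\<bar>
     \<le> norm e * 1 / (norm (x - z) ^ 2 * norm (x - reflect z)) + 1 * norm e / (norm (x - z) ^ 2 * norm (x - reflect z))"
    by (intro order_trans[OF abs_triangle_ineq add_mono] product_bounds[OF nphi_bounds(3) nphi_bounds(2)]
        product_bounds[OF nphi_bounds(1) nphi_bounds(4)]) auto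
  also have "\<dots> = 2 * norm e / (norm (x - z) ^ 2 * norm (x - reflect z))" by simp
  finally have "1 / (2 * pi) * \<bar>nphi1 (x - z) e * (1 / norm (x - reflect z)) + 1 / norm (x - z) * nphi1 (x - reflect z) e\<bar>
     \<le> 1 * (2 * norm e / (norm (x - z) ^ 2 * norm (x - reflect z)))"
    by (intro mult_mono inverse_2pi_le) auto
  then show ?thesis by (simp add: green_x_def abs_mult)
qed

text \<open>The four product-rule terms contribute 4, 1, 1 and 4.\<close>

lemma green_xz_bound: "\<bar>green_xz e f x z\<bar> \<le> 10 * norm e * norm f / (norm (x - z) ^ 3 * norm (x - reflect z))"
proof -
  have "\<bar>nphi2 (x - z) e f * (1 / norm (x - reflect z)) + nphi1 (x - z) e * nphi1 (x - reflect z) (reflect f)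
      + nphi1 (x - z) f * nphi1 (x - reflect z) e + 1 / norm (x - z) * nphi2 (x - reflect z) e (reflect f)\<bar>
     \<le> (4 * norm e * norm f) * 1 / (norm (x - z) ^ 3 * norm (x - reflect z))
       + norm e * norm (reflect f) / (norm (x - z) ^ 3 * norm (x - reflect z))
       + norm f * norm e / (norm (x - z) ^ 3 * norm (x - reflect z))
       + 1 * (4 * norm e * norm (reflect f)) / (norm (x - z) ^ 3 * norm (x - reflect z))"
    by (intro order_trans[OF abs_triangle_ineq add_mono] product_bounds[OF nphi_bounds(5) nphi_bounds(2)]
        product_bounds[OF nphi_bounds(3) nphi_bounds(4)] product_bounds[OF nphi_bounds(1) nphi_bounds(6)]) auto
  also have "\<dots> = 10 * norm e * norm f / (norm (x - z) ^ 3 * norm (x - reflect z))"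
    by (simp add: add_divide_distrib[symmetric])
  finally have "1 / (2 * pi) * \<bar>nphi2 (x - z) e f * (1 / norm (x - reflect z)) + nphi1 (x - z) e * nphi1 (x - reflect z) (reflect f)
      + nphi1 (x - z) f * nphi1 (x - reflect z) e + 1 / norm (x - z) * nphi2 (x - reflect z) e (reflect f)\<bar>
     \<le> 1 * (10 * norm e * norm f / (norm (x - z) ^ 3 * norm (x - reflect z)))"
    by (intro mult_mono inverse_2pi_le) auto
  then show ?thesis unfolding green_xz_def abs_mult by simp
qed

text \<open>The two terms with a third derivative contribute 24 each, the six mixed ones 4
  each.\<close>

lemma green_xzz_bound:
  "\<bar>green_xzz e f g x z\<bar> \<le> 72 * norm e * norm f * norm g / (norm (x - z) ^ 4 * norm (x - reflect z))"
proof -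
  let ?D = "norm (x - z) ^ 4 * norm (x - reflect z)"
  let ?S = "nphi3 (x - z) e f g * (1 / norm (x - reflect z)) + nphi2 (x - z) e f * nphi1 (x - reflect z) (reflect g)
      + nphi2 (x - z) e g * nphi1 (x - reflect z) (reflect f)
      + nphi1 (x - z) e * nphi2 (x - reflect z) (reflect f) (reflect g)
      + nphi2 (x - z) f g * nphi1 (x - reflect z) e + nphi1 (x - z) f * nphi2 (x - reflect z) e (reflect g)
      + nphi1 (x - z) g * nphi2 (x - reflect z) e (reflect f)
      + 1 / norm (x - z) * nphi3 (x - reflect z) e (reflect f) (reflect g)"
  have "\<bar>?S\<bar> \<le> (24 * norm e * norm f * norm g) * 1 / ?D + (4 * norm e * norm f) * norm (reflect g) / ?D
      + (4 * norm e * norm g) * norm (reflect f) / ?D + norm e * (4 * norm (reflect f) * norm (reflect g)) / ?D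
      + (4 * norm f * norm g) * norm e / ?D + norm f * (4 * norm e * norm (reflect g)) / ?D
      + norm g * (4 * norm e * norm (reflect f)) / ?D + 1 * (24 * norm e * norm (reflect f) * norm (reflect g)) / ?D"
    by (intro order_trans[OF abs_triangle_ineq add_mono] product_bounds[OF nphi_bounds(7) nphi_bounds(2)]
        product_bounds[OF nphi_bounds(5) nphi_bounds(4)] product_bounds[OF nphi_bounds(3) nphi_bounds(6)]
        product_bounds[OF nphi_bounds(1) nphi_bounds(8)]) auto
  also have "\<dots> = 72 * norm e * norm f * norm g / ?D"
    by (simp add: add_divide_distrib[symmetric])
  finally have "1 / (2 * pi) * \<bar>?S\<bar> \<le> 1 * (72 * norm e * norm f * norm g / ?D)"
    by (intro mult_mono inverse_2pi_le) auto
  then show ?thesis unfolding green_xzz_def abs_mult by simp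
qed

end

section \<open>Smooth bumps and a monotone class argument\<close>

text \<open>The classical flat functions p(1/t) e^(-1/t), continued by 0. Carrying the polynomial
  makes the family closed under differentiation, so that one induction proves smoothness of all of
  them.\<close>

definition flat :: "real poly \<Rightarrow> real \<Rightarrow> real" where
  "flat p t = (if 0 < t then poly p (1 / t) * exp (- (1 / t)) else 0)"

text \<open>With s = 1/t the derivative of p(s) e^(-s) with respect to t is s^2 (p(s) - p'(s))
  e^(-s).\<close>

definition flat_deriv :: "real poly \<Rightarrow> real poly" where
  "flat_deriv p = [:0, 0, 1:] * (p - pderiv p)"

text \<open>The extra power of s is what the induction over the coefficients passes along: s^k (a +
  s p(s)) = a s^k + s^(k+1) p(s).\<close>

lemma poly_exp_decay: "((\<lambda>s. s ^ k * poly p s * exp (- s)) \<longlongrightarrow> (0::real)) at_top"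
proof (induction p arbitrary: k)
  case (pCons a p)
  have "((\<lambda>s::real. a * (s ^ k / exp s) + s ^ Suc k * poly p s * exp (- s)) \<longlongrightarrow> a * 0 + 0) at_top"
    by (intro tendsto_intros tendsto_power_div_exp_0 pCons.IH)
  then show ?case
    by (simp add: algebra_simps exp_minus divide_inverse)
qed simp

lemma flat_has_derivative: "(flat p has_real_derivative flat (flat_deriv p) t) (at t)"
proof -
  consider "t > 0" | "t < 0" | "t = 0" by linarith
  then show ?thesis
  proof cases
    case 1
    have "((\<lambda>t. poly p (1 / t) * exp (- (1 / t))) has_real_derivative flat (flat_deriv p) t) (at t)"
      using 1 unfolding flat_def flat_deriv_def
      by (auto intro!: derivative_eq_intros DERIV_chain2[OF poly_DERIV] simp: field_simps power2_eq_square)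
    then show ?thesis
      by (rule has_field_derivative_transform_within_open[where S="{0<..}"]) (use 1 in \<open>auto simp: flat_def\<close>)
  next
    case 2
    have "((\<lambda>t. 0) has_real_derivative flat (flat_deriv p) t) (at t)"
      using 2 by (simp add: flat_def)
    then show ?thesis
      by (rule has_field_derivative_transform_within_open[where S="{..<0}"]) (use 2 in \<open>auto simp: flat_def\<close>)
  next
    case 3
    \<comment> \<open>With s = 1/h the right difference quotient at 0 becomes s p(s) e^(-s), which
      tends to 0.\<close>
    have "((\<lambda>h. 1 / h * (poly p (1 / h) * exp (- (1 / h)))) \<longlongrightarrow> 0) (at_right 0)"
      using filterlim_compose[OF poly_exp_decay[of 1 p] filterlim_inverse_at_top_right]
      by (simp add: inverse_eq_divide mult.assoc)
    moreover have "\<forall>\<^sub>F h in at_right 0. 1 / h * (poly p (1 / h) * exp (- (1 / h))) = flat p h / h"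
      unfolding eventually_at_right_field by (intro exI[of _ 1]) (auto simp: flat_def)
    ultimately have "((\<lambda>h. flat p h / h) \<longlongrightarrow> 0) (at_right 0)"
      by (rule Lim_transform_eventually)
    moreover have "((\<lambda>h. flat p h / h) \<longlongrightarrow> 0) (at_left 0)"
    proof (rule tendsto_eventually)
      show "\<forall>\<^sub>F h in at_left 0. flat p h / h = 0"
        unfolding eventually_at_left_field by (intro exI[of _ "-1"]) (auto simp: flat_def)
    qed
    ultimately have "((\<lambda>h. flat p h / h) \<longlongrightarrow> 0) (at 0)"
      by (simp add: filterlim_split_at)
    then show ?thesis
      using 3 by (simp add: DERIV_def flat_def)
  qed
qed

text \<open>G is open, so derivatives at a point of G see values on G only. This permits replacing
  \<open>frechet_derivative\<close> by an explicit derivative inside the recursion.\<close>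

lemma Ck_on_G_cong:
  assumes "\<And>p. p \<in> G \<Longrightarrow> f p = g p"
  shows "Ck_on_G k f \<longleftrightarrow> Ck_on_G k g"
  using assms
proof (induction k arbitrary: f g)
  case 0
  then show ?case by (auto cong: continuous_on_cong)
next
  case (Suc k)
  have hd: "(f has_derivative D) (at p) \<longleftrightarrow> (g has_derivative D) (at p)" if "p \<in> G" for p D
    using has_derivative_transform_within_open[OF _ open_G that, of f D _ g]
      has_derivative_transform_within_open[OF _ open_G that, of g D _ f] Suc.prems by metis
  then have fd: "frechet_derivative f (at p) = frechet_derivative g (at p)" if "p \<in> G" for p
    using that unfolding frechet_derivative_def by simp
  have "Ck_on_G k (\<lambda>p. frechet_derivative f (at p) v) \<longleftrightarrow> Ck_on_G k (\<lambda>p. frechet_derivative g (at p) v)" for v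
    by (rule Suc.IH) (simp add: fd)
  then show ?case using hd by (auto simp: differentiable_def)
qed

lemma Ck_on_G_Suc_imp: "Ck_on_G (Suc k) f \<Longrightarrow> Ck_on_G k f"
proof (induction k arbitrary: f)
  case 0
  have "\<forall>p\<in>G. isCont f p"
    using 0 differentiable_imp_continuous_within[of f _ UNIV] by simp
  then have "continuous_on G f" by (rule continuous_at_imp_continuous_on)
  then show ?case by simp
next
  case (Suc k)
  have "\<forall>p\<in>G. f differentiable at p" using Suc.prems unfolding Ck_on_G.simps(2) by blast
  moreover have "Ck_on_G k (\<lambda>p. frechet_derivative f (at p) v)" for v
    using Suc.prems unfolding Ck_on_G.simps(2)[of "Suc k"] by (intro Suc.IH) blast
  ultimately show ?case unfolding Ck_on_G.simps(2)[of k] by blast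
qed

lemma Ck_on_G_SucI:
  assumes "\<And>p. p \<in> G \<Longrightarrow> (f has_derivative D p) (at p)" "\<And>v. Ck_on_G k (\<lambda>p. D p v)"
  shows "Ck_on_G (Suc k) f"
proof -
  have "frechet_derivative f (at p) = D p" if "p \<in> G" for p
    using frechet_derivative_at[OF assms(1)[OF that]] by simp
  then have "Ck_on_G k (\<lambda>p. frechet_derivative f (at p) v) \<longleftrightarrow> Ck_on_G k (\<lambda>p. D p v)" for v
    by (intro Ck_on_G_cong) simp
  moreover have "f differentiable at p" if "p \<in> G" for p
    using assms(1)[OF that] by (rule differentiableI)
  ultimately show ?thesis using assms(2) by simp
qed

lemma Ck_on_G_SucD:
  assumes "Ck_on_G (Suc k) f" "p \<in> G"
  shows "(f has_derivative frechet_derivative f (at p)) (at p)"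
  using assms frechet_derivative_works by auto

lemma Ck_on_G_add: "Ck_on_G k f \<Longrightarrow> Ck_on_G k g \<Longrightarrow> Ck_on_G k (\<lambda>p. f p + g p)"
proof (induction k arbitrary: f g)
  case 0
  then show ?case by (auto intro: continuous_on_add)
next
  case (Suc k)
  show ?case
    by (rule Ck_on_G_SucI[OF has_derivative_add[OF Ck_on_G_SucD[OF Suc.prems(1)] Ck_on_G_SucD[OF Suc.prems(2)]]])
      (use Suc in auto)
qed

lemma Ck_on_G_mult: "Ck_on_G k f \<Longrightarrow> Ck_on_G k g \<Longrightarrow> Ck_on_G k (\<lambda>p. f p * g p)"
proof (induction k arbitrary: f g)
  case 0
  then show ?case by (auto intro: continuous_on_mult)
next
  case (Suc k)
  show ?case
    by (rule Ck_on_G_SucI[OF has_derivative_mult[OF Ck_on_G_SucD[OF Suc.prems(1)] Ck_on_G_SucD[OF Suc.prems(2)]]])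
      (use Suc Ck_on_G_Suc_imp[OF Suc.prems(1)] Ck_on_G_Suc_imp[OF Suc.prems(2)] in \<open>auto intro!: Ck_on_G_add\<close>)
qed

lemma Ck_on_G_const: "Ck_on_G k (\<lambda>p. c)"
proof (induction k arbitrary: c)
  case (Suc k)
  show ?case by (rule Ck_on_G_SucI[OF has_derivative_const]) (rule Suc)
qed simp

text \<open>The induction runs over all polynomials q, because differentiating replaces q by
  \<open>flat_deriv q\<close> and multiplies by a constant.\<close>

lemma Ck_on_G_flat: "Ck_on_G k (\<lambda>p. complex_of_real (flat q (w \<bullet> p + b)))"
proof (induction k arbitrary: q)
  case 0
  have "continuous_on UNIV (flat q)"
    using DERIV_isCont[OF flat_has_derivative] by (simp add: continuous_at_imp_continuous_on)
  then have "continuous_on G (\<lambda>p. flat q (w \<bullet> p + b))"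
    by (rule continuous_on_compose2) (intro continuous_intros, simp)
  then show ?case by (simp add: continuous_on_of_real)
next
  case (Suc k)
  have D: "((\<lambda>p. complex_of_real (flat q (w \<bullet> p + b))) has_derivative
      (\<lambda>v. complex_of_real (flat (flat_deriv q) (w \<bullet> p + b)) * complex_of_real (w \<bullet> v))) (at p)" for p
  proof -
    have "((\<lambda>p. w \<bullet> p + b) has_derivative (\<lambda>v. w \<bullet> v)) (at p)"
      by (auto intro!: derivative_eq_intros)
    then have "((\<lambda>p. flat q (w \<bullet> p + b)) has_derivative (\<lambda>v. flat (flat_deriv q) (w \<bullet> p + b) * (w \<bullet> v))) (at p)"
      by (rule has_derivative_compose[OF _ flat_has_derivative[unfolded has_field_derivative_def]])
    then show ?thesis
      by (rule has_derivative_eq_rhs[OF has_derivative_of_real]) simp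
  qed
  show ?case
    by (rule Ck_on_G_SucI[OF D]) (intro Ck_on_G_mult Suc Ck_on_G_const)
qed

text \<open>Six one-sided cutoffs e^(-1/(n t)), t being the signed distance to a face. Each is
  smooth, at most 1, zero beyond its face, and tends to 1 inside as n grows. If l has positive
  height the bumps are thus test functions, with limit the indicator of the open box.\<close>

definition bump :: "point \<Rightarrow> point \<Rightarrow> nat \<Rightarrow> point \<Rightarrow> complex" where
  "bump l u n z =
     of_real (flat 1 (real n * (fst z - fst l))) * of_real (flat 1 (real n * (fst u - fst z))) *
     of_real (flat 1 (real n * (fst (snd z) - fst (snd l)))) * of_real (flat 1 (real n * (fst (snd u) - fst (snd z)))) *
     of_real (flat 1 (real n * (snd (snd z) - snd (snd l)))) * of_real (flat 1 (real n * (snd (snd u) - snd (snd z))))"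

lemma flat_1_bounds: "0 \<le> flat 1 t" "flat 1 t \<le> 1"
  by (auto simp: flat_def)

lemma norm_flat_1: "cmod (of_real (flat 1 t)) \<le> 1"
  using flat_1_bounds[of t] by simp

lemma bump_bound: "cmod (bump l u n z) \<le> 1"
  unfolding bump_def norm_mult by (intro mult_le_one mult_nonneg_nonneg norm_ge_zero norm_flat_1)

lemma mem_box_point:
  "(z::point) \<in> box l u \<longleftrightarrow> fst l < fst z \<and> fst z < fst u \<and> fst (snd l) < fst (snd z) \<and> fst (snd z) < fst (snd u)
     \<and> snd (snd l) < snd (snd z) \<and> snd (snd z) < snd (snd u)"
  by (cases z; cases l; cases u) (auto simp: mem_box Basis_prod_def)

lemma mem_cbox_point:
  "(z::point) \<in> cbox l u \<longleftrightarrow> fst l \<le> fst z \<and> fst z \<le> fst u \<and> fst (snd l) \<le> fst (snd z) \<and> fst (snd z) \<le> fst (snd u)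
     \<and> snd (snd l) \<le> snd (snd z) \<and> snd (snd z) \<le> snd (snd u)"
  by (cases z; cases l; cases u) (auto simp: mem_box Basis_prod_def)

lemma bump_zero: "z \<notin> box l u \<Longrightarrow> bump l u n z = 0"
proof -
  have "flat 1 (real n * t) = 0" if "t \<le> 0" for t
    using that by (simp add: flat_def not_less mult_nonneg_nonpos)
  then show "z \<notin> box l u \<Longrightarrow> bump l u n z = 0"
    by (auto simp: mem_box_point bump_def not_less)
qed

lemma bump_tendsto: "(\<lambda>n. bump l u n z) \<longlonglongrightarrow> indicator (box l u) z"
proof (cases "z \<in> box l u")
  case True
  have "(\<lambda>n. flat 1 (real n * t)) \<longlonglongrightarrow> 1" if "t > 0" for t
  proof -
    have "(\<lambda>n. exp (- (1 / t / real n))) \<longlonglongrightarrow> exp (- 0)"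
      by (intro tendsto_intros lim_const_over_n)
    moreover have "\<forall>\<^sub>F n in sequentially. exp (- (1 / t / real n)) = flat 1 (real n * t)"
      using eventually_gt_at_top[of 0] by eventually_elim (use that in \<open>simp add: flat_def mult.commute\<close>)
    ultimately have "(\<lambda>n. flat 1 (real n * t)) \<longlonglongrightarrow> exp (- 0)"
      by (rule Lim_transform_eventually)
    then show ?thesis by simp
  qed
  then have "(\<lambda>n. complex_of_real (flat 1 (real n * t))) \<longlonglongrightarrow> 1" if "t > 0" for t
    using tendsto_of_real[where 'a=complex, of "\<lambda>n. flat 1 (real n * t)" 1] that by simp
  then have "(\<lambda>n. bump l u n z) \<longlonglongrightarrow> 1 * 1 * 1 * 1 * 1 * 1"
    using True unfolding bump_def by (intro tendsto_mult) (auto simp: mem_box_point)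
  then show ?thesis using True by simp
qed (simp add: bump_zero)

lemma cbox_subset_G: "0 < snd (snd l) \<Longrightarrow> cbox l u \<subseteq> G"
  by (auto simp: mem_cbox_point G_iff)

lemma bump_test:
  assumes "0 < snd (snd l)" shows "bump l u n \<in> test_functions"
proof -
  have "Ck_on_G k (bump l u n)" for k
  proof -
    have i: "(a, 0, 0) \<bullet> p = a * fst p" "(0, a, 0) \<bullet> p = a * fst (snd p)" "(0, 0, a) \<bullet> p = a * snd (snd p)"
      for a :: real and p :: point by (cases p; simp)+
    have "Ck_on_G k (\<lambda>z.
     of_real (flat 1 ((real n, 0, 0) \<bullet> z + (- real n * fst l))) * of_real (flat 1 ((- real n, 0, 0) \<bullet> z + real n * fst u)) *
     of_real (flat 1 ((0, real n, 0) \<bullet> z + (- real n * fst (snd l)))) * of_real (flat 1 ((0, - real n, 0) \<bullet> z + real n * fst (snd u))) *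
     of_real (flat 1 ((0, 0, real n) \<bullet> z + (- real n * snd (snd l)))) * of_real (flat 1 ((0, 0, - real n) \<bullet> z + real n * snd (snd u))))" (is "Ck_on_G k ?f")
      by (intro Ck_on_G_mult Ck_on_G_flat)
    also have "?f = bump l u n"
      unfolding i by (rule ext) (simp add: bump_def right_diff_distrib)
    finally show ?thesis .
  qed
  then have "\<forall>k. Ck_on_G k (bump l u n)" by (rule allI)
  moreover have "p \<notin> cbox l u \<longrightarrow> bump l u n p = 0" for p
    using bump_zero[of p l u n] subsetD[OF box_subset_cbox[of l u], of p] by fast
  then have "\<forall>p. p \<notin> cbox l u \<longrightarrow> bump l u n p = 0" by (rule allI)
  ultimately show ?thesis
    using cbox_subset_G[OF assms, of u] compact_cbox[of l u] unfolding test_functions_def mem_Collect_eq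
    by (intro conjI exI[of _ "cbox l u"])
qed

section \<open>Bounded Borel functions on a box\<close>

definition bounded_on_box :: "point \<Rightarrow> point \<Rightarrow> (point \<Rightarrow> complex) \<Rightarrow> bool" where
  "bounded_on_box l u f \<longleftrightarrow> f \<in> borel_measurable borel \<and> (\<forall>z. z \<notin> box l u \<longrightarrow> f z = 0) \<and> (\<exists>M. \<forall>z. cmod (f z) \<le> M)"

lemma test_function_continuous:
  assumes "g \<in> test_functions" shows "continuous_on UNIV g"
proof -
  obtain K where K: "compact K" "K \<subseteq> G" "\<And>p. p \<notin> K \<Longrightarrow> g p = 0"
    and C: "Ck_on_G 0 g" using assms unfolding test_functions_def by blast
  have "continuous_on (G \<union> - K) g"
    using C K open_G compact_imp_closed[OF K(1)]
    by (intro continuous_on_open_Un) (auto intro: continuous_on_eq[OF continuous_on_const[of _ 0]])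
  moreover have "G \<union> - K = UNIV" using K(2) by auto
  ultimately show ?thesis by simp
qed

lemma bounded_on_boxI:
  assumes "f \<in> borel_measurable borel" "\<And>z. z \<notin> box l u \<Longrightarrow> f z = 0" "\<And>z. cmod (f z) \<le> M"
  shows "bounded_on_box l u f"
  unfolding bounded_on_box_def using assms by (intro conjI allI impI exI[of _ M])

lemma bounded_on_boxE:
  assumes "bounded_on_box l u f"
  obtains M where "0 \<le> M" "f \<in> borel_measurable borel" "\<And>z. z \<notin> box l u \<Longrightarrow> f z = 0" "\<And>z. cmod (f z) \<le> M"
proof -
  obtain M where M: "\<forall>z. cmod (f z) \<le> M" using assms unfolding bounded_on_box_def by (elim conjE exE)
  then have "0 \<le> M" using norm_ge_zero[of "f 0"] by (intro order_trans[OF norm_ge_zero[of "f 0"]]) (rule spec)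
  then show ?thesis using assms that[of M] M unfolding bounded_on_box_def by simp
qed

lemma test_bounded_on_box:
  assumes g: "g \<in> test_functions" and 0: "\<And>z. z \<notin> box l u \<Longrightarrow> g z = 0"
  shows "bounded_on_box l u g"
proof -
  note c = test_function_continuous[OF g]
  have "bounded (g ` cbox l u)"
    by (intro compact_imp_bounded compact_continuous_image compact_cbox continuous_on_subset[OF c]) simp
  then obtain M where M: "\<forall>w\<in>g ` cbox l u. cmod w \<le> M"
    unfolding bounded_iff by (elim exE)
  have "cmod (g z) \<le> max M 0" for z
  proof (cases "z \<in> box l u")
    case True
    then have "cmod (g z) \<le> M" using box_subset_cbox[of l u] by (intro M[rule_format] imageI) (rule subsetD)
    then show ?thesis by simp
  qed (simp add: 0)
  then show ?thesis
    using 0 borel_measurable_continuous_onI[OF c] by (intro bounded_on_boxI)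
qed

lemma bounded_on_box_add:
  assumes "bounded_on_box l u f" "bounded_on_box l u g"
  shows "bounded_on_box l u (\<lambda>z. f z + g z)"
proof -
  obtain M where M: "0 \<le> M" "f \<in> borel_measurable borel" "\<And>z. z \<notin> box l u \<Longrightarrow> f z = 0" "\<And>z. cmod (f z) \<le> M"
    by (rule bounded_on_boxE[OF assms(1)]) (rule that)
  obtain N where N: "0 \<le> N" "g \<in> borel_measurable borel" "\<And>z. z \<notin> box l u \<Longrightarrow> g z = 0" "\<And>z. cmod (g z) \<le> N"
    by (rule bounded_on_boxE[OF assms(2)]) (rule that)
  show ?thesis
    using M N by (intro bounded_on_boxI[where M="M + N"] norm_triangle_mono) simp_all
qed

lemma bounded_on_box_cmult:
  assumes "bounded_on_box l u f" shows "bounded_on_box l u (\<lambda>z. c * f z)"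
proof -
  obtain M where M: "0 \<le> M" "f \<in> borel_measurable borel" "\<And>z. z \<notin> box l u \<Longrightarrow> f z = 0" "\<And>z. cmod (f z) \<le> M"
    by (rule bounded_on_boxE[OF assms]) (rule that)
  then show ?thesis
    by (intro bounded_on_boxI[where M="cmod c * M"]) (simp_all add: norm_mult mult_left_mono)
qed

text \<open>Bumps give indicators of boxes by a bounded limit, the \<pi>-\<lambda> theorem gives
  indicators of Borel sets, linear combinations give simple functions, and a last bounded limit
  gives f. All intermediate functions live on the same box, so an identity with a kernel bounded
  there survives every step.\<close>

lemma bounded_on_box_induct [consumes 2, case_names test add cmult lim]:
  assumes l: "0 < snd (snd l)" and f: "bounded_on_box l u f"
    and test: "\<And>g. g \<in> test_functions \<Longrightarrow> bounded_on_box l u g \<Longrightarrow> P g"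
    and add: "\<And>f g. bounded_on_box l u f \<Longrightarrow> bounded_on_box l u g \<Longrightarrow> P f \<Longrightarrow> P g \<Longrightarrow> P (\<lambda>z. f z + g z)"
    and cmult: "\<And>c f. bounded_on_box l u f \<Longrightarrow> P f \<Longrightarrow> P (\<lambda>z. c * f z)"
    and lim: "\<And>F f M. (\<And>n. bounded_on_box l u (F n)) \<Longrightarrow> bounded_on_box l u f \<Longrightarrow> (\<And>n. P (F n)) \<Longrightarrow>
       (\<And>n z. cmod (F n z) \<le> M) \<Longrightarrow> (\<And>z. (\<lambda>n. F n z) \<longlonglongrightarrow> f z) \<Longrightarrow> P f"
  shows "P f"
proof -
  define J :: "point set \<Rightarrow> point \<Rightarrow> complex" where "J A = indicator (A \<inter> box l u)" for A
  have J: "bounded_on_box l u (J A)" if "A \<in> sets borel" for A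
    using that by (intro bounded_on_boxI[where M=1]) (simp_all add: J_def indicator_def)
  have diff: "P (\<lambda>z. f z - g z)" if "bounded_on_box l u f" "bounded_on_box l u g" "P f" "P g" for f g
    using add[OF that(1) bounded_on_box_cmult[OF that(2)] that(3) cmult[OF that(2,4)], of "-1"] by simp
  have zero: "bounded_on_box l u (\<lambda>z. 0)" by (rule bounded_on_boxI[where M=0]) simp_all
  have b: "bounded_on_box l u (bump l u 0)"
    by (rule test_bounded_on_box[OF bump_test[OF l]]) (rule bump_zero)
  have P0: "P (\<lambda>z. 0)"
    using cmult[of "bump l u 0" 0, OF b test[OF bump_test[OF l] b]] by simp
  have Pbox: "P (J (box a b))" for a b
  proof -
    \<comment> \<open>Corners of the intersection of the two boxes; its lower height is still
      positive because that of l is.\<close>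
    define l' :: point where "l' = (max (fst a) (fst l), max (fst (snd a)) (fst (snd l)), max (snd (snd a)) (snd (snd l)))"
    define u' :: point where "u' = (min (fst b) (fst u), min (fst (snd b)) (fst (snd u)), min (snd (snd b)) (snd (snd u)))"
    have eq: "box a b \<inter> box l u = box l' u'"
      by (auto simp: mem_box_point l'_def u'_def)
    have l': "0 < snd (snd l')" using l by (simp add: l'_def)
    have sub: "bump l' u' n z = 0" if "z \<notin> box l u" for n z
      using that by (intro bump_zero) (simp add: eq[symmetric])
    note t = bump_test[OF l'] test_bounded_on_box[OF bump_test[OF l'] sub]
    show ?thesis
    proof (rule lim[of "\<lambda>n. bump l' u' n" _ 1])
      show "(\<lambda>n. bump l' u' n z) \<longlonglongrightarrow> J (box a b) z" for z
        unfolding J_def eq by (rule bump_tendsto)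
    qed (simp_all add: t test J bump_bound)
  qed
  have PJ: "P (J A)" if "A \<in> sets borel" for A
  proof -
    have sb: "sets (borel :: point measure) = sigma_sets UNIV (range (\<lambda>(a, b). box a b))"
      by (subst borel_eq_box) simp
    have "Int_stable (range (\<lambda>(a, b). box a b :: point set))"
    proof (rule Int_stableI)
      fix A B :: "point set" assume "A \<in> range (\<lambda>(a, b). box a b)" "B \<in> range (\<lambda>(a, b). box a b)"
      then obtain a b c d where "A = box a b" "B = box c d" by auto
      then have "A \<inter> B = box (\<Sum>i\<in>Basis. max (a \<bullet> i) (c \<bullet> i) *\<^sub>R i) (\<Sum>i\<in>Basis. min (b \<bullet> i) (d \<bullet> i) *\<^sub>R i)"
        by (simp add: box_Int_box)
      then show "A \<inter> B \<in> range (\<lambda>(a, b). box a b)" by (intro range_eqI[of _ _ "(_, _)"]) simp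
    qed
    moreover have "range (\<lambda>(a, b). box a b :: point set) \<subseteq> Pow UNIV" by simp
    moreover have "A \<in> sigma_sets UNIV (range (\<lambda>(a, b). box a b))" using that sb by simp
    ultimately show ?thesis
    proof (induction A rule: sigma_sets_induct_disjoint)
      case (basic A)
      then show ?case using Pbox by auto
    next
      case empty
      then show ?case using P0 by (simp add: J_def indicator_def[abs_def])
    next
      \<comment> \<open>Complements are taken inside the box: \<open>J UNIV\<close> is the indicator
        of the box itself, which \<open>Pbox\<close> covers.\<close>
      case (compl A)
      have "J (UNIV - A) = (\<lambda>z. J UNIV z - J A z)"
        by (auto simp: J_def indicator_def)
      moreover have "J UNIV = J (box l u)" by (auto simp: J_def indicator_def)
      moreover have "A \<in> sets borel" using compl sb by simp
      ultimately show ?case using diff[OF J J Pbox compl.IH] by simp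
    next
      case (union A)
      have A: "A i \<in> sets borel" for i using union sb by auto
      have PU: "P (J (\<Union>i<n. A i))" for n
      proof (induction n)
        case 0
        then show ?case using P0 by (simp add: J_def indicator_def[abs_def])
      next
        case (Suc n)
        have "J (\<Union>i<Suc n. A i) = (\<lambda>z. J (\<Union>i<n. A i) z + J (A n) z)"
        proof
          fix z
          have "z \<notin> A n" if "z \<in> A i" "i < n" for i
            using that union(1) unfolding disjoint_family_on_def by (metis UNIV_I disjoint_iff less_irrefl)
          then show "J (\<Union>i<Suc n. A i) z = J (\<Union>i<n. A i) z + J (A n) z"
            by (auto simp: J_def indicator_def less_Suc_eq)
        qed
        then show ?case using add[OF J J Suc union(3)] A by auto
      qed
      show ?case
      proof (rule lim[of "\<lambda>n. J (\<Union>i<n. A i)" _ 1])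
        fix z
        show "(\<lambda>n. J (\<Union>i<n. A i) z) \<longlonglongrightarrow> J (\<Union>i. A i) z"
        proof (cases "z \<in> (\<Union>i. A i)")
          case True
          then obtain i where i: "z \<in> A i" by blast
          have "\<forall>\<^sub>F n in sequentially. J (\<Union>i<n. A i) z = J (\<Union>i. A i) z"
            using eventually_gt_at_top[of i] by eventually_elim (use i in \<open>auto simp: J_def indicator_def\<close>)
          then show ?thesis by (rule tendsto_eventually)
        qed (auto simp: J_def indicator_def)
      qed (use PU A in \<open>auto intro!: J sets.countable_UN, auto simp: J_def indicator_def\<close>)
    qed
  qed
  obtain M where "0 \<le> M" and f': "f \<in> borel_measurable borel" "\<And>z. z \<notin> box l u \<Longrightarrow> f z = 0"
    and M: "\<And>z. cmod (f z) \<le> M"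
    by (rule bounded_on_boxE[OF f]) (rule that)
  obtain s where s': "\<forall>i. simple_function borel (s i)" "\<forall>z. (\<lambda>i. s i z) \<longlonglongrightarrow> f z" "\<forall>i z. cmod (s i z) \<le> 2 * cmod (f z)"
    using borel_measurable_implies_sequence_metric[OF f'(1), of 0] by (elim exE conjE) (rule that, simp_all add: dist_norm)
  note s = s'[rule_format]
  have s0: "s i z = 0" if "z \<notin> box l u" for i z using s(3)[of i z] f'(2)[OF that] by simp
  have Ps: "P (s i) \<and> bounded_on_box l u (s i)" for i
  proof -
    have fin: "finite (range (s i))" and ms: "\<And>v. s i -` {v} \<in> sets borel"
      using s(1)[of i] simple_functionD(2)[OF s(1)[of i]] by (auto dest: simple_functionD(1))
    have part: "P (\<lambda>z. \<Sum>v\<in>V. v * J (s i -` {v}) z) \<and> bounded_on_box l u (\<lambda>z. \<Sum>v\<in>V. v * J (s i -` {v}) z)" if "finite V" for V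
      using that
    proof (induction V)
      case empty
      then show ?case using P0 zero by simp
    next
      case (insert v V)
      then show ?case
        using add[OF bounded_on_box_cmult[OF J[OF ms]] _ cmult[OF J[OF ms] PJ[OF ms]]]
          bounded_on_box_add[OF bounded_on_box_cmult[OF J[OF ms]]] by simp
    qed
    have "s i = (\<lambda>z. \<Sum>v\<in>range (s i). v * J (s i -` {v}) z)"
    proof
      fix z
      have "(\<Sum>v\<in>range (s i). v * J (s i -` {v}) z) = (\<Sum>v\<in>range (s i). if v = s i z then s i z else 0)"
        using s0[of z i] by (intro sum.cong) (auto simp: J_def indicator_def)
      then show "s i z = (\<Sum>v\<in>range (s i). v * J (s i -` {v}) z)" using fin by simp
    qed
    then show ?thesis using part[OF fin] by simp
  qed
  show ?thesis
  proof (rule lim[of s f "2 * M"])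
    show "cmod (s n z) \<le> 2 * M" for n z using s(3)[of n z] M[of z] by linarith
  qed (use Ps f s(2) in simp_all)
qed

section \<open>Change of variables in the convolution\<close>

text \<open>The height is the outermost variable, since the affine substitutions in the other two
  depend on it.\<close>

lemma nn_integral_lborel_point:
  assumes "H \<in> borel_measurable (borel :: point measure)"
  shows "(\<integral>\<^sup>+z. H z \<partial>lborel) = (\<integral>\<^sup>+c. \<integral>\<^sup>+y. \<integral>\<^sup>+x. H (x, y, c) \<partial>lborel \<partial>lborel \<partial>lborel)"
proof -
  have m1: "H \<in> borel_measurable (lborel \<Otimes>\<^sub>M lborel)"
    using assms by (simp add: lborel_prod)
  have m2: "(\<lambda>q. \<integral>\<^sup>+x. H (x, q) \<partial>lborel) \<in> borel_measurable (lborel \<Otimes>\<^sub>M lborel)"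
  proof -
    have "(\<lambda>q. \<integral>\<^sup>+x. H (x, q) \<partial>lborel) \<in> borel_measurable lborel"
      using measurable_compose[OF measurable_pair_swap' m1]
      by (intro lborel.borel_measurable_nn_integral) (simp add: case_prod_unfold)
    then show ?thesis by (simp add: lborel_prod)
  qed
  have "(\<integral>\<^sup>+z. H z \<partial>lborel) = (\<integral>\<^sup>+q. \<integral>\<^sup>+x. H (x, q) \<partial>lborel \<partial>lborel)"
    using lborel_pair.nn_integral_snd[OF m1] by (simp add: lborel_prod)
  also have "\<dots> = (\<integral>\<^sup>+c. \<integral>\<^sup>+y. \<integral>\<^sup>+x. H (x, y, c) \<partial>lborel \<partial>lborel \<partial>lborel)"
    using lborel_pair.nn_integral_snd[OF m2] by (simp add: lborel_prod)
  finally show ?thesis .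
qed

text \<open>Substitution on [-n, n] and monotone convergence. The purpose is to turn the inversion c
  \<mapsto> a / c of the positive half line into the reflection t \<mapsto> ln a - t of the line,
  under which Lebesgue measure is invariant.\<close>

lemma distr_lborel_exp: "distr lborel borel exp = density lborel (\<lambda>c. ennreal (indicator {0<..} c / c))"
proof (rule measure_eqI)
  fix A :: "real set" assume "A \<in> sets (distr lborel borel exp)"
  then have A [measurable]: "A \<in> sets borel" by simp
  define h :: "real \<Rightarrow> real" where "h c = indicator (A \<inter> {0<..}) c / c" for c
  have h: "h \<in> borel_measurable borel" unfolding h_def by (intro borel_measurable_divide borel_measurable_indicator) auto
  have sub: "(\<integral>\<^sup>+x. h x * indicator {exp (- real n)..exp (real n)} x \<partial>lborel)
      = (\<integral>\<^sup>+x. h (exp x) * exp x * indicator {- real n..real n} x \<partial>lborel)" for n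
    using h by (intro nn_integral_substitution[where g=exp and g'=exp and f=h])
       (auto intro!: derivative_eq_intros continuous_intros simp: set_borel_measurable_def)
  have mono: "(\<Union>n. {- real n..real n}) = UNIV" "(\<Union>n. {exp (- real n)..exp (real n)}) = {0<..}"
  proof -
    have ex: "\<exists>n. - real n \<le> x \<and> x \<le> real n" for x
    proof -
      obtain n where "\<bar>x\<bar> \<le> real n" using real_arch_simple by blast
      then have "- real n \<le> x \<and> x \<le> real n" by linarith
      then show ?thesis ..
    qed
    show "(\<Union>n. {- real n..real n}) = UNIV" using ex by auto
    have "\<exists>n. x \<in> {exp (- real n)..exp (real n)}" if "x > 0" for x
    proof -
      obtain n where "- real n \<le> ln x \<and> ln x \<le> real n" using ex by blast
      then have "exp (- real n) \<le> exp (ln x) \<and> exp (ln x) \<le> exp (real n)" by simp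
      then show ?thesis using that by auto
    qed
    moreover have "x > 0" if "x \<in> {exp (- real n)..exp (real n)}" for x n
      using that exp_gt_zero[of "- real n"] by (simp del: exp_gt_zero)
    ultimately show "(\<Union>n. {exp (- real n)..exp (real n)}) = {0<..}" by blast
  qed
  have inc1: "incseq (\<lambda>n x::real. ennreal (h x * indicator {exp (- real n)..exp (real n)} x))"
  proof (intro incseq_SucI le_funI ennreal_leI mult_left_mono)
    fix n x show "indicator {exp (- real n)..exp (real n)} x \<le> (indicator {exp (- real (Suc n))..exp (real (Suc n))} x :: real)"
    proof (cases "x \<in> {exp (- real n)..exp (real n)}")
      case True
      have "exp (- real (Suc n)) \<le> exp (- real n)" "exp (real n) \<le> exp (real (Suc n))" by simp_all
      then have "x \<in> {exp (- real (Suc n))..exp (real (Suc n))}"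
        using True unfolding atLeastAtMost_iff by (meson order_trans)
      then show ?thesis using True by simp
    qed simp
  qed (simp add: h_def indicator_def)
  have inc2: "incseq (\<lambda>n x::real. ennreal (h (exp x) * exp x * indicator {- real n..real n} x))"
    by (intro incseq_SucI le_funI ennreal_leI mult_left_mono) (auto simp: h_def indicator_def)
  have "emeasure (distr lborel borel exp) A = emeasure lborel (exp -` A)"
    by (simp add: emeasure_distr)
  also have "\<dots> = (\<integral>\<^sup>+x. indicator (exp -` A) x \<partial>lborel)" by (simp add: measurable_sets_borel[OF _ A])
  also have "\<dots> = (\<integral>\<^sup>+x. (SUP n. ennreal (h (exp x) * exp x * indicator {- real n..real n} x)) \<partial>lborel)"
  proof (rule nn_integral_cong)
    fix x :: real
    obtain n where n: "x \<in> {- real n..real n}" using mono(1) by blast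
    show "indicator (exp -` A) x = (SUP n. ennreal (h (exp x) * exp x * indicator {- real n..real n} x))"
    proof (rule antisym)
      show "indicator (exp -` A) x \<le> (SUP n. ennreal (h (exp x) * exp x * indicator {- real n..real n} x))"
        by (rule SUP_upper2[of n]) (use n in \<open>auto simp: h_def indicator_def\<close>)
      show "(SUP n. ennreal (h (exp x) * exp x * indicator {- real n..real n} x)) \<le> indicator (exp -` A) x"
        by (rule SUP_least) (auto simp: h_def indicator_def)
    qed
  qed
  also have "\<dots> = (SUP n. \<integral>\<^sup>+x. ennreal (h (exp x) * exp x * indicator {- real n..real n} x) \<partial>lborel)"
    using h by (intro nn_integral_monotone_convergence_SUP inc2)
      (intro measurable_compose[OF _ measurable_ennreal] borel_measurable_times borel_measurable_indicator
        measurable_compose[OF _ h], auto)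
  also have "\<dots> = (SUP n. \<integral>\<^sup>+x. ennreal (h x * indicator {exp (- real n)..exp (real n)} x) \<partial>lborel)"
    using sub by (simp add: ennreal_mult' ennreal_indicator)
  also have "\<dots> = (\<integral>\<^sup>+x. (SUP n. ennreal (h x * indicator {exp (- real n)..exp (real n)} x)) \<partial>lborel)"
    using h by (intro nn_integral_monotone_convergence_SUP[symmetric] inc1)
      (intro measurable_compose[OF _ measurable_ennreal] borel_measurable_times borel_measurable_indicator, auto)
  also have "\<dots> = (\<integral>\<^sup>+x. ennreal (indicator {0<..} x / x) * indicator A x \<partial>lborel)"
  proof (rule nn_integral_cong)
    fix x :: real
    show "(SUP n. ennreal (h x * indicator {exp (- real n)..exp (real n)} x)) = ennreal (indicator {0<..} x / x) * indicator A x"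
    proof (cases "x > 0")
      case True
      then have "x \<in> (\<Union>n. {exp (- real n)..exp (real n)})" unfolding mono(2) by simp
      then obtain n where n: "x \<in> {exp (- real n)..exp (real n)}" by blast
      show ?thesis
      proof (rule antisym)
        show "(SUP n. ennreal (h x * indicator {exp (- real n)..exp (real n)} x)) \<le> ennreal (indicator {0<..} x / x) * indicator A x"
          by (rule SUP_least) (auto simp: h_def indicator_def)
        show "ennreal (indicator {0<..} x / x) * indicator A x \<le> (SUP n. ennreal (h x * indicator {exp (- real n)..exp (real n)} x))"
          by (rule SUP_upper2[of n]) (use n in \<open>auto simp: h_def indicator_def\<close>)
      qed
    qed (simp add: h_def)
  qed
  also have "\<dots> = emeasure (density lborel (\<lambda>c. ennreal (indicator {0<..} c / c))) A"
    by (subst emeasure_density)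
      (auto intro!: measurable_compose[OF _ measurable_ennreal] borel_measurable_divide borel_measurable_indicator)
  finally show "emeasure (distr lborel borel exp) A = emeasure (density lborel (\<lambda>c. ennreal (indicator {0<..} c / c))) A" .
qed simp

lemma nn_integral_multiplicative_haar:
  assumes F [measurable]: "F \<in> borel_measurable borel"
  shows "(\<integral>\<^sup>+c. ennreal (indicator {0<..} c / c) * F c \<partial>lborel) = (\<integral>\<^sup>+t. F (exp t) \<partial>lborel)"
proof -
  have "(\<integral>\<^sup>+c. ennreal (indicator {0<..} c / c) * F c \<partial>lborel) = (\<integral>\<^sup>+c. F c \<partial>density lborel (\<lambda>c. ennreal (indicator {0<..} c / c)))"
    by (rule nn_integral_density[symmetric])
      (auto intro!: measurable_compose[OF _ measurable_ennreal] borel_measurable_divide borel_measurable_indicator)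
  also have "\<dots> = (\<integral>\<^sup>+c. F c \<partial>distr lborel borel exp)" by (simp add: distr_lborel_exp)
  also have "\<dots> = (\<integral>\<^sup>+t. F (exp t) \<partial>lborel)" by (rule nn_integral_distr) auto
  finally show ?thesis .
qed

lemma nn_integral_haar_inversion:
  assumes F [measurable]: "F \<in> borel_measurable borel" and a: "0 < a"
  shows "(\<integral>\<^sup>+c. ennreal (indicator {0<..} c / c) * F (a / c) \<partial>lborel) = (\<integral>\<^sup>+c. ennreal (indicator {0<..} c / c) * F c \<partial>lborel)"
proof -
  have "(\<integral>\<^sup>+c. ennreal (indicator {0<..} c / c) * F (a / c) \<partial>lborel) = (\<integral>\<^sup>+t. F (a / exp t) \<partial>lborel)"
    by (rule nn_integral_multiplicative_haar) measurable
  also have "\<dots> = (\<integral>\<^sup>+t. F (exp (ln a + (-1) * t)) \<partial>lborel)"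
    using a by (simp add: exp_diff)
  also have "\<dots> = (\<integral>\<^sup>+t. F (exp t) \<partial>lborel)"
    using nn_integral_real_affine[of "\<lambda>t. F (exp t)" "-1" "ln a"] by simp
  also have "\<dots> = (\<integral>\<^sup>+c. ennreal (indicator {0<..} c / c) * F c \<partial>lborel)"
    by (rule nn_integral_multiplicative_haar[symmetric]) simp
  finally show ?thesis .
qed

lemma wt_triple: "wt (x, y, c) = indicator {0<..} c / c"
  by (simp add: wt_def indicator_def G_iff)

lemma gmult_ginv: "(x1, x2, a) \<odot> ginv (y1, y2, b) = (x1 - a * y1 / b, x2 - a * y2 / b, a / b)"
  by (simp add: gmult_def ginv_def)

lemma gmult_ginv_measurable: "(\<lambda>y. x \<odot> ginv y) \<in> borel \<rightarrow>\<^sub>M borel"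
proof -
  obtain x1 x2 a where x: "x = (x1, x2, a)" by (cases x)
  have "(\<lambda>y. x \<odot> ginv y) = (\<lambda>y. (x1 - a * fst y / snd (snd y), x2 - a * fst (snd y) / snd (snd y), a / snd (snd y)))"
  proof
    fix y show "x \<odot> ginv y = (x1 - a * fst y / snd (snd y), x2 - a * fst (snd y) / snd (snd y), a / snd (snd y))"
      by (cases y) (simp add: x gmult_ginv)
  qed
  moreover have "\<dots> \<in> borel \<rightarrow>\<^sub>M (borel \<Otimes>\<^sub>M (borel \<Otimes>\<^sub>M borel))"
    by (intro measurable_Pair borel_measurable_diff borel_measurable_divide borel_measurable_times
        borel_measurable_const borel_measurable_continuous_onI continuous_intros)
  ultimately show ?thesis by (simp add: borel_prod)
qed

lemma gmult_ginv_measurable_rho: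
  assumes "x \<in> G" shows "(\<lambda>y. x \<odot> ginv y) \<in> rho \<rightarrow>\<^sub>M rho"
proof -
  have "(\<lambda>y. x \<odot> ginv y) \<in> restrict_space borel G \<rightarrow>\<^sub>M restrict_space borel G"
    using assms by (intro measurable_restrict_space3 gmult_ginv_measurable) (auto intro: gmult_closed ginv_closed)
  then show ?thesis using measurable_cong_sets[OF sets_rho sets_rho] by simp
qed

text \<open>Inversion carries the right Haar measure to the left one, which is \<delta> \<rho>, and
  left translation by x preserves the latter. In coordinates: at fixed height b of y both horizontal
  substitutions have slope -k with k = a / b, which gives k^2 against the factor k^-2, and the
  height is inverted by b \<mapsto> a / b.\<close>

lemma nn_integral_rho_reflect:
  assumes H: "H \<in> borel_measurable borel" and x: "x \<in> G"
  shows "(\<integral>\<^sup>+y. H (x \<odot> ginv y) \<partial>rho) = (\<integral>\<^sup>+z. ennreal (1 / snd (snd z) ^ 2) * H z \<partial>rho)"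
proof -
  obtain x1 x2 a where xa: "x = (x1, x2, a)" by (cases x)
  have a: "0 < a" using x by (simp add: xa G_iff)
  have Hp: "H \<in> borel_measurable (borel \<Otimes>\<^sub>M (borel \<Otimes>\<^sub>M borel))"
    using H by (simp add: borel_prod)
  note [measurable] = Hp
  have mH: "(\<lambda>y. H (x \<odot> ginv y)) \<in> borel_measurable borel"
    by (rule measurable_compose[OF gmult_ginv_measurable H])
  have mw: "(\<lambda>z. ennreal (wt z)) \<in> borel_measurable borel" by (rule measurable_compose[OF wt_measurable measurable_ennreal])
  have ms: "(\<lambda>z::point. ennreal (1 / snd (snd z) ^ 2)) \<in> borel_measurable borel"
    by (intro measurable_compose[OF _ measurable_ennreal] borel_measurable_divide borel_measurable_power) simp_all
  define F where "F c = ennreal (1 / c ^ 2) * (\<integral>\<^sup>+y. \<integral>\<^sup>+x. H (x, y, c) \<partial>lborel \<partial>lborel)" for c :: real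
  have F: "F \<in> borel_measurable borel"
    unfolding F_def by measurable
  have "(\<integral>\<^sup>+y. H (x \<odot> ginv y) \<partial>rho) = (\<integral>\<^sup>+y. ennreal (wt y) * H (x \<odot> ginv y) \<partial>lborel)"
    by (rule nn_integral_rho_wt) (rule borel_imp_rho[OF mH])
  also have "\<dots> = (\<integral>\<^sup>+b. \<integral>\<^sup>+y2. \<integral>\<^sup>+y1. ennreal (indicator {0<..} b / b) * H (x1 - a * y1 / b, x2 - a * y2 / b, a / b) \<partial>lborel \<partial>lborel \<partial>lborel)"
    by (subst nn_integral_lborel_point) (auto simp: wt_triple xa gmult_ginv intro!: borel_measurable_times_ennreal mw mH[unfolded xa])
  also have "\<dots> = (\<integral>\<^sup>+b. ennreal (indicator {0<..} b / b) * F (a / b) \<partial>lborel)"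
  proof (rule nn_integral_cong)
    fix b :: real
    show "(\<integral>\<^sup>+y2. \<integral>\<^sup>+y1. ennreal (indicator {0<..} b / b) * H (x1 - a * y1 / b, x2 - a * y2 / b, a / b) \<partial>lborel \<partial>lborel)
       = ennreal (indicator {0<..} b / b) * F (a / b)"
    proof (cases "b > 0")
      case True
      define k where "k = a / b"
      have k: "k > 0" using True a by (simp add: k_def)
      have 1: "(\<integral>\<^sup>+x. H (x, y, k) \<partial>lborel) = ennreal k * (\<integral>\<^sup>+y1. H (x1 - a * y1 / b, y, k) \<partial>lborel)" for y
        using nn_integral_real_affine[of "\<lambda>x. H (x, y, k)" "- k" x1] a True by (simp add: k_def)
      have 2: "(\<integral>\<^sup>+y. \<integral>\<^sup>+y1. H (x1 - a * y1 / b, y, k) \<partial>lborel \<partial>lborel)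
          = ennreal k * (\<integral>\<^sup>+y2. \<integral>\<^sup>+y1. H (x1 - a * y1 / b, x2 - a * y2 / b, k) \<partial>lborel \<partial>lborel)"
        using nn_integral_real_affine[of "\<lambda>y. \<integral>\<^sup>+y1. H (x1 - a * y1 / b, y, k) \<partial>lborel" "- k" x2] a True by (simp add: k_def)
      have "F k = ennreal (1 / k ^ 2) * (ennreal k * (ennreal k * (\<integral>\<^sup>+y2. \<integral>\<^sup>+y1. H (x1 - a * y1 / b, x2 - a * y2 / b, k) \<partial>lborel \<partial>lborel)))"
        unfolding F_def 1 by (subst nn_integral_cmult) (simp_all add: 2)
      also have "\<dots> = ennreal (1 / k ^ 2 * (k * k)) * (\<integral>\<^sup>+y2. \<integral>\<^sup>+y1. H (x1 - a * y1 / b, x2 - a * y2 / b, k) \<partial>lborel \<partial>lborel)"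
        using k by (simp add: mult.assoc[symmetric] ennreal_mult'[symmetric])
      also have "1 / k ^ 2 * (k * k) = 1" using k by (simp add: power2_eq_square)
      finally have "F (a / b) = (\<integral>\<^sup>+y2. \<integral>\<^sup>+y1. H (x1 - a * y1 / b, x2 - a * y2 / b, a / b) \<partial>lborel \<partial>lborel)"
        by (simp add: k_def)
      then show ?thesis by (simp add: nn_integral_cmult)
    qed simp
  qed
  also have "\<dots> = (\<integral>\<^sup>+b. ennreal (indicator {0<..} b / b) * F b \<partial>lborel)"
    by (rule nn_integral_haar_inversion[OF F a])
  also have "\<dots> = (\<integral>\<^sup>+c. \<integral>\<^sup>+y. \<integral>\<^sup>+x. ennreal (wt (x, y, c)) * (ennreal (1 / c ^ 2) * H (x, y, c)) \<partial>lborel \<partial>lborel \<partial>lborel)"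
    unfolding F_def wt_triple by (simp add: nn_integral_cmult mult.assoc)
  also have "\<dots> = (\<integral>\<^sup>+z. ennreal (wt z) * (ennreal (1 / snd (snd z) ^ 2) * H z) \<partial>lborel)"
    by (subst nn_integral_lborel_point[of "\<lambda>z. ennreal (wt z) * (ennreal (1 / snd (snd z) ^ 2) * H z)"])
      (auto intro!: borel_measurable_times_ennreal mw ms H)
  also have "\<dots> = (\<integral>\<^sup>+z. ennreal (1 / snd (snd z) ^ 2) * H z \<partial>rho)"
    by (rule nn_integral_rho_wt[symmetric]) (intro borel_imp_rho borel_measurable_times_ennreal ms H)
  finally show ?thesis .
qed

text \<open>cosh^2 - 1 factors into D + (b - 1)^2 and D + (b + 1)^2 over (2 b)^2, and these two are
  |x - z|^2 and |x - z'|^2 up to the scale (a / b)^2. The square of the height of z compensates the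
  factor \<delta> of the change of variables. At y = e both sides are 0, since division by zero
  gives 0.\<close>

lemma W_eq_green:
  assumes x: "x \<in> G" and y: "y \<in> G"
  shows "W y = snd (snd (x \<odot> ginv y)) ^ 2 * green x (x \<odot> ginv y)"
proof -
  obtain x1 x2 a where xa: "x = (x1, x2, a)" by (cases x)
  obtain y1 y2 b where yb: "y = (y1, y2, b)" by (cases y)
  have a: "a > 0" and b: "b > 0" using x y by (auto simp: xa yb G_iff)
  define D where "D = y1\<^sup>2 + y2\<^sup>2"
  define c where "c = (b + 1 / b + D / b) / 2"
  have c: "cosh (dist_e y) = c" "0 \<le> dist_e y"
    using cosh_dist_e[of y1 y2 b] y by (simp_all add: yb c_def D_def)
  have "sinh (dist_e y) ^ 2 = c ^ 2 - 1" using c(1) by (simp add: sinh_square_eq)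
  moreover have "c ^ 2 - 1 = ((D + (b - 1)\<^sup>2) * (D + (b + 1)\<^sup>2)) / (2 * b) ^ 2"
    using b by (simp add: c_def field_simps power2_eq_square)
  ultimately have "sinh (dist_e y) = sqrt (((D + (b - 1)\<^sup>2) * (D + (b + 1)\<^sup>2)) / (2 * b) ^ 2)"
    using c(2) by (intro real_sqrt_unique[symmetric]) auto
  then have sinh: "sinh (dist_e y) = sqrt (D + (b - 1)\<^sup>2) * sqrt (D + (b + 1)\<^sup>2) / (2 * b)"
    using b by (simp add: real_sqrt_divide real_sqrt_mult)
  have "sqrt (modular y) = 1 / b" using b by (simp add: modular_def yb real_sqrt_divide)
  then have W: "W y = 1 / (2 * pi) * (1 / (sqrt (D + (b - 1)\<^sup>2) * sqrt (D + (b + 1)\<^sup>2)))"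
    using b by (simp add: W_def sinh)
  define z where "z = x \<odot> ginv y"
  have z: "z = (x1 - a * y1 / b, x2 - a * y2 / b, a / b)" by (simp add: z_def xa yb gmult_ginv)
  have n1: "norm (x - z) = (a / b) * sqrt (D + (b - 1)\<^sup>2)"
  proof -
    have "norm (x - z) ^ 2 = (a / b) ^ 2 * (D + (b - 1)\<^sup>2)"
      unfolding norm_point using b by (simp add: xa z D_def field_simps power2_eq_square)
    then have "sqrt ((a / b) ^ 2 * (D + (b - 1)\<^sup>2)) = norm (x - z)" by (intro real_sqrt_unique) auto
    then show ?thesis using a b by (simp add: real_sqrt_mult real_sqrt_divide)
  qed
  have n2: "norm (x - reflect z) = (a / b) * sqrt (D + (b + 1)\<^sup>2)"
  proof -
    have "norm (x - reflect z) ^ 2 = (a / b) ^ 2 * (D + (b + 1)\<^sup>2)"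
      unfolding norm_point using b by (simp add: xa z D_def reflect_def field_simps power2_eq_square)
    then have "sqrt ((a / b) ^ 2 * (D + (b + 1)\<^sup>2)) = norm (x - reflect z)" by (intro real_sqrt_unique) auto
    then show ?thesis using a b by (simp add: real_sqrt_mult real_sqrt_divide)
  qed
  have "snd (snd z) ^ 2 * green x z = 1 / (2 * pi) * (1 / (sqrt (D + (b - 1)\<^sup>2) * sqrt (D + (b + 1)\<^sup>2)))"
  proof -
    have "snd (snd z) = a / b" by (simp add: z)
    then show ?thesis unfolding green_def n1 n2 using a b by (simp add: power2_eq_square)
  qed
  then show ?thesis by (simp add: W z_def)
qed

lemma distr_rho_reflect:
  assumes x: "x \<in> G"
  shows "distr rho rho (\<lambda>y. x \<odot> ginv y) = density rho (\<lambda>z. ennreal (1 / snd (snd z) ^ 2))"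
proof (rule measure_eqI)
  note m = gmult_ginv_measurable_rho[OF x]
  fix A assume "A \<in> sets (distr rho rho (\<lambda>y. x \<odot> ginv y))"
  then have A: "A \<in> sets rho" by simp
  then have AG: "A \<subseteq> G" "A \<in> sets borel" unfolding sets_rho by (auto simp: sets_restrict_space)
  have "emeasure (distr rho rho (\<lambda>y. x \<odot> ginv y)) A = (\<integral>\<^sup>+y. indicator A (x \<odot> ginv y) \<partial>rho)"
  proof -
    have "emeasure (distr rho rho (\<lambda>y. x \<odot> ginv y)) A = (\<integral>\<^sup>+z. indicator A z \<partial>distr rho rho (\<lambda>y. x \<odot> ginv y))"
      by (rule nn_integral_indicator[symmetric]) (use A in simp)
    also have "\<dots> = (\<integral>\<^sup>+y. indicator A (x \<odot> ginv y) \<partial>rho)"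
      by (rule nn_integral_distr[OF m]) (use A in simp)
    finally show ?thesis .
  qed
  also have "\<dots> = (\<integral>\<^sup>+z. ennreal (1 / snd (snd z) ^ 2) * indicator A z \<partial>rho)"
    using AG by (intro nn_integral_rho_reflect x) simp
  also have "\<dots> = emeasure (density rho (\<lambda>z. ennreal (1 / snd (snd z) ^ 2))) A"
    using A by (intro emeasure_density[symmetric] borel_imp_rho measurable_compose[OF _ measurable_ennreal]
       borel_measurable_divide borel_measurable_power) simp_all
  finally show "emeasure (distr rho rho (\<lambda>y. x \<odot> ginv y)) A = emeasure (density rho (\<lambda>z. ennreal (1 / snd (snd z) ^ 2))) A" .
qed simp

lemma of_real_measurable: "complex_of_real \<in> borel_measurable borel"
  by (intro borel_measurable_continuous_onI continuous_intros)

lemma green_measurable2: "(\<lambda>p. green (fst p) (snd p)) \<in> borel_measurable borel"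
proof -
  have "(\<lambda>p. norm (fst p - snd p)) \<in> borel_measurable (borel :: (point \<times> point) measure)"
    by (intro borel_measurable_continuous_onI continuous_intros)
  moreover have "(\<lambda>p. norm (fst p - reflect (snd p))) \<in> borel_measurable (borel :: (point \<times> point) measure)"
    unfolding reflect_def by (intro borel_measurable_continuous_onI continuous_intros)
  ultimately show ?thesis
    unfolding green_def by (intro borel_measurable_times borel_measurable_divide borel_measurable_const)
qed

lemma green_measurable:
  "green x \<in> borel_measurable borel" "(\<lambda>x. green x z) \<in> borel_measurable borel"
proof -
  have "(\<lambda>z. (x, z)) \<in> borel \<rightarrow>\<^sub>M borel" "(\<lambda>x. (x, z)) \<in> borel \<rightarrow>\<^sub>M (borel :: (point \<times> point) measure)"
    by (intro borel_measurable_continuous_onI continuous_intros)+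
  from this[THEN measurable_compose[OF _ green_measurable2]]
  show "green x \<in> borel_measurable borel" "(\<lambda>x. green x z) \<in> borel_measurable borel" by simp_all
qed

text \<open>Reflection is an isometry and an involution, so |x - z'| = |x' - z|. The symmetry of the
  kernel is what makes \<Delta>^-1 its own transpose with respect to \<rho>.\<close>

lemma green_sym: "green x z = green z x"
proof -
  have "norm (x - reflect z) = norm (reflect (x - reflect z))" by simp
  also have "reflect (x - reflect z) = - (z - reflect x)" by (simp add: reflect_def prod_eq_iff)
  also have "norm (- (z - reflect x)) = norm (z - reflect x)" by (rule norm_minus_cancel)
  finally have "norm (x - reflect z) = norm (z - reflect x)" .
  then show ?thesis unfolding green_def norm_minus_commute[of x z] by simp
qed

lemma green_nonneg: "0 \<le> green x z"
  by (simp add: green_def)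

lemma W_eq_green_gone: "y \<in> G \<Longrightarrow> W y = green y gone"
  using W_eq_green[of y y] by (simp add: ginv_right gone_def)

lemma W_measurable: "W \<in> borel_measurable rho"
proof -
  have "(\<lambda>y. green y gone) \<in> borel_measurable rho"
    by (rule borel_imp_rho) (rule green_measurable)
  then show ?thesis
    by (rule measurable_cong[THEN iffD1, rotated]) (simp add: W_eq_green_gone)
qed

text \<open>\<open>K\<close> carries the square of the height, which the density of the transformed
  measure removes; the Green kernel is what remains of W.\<close>

lemma integral_W_green:
  fixes F :: "point \<Rightarrow> complex"
  assumes x: "x \<in> G" and F: "F \<in> borel_measurable rho"
  shows "(\<integral>y. F (x \<odot> ginv y) * of_real (W y) \<partial>rho) = (\<integral>z. F z * of_real (green x z) \<partial>rho)"
proof -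
  define K where "K z = F z * of_real (snd (snd z) ^ 2 * green x z)" for z
  have K: "K \<in> borel_measurable rho"
    unfolding K_def using F
    by (intro borel_measurable_times measurable_compose[OF _ of_real_measurable] borel_imp_rho[OF green_measurable(1)]
        borel_measurable_power borel_imp_rho[OF height_measurable])
  note m = gmult_ginv_measurable_rho[OF x]
  have d: "(\<lambda>z::point. 1 / snd (snd z) ^ 2) \<in> borel_measurable rho"
    by (intro borel_imp_rho borel_measurable_divide borel_measurable_power) simp_all
  have eqW: "F (x \<odot> ginv y) * of_real (W y) = K (x \<odot> ginv y)" if "y \<in> space rho" for y
    using that by (simp add: K_def W_eq_green[OF x])
  have eqg: "(1 / snd (snd z) ^ 2) *\<^sub>R K z = F z * of_real (green x z)" if "z \<in> space rho" for z
    using that by (simp add: K_def G_iff scaleR_conv_of_real)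
  have "(\<integral>y. F (x \<odot> ginv y) * of_real (W y) \<partial>rho) = (\<integral>y. K (x \<odot> ginv y) \<partial>rho)"
    by (rule Bochner_Integration.integral_cong[OF refl eqW])
  also have "\<dots> = (\<integral>z. K z \<partial>distr rho rho (\<lambda>y. x \<odot> ginv y))"
    by (rule integral_distr[OF m K, symmetric])
  also have "\<dots> = (\<integral>z. (1 / snd (snd z) ^ 2) *\<^sub>R K z \<partial>rho)"
    unfolding distr_rho_reflect[OF x] by (rule integral_density[OF K d]) simp
  also have "\<dots> = (\<integral>z. F z * of_real (green x z) \<partial>rho)"
    by (rule Bochner_Integration.integral_cong[OF refl eqg])
  finally show "(\<integral>y. F (x \<odot> ginv y) * of_real (W y) \<partial>rho) = (\<integral>z. F z * of_real (green x z) \<partial>rho)" .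
qed

lemma compact_height_bound:
  assumes "compact K" "K \<subseteq> G"
  obtains m where "0 < m" "\<And>z. z \<in> K \<Longrightarrow> m \<le> snd (snd z)"
proof (cases "K = {}")
  case False
  have "continuous_on K (\<lambda>z::point. snd (snd z))" by (intro continuous_intros)
  then obtain z0 where "z0 \<in> K" "\<forall>z\<in>K. snd (snd z0) \<le> snd (snd z)"
    using continuous_attains_inf[OF assms(1) False] by blast
  then show ?thesis using that[of "snd (snd z0)"] assms(2) by (auto simp: G_iff)
qed (use that[of 1] in simp)

lemma inverse_norm_rho_compact:
  assumes K: "compact K" "K \<subseteq> G"
  obtains C where "0 < C" "\<And>x. integrable rho (\<lambda>z. indicator K z / norm (z - x))"
    "\<And>x. (\<integral>z. indicator K z / norm (z - x) \<partial>rho) \<le> C"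
proof -
  obtain m where m: "0 < m" "\<And>z. z \<in> K \<Longrightarrow> m \<le> snd (snd z)"
    by (rule compact_height_bound[OF K]) (rule that)
  obtain C where C: "C > 0" "\<And>x. (\<integral>\<^sup>+z. ennreal (1 / norm (z - x)) * indicator K z \<partial>lborel) \<le> ennreal C"
    using nn_integral_inverse_norm_compact[OF K(1)] by (elim exE conjE) (rule that, assumption, erule spec)
  have Kb: "K \<in> sets borel" using K(1) by (simp add: compact_imp_closed)
  have me: "(\<lambda>z. indicator K z / norm (z - x)) \<in> borel_measurable borel" for x
    using Kb by (intro borel_measurable_divide borel_measurable_indicator borel_measurable_norm borel_measurable_diff) simp_all
  have le: "(\<integral>\<^sup>+z. ennreal (indicator K z / norm (z - x)) \<partial>rho) \<le> ennreal (C / m)" for x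
  proof -
    have "(\<integral>\<^sup>+z. ennreal (indicator K z / norm (z - x)) \<partial>rho) = (\<integral>\<^sup>+z. ennreal (wt z) * ennreal (indicator K z / norm (z - x)) \<partial>lborel)"
      by (intro nn_integral_rho_wt borel_imp_rho measurable_compose[OF me measurable_ennreal])
    also have "\<dots> \<le> (\<integral>\<^sup>+z. ennreal (1 / m) * (ennreal (1 / norm (z - x)) * indicator K z) \<partial>lborel)"
    proof (rule nn_integral_mono)
      fix z
      show "ennreal (wt z) * ennreal (indicator K z / norm (z - x)) \<le> ennreal (1 / m) * (ennreal (1 / norm (z - x)) * indicator K z)"
      proof (cases "z \<in> K")
        case True
        then have "wt z \<le> 1 / m" using m(1) m(2)[OF True] subsetD[OF K(2) True] by (simp add: wt_G frac_le)
        then show ?thesis using True by (simp add: mult_right_mono ennreal_leI)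
      qed simp
    qed
    also have "\<dots> = ennreal (1 / m) * (\<integral>\<^sup>+z. ennreal (1 / norm (z - x)) * indicator K z \<partial>lborel)"
      using Kb by (intro nn_integral_cmult borel_measurable_times_ennreal borel_measurable_indicator) simp_all
    also have "\<dots> \<le> ennreal (1 / m) * ennreal C" by (intro mult_left_mono C(2)) simp
    also have "\<dots> = ennreal (C / m)" using m(1) by (simp add: ennreal_mult'[symmetric])
    finally show ?thesis .
  qed
  have int: "integrable rho (\<lambda>z. indicator K z / norm (z - x))" for x
  proof (rule integrableI_bounded)
    show "(\<lambda>z. indicator K z / norm (z - x)) \<in> borel_measurable rho" by (rule borel_imp_rho[OF me])
    have "(\<integral>\<^sup>+z. ennreal (norm (indicator K z / norm (z - x))) \<partial>rho) \<le> ennreal (C / m)" using le[of x] by simp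
    then show "(\<integral>\<^sup>+z. ennreal (norm (indicator K z / norm (z - x))) \<partial>rho) < \<infinity>" by (rule le_less_trans) simp
  qed
  have "(\<integral>z. indicator K z / norm (z - x) \<partial>rho) \<le> C / m" for x
  proof -
    have "ennreal (\<integral>z. indicator K z / norm (z - x) \<partial>rho) = (\<integral>\<^sup>+z. ennreal (indicator K z / norm (z - x)) \<partial>rho)"
      by (rule nn_integral_eq_integral[OF int, symmetric]) simp
    also note le[of x]
    finally show ?thesis using C(1) m(1) by (simp add: ennreal_le_iff)
  qed
  then show ?thesis using that[of "C / m"] int C(1) m(1) by simp
qed

text \<open>The factor |x - z'| allowed in the bound on f cancels the second factor of the Green
  kernel and leaves 1 / |x - z|, whose integral over K is bounded uniformly in x. The allowance
  serves the derivatives of translates, which grow with the distance from x.\<close>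

lemma green_potential_bound:
  assumes K: "compact K" "K \<subseteq> G"
  shows "\<exists>C>0. \<forall>x f M. x \<in> G \<longrightarrow> f \<in> borel_measurable rho \<longrightarrow> 0 \<le> M \<longrightarrow>
       (\<forall>z\<in>G. cmod (f z) \<le> M * indicator K z * norm (x - reflect z)) \<longrightarrow>
       integrable rho (\<lambda>z. f z * of_real (green x z)) \<and>
       (\<integral>z. cmod (f z) * green x z \<partial>rho) \<le> M * C \<and>
       cmod (\<integral>z. f z * of_real (green x z) \<partial>rho) \<le> M * C"
proof -
  obtain C where C: "0 < C" "\<And>x. integrable rho (\<lambda>z. indicator K z / norm (z - x))"
    "\<And>x. (\<integral>z. indicator K z / norm (z - x) \<partial>rho) \<le> C"
    by (rule inverse_norm_rho_compact[OF K]) (rule that)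
  have "integrable rho (\<lambda>z. f z * of_real (green x z)) \<and> (\<integral>z. cmod (f z) * green x z \<partial>rho) \<le> M * C \<and>
       cmod (\<integral>z. f z * of_real (green x z) \<partial>rho) \<le> M * C"
    if x: "x \<in> G" and f: "f \<in> borel_measurable rho" and M: "0 \<le> M"
      and b: "\<And>z. z \<in> G \<Longrightarrow> cmod (f z) \<le> M * indicator K z * norm (x - reflect z)" for x f M
  proof -
    have pt: "cmod (f z) * green x z \<le> M * (indicator K z / norm (z - x))" if z: "z \<in> G" for z
    proof (cases "z = x")
      case True
      then show ?thesis by (simp add: green_def)
    next
      case False
      have "cmod (f z) * green x z \<le> (M * indicator K z * norm (x - reflect z)) * (1 / (norm (x - z) * norm (x - reflect z)))"
        using False z x M by (intro mult_mono b green_bound) auto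
      also have "\<dots> = M * (indicator K z / norm (z - x))"
        using ne_reflect[OF x z] by (simp add: norm_minus_commute)
      finally show ?thesis .
    qed
    have ib: "integrable rho (\<lambda>z. M * (indicator K z / norm (z - x)))" using C(2)[of x] by (rule integrable_mult_right)
    have mg: "(\<lambda>z. f z * of_real (green x z)) \<in> borel_measurable rho"
      using f by (intro borel_measurable_times measurable_compose[OF _ of_real_measurable] borel_imp_rho[OF green_measurable(1)])
    have int: "integrable rho (\<lambda>z. f z * of_real (green x z))"
    proof (rule Bochner_Integration.integrable_bound[OF ib mg])
      show "AE z in rho. cmod (f z * of_real (green x z)) \<le> norm (M * (indicator K z / norm (z - x)))"
        using pt M by (intro AE_I2) (simp add: norm_mult green_nonneg)
    qed
    have "(\<integral>z. cmod (f z) * green x z \<partial>rho) \<le> (\<integral>z. M * (indicator K z / norm (z - x)) \<partial>rho)"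
    proof (rule integral_mono[OF _ ib])
      show "integrable rho (\<lambda>z. cmod (f z) * green x z)"
        using integrable_norm[OF int] by (simp add: norm_mult green_nonneg)
    qed (use pt in simp)
    also have "\<dots> = M * (\<integral>z. indicator K z / norm (z - x) \<partial>rho)" by (rule integral_mult_right_zero)
    also have "\<dots> \<le> M * C" by (rule mult_left_mono[OF C(3) M])
    finally have 1: "(\<integral>z. cmod (f z) * green x z \<partial>rho) \<le> M * C" .
    have "cmod (\<integral>z. f z * of_real (green x z) \<partial>rho) \<le> (\<integral>z. cmod (f z * of_real (green x z)) \<partial>rho)"
      by (rule integral_norm_bound)
    then have "cmod (\<integral>z. f z * of_real (green x z) \<partial>rho) \<le> M * C"
      using 1 by (simp add: norm_mult green_nonneg)
    with int 1 show ?thesis by blast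
  qed
  then show ?thesis using C(1) by (intro exI[of _ C] conjI allI impI) simp_all
qed

text \<open>The point y stays at distance at least 1 from the reflection of the identity, so W has
  only the singularity 1 / |y - e|, which is integrable.\<close>

lemma W_integrable_compact:
  assumes S: "compact S" "S \<subseteq> G"
  shows "integrable rho (\<lambda>y. indicator S y * W y)"
proof -
  obtain C where C: "0 < C" "\<And>x. integrable rho (\<lambda>z. indicator S z / norm (z - x))"
    "\<And>x. (\<integral>z. indicator S z / norm (z - x) \<partial>rho) \<le> C"
    by (rule inverse_norm_rho_compact[OF S]) (rule that)
  have Sb: "S \<in> sets borel" using S(1) by (simp add: compact_imp_closed)
  show ?thesis
  proof (rule Bochner_Integration.integrable_bound[OF C(2)[of gone]])
    show "(\<lambda>y. indicator S y * W y) \<in> borel_measurable rho"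
      using Sb by (intro borel_measurable_times W_measurable borel_imp_rho[OF borel_measurable_indicator])
    have "norm (indicator S y * W y) \<le> norm (indicator S y / norm (y - gone))" if y: "y \<in> G" for y
    proof (cases "y = gone")
      case False
      have "green y gone \<le> 1 / (norm (y - gone) * norm (y - reflect gone))"
        by (rule green_bound(2)[OF y gone_closed False])
      also have "\<dots> \<le> 1 / (norm (y - gone) * 1)"
      proof -
        have "1 \<le> norm (y - reflect gone)"
          using reflect_norm_le(3)[OF y gone_closed] by (simp add: gone_def)
        then show ?thesis using False by (intro divide_left_mono mult_left_mono mult_pos_pos) auto
      qed
      finally have "W y \<le> 1 / norm (y - gone)" using W_eq_green_gone[OF y] by simp
      moreover have "0 \<le> W y" using W_eq_green_gone[OF y] green_nonneg by simp
      ultimately show ?thesis by (simp add: indicator_def)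
    qed (use y in \<open>simp add: W_eq_green_gone green_def\<close>)
    then show "AE y in rho. norm (indicator S y * W y) \<le> norm (indicator S y / norm (y - gone))"
      by (intro AE_I2) simp
  qed
qed

section \<open>Potentials of compactly supported functions\<close>

text \<open>D is carried along instead of \<open>frechet_derivative\<close> because it is known
  explicitly for X_j g. Since h vanishes off K it is differentiable on all of R^3, so its arguments
  x y^-1 can be varied freely.\<close>

definition C1_compact :: "point set \<Rightarrow> (point \<Rightarrow> complex) \<Rightarrow> (point \<Rightarrow> point \<Rightarrow> complex) \<Rightarrow> bool" where
  "C1_compact K h D \<longleftrightarrow> compact K \<and> K \<subseteq> G \<and> (\<forall>z. z \<notin> K \<longrightarrow> h z = 0) \<and>
     (\<forall>z. (h has_derivative D z) (at z)) \<and> (\<forall>v. continuous_on UNIV (\<lambda>z. D z v))"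

context
  fixes K h D assumes h: "C1_compact K h D"
begin

lemma C1_compactD: "compact K" "K \<subseteq> G" "\<And>z. z \<notin> K \<Longrightarrow> h z = 0" "\<And>z. (h has_derivative D z) (at z)"
    "\<And>v. continuous_on UNIV (\<lambda>z. D z v)"
  using h by (simp_all add: C1_compact_def)

lemma C1_compact_linear: "linear (D z)"
  using C1_compactD(4) by (rule has_derivative_linear)

lemma C1_compact_continuous: "continuous_on UNIV h"
  using has_derivative_continuous[OF C1_compactD(4)] by (simp add: continuous_at_imp_continuous_on)

lemma C1_compact_measurable: "h \<in> borel_measurable borel" "(\<lambda>z. D z v) \<in> borel_measurable borel"
  by (rule borel_measurable_continuous_onI[OF C1_compact_continuous], rule borel_measurable_continuous_onI[OF C1_compactD(5)])

lemma C1_compact_deriv_zero: "z \<notin> K \<Longrightarrow> D z v = 0"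
proof -
  assume z: "z \<notin> K"
  have "(h has_derivative (\<lambda>v. 0)) (at z)"
    using z compact_imp_closed[OF C1_compactD(1)] C1_compactD(3)
    by (intro has_derivative_transform_within_open[OF has_derivative_const[of 0], of "- K"]) (auto simp: open_Compl)
  then have "D z = (\<lambda>v. 0)" using C1_compactD(4) by (rule has_derivative_unique[rotated])
  then show ?thesis by simp
qed

lemma compact_function_bounded:
  fixes f :: "point \<Rightarrow> complex"
  assumes "continuous_on UNIV f" "\<And>z. z \<notin> K \<Longrightarrow> f z = 0"
  obtains M where "0 \<le> M" "\<And>z. cmod (f z) \<le> M"
proof -
  have "bounded (f ` K)"
    using assms(1) C1_compactD(1) by (intro compact_imp_bounded compact_continuous_image continuous_on_subset[OF assms(1)]) auto
  then obtain M where M: "\<forall>w\<in>f ` K. cmod w \<le> M" unfolding bounded_iff by (elim exE)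
  show ?thesis
  proof (rule that[of "max M 0"])
    fix z show "cmod (f z) \<le> max M 0"
      using M assms(2)[of z] by (cases "z \<in> K") (auto intro: max.coboundedI1)
  qed simp
qed

lemma C1_compact_bounded:
  obtains M where "0 \<le> M" "\<And>z. cmod (h z) \<le> M"
  by (rule compact_function_bounded[OF C1_compact_continuous C1_compactD(3)]) (assumption, rule that)

lemma C1_compact_deriv_expand: "D z v = (\<Sum>b\<in>Basis. (v \<bullet> b) *\<^sub>R D z b)"
proof -
  have "D z v = D z (\<Sum>b\<in>Basis. (v \<bullet> b) *\<^sub>R b)" by (simp only: euclidean_representation)
  also have "\<dots> = (\<Sum>b\<in>Basis. (v \<bullet> b) *\<^sub>R D z b)"
    using C1_compact_linear[of z] by (simp only: linear_sum linear_cmul o_def)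
  finally show ?thesis .
qed

lemma C1_compact_deriv_bounded:
  obtains M where "0 \<le> M" "\<And>z v. cmod (D z v) \<le> M * indicator K z * norm v"
proof -
  have "\<exists>M. 0 \<le> M \<and> (\<forall>z. cmod (D z b) \<le> M)" for b
    by (rule compact_function_bounded[OF C1_compactD(5)[of b] C1_compact_deriv_zero]) (assumption, blast)
  then obtain N where N: "\<And>b. 0 \<le> N b" "\<And>b z. cmod (D z b) \<le> N b" by metis
  show ?thesis
  proof (rule that[of "\<Sum>b\<in>Basis. N b"])
    show "0 \<le> (\<Sum>b\<in>Basis. N b)" using N(1) by (rule sum_nonneg)
    fix z v
    show "cmod (D z v) \<le> (\<Sum>b\<in>Basis. N b) * indicator K z * norm v"
    proof (cases "z \<in> K")
      case True
      have "cmod (D z v) \<le> (\<Sum>b\<in>Basis. cmod ((v \<bullet> b) *\<^sub>R D z b))"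
        by (subst C1_compact_deriv_expand) (rule norm_sum)
      also have "\<dots> \<le> (\<Sum>b\<in>Basis. norm v * N b)"
        using N by (intro sum_mono) (simp add: mult_mono Basis_le_norm)
      finally show ?thesis using True by (simp add: sum_distrib_left mult.commute)
    qed (simp add: C1_compact_deriv_zero)
  qed
qed

lemma C1_compact_deriv_measurable:
  assumes "w \<in> borel_measurable borel"
  shows "(\<lambda>z. D z (w z)) \<in> borel_measurable borel"
  unfolding C1_compact_deriv_expand[of _ "w _"] using assms
  by (intro borel_measurable_sum borel_measurable_scaleR C1_compact_measurable borel_measurable_inner borel_measurable_const)

lemma C1_compact_has_vector_derivative:
  "((\<lambda>s. h (z + s *\<^sub>R v)) has_vector_derivative D (z + t *\<^sub>R v) v) (at t)"
proof -
  have "((\<lambda>s. z + s *\<^sub>R v) has_derivative (\<lambda>s. s *\<^sub>R v)) (at t)" by (auto intro!: derivative_eq_intros)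
  then have "((\<lambda>s. h (z + s *\<^sub>R v)) has_derivative (\<lambda>s. D (z + t *\<^sub>R v) (s *\<^sub>R v))) (at t)"
    by (rule has_derivative_compose) (rule C1_compactD(4))
  then show ?thesis
    unfolding has_vector_derivative_def using C1_compact_linear by (simp add: linear_cmul)
qed

end

text \<open>X_j is the height times the Euclidean derivative along \<open>cdir j\<close>; index 0 is
  the vertical direction, as in the numbering of the vector fields.\<close>

definition cdir :: "nat \<Rightarrow> point" where
  "cdir j = [(0, 0, 1), (1, 0, 0), (0, 1, 0)] ! j"

lemma cdir_simps: "cdir 0 = (0, 0, 1)" "cdir (Suc 0) = (1, 0, 0)" "cdir 2 = (0, 1, 0)"
  by (simp_all add: cdir_def)

lemma norm_cdir: "j \<in> {0, 1, 2} \<Longrightarrow> norm (cdir j) = 1"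
  by (auto simp: cdir_simps norm_prod_def)

lemma X_eqI:
  assumes j: "j \<in> {0, 1, 2}"
    and d: "((\<lambda>t. f (z + t *\<^sub>R cdir j)) has_vector_derivative d) (at 0)"
  shows "X j f z = snd (snd z) *\<^sub>R d"
proof -
  obtain z1 z2 a where z: "z = (z1, z2, a)" by (cases z)
  have shift: "((\<lambda>t. g t) has_vector_derivative d) (at c)"
    if "((\<lambda>t. g (c + t)) has_vector_derivative d) (at 0)" for g :: "real \<Rightarrow> complex" and c
  proof -
    have "((\<lambda>t. t - c) has_vector_derivative 1) (at c)" by (auto intro!: derivative_eq_intros)
    moreover have "((\<lambda>t. g (c + t)) has_vector_derivative d) (at (c - c))" using that by simp
    ultimately have "((\<lambda>t. g (c + t)) \<circ> (\<lambda>t. t - c) has_vector_derivative 1 *\<^sub>R d) (at c)"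
      by (rule vector_diff_chain_at)
    then show ?thesis by (simp add: o_def)
  qed
  from j consider "j = 0" | "j = 1" | "j = 2" by auto
  then show ?thesis
  proof cases
    case 1
    then have "((\<lambda>t. f (z1, z2, t)) has_vector_derivative d) (at a)" using d by - (rule shift, simp add: z cdir_simps)
    then show ?thesis using 1 by (simp add: X_def X0_def z vector_derivative_at)
  next
    case 2
    then have "((\<lambda>t. f (t, z2, a)) has_vector_derivative d) (at z1)" using d by - (rule shift, simp add: z cdir_simps)
    then show ?thesis using 2 by (simp add: X_def X1_def z vector_derivative_at)
  next
    case 3
    then have "((\<lambda>t. f (z1, t, a)) has_vector_derivative d) (at z2)" using d by - (rule shift, simp add: z cdir_simps)
    then show ?thesis using 3 by (simp add: X_def X2_def z vector_derivative_at numeral_2_eq_2)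
  qed
qed

lemma C1_compact_X:
  assumes "C1_compact K h D" "j \<in> {0, 1, 2}"
  shows "X j h z = snd (snd z) *\<^sub>R D z (cdir j)"
  using C1_compact_has_vector_derivative[OF assms(1), of z "cdir j" 0] by (intro X_eqI assms) simp

text \<open>G and the complement of K are open and cover the space, so smoothness on G and extension
  by zero fit together.\<close>

lemma Ck_zero_outside_C1:
  assumes C: "Ck_on_G 1 g" and K: "compact K" "K \<subseteq> G" "\<And>z. z \<notin> K \<Longrightarrow> g z = 0"
  shows "C1_compact K g (\<lambda>z. frechet_derivative g (at z))"
proof -
  have cl: "open (- K)" using K(1) by (simp add: compact_imp_closed open_Compl)
  have out: "(g has_derivative (\<lambda>v. 0)) (at z)" if "z \<notin> K" for z
    using that cl K(3) by (intro has_derivative_transform_within_open[OF has_derivative_const[of 0], of "- K"]) auto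
  have d: "(g has_derivative frechet_derivative g (at z)) (at z)" for z
  proof (cases "z \<in> K")
    case True
    then show ?thesis using C K(2) by (intro Ck_on_G_SucD[of 0]) auto
  next
    case False
    show ?thesis using frechet_derivative_at[OF out[OF False]] out[OF False] by simp
  qed
  have "continuous_on UNIV (\<lambda>z. frechet_derivative g (at z) v)" for v
  proof -
    have "continuous_on (- K) (\<lambda>z. frechet_derivative g (at z) v)"
    proof (rule continuous_on_eq[OF continuous_on_const[of _ 0]])
      fix z assume "z \<in> - K"
      then show "0 = frechet_derivative g (at z) v" using frechet_derivative_at[OF out[of z]] by (metis ComplD)
    qed
    moreover have "continuous_on G (\<lambda>z. frechet_derivative g (at z) v)" using C by simp
    ultimately have "continuous_on (G \<union> - K) (\<lambda>z. frechet_derivative g (at z) v)"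
      using open_G cl by (intro continuous_on_open_Un)
    moreover have "G \<union> - K = UNIV" using K(2) by auto
    ultimately show ?thesis by simp
  qed
  with K d show ?thesis by (simp add: C1_compact_def)
qed

lemma frechet_zero_outside:
  assumes "compact K" "\<And>z. z \<notin> K \<Longrightarrow> g z = 0" "z \<notin> K"
  shows "frechet_derivative g (at z) v = 0"
proof -
  have "open (- K)" using assms(1) by (simp add: compact_imp_closed open_Compl)
  then have "(g has_derivative (\<lambda>v. 0)) (at z)"
    using assms by (intro has_derivative_transform_within_open[OF has_derivative_const[of 0], of "- K"]) auto
  from frechet_derivative_at[OF this] show ?thesis by (metis)
qed

text \<open>Both g and X_j g occur as densities of potentials or as factors in integrations by
  parts, so both need a continuous derivative; this takes two derivatives of g.\<close>

lemma test_C1_compact: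
  assumes g: "g \<in> test_functions" and K: "compact K" "K \<subseteq> G" "\<And>z. z \<notin> K \<Longrightarrow> g z = 0" and j: "j \<in> {0, 1, 2}"
  obtains D D' where "C1_compact K g D" "C1_compact K (X j g) D'"
proof -
  have C: "Ck_on_G k g" for k using g by (simp add: test_functions_def)
  define D where "D = (\<lambda>z. frechet_derivative g (at z))"
  have g1: "C1_compact K g D" unfolding D_def by (rule Ck_zero_outside_C1[OF C K])
  have "Ck_on_G (Suc 1) g" by (rule C)
  then have "Ck_on_G 1 (\<lambda>z. D z (cdir j))" unfolding D_def Ck_on_G.simps(2)[of 1] by (elim conjE allE)
  then have g2: "C1_compact K (\<lambda>z. D z (cdir j)) (\<lambda>z. frechet_derivative (\<lambda>z. D z (cdir j)) (at z))"
    using K(1,2) frechet_zero_outside[OF K(1,3)] by (intro Ck_zero_outside_C1) (simp_all add: D_def)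
  define E where "E = (\<lambda>z. frechet_derivative (\<lambda>z. D z (cdir j)) (at z))"
  note g2 = g2[folded E_def]
  have X: "X j g = (\<lambda>z. snd (snd z) *\<^sub>R D z (cdir j))"
    by (rule ext) (rule C1_compact_X[OF g1 j])
  have "C1_compact K (X j g) (\<lambda>z v. snd (snd z) *\<^sub>R E z v + snd (snd v) *\<^sub>R D z (cdir j))"
    unfolding C1_compact_def X
  proof (intro conjI allI impI)
    fix z v
    have "((\<lambda>z::point. snd (snd z)) has_derivative (\<lambda>v. snd (snd v))) (at z)"
      by (auto intro!: derivative_eq_intros)
    then show "((\<lambda>z. snd (snd z) *\<^sub>R D z (cdir j)) has_derivative (\<lambda>v. snd (snd z) *\<^sub>R E z v + snd (snd v) *\<^sub>R D z (cdir j))) (at z)"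
      by (rule has_derivative_scaleR) (rule C1_compactD(4)[OF g2])
    show "continuous_on UNIV (\<lambda>z. snd (snd z) *\<^sub>R E z v + snd (snd v) *\<^sub>R D z (cdir j))"
      by (intro continuous_intros C1_compactD(5)[OF g2] C1_compactD(5)[OF g1])
    show "snd (snd z) *\<^sub>R D z (cdir j) = 0" if "z \<notin> K"
      using C1_compact_deriv_zero[OF g1 that] by simp
  qed (use K in auto)
  with g1 show ?thesis by (rule that)
qed

text \<open>For a fixed right factor the product is linear in the left one as a vector of R^3. Here
  e is a tangent direction and need not lie in G.\<close>

lemma gmult_add_left: "(x + s *\<^sub>R e) \<odot> q = x \<odot> q + s *\<^sub>R (e \<odot> q)"
  by (cases x; cases e; cases q) (simp add: gmult_def algebra_simps)

lemma Delta_inv_eq_green: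
  assumes x: "x \<in> G" and h: "h \<in> borel_measurable rho"
  shows "Delta_inv h x = (\<integral>z. h z * of_real (green x z) \<partial>rho)"
  unfolding Delta_inv_def conv_def by (rule integral_W_green[OF x h])

text \<open>Differentiation falls on \<open>h\<close>, since \<open>x \<mapsto> x y\<^sup>-\<^sup>1\<close> is affine in coordinates.\<close>

lemma Delta_inv_has_vector_derivative:
  assumes h: "C1_compact K h D" and x: "x \<in> G"
  shows "((\<lambda>t. Delta_inv h (x + t *\<^sub>R e)) has_vector_derivative
           (\<integral>z. D z (e \<odot> (ginv x \<odot> z)) * of_real (green x z) \<partial>rho)) (at 0)"
proof -
  note hD = C1_compactD[OF h]
  define \<delta> where "\<delta> = snd (snd x) / 2"
  have a: "snd (snd x) > 0" using x by (simp add: G_iff)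
  have \<delta>: "\<delta> > 0" using a by (simp add: \<delta>_def)
  define \<epsilon> where "\<epsilon> = \<delta> / (1 + norm e)"
  have \<epsilon>: "\<epsilon> > 0" using \<delta> by (simp add: \<epsilon>_def add_pos_nonneg)
  have near: "x + t *\<^sub>R e \<in> cball x \<delta>" if "\<bar>t\<bar> < \<epsilon>" for t
  proof -
    have "\<bar>t\<bar> * norm e \<le> \<epsilon> * (1 + norm e)" using that \<epsilon> by (intro mult_mono) auto
    also have "\<dots> = \<delta>" by (simp add: \<epsilon>_def add_nonneg_eq_0_iff)
    finally show ?thesis by (simp add: dist_norm)
  qed
  have ballG: "cball x \<delta> \<subseteq> G"
  proof
    fix y assume "y \<in> cball x \<delta>"
    then have "norm (x - y) \<le> \<delta>" by (simp add: dist_norm)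
    moreover have "\<bar>snd (snd (x - y))\<bar> \<le> norm (x - y)"
      using norm_snd_le[of "snd (snd (x - y))" "fst (snd (x - y))"] norm_snd_le[of "snd (x - y)" "fst (x - y)"]
      by (simp only: prod.collapse real_norm_def)
    ultimately show "y \<in> G" using a by (simp add: G_iff \<delta>_def)
  qed
  \<comment> \<open>\<open>S\<close> collects all y with w y^-1 in K for some w in the ball about x.
    It is compact in G and contains the support of every integrand with |t| < \<epsilon>, so W
    restricted to it is, up to a constant, an integrable majorant.\<close>
  define S where "S = (\<lambda>p. ginv (snd p) \<odot> fst p) ` (cball x \<delta> \<times> K)"
  have "continuous_on (cball x \<delta> \<times> K) (\<lambda>p. ginv (snd p) \<odot> fst p)"
  proof -
    have "ginv z \<odot> w = ((fst w - fst z) / snd (snd z), (fst (snd w) - fst (snd z)) / snd (snd z), snd (snd w) / snd (snd z))" for z w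
      by (cases z; cases w) (simp add: ginv_def gmult_def diff_divide_distrib)
    then show ?thesis
      using hD(2) by (simp only:) (intro continuous_intros; auto simp: G_iff subset_eq)
  qed
  then have S: "compact S" unfolding S_def by (intro compact_continuous_image compact_Times compact_cball hD(1))
  have SG: "S \<subseteq> G"
  proof
    fix y assume "y \<in> S"
    then obtain p where p: "p \<in> cball x \<delta> \<times> K" "y = ginv (snd p) \<odot> fst p" unfolding S_def by (rule imageE)
    then have "snd p \<in> G" "fst p \<in> G" using ballG hD(2) by (auto simp del: mem_cball)
    then show "y \<in> G" unfolding p(2) by (intro gmult_closed ginv_closed)
  qed
  have inS: "y \<in> S" if y: "y \<in> G" and t: "\<bar>t\<bar> < \<epsilon>" and m: "(x + t *\<^sub>R e) \<odot> ginv y \<in> K" for y t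
  proof -
    let ?x' = "x + t *\<^sub>R e"
    have x': "?x' \<in> G" using near[OF t] ballG by blast
    have "ginv (?x' \<odot> ginv y) \<odot> ?x' = ginv (?x' \<odot> ginv y) \<odot> ((?x' \<odot> ginv y) \<odot> y)"
      using y by (simp add: gmult_assoc ginv_left gone_right)
    also have "\<dots> = y"
      using m hD(2) by (subst gmult_assoc[symmetric]) (auto simp: ginv_left gone_left)
    finally show ?thesis unfolding S_def using near[OF t] m by (intro image_eqI[of _ _ "(?x', ?x' \<odot> ginv y)"]) auto
  qed
  have Sb: "S \<in> sets borel" using S by (simp add: compact_imp_closed)
  have "bounded ((\<lambda>y. e \<odot> ginv y) ` S)"
  proof -
    have "e \<odot> ginv y = (fst e - snd (snd e) * fst y / snd (snd y), fst (snd e) - snd (snd e) * fst (snd y) / snd (snd y), snd (snd e) / snd (snd y))" for y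
      by (cases e; cases y) (simp add: gmult_ginv)
    then have "continuous_on S (\<lambda>y. e \<odot> ginv y)"
      using SG by (simp only:) (intro continuous_intros; auto simp: G_iff subset_eq)
    then show ?thesis using S by (intro compact_imp_bounded compact_continuous_image)
  qed
  then obtain B where B0: "0 < B" and B: "\<forall>w\<in>(\<lambda>y. e \<odot> ginv y) ` S. norm w \<le> B" unfolding bounded_pos by (elim exE conjE)
  obtain M where M: "0 \<le> M" "\<And>z. cmod (h z) \<le> M" by (rule C1_compact_bounded[OF h]) (rule that)
  obtain N where N: "0 \<le> N" "\<And>z v. cmod (D z v) \<le> N * indicator K z * norm v" by (rule C1_compact_deriv_bounded[OF h]) (rule that)
  have W0: "0 \<le> W y" if "y \<in> G" for y using that by (simp add: W_eq_green_gone green_nonneg)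
  define F where "F t y = h ((x + t *\<^sub>R e) \<odot> ginv y) * of_real (W y)" for t y
  define F' where "F' t y = D ((x + t *\<^sub>R e) \<odot> ginv y) (e \<odot> ginv y) * of_real (W y)" for t y
  define w where "w y = max M (N * B) * (indicator S y * W y)" for y
  have w: "integrable rho w" unfolding w_def by (intro integrable_mult_right W_integrable_compact S SG)
  have mF: "F t \<in> borel_measurable rho" for t
    unfolding F_def
    by (intro borel_measurable_times borel_imp_rho[OF measurable_compose[OF gmult_ginv_measurable C1_compact_measurable(1)[OF h]]]
        measurable_compose[OF W_measurable of_real_measurable])
  have Fb: "cmod (F t y) \<le> w y" if t: "\<bar>t\<bar> < \<epsilon>" and y: "y \<in> G" for t y
  proof (cases "y \<in> S")
    case True
    have "cmod (F t y) \<le> M * W y" unfolding F_def norm_mult using W0[OF y] by (simp add: mult_right_mono M(2))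
    also have "\<dots> \<le> max M (N * B) * W y" using W0[OF y] by (intro mult_right_mono) auto
    finally show ?thesis using True by (simp add: w_def)
  next
    case False
    then have "(x + t *\<^sub>R e) \<odot> ginv y \<notin> K" using inS[OF y t] by blast
    then show ?thesis using hD(3) False by (simp add: F_def w_def)
  qed
  have F'b: "cmod (F' t y) \<le> w y" if t: "\<bar>t\<bar> < \<epsilon>" and y: "y \<in> G" for t y
  proof (cases "y \<in> S")
    case True
    have "cmod (D ((x + t *\<^sub>R e) \<odot> ginv y) (e \<odot> ginv y)) \<le> N * indicator K ((x + t *\<^sub>R e) \<odot> ginv y) * norm (e \<odot> ginv y)"
      by (rule N(2))
    also have "\<dots> \<le> N * 1 * B"
      using True B N(1) B0 by (intro mult_mono mult_left_mono) (auto simp: indicator_def)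
    finally have "cmod (F' t y) \<le> (N * B) * W y" unfolding F'_def norm_mult using W0[OF y] by (simp add: mult_right_mono)
    also have "\<dots> \<le> max M (N * B) * W y" using W0[OF y] by (intro mult_right_mono) auto
    finally show ?thesis using True by (simp add: w_def)
  next
    case False
    then have "(x + t *\<^sub>R e) \<odot> ginv y \<notin> K" using inS[OF y t] by blast
    then show ?thesis using C1_compact_deriv_zero[OF h] False by (simp add: F'_def w_def)
  qed
  have int: "integrable rho (F t)" if "\<bar>t\<bar> < \<epsilon>" for t
  proof (rule Bochner_Integration.integrable_bound[OF w mF])
    have "cmod (F t y) \<le> norm (w y)" if "y \<in> G" for y using Fb[OF \<open>\<bar>t\<bar> < \<epsilon>\<close> that] by (simp add: abs_le_iff)
    then show "AE y in rho. cmod (F t y) \<le> norm (w y)" by (intro AE_I2) simp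
  qed
  have der: "((\<lambda>s. F s y) has_vector_derivative F' t y) (at t)" for t y
    unfolding F_def F'_def gmult_add_left
    by (intro has_vector_derivative_mult_left C1_compact_has_vector_derivative[OF h])
  have L: "((\<lambda>t. \<integral>y. F t y \<partial>rho) has_vector_derivative (\<integral>y. F' 0 y \<partial>rho)) (at 0)"
    by (rule has_vector_derivative_integral(2)[OF \<epsilon> int der _ w]) (assumption, rule F'b, assumption, simp)
  \<comment> \<open>Writing y^-1 as x^-1 (x y^-1) turns the integrand into a function of z = x y^-1,
    as the substitution requires.\<close>
  have "(\<integral>y. F' 0 y \<partial>rho) = (\<integral>y. D (x \<odot> ginv y) (e \<odot> (ginv x \<odot> (x \<odot> ginv y))) * of_real (W y) \<partial>rho)"
    unfolding F'_def using x by (simp add: gmult_assoc[symmetric] ginv_left gone_left gone_right)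
  also have "\<dots> = (\<integral>z. D z (e \<odot> (ginv x \<odot> z)) * of_real (green x z) \<partial>rho)"
  proof (rule integral_W_green[OF x])
    have "e \<odot> (ginv x \<odot> z) = (fst e + snd (snd e) * ((fst z - fst x) / snd (snd x)),
        fst (snd e) + snd (snd e) * ((fst (snd z) - fst (snd x)) / snd (snd x)), snd (snd e) * (snd (snd z) / snd (snd x)))" for z
      by (cases e; cases x; cases z) (simp add: gmult_def ginv_def diff_divide_distrib)
    then have "(\<lambda>z. e \<odot> (ginv x \<odot> z)) \<in> borel_measurable borel"
      using a by (simp only:) (intro borel_measurable_continuous_onI continuous_intros; simp)
    then show "(\<lambda>z. D z (e \<odot> (ginv x \<odot> z))) \<in> borel_measurable rho"
      by (intro borel_imp_rho C1_compact_deriv_measurable[OF h])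
  qed
  finally show ?thesis using L by (simp add: F_def Delta_inv_def conv_def)
qed

text \<open>On all of R^3 the weighted Lebesgue integral is measurable in x as a parametric
  integral, whereas \<open>Delta_inv\<close> is controlled on G only; the two agree there.\<close>

lemma lborel_measurable_Delta_inv:
  fixes h :: "point \<Rightarrow> complex"
  assumes h: "h \<in> borel_measurable borel"
  shows "(\<lambda>x. \<integral>z. wt z *\<^sub>R (h z * of_real (green x z)) \<partial>lborel) \<in> borel_measurable borel"
proof -
  have m: "(\<lambda>p. wt (snd p) *\<^sub>R (h (snd p) * of_real (green (fst p) (snd p)))) \<in> borel_measurable (borel :: (point \<times> point) measure)"
  proof -
    have s: "(snd :: point \<times> point \<Rightarrow> point) \<in> borel \<rightarrow>\<^sub>M borel"
      by (intro borel_measurable_continuous_onI continuous_intros)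
    show ?thesis
      by (intro borel_measurable_scaleR borel_measurable_times measurable_compose[OF s h] measurable_compose[OF s wt_measurable]
          measurable_compose[OF green_measurable2 of_real_measurable])
  qed
  have s: "sets (borel \<Otimes>\<^sub>M lborel) = sets (borel :: (point \<times> point) measure)"
    using sets_pair_measure_cong[OF refl sets_lborel, of "borel :: point measure"] by (simp only: borel_prod)
  have "(\<lambda>p. wt (snd p) *\<^sub>R (h (snd p) * of_real (green (fst p) (snd p)))) \<in> borel_measurable (borel \<Otimes>\<^sub>M lborel)"
    using m by (simp only: measurable_cong_sets[OF s refl])
  then show ?thesis
    by (intro lborel.borel_measurable_lebesgue_integral) (simp add: case_prod_unfold)
qed

lemma Delta_inv_lborel:
  assumes h: "h \<in> borel_measurable borel" and x: "x \<in> G"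
  shows "Delta_inv h x = (\<integral>z. wt z *\<^sub>R (h z * of_real (green x z)) \<partial>lborel)"
  unfolding Delta_inv_eq_green[OF x borel_imp_rho[OF h]]
  by (intro integral_rho borel_imp_rho borel_measurable_times h measurable_compose[OF green_measurable(1) of_real_measurable])

lemma Delta_inv_measurable_on:
  assumes h: "h \<in> borel_measurable borel" and K: "K \<in> sets borel" "K \<subseteq> G"
  shows "(\<lambda>x. indicator K x *\<^sub>R Delta_inv h x) \<in> borel_measurable borel"
proof -
  have "(\<lambda>x. indicator K x *\<^sub>R Delta_inv h x) =
      (\<lambda>x. indicator K x *\<^sub>R (\<integral>z. wt z *\<^sub>R (h z * of_real (green x z)) \<partial>lborel))"
  proof
    fix x show "indicator K x *\<^sub>R Delta_inv h x = indicator K x *\<^sub>R (\<integral>z. wt z *\<^sub>R (h z * of_real (green x z)) \<partial>lborel)"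
      using Delta_inv_lborel[OF h, of x] K(2) by (cases "x \<in> K") auto
  qed
  moreover have "\<dots> \<in> borel_measurable borel"
    by (intro borel_measurable_scaleR borel_measurable_indicator K lborel_measurable_Delta_inv[OF h])
  ultimately show ?thesis by (simp only:)
qed

text \<open>For a horizontal direction \<open>cdir j \<odot> (ginv x \<odot> z)\<close> is a unit
  vector, and a \<le> |x - z'|. For the vertical one it is x^-1 z, which after scaling by a has
  coordinates (z1 - x1, z2 - x2, c) with c \<le> a + c. This supplies the growth hypothesis of
  \<open>green_potential_bound\<close>.\<close>

lemma cdir_shift_bound:
  assumes x: "x \<in> G" and z: "z \<in> G" and j: "j \<in> {0, 1, 2}"
  shows "snd (snd x) * norm (cdir j \<odot> (ginv x \<odot> z)) \<le> norm (x - reflect z)"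
proof -
  obtain x1 x2 a where xa: "x = (x1, x2, a)" by (cases x)
  obtain z1 z2 c where zc: "z = (z1, z2, c)" by (cases z)
  have a: "a > 0" and c: "c > 0" using x z by (auto simp: xa zc G_iff)
  from j consider "j = 0" | "norm (cdir j \<odot> (ginv x \<odot> z)) = 1"
    by (cases "ginv x \<odot> z") (auto simp: cdir_simps gmult_def norm_prod_def)
  then show ?thesis
  proof cases
    case 1
    have e: "a *\<^sub>R (cdir j \<odot> (ginv x \<odot> z)) = (z1 - x1, z2 - x2, c)"
      using a by (simp add: 1 cdir_simps gmult_def ginv_def xa zc field_simps)
    have "norm (a *\<^sub>R (cdir j \<odot> (ginv x \<odot> z))) ^ 2 \<le> norm (x - reflect z) ^ 2"
    proof -
      have "c\<^sup>2 \<le> (a + c)\<^sup>2" using a c by (intro power_mono) auto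
      then show ?thesis unfolding e norm_point by (simp add: xa zc reflect_def power2_commute[of z1] power2_commute[of z2])
    qed
    then have "norm (a *\<^sub>R (cdir j \<odot> (ginv x \<odot> z))) \<le> norm (x - reflect z)" by (rule power2_le_imp_le) simp
    then show ?thesis using a by (simp add: xa)
  next
    case 2
    then show ?thesis using reflect_norm_le(2)[OF x z] by simp
  qed
qed

text \<open>Both h and the derivative of its translates are bounded by a multiple of |x - z'| / a,
  so one estimate gives the potential and its derivative the size C / a. The height in X_j cancels
  this a, which is why X_j \<Delta>^-1 h is bounded on all of G.\<close>

lemma Delta_inv_bounds:
  assumes h: "C1_compact K h D" and j: "j \<in> {0, 1, 2}"
  obtains C d where "0 \<le> C"
    "\<And>x. x \<in> G \<Longrightarrow> cmod (Delta_inv h x) \<le> C / snd (snd x)"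
    "\<And>x. x \<in> G \<Longrightarrow> (\<integral>z. cmod (h z) * green x z \<partial>rho) \<le> C / snd (snd x)"
    "\<And>x. x \<in> G \<Longrightarrow> integrable rho (\<lambda>z. h z * of_real (green x z))"
    "\<And>x. x \<in> G \<Longrightarrow> ((\<lambda>t. Delta_inv h (x + t *\<^sub>R cdir j)) has_vector_derivative d x) (at 0)"
    "\<And>x. x \<in> G \<Longrightarrow> snd (snd x) * cmod (d x) \<le> C"
proof -
  note hD = C1_compactD[OF h]
  obtain C where C: "0 < C" and gp0: "\<forall>x f M. x \<in> G \<longrightarrow> f \<in> borel_measurable rho \<longrightarrow> 0 \<le> M \<longrightarrow>
       (\<forall>z\<in>G. cmod (f z) \<le> M * indicator K z * norm (x - reflect z)) \<longrightarrow>
       integrable rho (\<lambda>z. f z * of_real (green x z)) \<and>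
       (\<integral>z. cmod (f z) * green x z \<partial>rho) \<le> M * C \<and>
       cmod (\<integral>z. f z * of_real (green x z) \<partial>rho) \<le> M * C"
    using green_potential_bound[OF hD(1,2)] by (elim exE conjE)
  have gp: "integrable rho (\<lambda>z. f z * of_real (green x z)) \<and>
       (\<integral>z. cmod (f z) * green x z \<partial>rho) \<le> M * C \<and>
       cmod (\<integral>z. f z * of_real (green x z) \<partial>rho) \<le> M * C"
    if "x \<in> G" "f \<in> borel_measurable rho" "0 \<le> M"
       "\<And>z. z \<in> G \<Longrightarrow> cmod (f z) \<le> M * indicator K z * norm (x - reflect z)" for x f M
    using gp0[rule_format, of x f M] that by simp
  obtain M where M: "0 \<le> M" "\<And>z. cmod (h z) \<le> M" by (rule C1_compact_bounded[OF h]) (rule that)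
  obtain N where N: "0 \<le> N" "\<And>z v. cmod (D z v) \<le> N * indicator K z * norm v" by (rule C1_compact_deriv_bounded[OF h]) (rule that)
  have hm: "h \<in> borel_measurable rho" by (rule borel_imp_rho[OF C1_compact_measurable(1)[OF h]])
  define d where "d x = (\<integral>z. D z (cdir j \<odot> (ginv x \<odot> z)) * of_real (green x z) \<partial>rho)" for x
  have 1: "integrable rho (\<lambda>z. h z * of_real (green x z)) \<and> (\<integral>z. cmod (h z) * green x z \<partial>rho) \<le> M / snd (snd x) * C
      \<and> cmod (\<integral>z. h z * of_real (green x z) \<partial>rho) \<le> M / snd (snd x) * C" if x: "x \<in> G" for x
  proof (rule gp[OF x hm])
    have a: "snd (snd x) > 0" using x by (simp add: G_iff)
    then show "0 \<le> M / snd (snd x)" using M by simp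
    fix z assume z: "z \<in> G"
    show "cmod (h z) \<le> M / snd (snd x) * indicator K z * norm (x - reflect z)"
    proof (cases "z \<in> K")
      case True
      have "cmod (h z) \<le> M * 1" using M(2)[of z] by simp
      also have "\<dots> \<le> M * (norm (x - reflect z) / snd (snd x))"
        using a M(1) reflect_norm_le(2)[OF x z] by (intro mult_left_mono) simp_all
      finally show ?thesis using True by simp
    qed (simp add: hD(3))
  qed
  have 2: "cmod (d x) \<le> N / snd (snd x) * C" if x: "x \<in> G" for x
  proof -
    have a: "snd (snd x) > 0" using x by (simp add: G_iff)
    have m: "(\<lambda>z. D z (cdir j \<odot> (ginv x \<odot> z))) \<in> borel_measurable rho"
    proof -
      have "cdir j \<odot> (ginv x \<odot> z) = (fst (cdir j) + snd (snd (cdir j)) * ((fst z - fst x) / snd (snd x)),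
        fst (snd (cdir j)) + snd (snd (cdir j)) * ((fst (snd z) - fst (snd x)) / snd (snd x)), snd (snd (cdir j)) * (snd (snd z) / snd (snd x)))" for z
        by (cases "cdir j"; cases x; cases z) (simp add: gmult_def ginv_def diff_divide_distrib)
      then have "(\<lambda>z. cdir j \<odot> (ginv x \<odot> z)) \<in> borel_measurable borel"
        using a by (simp only:) (intro borel_measurable_continuous_onI continuous_intros; simp)
      then show ?thesis by (intro borel_imp_rho C1_compact_deriv_measurable[OF h])
    qed
    have "cmod (D z (cdir j \<odot> (ginv x \<odot> z))) \<le> N / snd (snd x) * indicator K z * norm (x - reflect z)" if z: "z \<in> G" for z
    proof -
      have "cmod (D z (cdir j \<odot> (ginv x \<odot> z))) \<le> N * indicator K z * norm (cdir j \<odot> (ginv x \<odot> z))" by (rule N(2))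
      also have "\<dots> \<le> N * indicator K z * (norm (x - reflect z) / snd (snd x))"
        using cdir_shift_bound[OF x z j] a N(1) by (intro mult_left_mono) (simp_all add: field_simps)
      finally show ?thesis by simp
    qed
    then show ?thesis unfolding d_def using gp[OF x m, of "N / snd (snd x)"] N(1) a by simp
  qed
  show ?thesis
  proof (rule that[of "max M N * C" d])
    show "0 \<le> max M N * C" using M(1) C by simp
    fix x assume x: "x \<in> G"
    have a: "snd (snd x) > 0" using x by (simp add: G_iff)
    have le: "M / snd (snd x) * C \<le> max M N * C / snd (snd x)"
      using a C by (simp add: divide_right_mono mult_right_mono)
    show "cmod (Delta_inv h x) \<le> max M N * C / snd (snd x)"
      unfolding Delta_inv_eq_green[OF x hm] using 1[OF x] le by linarith
    show "(\<integral>z. cmod (h z) * green x z \<partial>rho) \<le> max M N * C / snd (snd x)" using 1[OF x] le by linarith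
    show "integrable rho (\<lambda>z. h z * of_real (green x z))" using 1[OF x] by blast
    show "((\<lambda>t. Delta_inv h (x + t *\<^sub>R cdir j)) has_vector_derivative d x) (at 0)"
      unfolding d_def by (rule Delta_inv_has_vector_derivative[OF h x])
    have "snd (snd x) * cmod (d x) \<le> N * C" using 2[OF x] a by (simp add: field_simps)
    also have "\<dots> \<le> max M N * C" using C by (intro mult_right_mono) auto
    finally show "snd (snd x) * cmod (d x) \<le> max M N * C" .
  qed
qed

text \<open>The factor a of X_j cancels the density 1 / a of \<rho>, so the Euclidean formula
  applies without extra terms. The second conclusion is the source of measurability for derivatives
  of potentials, which are given only pointwise.\<close>

lemma integration_by_parts_rho:
  assumes g: "C1_compact K g D" and j: "j \<in> {0, 1, 2}"
    and dF: "\<And>z. z \<in> K \<Longrightarrow> ((\<lambda>t. F (z + t *\<^sub>R cdir j)) has_vector_derivative F' z) (at 0)"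
    and bF: "\<And>z. z \<in> K \<Longrightarrow> cmod (F z) \<le> N" and bF': "\<And>z. z \<in> K \<Longrightarrow> cmod (F' z) \<le> N"
    and mF: "(\<lambda>z. indicator K z *\<^sub>R F z) \<in> borel_measurable borel"
  shows "(\<integral>z. X j g z * F z \<partial>rho) = - (\<integral>z. g z * (snd (snd z) *\<^sub>R F' z) \<partial>rho)"
    "(\<lambda>z. g z * (snd (snd z) *\<^sub>R F' z)) \<in> borel_measurable borel"
proof -
  note gD = C1_compactD[OF g]
  obtain M where M: "0 \<le> M" "\<And>z. cmod (g z) \<le> M" by (rule C1_compact_bounded[OF g]) (rule that)
  obtain B where B: "0 \<le> B" "\<And>z v. cmod (D z v) \<le> B * indicator K z * norm v" by (rule C1_compact_deriv_bounded[OF g]) (rule that)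
  have bD: "cmod (D z (cdir j)) \<le> max M B" for z
  proof -
    have "B * indicator K z * norm (cdir j) \<le> B * 1 * 1"
      using B(1) norm_cdir[OF j] by (intro mult_mono mult_left_mono) (auto simp: indicator_def)
    then show ?thesis using B(2)[of z "cdir j"] by simp
  qed
  have bg: "cmod (g z) \<le> max M B" for z using M(2)[of z] by simp
  have dg: "((\<lambda>t. g (z + t *\<^sub>R cdir j)) has_vector_derivative D z (cdir j)) (at 0)" for z
    using C1_compact_has_vector_derivative[OF g, of z "cdir j" 0] by simp
  note I = integration_by_parts_directional[OF gD(1,3) dg bg bD C1_compact_measurable(1)[OF g] C1_compact_measurable(2)[OF g] dF bF bF' mF]
  have wt1: "wt z * snd (snd z) = 1" if "z \<in> K" for z
    using that gD(2) by (auto simp: wt_G G_iff)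
  have e1: "wt z *\<^sub>R (X j g z * F z) = D z (cdir j) * F z" for z
  proof (cases "z \<in> K")
    case True
    have "wt z *\<^sub>R (X j g z * F z) = (wt z * snd (snd z)) *\<^sub>R (D z (cdir j) * F z)"
      by (simp add: C1_compact_X[OF g j])
    then show ?thesis using wt1[OF True] by simp
  qed (simp add: C1_compact_X[OF g j] C1_compact_deriv_zero[OF g])
  have e2: "wt z *\<^sub>R (g z * (snd (snd z) *\<^sub>R F' z)) = g z * F' z" for z
  proof (cases "z \<in> K")
    case True
    have "wt z *\<^sub>R (g z * (snd (snd z) *\<^sub>R F' z)) = (wt z * snd (snd z)) *\<^sub>R (g z * F' z)" by simp
    then show ?thesis using wt1[OF True] by simp
  qed (simp add: gD(3))
  have m1: "(\<lambda>z. X j g z * F z) \<in> borel_measurable borel"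
  proof -
    have "(\<lambda>z. X j g z * F z) = (\<lambda>z. snd (snd z) *\<^sub>R (D z (cdir j) * F z))"
      by (simp add: C1_compact_X[OF g j])
    then show ?thesis using borel_measurable_integrable[OF I(1)] by (simp only:) (intro borel_measurable_scaleR; simp)
  qed
  have "(\<lambda>z. g z * (snd (snd z) *\<^sub>R F' z)) = (\<lambda>z. snd (snd z) *\<^sub>R (g z * F' z))" by simp
  then show m2: "(\<lambda>z. g z * (snd (snd z) *\<^sub>R F' z)) \<in> borel_measurable borel"
    using borel_measurable_integrable[OF I(2)] by (simp only:) (intro borel_measurable_scaleR; simp)
  show "(\<integral>z. X j g z * F z \<partial>rho) = - (\<integral>z. g z * (snd (snd z) *\<^sub>R F' z) \<partial>rho)"
    unfolding integral_rho[OF borel_imp_rho[OF m1]] integral_rho[OF borel_imp_rho[OF m2]] e1 e2 by (rule I(3))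
qed

text \<open>Fubini and the symmetry of \<open>green\<close>. Absolute integrability holds since the
  inner integral is at most C / a, hence at most C / m on L, where the heights are at least
  m.\<close>

lemma potential_symmetric:
  assumes h: "C1_compact K h D" and \<psi>: "C1_compact L \<psi> E"
  shows "(\<integral>x. \<psi> x * Delta_inv h x \<partial>rho) = (\<integral>z. h z * Delta_inv \<psi> z \<partial>rho)"
proof -
  note hD = C1_compactD[OF h] and \<psi>D = C1_compactD[OF \<psi>]
  note hm = C1_compact_measurable(1)[OF h] and \<psi>m = C1_compact_measurable(1)[OF \<psi>]
  obtain C d where C: "0 \<le> C" "\<And>x. x \<in> G \<Longrightarrow> (\<integral>z. cmod (h z) * green x z \<partial>rho) \<le> C / snd (snd x)"
    "\<And>x. x \<in> G \<Longrightarrow> integrable rho (\<lambda>z. h z * of_real (green x z))"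
    by (rule Delta_inv_bounds[OF h, of 0]) (simp, rule that)
  obtain M where M: "0 \<le> M" "\<And>z. cmod (\<psi> z) \<le> M" by (rule C1_compact_bounded[OF \<psi>]) (rule that)
  obtain m where m: "0 < m" "\<And>z. z \<in> L \<Longrightarrow> m \<le> snd (snd z)"
    by (rule compact_height_bound[OF \<psi>D(1,2)]) (rule that)
  define f where "f x z = (wt x *\<^sub>R \<psi> x) * (wt z *\<^sub>R (h z * of_real (green x z)))" for x z
  have mg: "(\<lambda>z. h z * of_real (green x z)) \<in> borel_measurable rho" for x
    by (intro borel_imp_rho borel_measurable_times hm measurable_compose[OF green_measurable(1) of_real_measurable])
  have f_in: "integrable lborel (\<lambda>z. f x z)" for x
  proof (cases "x \<in> L")
    case True
    then have "integrable lborel (\<lambda>z. wt z *\<^sub>R (h z * of_real (green x z)))"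
      using C(3)[of x] \<psi>D(2) integrable_rho[OF mg] by blast
    then show ?thesis unfolding f_def by (rule integrable_mult_right)
  qed (simp add: f_def \<psi>D(3))
  have Lb: "L \<in> sets borel" using \<psi>D(1) by (simp add: compact_imp_closed)
  have inner: "(\<integral>z. norm (f x z) \<partial>lborel) = wt x * cmod (\<psi> x) * (\<integral>z. cmod (h z) * green x z \<partial>rho)" for x
  proof -
    have "(\<integral>z. cmod (h z) * green x z \<partial>rho) = (\<integral>z. wt z *\<^sub>R (cmod (h z) * green x z) \<partial>lborel)"
      by (rule integral_rho[OF borel_imp_rho[OF borel_measurable_times[OF measurable_compose[OF hm borel_measurable_norm] green_measurable(1)]]])
    moreover have "norm (f x z) = (wt x * cmod (\<psi> x)) * (wt z *\<^sub>R (cmod (h z) * green x z))" for z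
      by (simp add: f_def norm_mult green_nonneg mult.assoc)
    ultimately show ?thesis by (simp only: integral_mult_right_zero)
  qed
  have mpair: "(\<lambda>p. f (fst p) (snd p)) \<in> borel_measurable borel"
  proof -
    have s: "(fst :: point \<times> point \<Rightarrow> point) \<in> borel \<rightarrow>\<^sub>M borel" "(snd :: point \<times> point \<Rightarrow> point) \<in> borel \<rightarrow>\<^sub>M borel"
      by (intro borel_measurable_continuous_onI continuous_intros)+
    show ?thesis unfolding f_def
      by (intro borel_measurable_scaleR borel_measurable_times measurable_compose[OF s(2) hm] measurable_compose[OF s(1) \<psi>m]
          measurable_compose[OF s(1) wt_measurable] measurable_compose[OF s(2) wt_measurable]
          measurable_compose[OF green_measurable2 of_real_measurable])
  qed
  have mpair': "case_prod f \<in> borel_measurable (lborel \<Otimes>\<^sub>M lborel)"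
    using mpair by (simp add: lborel_prod case_prod_unfold)
  have int: "integrable (lborel \<Otimes>\<^sub>M lborel) (case_prod f)"
  proof (rule lborel_pair.Fubini_integrable[OF mpair'])
    show "integrable lborel (\<lambda>x. \<integral>y. norm (case (x, y) of (x, z) \<Rightarrow> f x z) \<partial>lborel)"
    proof (rule Bochner_Integration.integrable_bound)
      show "integrable lborel (\<lambda>x. (1 / m * M * (C / m)) * indicator L x)"
        using Lb emeasure_compact_finite[OF \<psi>D(1)] by (intro integrable_mult_right integrable_real_indicator) auto
      show "(\<lambda>x. \<integral>y. norm (case (x, y) of (x, z) \<Rightarrow> f x z) \<partial>lborel) \<in> borel_measurable lborel"
        using mpair' by (intro lborel.borel_measurable_lebesgue_integral) (simp add: case_prod_unfold)
      have "norm (\<integral>y. norm (f x y) \<partial>lborel) \<le> norm ((1 / m * M * (C / m)) * indicator L x)" for x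
      proof (cases "x \<in> L")
        case True
        have x: "x \<in> G" using True \<psi>D(2) by blast
        have w: "wt x \<le> 1 / m" using m(1) m(2)[OF True] by (simp add: wt_G[OF x] frac_le)
        have "(\<integral>z. cmod (h z) * green x z \<partial>rho) \<le> C / m"
        proof -
          have "C / snd (snd x) \<le> C / m" using m(1) m(2)[OF True] C(1) by (simp add: frac_le)
          then show ?thesis using C(2)[OF x] by linarith
        qed
        then have "wt x * cmod (\<psi> x) * (\<integral>z. cmod (h z) * green x z \<partial>rho) \<le> 1 / m * M * (C / m)"
          using w M m(1) by (intro mult_mono) (auto simp: green_nonneg intro!: Bochner_Integration.integral_nonneg)
        moreover have "0 \<le> wt x * cmod (\<psi> x) * (\<integral>z. cmod (h z) * green x z \<partial>rho)"
          by (intro mult_nonneg_nonneg Bochner_Integration.integral_nonneg) (auto simp: green_nonneg)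
        moreover have "0 \<le> 1 / m * M * (C / m)" using m(1) M(1) C(1) by simp
        ultimately have "\<bar>wt x * cmod (\<psi> x) * (\<integral>z. cmod (h z) * green x z \<partial>rho)\<bar> \<le> \<bar>1 / m * M * (C / m)\<bar>"
          by linarith
        then show ?thesis unfolding inner real_norm_def using True by (simp only: indicator_simps mult_1_right)
      qed (simp add: inner \<psi>D(3))
      then show "AE x in lborel. norm (\<integral>y. norm (case (x, y) of (x, z) \<Rightarrow> f x z) \<partial>lborel) \<le> norm ((1 / m * M * (C / m)) * indicator L x)"
        by simp
    qed
    show "AE x in lborel. integrable lborel (\<lambda>y. case (x, y) of (x, z) \<Rightarrow> f x z)" using f_in by simp
  qed
  have fub: "(\<integral>z. (\<integral>x. f x z \<partial>lborel) \<partial>lborel) = (\<integral>x. (\<integral>z. f x z \<partial>lborel) \<partial>lborel)"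
    by (rule lborel_pair.Fubini_integral[OF int])
  have pm: "(\<lambda>x. p x * Delta_inv q x) \<in> borel_measurable borel"
    if p: "p \<in> borel_measurable borel" "\<And>z. z \<notin> A \<Longrightarrow> p z = 0" and q: "q \<in> borel_measurable borel" and A: "compact A" "A \<subseteq> G" for p q A
  proof -
    have "(\<lambda>x. p x * Delta_inv q x) = (\<lambda>x. p x * (indicator A x *\<^sub>R Delta_inv q x))"
    proof
      fix x show "p x * Delta_inv q x = p x * (indicator A x *\<^sub>R Delta_inv q x)" using p(2) by (cases "x \<in> A") simp_all
    qed
    moreover have "\<dots> \<in> borel_measurable borel"
      using A by (intro borel_measurable_times p Delta_inv_measurable_on[OF q]) (simp_all add: compact_imp_closed)
    ultimately show ?thesis by (simp only:)
  qed
  have l: "(\<integral>x. \<psi> x * Delta_inv h x \<partial>rho) = (\<integral>x. (\<integral>z. f x z \<partial>lborel) \<partial>lborel)"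
  proof -
    have "(\<integral>x. \<psi> x * Delta_inv h x \<partial>rho) = (\<integral>x. wt x *\<^sub>R (\<psi> x * Delta_inv h x) \<partial>lborel)"
      by (rule integral_rho[OF borel_imp_rho[OF pm[OF \<psi>m \<psi>D(3) hm \<psi>D(1,2)]]])
    also have "\<dots> = (\<integral>x. (\<integral>z. f x z \<partial>lborel) \<partial>lborel)"
    proof (rule Bochner_Integration.integral_cong[OF refl])
      fix x show "wt x *\<^sub>R (\<psi> x * Delta_inv h x) = (\<integral>z. f x z \<partial>lborel)"
      proof (cases "x \<in> L")
        case True
        then have "x \<in> G" using \<psi>D(2) by blast
        then show ?thesis
          unfolding f_def integral_mult_right_zero by (simp add: Delta_inv_lborel[OF hm])
      qed (simp add: f_def \<psi>D(3))
    qed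
    finally show ?thesis .
  qed
  have r: "(\<integral>z. h z * Delta_inv \<psi> z \<partial>rho) = (\<integral>z. (\<integral>x. f x z \<partial>lborel) \<partial>lborel)"
  proof -
    have "(\<integral>z. h z * Delta_inv \<psi> z \<partial>rho) = (\<integral>z. wt z *\<^sub>R (h z * Delta_inv \<psi> z) \<partial>lborel)"
      by (rule integral_rho[OF borel_imp_rho[OF pm[OF hm hD(3) \<psi>m hD(1,2)]]])
    also have "\<dots> = (\<integral>z. (\<integral>x. f x z \<partial>lborel) \<partial>lborel)"
    proof (rule Bochner_Integration.integral_cong[OF refl])
      fix z show "wt z *\<^sub>R (h z * Delta_inv \<psi> z) = (\<integral>x. f x z \<partial>lborel)"
      proof (cases "z \<in> K")
        case True
        have "f x z = (wt z *\<^sub>R h z) * (wt x *\<^sub>R (\<psi> x * of_real (green z x)))" for x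
          by (simp add: f_def green_sym[of x z] ac_simps)
        then have "(\<integral>x. f x z \<partial>lborel) = (wt z *\<^sub>R h z) * (\<integral>x. wt x *\<^sub>R (\<psi> x * of_real (green z x)) \<partial>lborel)"
          by (simp only: integral_mult_right_zero)
        moreover have "z \<in> G" using True hD(2) by blast
        ultimately show ?thesis by (simp add: Delta_inv_lborel[OF \<psi>m])
      qed (simp add: f_def hD(3))
    qed
    finally show ?thesis .
  qed
  show ?thesis unfolding l r by (rule fub[symmetric])
qed

section \<open>The Riesz transforms on test functions\<close>

lemma integrable_rho_indicator:
  assumes S: "S \<in> sets borel" and m: "0 < m" "\<And>z. z \<in> S \<Longrightarrow> m \<le> snd (snd z)" and fin: "emeasure lborel S < \<infinity>"
  shows "integrable rho (indicator S :: point \<Rightarrow> real)"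
proof -
  have "(indicator S :: point \<Rightarrow> real) \<in> borel_measurable rho" by (rule borel_imp_rho) (use S in simp)
  moreover have "integrable lborel (\<lambda>z. wt z *\<^sub>R indicator S z :: real)"
  proof (rule Bochner_Integration.integrable_bound)
    show "integrable lborel (\<lambda>z. (1 / m) * indicator S z)"
      using S fin by (intro integrable_mult_right integrable_real_indicator) simp_all
    show "(\<lambda>z. wt z *\<^sub>R indicator S z :: real) \<in> borel_measurable lborel"
      using S by (intro borel_measurable_scaleR) simp_all
    have "norm (wt z *\<^sub>R indicator S z :: real) \<le> norm ((1 / m) * indicator S z)" for z
    proof (cases "z \<in> S")
      case True
      then have "z \<in> G" using m(1) m(2)[OF True] by (simp add: G_iff)
      then show ?thesis using m(1) m(2)[OF True] True by (simp add: wt_G frac_le)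
    qed simp
    then show "AE z in lborel. norm (wt z *\<^sub>R indicator S z :: real) \<le> norm ((1 / m) * indicator S z)" by simp
  qed
  ultimately show ?thesis by (subst integrable_rho)
qed

lemma compact_positive_lower_bound:
  fixes f :: "point \<Rightarrow> real"
  assumes "compact K" "continuous_on K f" "\<And>z. z \<in> K \<Longrightarrow> 0 < f z"
  obtains m where "0 < m" "\<And>z. z \<in> K \<Longrightarrow> m \<le> f z"
proof (cases "K = {}")
  case False
  obtain z0 where "z0 \<in> K" "\<forall>z\<in>K. f z0 \<le> f z"
    using continuous_attains_inf[OF assms(1) False assms(2)] by blast
  then show ?thesis using that[of "f z0"] assms(3) by simp
qed (use that[of 1] in simp)

text \<open>Boxes from \<open>exl n\<close> to \<open>exu n\<close> exhaust G and have compact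
  closure in G; the one for n = 0 is empty. Statements modulo null sets are checked on each of
  them.\<close>

definition exl :: "nat \<Rightarrow> point" where
  "exl n = (- real (Suc n), - real (Suc n), 1 / real (Suc n))"

definition exu :: "nat \<Rightarrow> point" where
  "exu n = (real (Suc n), real (Suc n), real (Suc n))"

lemma exl_pos: "0 < snd (snd (exl n))"
  by (simp add: exl_def)

lemma ex_box_subset_G: "box (exl n) (exu n) \<subseteq> G"
  using cbox_subset_G[OF exl_pos, of n "exu n"] box_subset_cbox[of "exl n" "exu n"] by (rule order_trans[rotated])

lemma ex_box_eventually:
  assumes x: "x \<in> G" shows "\<forall>\<^sub>F n in sequentially. x \<in> box (exl n) (exu n)"
proof -
  have a: "snd (snd x) > 0" using x by (simp add: G_iff)
  obtain N where N: "\<bar>fst x\<bar> + \<bar>fst (snd x)\<bar> + snd (snd x) + 1 / snd (snd x) < real N"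
    using reals_Archimedean2 by blast
  have "x \<in> box (exl n) (exu n)" if n: "N \<le> n" for n
  proof -
    have i: "0 < 1 / snd (snd x)" using a by simp
    have n': "real N < real (Suc n)" using n by simp
    have "1 / snd (snd x) < real (Suc n)" using N n' a by linarith
    then have "1 / real (Suc n) < snd (snd x)" using a by (simp add: field_simps)
    then show ?thesis using N n' a i unfolding mem_box_point exl_def exu_def fst_conv snd_conv by linarith
  qed
  then show ?thesis unfolding eventually_sequentially by (intro exI[of _ N]) simp
qed

lemma nphi_measurable:
  "(\<lambda>v::point. nphi1 v e) \<in> borel_measurable borel" "(\<lambda>v::point. nphi2 v e f) \<in> borel_measurable borel"
proof -
  have [measurable]: "(\<lambda>v::point. v \<bullet> w) \<in> borel_measurable borel" "(norm :: point \<Rightarrow> real) \<in> borel_measurable borel" for w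
    by (intro borel_measurable_continuous_onI continuous_intros)+
  show "(\<lambda>v::point. nphi1 v e) \<in> borel_measurable borel" "(\<lambda>v::point. nphi2 v e f) \<in> borel_measurable borel"
    unfolding nphi1_def nphi2_def by (intro borel_measurable_divide borel_measurable_uminus borel_measurable_diff borel_measurable_times borel_measurable_power borel_measurable_const; measurable)+
qed

lemma green_derivs_measurable:
  "(\<lambda>p. green_xz e f (fst p) (snd p)) \<in> borel_measurable borel"
  "(\<lambda>p. green_x e (fst p) (snd p)) \<in> borel_measurable borel"
proof -
  have c: "(\<lambda>p. fst p - snd p) \<in> borel \<rightarrow>\<^sub>M (borel :: point measure)" "(\<lambda>p. fst p - reflect (snd p)) \<in> borel \<rightarrow>\<^sub>M (borel :: point measure)"
    unfolding reflect_def by (intro borel_measurable_continuous_onI continuous_intros)+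
  note m = nphi_measurable[THEN measurable_compose[OF c(1)]] nphi_measurable[THEN measurable_compose[OF c(2)]]
    measurable_compose[OF c(1) borel_measurable_norm] measurable_compose[OF c(2) borel_measurable_norm]
  show "(\<lambda>p. green_xz e f (fst p) (snd p)) \<in> borel_measurable borel"
    unfolding green_xz_def
    by (intro borel_measurable_times borel_measurable_add borel_measurable_divide borel_measurable_const m)
  show "(\<lambda>p. green_x e (fst p) (snd p)) \<in> borel_measurable borel"
    unfolding green_x_def
    by (intro borel_measurable_times borel_measurable_add borel_measurable_divide borel_measurable_const m)
qed

lemma green_derivs_measurable_z:
  "green_xz e f x \<in> borel_measurable borel" "green_x e x \<in> borel_measurable borel"
proof -
  have "(\<lambda>z. (x, z)) \<in> borel \<rightarrow>\<^sub>M (borel :: (point \<times> point) measure)"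
    by (intro borel_measurable_continuous_onI continuous_intros)
  from green_derivs_measurable[THEN measurable_compose[OF this]]
  show "green_xz e f x \<in> borel_measurable borel" "green_x e x \<in> borel_measurable borel" by simp_all
qed

lemma Delta_inv_ibp:
  assumes h: "C1_compact K h D" and \<phi>: "C1_compact L \<phi> E" and j: "j \<in> {0, 1, 2}"
  shows "(\<integral>x. X j \<phi> x * Delta_inv h x \<partial>rho) = - (\<integral>x. \<phi> x * X j (Delta_inv h) x \<partial>rho)"
    "(\<lambda>x. \<phi> x * X j (Delta_inv h) x) \<in> borel_measurable borel"
proof -
  note hD = C1_compactD[OF h] and \<phi>D = C1_compactD[OF \<phi>]
  obtain C d where C: "0 \<le> C" "\<And>x. x \<in> G \<Longrightarrow> cmod (Delta_inv h x) \<le> C / snd (snd x)"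
    "\<And>x. x \<in> G \<Longrightarrow> ((\<lambda>t. Delta_inv h (x + t *\<^sub>R cdir j)) has_vector_derivative d x) (at 0)"
    "\<And>x. x \<in> G \<Longrightarrow> snd (snd x) * cmod (d x) \<le> C"
    by (rule Delta_inv_bounds[OF h j]) (rule that)
  obtain m where m: "0 < m" "\<And>z. z \<in> L \<Longrightarrow> m \<le> snd (snd z)"
    by (rule compact_height_bound[OF \<phi>D(1,2)]) (rule that)
  have LG: "x \<in> G" if "x \<in> L" for x using that \<phi>D(2) by blast
  have b1: "cmod (Delta_inv h x) \<le> C / m" if "x \<in> L" for x
  proof -
    have "C / snd (snd x) \<le> C / m" using m(1) m(2)[OF that] C(1) by (simp add: frac_le)
    then show ?thesis using C(2)[OF LG[OF that]] by linarith
  qed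
  have b2: "cmod (d x) \<le> C / m" if "x \<in> L" for x
  proof -
    have "m * cmod (d x) \<le> snd (snd x) * cmod (d x)" using m(2)[OF that] by (intro mult_right_mono) auto
    then show ?thesis using C(4)[OF LG[OF that]] m(1) by (simp add: field_simps)
  qed
  have mF: "(\<lambda>x. indicator L x *\<^sub>R Delta_inv h x) \<in> borel_measurable borel"
    using \<phi>D(1,2) by (intro Delta_inv_measurable_on[OF C1_compact_measurable(1)[OF h]]) (simp_all add: compact_imp_closed)
  note I = integration_by_parts_rho[OF \<phi> j C(3)[OF LG] b1 b2 mF]
  have eq: "\<phi> x * (snd (snd x) *\<^sub>R d x) = \<phi> x * X j (Delta_inv h) x" for x
  proof (cases "x \<in> L")
    case True
    then show ?thesis using X_eqI[OF j C(3)[OF LG[OF True]]] by simp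
  qed (simp add: \<phi>D(3))
  show "(\<integral>x. X j \<phi> x * Delta_inv h x \<partial>rho) = - (\<integral>x. \<phi> x * X j (Delta_inv h) x \<partial>rho)"
    using I(1) unfolding eq by simp
  show "(\<lambda>x. \<phi> x * X j (Delta_inv h) x) \<in> borel_measurable borel"
    using I(2) unfolding eq by simp
qed

text \<open>Two integrations by parts, whose signs cancel, around the symmetry of the potential. The
  pairing is bilinear, without conjugation, so transposition merely exchanges i and j.\<close>

lemma Riesz2_adjoint_test:
  assumes g: "g \<in> test_functions" and \<phi>: "\<phi> \<in> test_functions" and ij: "i \<in> {0, 1, 2}" "j \<in> {0, 1, 2}"
  shows "(\<integral>x. Riesz2 i j g x * \<phi> x \<partial>rho) = (\<integral>z. g z * Riesz2 j i \<phi> z \<partial>rho)"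
proof -
  obtain K where K: "compact K" "K \<subseteq> G" "\<And>z. z \<notin> K \<Longrightarrow> g z = 0" using g unfolding test_functions_def by blast
  obtain L where L: "compact L" "L \<subseteq> G" "\<And>z. z \<notin> L \<Longrightarrow> \<phi> z = 0" using \<phi> unfolding test_functions_def by blast
  obtain D D' where D: "C1_compact K g D" "C1_compact K (X j g) D'" by (rule test_C1_compact[OF g K ij(2)]) (assumption, rule that)
  obtain E E' where E: "C1_compact L \<phi> E" "C1_compact L (X i \<phi>) E'" by (rule test_C1_compact[OF \<phi> L ij(1)]) (assumption, rule that)
  have "(\<integral>x. Riesz2 i j g x * \<phi> x \<partial>rho) = (\<integral>x. \<phi> x * X i (Delta_inv (X j g)) x \<partial>rho)"
    by (simp add: Riesz2_def mult.commute)
  also have "\<dots> = - (\<integral>x. X i \<phi> x * Delta_inv (X j g) x \<partial>rho)"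
    using Delta_inv_ibp(1)[OF D(2) E(1) ij(1)] by simp
  also have "\<dots> = - (\<integral>z. X j g z * Delta_inv (X i \<phi>) z \<partial>rho)"
    by (simp only: potential_symmetric[OF D(2) E(2)])
  also have "\<dots> = (\<integral>z. g z * X j (Delta_inv (X i \<phi>)) z \<partial>rho)"
    using Delta_inv_ibp(1)[OF E(2) D(1) ij(2)] by simp
  finally show ?thesis by (simp add: Riesz2_def)
qed

lemma Riesz2_test_bounded:
  assumes \<phi>: "\<phi> \<in> test_functions" and ij: "i \<in> {0, 1, 2}" "j \<in> {0, 1, 2}"
  obtains C where "0 \<le> C" "\<And>z. z \<in> G \<Longrightarrow> cmod (Riesz2 j i \<phi> z) \<le> C"
proof -
  obtain L where L: "compact L" "L \<subseteq> G" "\<And>z. z \<notin> L \<Longrightarrow> \<phi> z = 0" using \<phi> unfolding test_functions_def by blast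
  obtain E E' where E: "C1_compact L \<phi> E" "C1_compact L (X i \<phi>) E'" by (rule test_C1_compact[OF \<phi> L ij(1)]) (assumption, rule that)
  obtain C d where C: "0 \<le> C"
    "\<And>x. x \<in> G \<Longrightarrow> ((\<lambda>t. Delta_inv (X i \<phi>) (x + t *\<^sub>R cdir j)) has_vector_derivative d x) (at 0)"
    "\<And>x. x \<in> G \<Longrightarrow> snd (snd x) * cmod (d x) \<le> C"
    by (rule Delta_inv_bounds[OF E(2) ij(2)]) (rule that)
  show ?thesis
  proof (rule that[OF C(1)])
    fix z assume z: "z \<in> G"
    then have "cmod (Riesz2 j i \<phi> z) = snd (snd z) * cmod (d z)"
      by (simp add: Riesz2_def X_eqI[OF ij(2) C(2)[OF z]] G_iff)
    then show "cmod (Riesz2 j i \<phi> z) \<le> C" using C(3)[OF z] by simp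
  qed
qed

text \<open>\<open>Riesz2\<close> is defined by pointwise derivatives, so measurability is drawn
  from integration by parts: a bump times the transform is measurable, and the bumps tend to
  indicators of boxes that exhaust G.\<close>

lemma Riesz2_test_measurable:
  assumes \<phi>: "\<phi> \<in> test_functions" and ij: "i \<in> {0, 1, 2}" "j \<in> {0, 1, 2}"
  shows "Riesz2 j i \<phi> \<in> borel_measurable rho"
proof -
  obtain L where L: "compact L" "L \<subseteq> G" "\<And>z. z \<notin> L \<Longrightarrow> \<phi> z = 0" using \<phi> unfolding test_functions_def by blast
  obtain E E' where E: "C1_compact L \<phi> E" "C1_compact L (X i \<phi>) E'" by (rule test_C1_compact[OF \<phi> L ij(1)]) (assumption, rule that)
  have box: "(\<lambda>x. indicator (box (exl k) (exu k)) x * Riesz2 j i \<phi> x) \<in> borel_measurable borel" for k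
  proof (rule borel_measurable_LIMSEQ_metric)
    fix n
    note t = bump_test[OF exl_pos, of k "exu k" n]
    have b: "C1_compact (cbox (exl k) (exu k)) (bump (exl k) (exu k) n) (\<lambda>z. frechet_derivative (bump (exl k) (exu k) n) (at z))"
    proof (rule Ck_zero_outside_C1)
      show "Ck_on_G 1 (bump (exl k) (exu k) n)" using t unfolding test_functions_def by blast
      show "bump (exl k) (exu k) n z = 0" if "z \<notin> cbox (exl k) (exu k)" for z
        using that box_subset_cbox[of "exl k" "exu k"] by (intro bump_zero) blast
    qed (use cbox_subset_G[OF exl_pos] in auto)
    show "(\<lambda>x. bump (exl k) (exu k) n x * Riesz2 j i \<phi> x) \<in> borel_measurable borel"
      using Delta_inv_ibp(2)[OF E(2) b ij(2)] by (simp add: Riesz2_def)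
    fix x
    show "(\<lambda>n. bump (exl k) (exu k) n x * Riesz2 j i \<phi> x) \<longlonglongrightarrow> indicator (box (exl k) (exu k)) x * Riesz2 j i \<phi> x"
      by (intro tendsto_mult bump_tendsto tendsto_const)
  qed
  have "(\<lambda>x. indicator G x *\<^sub>R Riesz2 j i \<phi> x) \<in> borel_measurable borel"
  proof (rule borel_measurable_LIMSEQ_metric[OF box])
    fix x
    show "(\<lambda>k. indicator (box (exl k) (exu k)) x * Riesz2 j i \<phi> x) \<longlonglongrightarrow> indicator G x *\<^sub>R Riesz2 j i \<phi> x"
    proof (cases "x \<in> G")
      case True
      show ?thesis
        by (rule tendsto_eventually, rule eventually_mono[OF ex_box_eventually[OF True]]) (use True in simp)
    next
      case False
      then have "x \<notin> box (exl k) (exu k)" for k using ex_box_subset_G[of k] by blast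
      then show ?thesis using False by simp
    qed
  qed
  then show ?thesis by (simp add: rho_measurable_iff)
qed

text \<open>For x off K the Green kernel is smooth in z on K and can be differentiated in x under
  the integral. Integration by parts then moves X_j from g to the kernel and produces the minus
  sign.\<close>

lemma Riesz2_off_support:
  assumes g: "g \<in> test_functions" and K: "compact K" "K \<subseteq> G" "\<And>z. z \<notin> K \<Longrightarrow> g z = 0"
    and ij: "i \<in> {0, 1, 2}" "j \<in> {0, 1, 2}" and x: "x \<in> G" "x \<notin> K"
  shows "Riesz2 i j g x = - (\<integral>z. g z * of_real (snd (snd x) * snd (snd z) * green_xz (cdir i) (cdir j) x z) \<partial>rho)"
proof -
  obtain D D' where D: "C1_compact K g D" "C1_compact K (X j g) D'" by (rule test_C1_compact[OF g K ij(2)]) (assumption, rule that)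
  let ?e = "cdir i" and ?f = "cdir j" and ?h = "X j g"
  note hD = C1_compactD[OF D(2)]
  have ne: "norm ?e = 1" "norm ?f = 1" using ij norm_cdir by auto
  have hm: "?h \<in> borel_measurable borel" by (rule C1_compact_measurable(1)[OF D(2)])
  obtain M where M: "0 \<le> M" "\<And>z. cmod (?h z) \<le> M" by (rule C1_compact_bounded[OF D(2)]) (rule that)
  have "open (G \<inter> - K)" using open_G K(1) by (simp add: compact_imp_closed open_Compl open_Int)
  then obtain \<eta> where \<eta>: "\<eta> > 0" "cball x \<eta> \<subseteq> G \<inter> - K" using x open_contains_cball by (metis ComplI IntI)
  \<comment> \<open>Half the radius of a ball that avoids K: moving x by less than \<epsilon> leaves
    a gap of at least \<epsilon> to K.\<close>
  define \<epsilon> where "\<epsilon> = \<eta> / 2"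
  have \<epsilon>: "\<epsilon> > 0" using \<eta> by (simp add: \<epsilon>_def)
  have xt: "x + t *\<^sub>R ?e \<in> G" if "\<bar>t\<bar> < \<epsilon>" for t
  proof -
    have "x + t *\<^sub>R ?e \<in> cball x \<eta>" using that ne(1) \<eta>(1) by (simp add: dist_norm \<epsilon>_def)
    then show ?thesis using \<eta>(2) by blast
  qed
  have far: "\<epsilon> \<le> norm (x + t *\<^sub>R ?e - z)" if t: "\<bar>t\<bar> < \<epsilon>" and z: "z \<in> K" for t z
  proof -
    have "z \<notin> cball x \<eta>" using z \<eta>(2) by blast
    then have "\<eta> < norm (x - z)" by (simp add: dist_norm)
    also have "\<dots> \<le> norm (x + t *\<^sub>R ?e - z) + norm (t *\<^sub>R ?e)"
      using norm_triangle_ineq4[of "x + t *\<^sub>R ?e - z" "t *\<^sub>R ?e"] by simp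
    finally show ?thesis using t ne(1) by (simp add: \<epsilon>_def)
  qed
  have KG: "z \<in> G" if "z \<in> K" for z using that K(2) by blast
  have neq: "x + t *\<^sub>R ?e \<noteq> z" if "\<bar>t\<bar> < \<epsilon>" "z \<in> K" for t z
    using far[OF that] \<epsilon> by auto
  have PQ: "\<epsilon> \<le> norm (x + t *\<^sub>R ?e - z)" "\<epsilon> \<le> norm (x + t *\<^sub>R ?e - reflect z)" if t: "\<bar>t\<bar> < \<epsilon>" and z: "z \<in> K" for t z
    using far[OF that] reflect_norm_le(1)[OF xt[OF t] KG[OF z]] by linarith+
  have frac: "c / (P ^ k * Q) \<le> c / \<epsilon> ^ Suc k" if "\<epsilon> \<le> P" "\<epsilon> \<le> Q" "0 \<le> c" for c P Q :: real and k
  proof -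
    have "\<epsilon> ^ Suc k = \<epsilon> ^ k * \<epsilon>" by simp
    also have "\<dots> \<le> P ^ k * Q" using that \<epsilon> by (intro mult_mono power_mono) auto
    finally show ?thesis using that \<epsilon> by (intro divide_left_mono mult_pos_pos zero_less_power) auto
  qed
  have g0: "green (x + t *\<^sub>R ?e) z \<le> 1 / \<epsilon> ^ 2" if t: "\<bar>t\<bar> < \<epsilon>" and z: "z \<in> K" for t z
    using green_bound(2)[OF xt[OF t] KG[OF z] neq[OF t z]] frac[OF PQ[OF t z], of 1 1] by (simp add: power2_eq_square)
  have g1: "\<bar>green_x ?e (x + t *\<^sub>R ?e) z\<bar> \<le> 2 / \<epsilon> ^ 3" if t: "\<bar>t\<bar> < \<epsilon>" and z: "z \<in> K" for t z
    using green_x_bound[OF xt[OF t] KG[OF z] neq[OF t z], of ?e] frac[OF PQ[OF t z], of 2 2] ne by (simp add: eval_nat_numeral)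
  have g2: "\<bar>green_xz ?e ?f x z\<bar> \<le> 10 / \<epsilon> ^ 4" if z: "z \<in> K" for z
    using green_xz_bound[OF x(1) KG[OF z], of ?e ?f] neq[of 0 z] \<epsilon> z frac[OF PQ[of 0 z], of 10 3] ne by (simp add: eval_nat_numeral)
  \<comment> \<open>A common bound for the kernel and the derivatives that occur, all at distance at
    least \<epsilon> from the singularity.\<close>
  define B where "B = 1 / \<epsilon> ^ 2 + 2 / \<epsilon> ^ 3 + 10 / \<epsilon> ^ 4"
  have B: "1 / \<epsilon> ^ 2 \<le> B" "2 / \<epsilon> ^ 3 \<le> B" "10 / \<epsilon> ^ 4 \<le> B" "0 \<le> B" using \<epsilon> by (simp_all add: B_def)
  define F where "F t z = ?h z * of_real (green (x + t *\<^sub>R ?e) z)" for t z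
  define F' where "F' t z = ?h z * of_real (green_x ?e (x + t *\<^sub>R ?e) z)" for t z
  have Kb: "K \<in> sets borel" using K(1) by (simp add: compact_imp_closed)
  have w: "integrable rho (\<lambda>z. M * B * indicator K z)"
  proof -
    obtain m where m: "0 < m" "\<And>z. z \<in> K \<Longrightarrow> m \<le> snd (snd z)" by (rule compact_height_bound[OF K(1,2)]) (rule that)
    show ?thesis
      using emeasure_compact_finite[OF K(1)] by (intro integrable_mult_right integrable_rho_indicator[OF Kb m]) simp_all
  qed
  have mF: "F t \<in> borel_measurable rho" for t
    unfolding F_def by (intro borel_imp_rho borel_measurable_times hm measurable_compose[OF green_measurable(1) of_real_measurable])
  have Fb: "cmod (F t z) \<le> M * B * indicator K z" "cmod (F' t z) \<le> M * B * indicator K z" if t: "\<bar>t\<bar> < \<epsilon>" for t z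
  proof -
    show "cmod (F t z) \<le> M * B * indicator K z"
    proof (cases "z \<in> K")
      case True
      have "cmod (F t z) \<le> M * B" unfolding F_def norm_mult
        using M g0[OF t True] B green_nonneg by (intro mult_mono) auto
      then show ?thesis using True by simp
    qed (simp add: F_def hD(3))
    show "cmod (F' t z) \<le> M * B * indicator K z"
    proof (cases "z \<in> K")
      case True
      have "cmod (F' t z) \<le> M * B" unfolding F'_def norm_mult
        using M g1[OF t True] B by (intro mult_mono) auto
      then show ?thesis using True by simp
    qed (simp add: F'_def hD(3))
  qed
  have int: "integrable rho (F t)" if t: "\<bar>t\<bar> < \<epsilon>" for t
  proof (rule Bochner_Integration.integrable_bound[OF w mF])
    have "cmod (F t z) \<le> norm (M * B * indicator K z)" for z using Fb(1)[OF t, of z] by (simp add: abs_le_iff)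
    then show "AE z in rho. cmod (F t z) \<le> norm (M * B * indicator K z)" by simp
  qed
  have der: "((\<lambda>s. F s z) has_vector_derivative F' t z) (at t)" if t: "\<bar>t\<bar> < \<epsilon>" for t z
  proof (cases "z \<in> K")
    case True
    have "((\<lambda>s. complex_of_real (green (x + s *\<^sub>R ?e) z)) has_vector_derivative of_real (green_x ?e (x + t *\<^sub>R ?e) z)) (at t)"
      using green_x_derivative[OF xt[OF t] KG[OF True] neq[OF t True]]
      by (intro has_vector_derivative_of_real) (simp add: has_real_derivative_iff_has_vector_derivative)
    then show ?thesis unfolding F_def F'_def by (rule has_vector_derivative_mult_right)
  qed (simp add: F_def F'_def hD(3))
  have L: "((\<lambda>t. \<integral>z. F t z \<partial>rho) has_vector_derivative (\<integral>z. F' 0 z \<partial>rho)) (at 0)"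
    by (rule has_vector_derivative_integral(2)[OF \<epsilon> int der Fb(2) w])
  have "((\<lambda>t. Delta_inv ?h (x + t *\<^sub>R ?e)) has_vector_derivative (\<integral>z. F' 0 z \<partial>rho)) (at 0)"
  proof (rule has_vector_derivative_transform_within_open[OF L, of "{-\<epsilon><..<\<epsilon>}"])
    fix t assume "t \<in> {-\<epsilon><..<\<epsilon>}"
    then have "\<bar>t\<bar> < \<epsilon>" by auto
    then show "(\<integral>z. F t z \<partial>rho) = Delta_inv ?h (x + t *\<^sub>R ?e)"
      by (simp add: Delta_inv_eq_green[OF xt borel_imp_rho[OF hm]] F_def)
  qed (use \<epsilon> in auto)
  then have R: "Riesz2 i j g x = snd (snd x) *\<^sub>R (\<integral>z. F' 0 z \<partial>rho)"
    unfolding Riesz2_def by (rule X_eqI[OF ij(1)])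
  have "(\<integral>z. F' 0 z \<partial>rho) = (\<integral>z. ?h z * of_real (green_x ?e x z) \<partial>rho)" by (simp add: F'_def)
  also have "\<dots> = - (\<integral>z. g z * (snd (snd z) *\<^sub>R of_real (green_xz ?e ?f x z)) \<partial>rho)"
  proof (rule integration_by_parts_rho(1)[OF D(1) ij(2)])
    fix z assume z: "z \<in> K"
    have xz: "x \<noteq> z" using neq[of 0 z] z \<epsilon> by simp
    have "((\<lambda>s. green_x ?e x (z + s *\<^sub>R ?f)) has_real_derivative green_xz ?e ?f x (z + 0 *\<^sub>R ?f)) (at 0)"
      using KG[OF z] xz by (intro green_xz_derivative x(1)) simp_all
    then show "((\<lambda>t. complex_of_real (green_x ?e x (z + t *\<^sub>R ?f))) has_vector_derivative of_real (green_xz ?e ?f x z)) (at 0)"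
      by (intro has_vector_derivative_of_real) (simp add: has_real_derivative_iff_has_vector_derivative)
    show "cmod (complex_of_real (green_x ?e x z)) \<le> B" using g1[of 0 z] z \<epsilon> B(2) by simp
    show "cmod (complex_of_real (green_xz ?e ?f x z)) \<le> B" using g2[OF z] B(3) by simp
  next
    show "(\<lambda>z. indicator K z *\<^sub>R complex_of_real (green_x ?e x z)) \<in> borel_measurable borel"
      using Kb by (intro borel_measurable_scaleR borel_measurable_indicator
          measurable_compose[OF green_derivs_measurable_z(2) of_real_measurable]) simp
  qed
  finally show ?thesis unfolding R by (simp add: scaleR_conv_of_real ac_simps flip: integral_mult_right_zero)
qed

section \<open>Square integrable functions\<close>

lemma Lp1_iff: "f \<in> Lp 1 \<longleftrightarrow> integrable rho f"
  using integrable_norm_iff[of f rho] by (auto simp: Lp_def)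

lemma Lp1_norm: "Lp_norm 1 f = (\<integral>x. cmod (f x) \<partial>rho)"
proof -
  have "0 \<le> (\<integral>x. cmod (f x) \<partial>rho)" by (rule Bochner_Integration.integral_nonneg) simp
  then show ?thesis by (simp add: Lp_norm_def)
qed

text \<open>The squared L^2 norm, which spares the square root; convergence in L^2 is expressed by
  \<open>sq_int\<close> tending to 0.\<close>

definition sq_int :: "(point \<Rightarrow> complex) \<Rightarrow> real" where
  "sq_int f = (\<integral>x. (cmod (f x))\<^sup>2 \<partial>rho)"

lemma Lp2_iff: "f \<in> Lp 2 \<longleftrightarrow> f \<in> borel_measurable rho \<and> integrable rho (\<lambda>x. (cmod (f x))\<^sup>2)"
  by (simp add: Lp_def)

lemma sq_int_nonneg: "0 \<le> sq_int f"
  unfolding sq_int_def by (rule Bochner_Integration.integral_nonneg) simp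

lemma Lp2_norm: "Lp_norm 2 f = sqrt (sq_int f)"
  using sq_int_nonneg[of f] by (simp add: Lp_norm_def sq_int_def powr_half_sqrt)

text \<open>Arithmetic-geometric mean with a free weight s. It takes the place of the Cauchy-Schwarz
  inequality, the weight being chosen to balance the two integrals.\<close>

lemma cmod_mult_le:
  assumes "0 < s" shows "cmod (u * v) \<le> ((cmod u)\<^sup>2 / s + (cmod v)\<^sup>2 * s) / 2"
proof -
  have "0 \<le> (cmod u - s * cmod v)\<^sup>2 / s" using assms by simp
  also have "\<dots> = (cmod u)\<^sup>2 / s + (cmod v)\<^sup>2 * s - 2 * (cmod u * cmod v)"
    using assms by (simp add: power2_eq_square field_simps)
  finally show ?thesis by (simp add: norm_mult)
qed

lemma cmod_add_sq: "(cmod (u + v))\<^sup>2 \<le> 2 * (cmod u)\<^sup>2 + 2 * (cmod v)\<^sup>2"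
proof -
  have "(cmod (u + v))\<^sup>2 \<le> (cmod u + cmod v)\<^sup>2" by (intro power_mono norm_triangle_ineq) simp
  also have "\<dots> \<le> 2 * (cmod u)\<^sup>2 + 2 * (cmod v)\<^sup>2"
    using zero_le_power2[of "cmod u - cmod v"] by (simp add: power2_eq_square algebra_simps)
  finally show ?thesis .
qed

lemma Lp2_add: assumes "f \<in> Lp 2" "g \<in> Lp 2" shows "(\<lambda>x. f x + g x) \<in> Lp 2"
proof -
  have "integrable rho (\<lambda>x. (cmod (f x + g x))\<^sup>2)"
  proof (rule Bochner_Integration.integrable_bound)
    show "integrable rho (\<lambda>x. 2 * (cmod (f x))\<^sup>2 + 2 * (cmod (g x))\<^sup>2)"
      using assms by (intro Bochner_Integration.integrable_add integrable_mult_right) (simp_all add: Lp2_iff)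
    show "(\<lambda>x. (cmod (f x + g x))\<^sup>2) \<in> borel_measurable rho" using assms by (auto simp: Lp2_iff)
    show "AE x in rho. norm ((cmod (f x + g x))\<^sup>2) \<le> norm (2 * (cmod (f x))\<^sup>2 + 2 * (cmod (g x))\<^sup>2)"
      by (intro AE_I2) (use cmod_add_sq in simp)
  qed
  then show ?thesis using assms by (auto simp: Lp2_iff)
qed

lemma Lp2_cmult: assumes "f \<in> Lp 2" shows "(\<lambda>x. c * f x) \<in> Lp 2"
  using assms by (auto simp: Lp2_iff norm_mult power_mult_distrib)

lemma Lp2_diff: "f \<in> Lp 2 \<Longrightarrow> g \<in> Lp 2 \<Longrightarrow> (\<lambda>x. f x - g x) \<in> Lp 2"
  using Lp2_add[OF _ Lp2_cmult[of g "-1"], of f] by simp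

lemma Lp2_mult_integrable:
  assumes "f \<in> Lp 2" "g \<in> Lp 2" shows "integrable rho (\<lambda>x. f x * g x)"
proof (rule Bochner_Integration.integrable_bound)
  show "integrable rho (\<lambda>x. ((cmod (f x))\<^sup>2 / 1 + (cmod (g x))\<^sup>2 * 1) / 2)"
    using assms by (auto simp: Lp2_iff)
  show "(\<lambda>x. f x * g x) \<in> borel_measurable rho" using assms by (auto simp: Lp2_iff)
  have "0 \<le> ((cmod (f x))\<^sup>2 / 1 + (cmod (g x))\<^sup>2 * 1) / 2" for x by simp
  then show "AE x in rho. norm (f x * g x) \<le> norm (((cmod (f x))\<^sup>2 / 1 + (cmod (g x))\<^sup>2 * 1) / 2)"
    using cmod_mult_le[of 1] by (intro AE_I2) (simp only: real_norm_def abs_of_nonneg zero_less_one)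
qed

lemma Lp2_mult_tendsto:
  assumes u: "\<And>n. u n \<in> Lp 2" and lim: "(\<lambda>n. sq_int (u n)) \<longlonglongrightarrow> 0" and g: "g \<in> Lp 2"
  shows "(\<lambda>n. \<integral>x. u n x * g x \<partial>rho) \<longlonglongrightarrow> 0"
proof -
  \<comment> \<open>The weight has to be positive even when \<open>u n\<close> vanishes almost
    everywhere; its square still dominates \<open>sq_int (u n)\<close>, and it tends to 0.\<close>
  define s where "s n = sqrt (sq_int (u n) + inverse (real (Suc n)))" for n
  have pos: "0 < sq_int (u n) + inverse (real (Suc n))" for n
    using sq_int_nonneg[of "u n"] by (intro add_nonneg_pos) simp_all
  then have s: "0 < s n" for n by (simp add: s_def del: of_nat_Suc)
  have slim: "s \<longlonglongrightarrow> 0"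
  proof -
    have "(\<lambda>n. sqrt (sq_int (u n) + inverse (real (Suc n)))) \<longlonglongrightarrow> sqrt (0 + 0)"
      by (intro tendsto_intros lim LIMSEQ_inverse_real_of_nat)
    then show ?thesis by (simp add: s_def[abs_def])
  qed
  have le: "sq_int (u n) \<le> s n ^ 2" for n using pos[of n] by (simp add: s_def)
  have b: "cmod (\<integral>x. u n x * g x \<partial>rho) \<le> (1 + sq_int g) / 2 * s n" for n
  proof -
    have i: "integrable rho (\<lambda>x. (cmod (u n x))\<^sup>2)" "integrable rho (\<lambda>x. (cmod (g x))\<^sup>2)"
      using u g by (simp_all add: Lp2_iff)
    have "cmod (\<integral>x. u n x * g x \<partial>rho) \<le> (\<integral>x. cmod (u n x * g x) \<partial>rho)" by (rule integral_norm_bound)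
    also have "\<dots> \<le> (\<integral>x. ((cmod (u n x))\<^sup>2 / s n + (cmod (g x))\<^sup>2 * s n) / 2 \<partial>rho)"
      using i Lp2_mult_integrable[OF u g] cmod_mult_le[OF s]
      by (intro integral_mono integrable_norm integrable_divide Bochner_Integration.integrable_add integrable_mult_left) auto
    also have "\<dots> = (sq_int (u n) / s n + sq_int g * s n) / 2"
      using i by (simp add: sq_int_def)
    also have "\<dots> \<le> (s n + sq_int g * s n) / 2"
      using le[of n] s[of n] by (simp add: divide_le_eq power2_eq_square)
    finally show ?thesis by (simp add: algebra_simps)
  qed
  have "(\<lambda>n. (1 + sq_int g) / 2 * s n) \<longlonglongrightarrow> 0" by (rule tendsto_mult_right_zero[OF slim])
  then show ?thesis by (rule Lim_null_comparison[rotated]) (rule always_eventually, rule allI, rule b)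
qed

lemma box_rho_finite:
  assumes l: "0 < snd (snd l)"
  shows "integrable rho (indicator (box l u) :: point \<Rightarrow> real)"
  by (rule integrable_rho_indicator[OF _ l])
    (use l in \<open>simp_all add: mem_box_point emeasure_lborel_box_finite[unfolded infinity_ennreal_def]\<close>)

lemma bounded_on_box_integrable:
  assumes l: "0 < snd (snd l)" and f: "bounded_on_box l u f"
    and k: "k \<in> borel_measurable rho" "\<And>z. z \<in> box l u \<Longrightarrow> cmod (k z) \<le> B"
  shows "integrable rho (\<lambda>z. f z * k z)"
proof -
  obtain M where M: "0 \<le> M" "f \<in> borel_measurable borel" "\<And>z. z \<notin> box l u \<Longrightarrow> f z = 0" "\<And>z. cmod (f z) \<le> M"
    by (rule bounded_on_boxE[OF f]) (rule that)
  show ?thesis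
  proof (rule Bochner_Integration.integrable_bound)
    show "integrable rho (\<lambda>z. M * B * indicator (box l u) z)" by (intro integrable_mult_right box_rho_finite l)
    show "(\<lambda>z. f z * k z) \<in> borel_measurable rho" by (intro borel_measurable_times k borel_imp_rho M)
    have "cmod (f z * k z) \<le> norm (M * B * indicator (box l u) z)" for z
    proof (cases "z \<in> box l u")
      case True
      have "cmod (f z * k z) \<le> M * B" unfolding norm_mult using M k(2)[OF True] by (intro mult_mono) auto
      then show ?thesis using True by simp
    qed (simp add: M(3))
    then show "AE z in rho. cmod (f z * k z) \<le> norm (M * B * indicator (box l u) z)" by simp
  qed
qed

lemma bounded_on_box_integral_tendsto:
  assumes l: "0 < snd (snd l)" and F: "\<And>n. bounded_on_box l u (F n)" and f: "bounded_on_box l u f"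
    and M: "\<And>n z. cmod (F n z) \<le> M" and lim: "\<And>z. (\<lambda>n. F n z) \<longlonglongrightarrow> f z"
    and k: "k \<in> borel_measurable rho" "\<And>z. z \<in> box l u \<Longrightarrow> cmod (k z) \<le> B"
  shows "(\<lambda>n. \<integral>z. F n z * k z \<partial>rho) \<longlonglongrightarrow> (\<integral>z. f z * k z \<partial>rho)"
proof (rule integral_dominated_convergence[where w="\<lambda>z. M * B * indicator (box l u) z"])
  have M0: "0 \<le> M" using order_trans[OF norm_ge_zero M] .
  show "integrable rho (\<lambda>z. M * B * indicator (box l u) z)" by (intro integrable_mult_right box_rho_finite l)
  have "f \<in> borel_measurable borel" "F n \<in> borel_measurable borel" for n
    using f F[of n] by (simp_all add: bounded_on_box_def)
  then show "(\<lambda>z. f z * k z) \<in> borel_measurable rho" "(\<lambda>z. F n z * k z) \<in> borel_measurable rho" for n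
    by (intro borel_measurable_times k borel_imp_rho; simp)+
  show "AE z in rho. (\<lambda>n. F n z * k z) \<longlonglongrightarrow> f z * k z" by (intro AE_I2 tendsto_intros lim)
  fix n
  have "cmod (F n z * k z) \<le> M * B * indicator (box l u) z" for z
  proof (cases "z \<in> box l u")
    case True
    have "cmod (F n z * k z) \<le> M * B" unfolding norm_mult using M M0 k(2)[OF True] by (intro mult_mono) auto
    then show ?thesis using True by simp
  qed (use F[of n] in \<open>simp add: bounded_on_box_def\<close>)
  then show "AE z in rho. cmod (F n z * k z) \<le> M * B * indicator (box l u) z" by simp
qed

lemma bounded_on_box_Lp2:
  assumes l: "0 < snd (snd l)" and f: "bounded_on_box l u f"
  shows "f \<in> Lp 2"
proof -
  obtain M where M: "0 \<le> M" "f \<in> borel_measurable borel" "\<And>z. z \<notin> box l u \<Longrightarrow> f z = 0" "\<And>z. cmod (f z) \<le> M"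
    by (rule bounded_on_boxE[OF f]) (rule that)
  have fm: "f \<in> borel_measurable rho" by (rule borel_imp_rho[OF M(2)])
  have "integrable rho (\<lambda>z. f z * cnj (f z))"
  proof (rule bounded_on_box_integrable[OF l f])
    show "(\<lambda>z. cnj (f z)) \<in> borel_measurable rho"
      by (rule measurable_compose[OF fm borel_measurable_continuous_onI]) (intro continuous_intros)
    show "cmod (cnj (f z)) \<le> M" for z using M(4) by simp
  qed
  then have "integrable rho (\<lambda>z. cmod (f z * cnj (f z)))" by (rule integrable_norm)
  then show ?thesis using fm by (simp add: Lp2_iff norm_mult power2_eq_square)
qed

lemma bounded_on_box_sq_tendsto:
  assumes l: "0 < snd (snd l)" and F: "\<And>n. bounded_on_box l u (F n)" and f: "bounded_on_box l u f"
    and M: "\<And>n z. cmod (F n z) \<le> M" and lim: "\<And>z. (\<lambda>n. F n z) \<longlonglongrightarrow> f z"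
  shows "(\<lambda>n. sq_int (\<lambda>z. F n z - f z)) \<longlonglongrightarrow> 0"
proof -
  have "(\<lambda>n. \<integral>z. (cmod (F n z - f z))\<^sup>2 \<partial>rho) \<longlonglongrightarrow> (\<integral>z. 0 \<partial>rho)"
  proof (rule integral_dominated_convergence[where w="\<lambda>z. (2 * M)\<^sup>2 * indicator (box l u) z"])
    show "integrable rho (\<lambda>z. (2 * M)\<^sup>2 * indicator (box l u) z)" by (intro integrable_mult_right box_rho_finite l)
    have "f \<in> borel_measurable rho" "F n \<in> borel_measurable rho" for n
      using f F[of n] by (auto simp: bounded_on_box_def intro: borel_imp_rho)
    then show "(\<lambda>z. (cmod (F n z - f z))\<^sup>2) \<in> borel_measurable rho" for n by simp
    have "(\<lambda>n. (cmod (F n z - f z))\<^sup>2) \<longlonglongrightarrow> (cmod (f z - f z))\<^sup>2" for z by (intro tendsto_intros lim)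
    then show "AE z in rho. (\<lambda>n. (cmod (F n z - f z))\<^sup>2) \<longlonglongrightarrow> 0" by simp
    fix n
    have fM: "cmod (f z) \<le> M" for z
      by (rule LIMSEQ_le_const2[OF tendsto_norm[OF lim]]) (use M in auto)
    have "norm ((cmod (F n z - f z))\<^sup>2) \<le> (2 * M)\<^sup>2 * indicator (box l u) z" for z
    proof (cases "z \<in> box l u")
      case True
      have "cmod (F n z - f z) \<le> cmod (F n z) + cmod (f z)" by (rule norm_triangle_ineq4)
      also have "\<dots> \<le> 2 * M" using M[of n z] fM[of z] by simp
      finally have "(cmod (F n z - f z))\<^sup>2 \<le> (2 * M)\<^sup>2" by (rule power_mono) simp
      then show ?thesis using True by simp
    qed (use F[of n] f in \<open>simp add: bounded_on_box_def\<close>)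
    then show "AE z in rho. norm ((cmod (F n z - f z))\<^sup>2) \<le> (2 * M)\<^sup>2 * indicator (box l u) z" by simp
  qed simp
  then show ?thesis by (simp add: sq_int_def)
qed

lemma sq_int_tendsto_AE_subseq:
  assumes u: "\<And>n. u n \<in> Lp 2" and lim: "(\<lambda>n. sq_int (u n)) \<longlonglongrightarrow> 0"
  obtains r where "strict_mono r" "AE x in rho. (\<lambda>n. u (r n) x) \<longlonglongrightarrow> 0"
proof -
  have "\<exists>r :: nat \<Rightarrow> nat. strict_mono r \<and> (AE x in rho. (\<lambda>n. (cmod (u (r n) x))\<^sup>2) \<longlonglongrightarrow> 0)"
    by (rule tendsto_L1_AE_subseq) (use u lim in \<open>simp_all add: Lp2_iff sq_int_def\<close>)
  then obtain r :: "nat \<Rightarrow> nat" where r: "strict_mono r" "AE x in rho. (\<lambda>n. (cmod (u (r n) x))\<^sup>2) \<longlonglongrightarrow> 0" by blast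
  have "AE x in rho. (\<lambda>n. u (r n) x) \<longlonglongrightarrow> 0"
    using r(2)
  proof eventually_elim
    case (elim x)
    have "(\<lambda>n. sqrt ((cmod (u (r n) x))\<^sup>2)) \<longlonglongrightarrow> sqrt 0" by (intro tendsto_real_sqrt elim)
    then show ?case by (simp add: tendsto_norm_zero_iff)
  qed
  then show ?thesis using that r(1) by blast
qed

lemma AE_zero_of_sq_int:
  assumes "u \<in> Lp 2" "sq_int u = 0" shows "AE x in rho. u x = 0"
proof -
  have "AE x in rho. (cmod (u x))\<^sup>2 = 0"
    using assms by (subst (asm) sq_int_def, subst (asm) integral_nonneg_eq_0_iff_AE) (simp_all add: Lp2_iff)
  then show ?thesis by simp
qed

section \<open>The extended operator\<close>

text \<open>The kernel of T_ij up to sign: off the support of f the transform is minus the integral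
  of f against \<open>kern\<close>, the sign coming from the integration by parts in z.\<close>

definition kern :: "nat \<Rightarrow> nat \<Rightarrow> point \<Rightarrow> point \<Rightarrow> complex" where
  "kern i j x z = of_real (snd (snd x) * snd (snd z) * green_xz (cdir i) (cdir j) x z)"

lemma kern_measurable: "kern i j x \<in> borel_measurable rho"
  unfolding kern_def
  by (intro borel_imp_rho measurable_compose[OF _ of_real_measurable] borel_measurable_times
      green_derivs_measurable_z borel_measurable_const height_measurable)

text \<open>The spare factor |x - z'| is bounded below by |x - z| in the first estimate and absorbs
  the height of z in the second.\<close>

lemma kern_bound:
  assumes ij: "i \<in> {0, 1, 2}" "j \<in> {0, 1, 2}" and xz: "x \<in> G" "z \<in> G" "x \<noteq> z"
  shows "cmod (kern i j x z) \<le> 10 * snd (snd x) * snd (snd z) / norm (x - z) ^ 4"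
    "cmod (kern i j x z) \<le> 10 * snd (snd x) / norm (x - z) ^ 3"
proof -
  have p: "0 < snd (snd x)" "0 < snd (snd z)" using xz by (auto simp: G_iff)
  define P where "P = norm (x - z)"
  define Q where "Q = norm (x - reflect z)"
  have PQ: "0 < P" "P \<le> Q" "snd (snd z) \<le> Q" using xz reflect_norm_le[OF xz(1,2)] by (auto simp: P_def Q_def)
  have "\<bar>green_xz (cdir i) (cdir j) x z\<bar> \<le> 10 / (P ^ 3 * Q)"
    using green_xz_bound[OF xz, of "cdir i" "cdir j"] norm_cdir[OF ij(1)] norm_cdir[OF ij(2)] by (simp add: P_def Q_def)
  then have b: "cmod (kern i j x z) \<le> snd (snd x) * snd (snd z) * (10 / (P ^ 3 * Q))"
    unfolding kern_def norm_of_real abs_mult using p by (simp only: abs_of_pos mult_pos_pos) (intro mult_left_mono; simp)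
  have "snd (snd x) * snd (snd z) * (10 / (P ^ 3 * Q)) \<le> snd (snd x) * snd (snd z) * (10 / (P ^ 3 * P))"
    using p PQ by (intro mult_left_mono divide_left_mono mult_pos_pos) auto
  also have "\<dots> = 10 * snd (snd x) * snd (snd z) / P ^ 4" by (simp add: power4_eq_xxxx power3_eq_cube mult.assoc mult.left_commute)
  finally show "cmod (kern i j x z) \<le> 10 * snd (snd x) * snd (snd z) / norm (x - z) ^ 4" using b by (simp add: P_def)
  have "snd (snd x) * snd (snd z) * (10 / (P ^ 3 * Q)) = 10 * snd (snd x) / P ^ 3 * (snd (snd z) / Q)" by simp
  also have "\<dots> \<le> 10 * snd (snd x) / P ^ 3 * 1" using p PQ by (intro mult_left_mono) auto
  finally show "cmod (kern i j x z) \<le> 10 * snd (snd x) / norm (x - z) ^ 3" using b by (simp add: P_def)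
qed

lemma kern_bounded_on_compact:
  assumes ij: "i \<in> {0, 1, 2}" "j \<in> {0, 1, 2}" and K: "compact K" "K \<subseteq> G" "x \<in> G" "x \<notin> K"
  obtains B where "\<And>z. z \<in> K \<Longrightarrow> cmod (kern i j x z) \<le> B"
proof -
  obtain m where m: "0 < m" "\<And>z. z \<in> K \<Longrightarrow> m \<le> norm (x - z)"
    by (rule compact_positive_lower_bound[of K "\<lambda>z. norm (x - z)"])
      (use K in \<open>auto intro!: continuous_intros\<close>)
  show ?thesis
  proof (rule that)
    fix z assume z: "z \<in> K"
    then have "cmod (kern i j x z) \<le> 10 * snd (snd x) / norm (x - z) ^ 3"
      using K by (intro kern_bound ij) auto
    also have "\<dots> \<le> 10 * snd (snd x) / m ^ 3"
      using K(3) m(1) m(2)[OF z] by (intro divide_left_mono power_mono mult_pos_pos zero_less_power) (auto simp: G_iff)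
    finally show "cmod (kern i j x z) \<le> 10 * snd (snd x) / m ^ 3" .
  qed
qed

context
  fixes i j :: nat and T :: "(point \<Rightarrow> complex) \<Rightarrow> point \<Rightarrow> complex"
  assumes ij: "i \<in> {0, 1, 2}" "j \<in> {0, 1, 2}" and ext: "L2_extension_Riesz2 i j T"
begin

lemma T_Lp2: "f \<in> Lp 2 \<Longrightarrow> T f \<in> Lp 2"
  using ext unfolding L2_extension_Riesz2_def bounded_L2_operator_def by blast

lemma T_add: "f \<in> Lp 2 \<Longrightarrow> g \<in> Lp 2 \<Longrightarrow> AE x in rho. T (\<lambda>y. f y + g y) x = T f x + T g x"
  using ext unfolding L2_extension_Riesz2_def bounded_L2_operator_def by blast

lemma T_cmult: "f \<in> Lp 2 \<Longrightarrow> AE x in rho. T (\<lambda>y. c * f y) x = c * T f x"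
  using ext unfolding L2_extension_Riesz2_def bounded_L2_operator_def by blast

lemma T_test: "f \<in> test_functions \<Longrightarrow> AE x in rho. T f x = Riesz2 i j f x"
  using ext unfolding L2_extension_Riesz2_def by blast

lemma T_sq_bound:
  obtains C where "0 \<le> C" "\<And>f. f \<in> Lp 2 \<Longrightarrow> sq_int (T f) \<le> C * sq_int f"
proof -
  obtain C where C: "\<forall>f\<in>Lp 2. Lp_norm 2 (T f) \<le> C * Lp_norm 2 f"
    using ext unfolding L2_extension_Riesz2_def bounded_L2_operator_def by blast
  show ?thesis
  proof (rule that[of "(max C 0)\<^sup>2"])
    fix f assume f: "f \<in> Lp 2"
    have "Lp_norm 2 (T f) \<le> max C 0 * Lp_norm 2 f"
      using C f by (intro order_trans[OF C[rule_format, OF f]] mult_right_mono) (simp_all add: Lp2_norm sq_int_nonneg)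
    then have "(Lp_norm 2 (T f))\<^sup>2 \<le> (max C 0 * Lp_norm 2 f)\<^sup>2"
      by (rule power_mono) (simp add: Lp2_norm sq_int_nonneg)
    then show "sq_int (T f) \<le> (max C 0)\<^sup>2 * sq_int f"
      by (simp add: Lp2_norm sq_int_nonneg power_mult_distrib)
  qed simp
qed

lemma T_diff:
  assumes "f \<in> Lp 2" "g \<in> Lp 2"
  shows "AE x in rho. T (\<lambda>y. f y - g y) x = T f x - T g x"
  using T_add[OF assms(1) Lp2_cmult[OF assms(2), of "-1"]] T_cmult[OF assms(2), of "-1"]
  by eventually_elim simp

lemma sq_int_cong: "f \<in> Lp 2 \<Longrightarrow> g \<in> Lp 2 \<Longrightarrow> AE x in rho. f x = g x \<Longrightarrow> sq_int f = sq_int g"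
  unfolding sq_int_def by (intro integral_cong_AE) (auto simp: Lp2_iff)

text \<open>\<open>T\<close> acts on functions rather than classes; independence of the
  representative follows from additivity and from the norm bound applied to f - g.\<close>

lemma T_cong:
  assumes f: "f \<in> Lp 2" and g: "g \<in> Lp 2" and eq: "AE x in rho. f x = g x"
  shows "AE x in rho. T f x = T g x"
proof -
  obtain C where C: "\<And>f. f \<in> Lp 2 \<Longrightarrow> sq_int (T f) \<le> C * sq_int f" by (rule T_sq_bound) (rule that)
  have d: "(\<lambda>y. f y - g y) \<in> Lp 2" by (rule Lp2_diff[OF f g])
  have "sq_int (\<lambda>y. f y - g y) = sq_int (\<lambda>y. 0)"
    by (rule sq_int_cong[OF d]) (use eq in \<open>auto simp: Lp2_iff\<close>)
  then have "sq_int (T (\<lambda>y. f y - g y)) \<le> 0" using C[OF d] by (simp add: sq_int_def)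
  then have "sq_int (T (\<lambda>y. f y - g y)) = 0" using sq_int_nonneg by (rule antisym)
  then have "AE x in rho. T (\<lambda>y. f y - g y) x = 0" by (rule AE_zero_of_sq_int[OF T_Lp2[OF d]])
  with T_diff[OF f g] show ?thesis by eventually_elim simp
qed

lemma T_tendsto:
  assumes F: "\<And>n. F n \<in> Lp 2" and f: "f \<in> Lp 2" and lim: "(\<lambda>n. sq_int (\<lambda>x. F n x - f x)) \<longlonglongrightarrow> 0"
  shows "(\<lambda>n. sq_int (\<lambda>x. T (F n) x - T f x)) \<longlonglongrightarrow> 0"
proof -
  obtain C where C: "0 \<le> C" "\<And>f. f \<in> Lp 2 \<Longrightarrow> sq_int (T f) \<le> C * sq_int f" by (rule T_sq_bound) (rule that)
  have "sq_int (\<lambda>x. T (F n) x - T f x) = sq_int (T (\<lambda>x. F n x - f x))" for n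
  proof (rule sq_int_cong)
    show "AE x in rho. T (F n) x - T f x = T (\<lambda>x. F n x - f x) x" using T_diff[OF F[of n] f] by eventually_elim simp
  qed (intro Lp2_diff T_Lp2 F f)+
  then have "norm (sq_int (\<lambda>x. T (F n) x - T f x)) \<le> C * sq_int (\<lambda>x. F n x - f x)" for n
    using C(2)[OF Lp2_diff[OF F f]] sq_int_nonneg by simp
  then show ?thesis
    by (intro Lim_null_comparison[OF always_eventually tendsto_mult_right_zero[OF lim, of C]] allI)
qed

text \<open>In the limit step a subsequence of \<open>T (F n)\<close> converges almost everywhere by
  the L^2 bound. For each x off the closed box the kernel is bounded on the box, so the integrals
  converge as well. Countably many exceptional null sets are collected.\<close>

lemma T_off_support:
  assumes l: "0 < snd (snd l)" and f: "bounded_on_box l u f"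
  shows "AE x in rho. x \<notin> cbox l u \<longrightarrow> T f x = - (\<integral>z. f z * kern i j x z \<partial>rho)"
  using l f
proof (induction rule: bounded_on_box_induct)
  case (test g)
  have 0: "g z = 0" if "z \<notin> cbox l u" for z
    using that test(2) box_subset_cbox[of l u] unfolding bounded_on_box_def by blast
  have "Riesz2 i j g x = - (\<integral>z. g z * kern i j x z \<partial>rho)" if "x \<in> G" "x \<notin> cbox l u" for x
    unfolding kern_def
    by (rule Riesz2_off_support[OF test(1) compact_cbox cbox_subset_G[OF l] 0 ij that])
  then have "AE x in rho. x \<notin> cbox l u \<longrightarrow> Riesz2 i j g x = - (\<integral>z. g z * kern i j x z \<partial>rho)"
    by (intro AE_I2) simp
  with T_test[OF test(1)] show ?case by eventually_elim simp
next
  case (add f g)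
  note L = bounded_on_box_Lp2[OF l add(1)] bounded_on_box_Lp2[OF l add(2)]
  have "(\<integral>z. (f z + g z) * kern i j x z \<partial>rho) = (\<integral>z. f z * kern i j x z \<partial>rho) + (\<integral>z. g z * kern i j x z \<partial>rho)"
    if x: "x \<in> G" "x \<notin> cbox l u" for x
  proof -
    obtain B where B: "\<And>z. z \<in> cbox l u \<Longrightarrow> cmod (kern i j x z) \<le> B"
      by (rule kern_bounded_on_compact[OF ij compact_cbox cbox_subset_G[OF l] x]) (rule that)
    have B': "cmod (kern i j x z) \<le> B" if "z \<in> box l u" for z using that box_subset_cbox[of l u] by (intro B) blast
    show ?thesis unfolding distrib_right
      by (rule Bochner_Integration.integral_add)
        (rule bounded_on_box_integrable[OF l add(1) kern_measurable B'], assumption,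
         rule bounded_on_box_integrable[OF l add(2) kern_measurable B'], assumption)
  qed
  then have "AE x in rho. x \<notin> cbox l u \<longrightarrow> (\<integral>z. (f z + g z) * kern i j x z \<partial>rho) = (\<integral>z. f z * kern i j x z \<partial>rho) + (\<integral>z. g z * kern i j x z \<partial>rho)"
    by (intro AE_I2) simp
  with add(3,4) T_add[OF L] show ?case by eventually_elim simp
next
  case (cmult c f)
  show ?case using cmult(2) T_cmult[OF bounded_on_box_Lp2[OF l cmult(1)], of c]
    by eventually_elim (simp add: mult.assoc)
next
  case (lim F f M)
  note L = bounded_on_box_Lp2[OF l lim(1)] bounded_on_box_Lp2[OF l lim(2)]
  have "(\<lambda>n. sq_int (\<lambda>x. T (F n) x - T f x)) \<longlonglongrightarrow> 0"
    by (intro T_tendsto L bounded_on_box_sq_tendsto[OF l lim(1,2,3,4)])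
  then obtain r where r: "strict_mono r" "AE x in rho. (\<lambda>n. T (F (r n)) x - T f x) \<longlonglongrightarrow> 0"
    by (rule sq_int_tendsto_AE_subseq[OF Lp2_diff[OF T_Lp2[OF L(1)] T_Lp2[OF L(2)]]]) (rule that)
  have "(\<lambda>n. \<integral>z. F (r n) z * kern i j x z \<partial>rho) \<longlonglongrightarrow> (\<integral>z. f z * kern i j x z \<partial>rho)"
    if x: "x \<in> G" "x \<notin> cbox l u" for x
  proof -
    obtain B where B: "\<And>z. z \<in> cbox l u \<Longrightarrow> cmod (kern i j x z) \<le> B"
      by (rule kern_bounded_on_compact[OF ij compact_cbox cbox_subset_G[OF l] x]) (rule that)
    have B': "cmod (kern i j x z) \<le> B" if "z \<in> box l u" for z using that box_subset_cbox[of l u] by (intro B) blast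
    have "(\<lambda>n. \<integral>z. F n z * kern i j x z \<partial>rho) \<longlonglongrightarrow> (\<integral>z. f z * kern i j x z \<partial>rho)"
      by (rule bounded_on_box_integral_tendsto[OF l lim(1,2,3,4) kern_measurable B'])
    from LIMSEQ_subseq_LIMSEQ[OF this r(1)] show ?thesis by (simp add: o_def)
  qed
  then have "AE x in rho. x \<notin> cbox l u \<longrightarrow> (\<lambda>n. \<integral>z. F (r n) z * kern i j x z \<partial>rho) \<longlonglongrightarrow> (\<integral>z. f z * kern i j x z \<partial>rho)"
    by (intro AE_I2) simp
  moreover have "AE x in rho. \<forall>n. x \<notin> cbox l u \<longrightarrow> T (F n) x = - (\<integral>z. F n z * kern i j x z \<partial>rho)"
    by (rule AE_all_countable[THEN iffD2]) (rule allI, rule lim(5))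
  ultimately show ?case using r(2)
  proof eventually_elim
    case (elim x)
    show ?case
    proof
      assume x: "x \<notin> cbox l u"
      have "(\<lambda>n. - (\<integral>z. F (r n) z * kern i j x z \<partial>rho)) \<longlonglongrightarrow> - (\<integral>z. f z * kern i j x z \<partial>rho)"
        using elim(1) x by (intro tendsto_minus) simp
      then have "(\<lambda>n. T (F (r n)) x) \<longlonglongrightarrow> - (\<integral>z. f z * kern i j x z \<partial>rho)" using elim(2) x by simp
      moreover have "(\<lambda>n. T (F (r n)) x) \<longlonglongrightarrow> T f x" using elim(3) by (simp add: LIM_zero_iff)
      ultimately show "T f x = - (\<integral>z. f z * kern i j x z \<partial>rho)" by (rule LIMSEQ_unique[rotated])
    qed
  qed
qed

text \<open>On test functions this is the transposition identity. Both sides survive bounded limits: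
  the left by the L^2 bound for \<open>T\<close>, the right because the transform of \<phi> is
  bounded on the box.\<close>

lemma T_adjoint_box:
  assumes \<phi>: "\<phi> \<in> test_functions" "\<phi> \<in> Lp 2" and l: "0 < snd (snd l)" and f: "bounded_on_box l u f"
  shows "(\<integral>x. T f x * \<phi> x \<partial>rho) = (\<integral>z. f z * Riesz2 j i \<phi> z \<partial>rho)"
proof -
  obtain C where C: "\<And>z. z \<in> G \<Longrightarrow> cmod (Riesz2 j i \<phi> z) \<le> C" by (rule Riesz2_test_bounded[OF \<phi>(1) ij]) (rule that)
  have C': "cmod (Riesz2 j i \<phi> z) \<le> C" if "z \<in> box l u" for z
    using that cbox_subset_G[OF l, of u] box_subset_cbox[of l u] by (intro C) blast
  note Vm = Riesz2_test_measurable[OF \<phi>(1) ij]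
  from l f show ?thesis
  proof (induction rule: bounded_on_box_induct)
    case (test g)
    note L = T_Lp2[OF bounded_on_box_Lp2[OF l test(2)]]
    have "AE x in rho. T g x * \<phi> x = Riesz2 i j g x * \<phi> x" using T_test[OF test(1)] by eventually_elim simp
    moreover have "(\<lambda>x. T g x * \<phi> x) \<in> borel_measurable rho" using L \<phi>(2) by (auto simp: Lp2_iff)
    moreover have "(\<lambda>x. Riesz2 i j g x * \<phi> x) \<in> borel_measurable rho"
      using Riesz2_test_measurable[OF test(1) ij(2,1)] \<phi>(2) by (auto simp: Lp2_iff)
    ultimately have "(\<integral>x. T g x * \<phi> x \<partial>rho) = (\<integral>x. Riesz2 i j g x * \<phi> x \<partial>rho)" by (intro integral_cong_AE)
    then show ?case using Riesz2_adjoint_test[OF test(1) \<phi>(1) ij] by simp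
  next
    case (add f g)
    note L = bounded_on_box_Lp2[OF l add(1)] bounded_on_box_Lp2[OF l add(2)]
      have "AE x in rho. T (\<lambda>z. f z + g z) x * \<phi> x = T f x * \<phi> x + T g x * \<phi> x"
      using T_add[OF L] by eventually_elim (simp add: distrib_right)
    moreover have "(\<lambda>x. T (\<lambda>z. f z + g z) x * \<phi> x) \<in> borel_measurable rho" "(\<lambda>x. T f x * \<phi> x + T g x * \<phi> x) \<in> borel_measurable rho"
      using T_Lp2[OF Lp2_add[OF L]] T_Lp2[OF L(1)] T_Lp2[OF L(2)] \<phi>(2) by (auto simp: Lp2_iff)
    ultimately have "(\<integral>x. T (\<lambda>z. f z + g z) x * \<phi> x \<partial>rho) = (\<integral>x. T f x * \<phi> x + T g x * \<phi> x \<partial>rho)" by (intro integral_cong_AE)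
    also have "\<dots> = (\<integral>x. T f x * \<phi> x \<partial>rho) + (\<integral>x. T g x * \<phi> x \<partial>rho)"
      by (intro Bochner_Integration.integral_add Lp2_mult_integrable T_Lp2 L \<phi>(2))
    also have "\<dots> = (\<integral>z. f z * Riesz2 j i \<phi> z \<partial>rho) + (\<integral>z. g z * Riesz2 j i \<phi> z \<partial>rho)" by (simp only: add(3,4))
    also have "\<dots> = (\<integral>z. (f z + g z) * Riesz2 j i \<phi> z \<partial>rho)"
      unfolding distrib_right
      by (rule Bochner_Integration.integral_add[symmetric])
        (rule bounded_on_box_integrable[OF l add(1) Vm C'], assumption,
         rule bounded_on_box_integrable[OF l add(2) Vm C'], assumption)
    finally show ?case .
  next
    case (cmult c f)
    note L = bounded_on_box_Lp2[OF l cmult(1)]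
    have "AE x in rho. T (\<lambda>z. c * f z) x * \<phi> x = c * (T f x * \<phi> x)"
      using T_cmult[OF L, of c] by eventually_elim (simp add: mult.assoc)
    moreover have "(\<lambda>x. T (\<lambda>z. c * f z) x * \<phi> x) \<in> borel_measurable rho" "(\<lambda>x. c * (T f x * \<phi> x)) \<in> borel_measurable rho"
      using T_Lp2[OF Lp2_cmult[OF L, of c]] T_Lp2[OF L] \<phi>(2) by (auto simp: Lp2_iff)
    ultimately have "(\<integral>x. T (\<lambda>z. c * f z) x * \<phi> x \<partial>rho) = (\<integral>x. c * (T f x * \<phi> x) \<partial>rho)" by (intro integral_cong_AE)
    then show ?case using cmult(2) by (simp add: mult.assoc)
  next
    case (lim F f M)
    note L = bounded_on_box_Lp2[OF l lim(1)] bounded_on_box_Lp2[OF l lim(2)]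
    have "(\<lambda>n. \<integral>x. (T (F n) x - T f x) * \<phi> x \<partial>rho) \<longlonglongrightarrow> 0"
      by (intro Lp2_mult_tendsto \<phi> Lp2_diff T_Lp2 L T_tendsto bounded_on_box_sq_tendsto[OF l lim(1,2,3,4)])
    moreover have "(\<integral>x. (T (F n) x - T f x) * \<phi> x \<partial>rho) = (\<integral>z. F n z * Riesz2 j i \<phi> z \<partial>rho) - (\<integral>x. T f x * \<phi> x \<partial>rho)" for n
      unfolding left_diff_distrib lim(5)[symmetric]
      by (intro Bochner_Integration.integral_diff Lp2_mult_integrable T_Lp2 L \<phi>(2))
    ultimately have "(\<lambda>n. \<integral>z. F n z * Riesz2 j i \<phi> z \<partial>rho) \<longlonglongrightarrow> (\<integral>x. T f x * \<phi> x \<partial>rho)"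
      by (simp add: LIM_zero_iff)
    moreover have "(\<lambda>n. \<integral>z. F n z * Riesz2 j i \<phi> z \<partial>rho) \<longlonglongrightarrow> (\<integral>z. f z * Riesz2 j i \<phi> z \<partial>rho)"
      by (rule bounded_on_box_integral_tendsto[OF l lim(1,2,3,4) Vm C'])
    ultimately show ?case by (rule LIMSEQ_unique)
  qed
qed

text \<open>Truncations of f converge in L^2, which serves the left side, and are dominated by |f|
  in L^1, which serves the right side since \<open>Riesz2 j i \<phi>\<close> is bounded.\<close>

lemma T_adjoint:
  assumes \<phi>: "\<phi> \<in> test_functions" "\<phi> \<in> Lp 2" and f: "f \<in> Lp 1" "f \<in> Lp 2"
  shows "(\<integral>x. T f x * \<phi> x \<partial>rho) = (\<integral>z. f z * Riesz2 j i \<phi> z \<partial>rho)"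
    "integrable rho (\<lambda>z. f z * Riesz2 j i \<phi> z)"
proof -
  obtain C where C: "0 \<le> C" "\<And>z. z \<in> G \<Longrightarrow> cmod (Riesz2 j i \<phi> z) \<le> C" by (rule Riesz2_test_bounded[OF \<phi>(1) ij]) (rule that)
  note Vm = Riesz2_test_measurable[OF \<phi>(1) ij]
  have fm: "f \<in> borel_measurable rho" and fi: "integrable rho (\<lambda>z. cmod (f z))" and fi2: "integrable rho (\<lambda>z. (cmod (f z))\<^sup>2)"
    using f by (simp_all add: Lp2_iff Lp1_iff integrable_norm)
  \<comment> \<open>Restriction to an exhausting box and a cutoff in size make \<open>F k\<close>
    admissible for the identity on boxes, with |F k| \<le> |f|.\<close>
  define g where "g k z = indicator (box (exl k) (exu k)) z *\<^sub>R f z" for k z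
  define F where "F k z = (if cmod (g k z) \<le> real k then g k z else 0)" for k z
  have gm: "g k \<in> borel_measurable borel" for k
    unfolding g_def by (rule rho_measurable_indicator[OF fm _ ex_box_subset_G]) simp
  have Fm: "F k \<in> borel_measurable borel" for k
  proof -
    have "{z. cmod (g k z) \<le> real k} \<in> sets borel"
      using borel_measurable_le[OF measurable_compose[OF gm[of k] borel_measurable_norm] borel_measurable_const[of "real k"]] by simp
    then show ?thesis unfolding F_def using gm by (intro measurable_If) (simp_all add: pred_def)
  qed
  have Fb: "bounded_on_box (exl k) (exu k) (F k)" for k
    by (rule bounded_on_boxI[OF Fm, of _ _ _ "real k"]) (simp_all add: F_def g_def)
  have FL: "F k \<in> Lp 2" for k by (rule bounded_on_box_Lp2[OF exl_pos Fb])
  have ev: "\<forall>\<^sub>F k in sequentially. F k z = f z" if z: "z \<in> G" for z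
  proof -
    obtain N where N: "cmod (f z) \<le> real N" using real_arch_simple by blast
    have "\<forall>\<^sub>F k in sequentially. cmod (f z) \<le> real k"
      by (rule eventually_mono[OF eventually_ge_at_top[of N]]) (rule order_trans[OF N], simp)
    with ex_box_eventually[OF z] show ?thesis by eventually_elim (simp add: F_def g_def)
  qed
  have le: "cmod (F k z) \<le> cmod (f z)" "cmod (F k z - f z) \<le> cmod (f z)" for k z
    by (auto simp: F_def g_def indicator_def)
  have "(\<lambda>k. \<integral>z. (cmod (F k z - f z))\<^sup>2 \<partial>rho) \<longlonglongrightarrow> (\<integral>z. 0 \<partial>rho)"
  proof (rule integral_dominated_convergence[OF _ _ fi2])
    show "(\<lambda>z. (cmod (F k z - f z))\<^sup>2) \<in> borel_measurable rho" for k
      using borel_imp_rho[OF Fm[of k]] fm by simp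
    have "(\<lambda>k. (cmod (F k z - f z))\<^sup>2) \<longlonglongrightarrow> 0" if "z \<in> G" for z
      using ev[OF that] by (intro tendsto_eventually) (auto elim!: eventually_mono)
    then show "AE z in rho. (\<lambda>k. (cmod (F k z - f z))\<^sup>2) \<longlonglongrightarrow> 0" by (intro AE_I2) simp
    show "AE z in rho. norm ((cmod (F k z - f z))\<^sup>2) \<le> (cmod (f z))\<^sup>2" for k
      using le(2) by (intro AE_I2) (simp add: power_mono)
  qed simp
  then have "(\<lambda>k. sq_int (\<lambda>z. F k z - f z)) \<longlonglongrightarrow> 0" by (simp add: sq_int_def)
  then have "(\<lambda>k. \<integral>x. (T (F k) x - T f x) * \<phi> x \<partial>rho) \<longlonglongrightarrow> 0"
    by (intro Lp2_mult_tendsto \<phi> Lp2_diff T_Lp2 FL f T_tendsto)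
  moreover have "(\<integral>x. (T (F k) x - T f x) * \<phi> x \<partial>rho) = (\<integral>z. F k z * Riesz2 j i \<phi> z \<partial>rho) - (\<integral>x. T f x * \<phi> x \<partial>rho)" for k
    unfolding left_diff_distrib T_adjoint_box[OF \<phi> exl_pos Fb, symmetric]
    by (intro Bochner_Integration.integral_diff Lp2_mult_integrable T_Lp2 FL f \<phi>(2))
  ultimately have l1: "(\<lambda>k. \<integral>z. F k z * Riesz2 j i \<phi> z \<partial>rho) \<longlonglongrightarrow> (\<integral>x. T f x * \<phi> x \<partial>rho)"
    by (simp add: LIM_zero_iff)
  have w: "integrable rho (\<lambda>z. cmod (f z) * C)" using fi by simp
  have fV: "(\<lambda>z. f z * Riesz2 j i \<phi> z) \<in> borel_measurable rho" by (intro borel_measurable_times fm Vm)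
  have b: "cmod (h z * Riesz2 j i \<phi> z) \<le> cmod (f z) * C" if "cmod (h z) \<le> cmod (f z)" "z \<in> G" for h :: "point \<Rightarrow> complex" and z
    unfolding norm_mult using that C by (intro mult_mono) auto
  have l2: "(\<lambda>k. \<integral>z. F k z * Riesz2 j i \<phi> z \<partial>rho) \<longlonglongrightarrow> (\<integral>z. f z * Riesz2 j i \<phi> z \<partial>rho)"
  proof (rule integral_dominated_convergence[OF fV _ w])
    show "(\<lambda>z. F k z * Riesz2 j i \<phi> z) \<in> borel_measurable rho" for k
      by (intro borel_measurable_times borel_imp_rho Fm Vm)
    have "(\<lambda>k. F k z * Riesz2 j i \<phi> z) \<longlonglongrightarrow> f z * Riesz2 j i \<phi> z" if "z \<in> G" for z
      using ev[OF that] by (intro tendsto_eventually) (auto elim!: eventually_mono)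
    then show "AE z in rho. (\<lambda>k. F k z * Riesz2 j i \<phi> z) \<longlonglongrightarrow> f z * Riesz2 j i \<phi> z" by (intro AE_I2) simp
    show "AE z in rho. norm (F k z * Riesz2 j i \<phi> z) \<le> cmod (f z) * C" for k
      using b[of "F k"] le(1)[of k] by (intro AE_I2) simp
  qed
  show "(\<integral>x. T f x * \<phi> x \<partial>rho) = (\<integral>z. f z * Riesz2 j i \<phi> z \<partial>rho)"
    using l1 l2 by (rule LIMSEQ_unique)
  show "integrable rho (\<lambda>z. f z * Riesz2 j i \<phi> z)"
  proof (rule Bochner_Integration.integrable_bound[OF w fV])
    show "AE z in rho. norm (f z * Riesz2 j i \<phi> z) \<le> norm (cmod (f z) * C)"
      using b[of f] C(1) by (intro AE_I2) (simp add: abs_mult)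
  qed
qed

end

text \<open>By the monotone class principle the vanishing of the pairing extends from test functions
  to the conjugate phase of v on the box, and pairing with that gives the integral of |v| over the
  box.\<close>

lemma AE_zero_on_box:
  assumes l: "0 < snd (snd l)" and v: "v \<in> borel_measurable rho"
    and int: "integrable rho (\<lambda>x. indicator (box l u) x *\<^sub>R v x)"
    and zero: "\<And>\<phi>. \<phi> \<in> test_functions \<Longrightarrow> bounded_on_box l u \<phi> \<Longrightarrow> (\<integral>x. v x * \<phi> x \<partial>rho) = 0"
  shows "AE x in rho. x \<in> box l u \<longrightarrow> v x = 0"
proof -
  define w where "w x = indicator (box l u) x *\<^sub>R v x" for x
  have BG: "box l u \<subseteq> G" using cbox_subset_G[OF l, of u] box_subset_cbox[of l u] by (rule order_trans[rotated])
  have wm: "w \<in> borel_measurable borel"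
    unfolding w_def by (rule rho_measurable_indicator[OF v _ BG]) simp
  have wi: "integrable rho (\<lambda>x. cmod (w x))" using int unfolding w_def by (rule integrable_norm)
  have b: "cmod (v x * f x) \<le> cmod (w x) * M" if "bounded_on_box l u f" "\<And>z. cmod (f z) \<le> M" for f M x
  proof (cases "x \<in> box l u")
    case True
    then show ?thesis unfolding norm_mult w_def using that(2)[of x] by (simp add: mult_left_mono)
  next
    case False
    then show ?thesis using that unfolding bounded_on_box_def by (simp add: w_def)
  qed
  have vf: "integrable rho (\<lambda>x. v x * f x)" if f: "bounded_on_box l u f" for f
  proof -
    obtain M where M: "0 \<le> M" "f \<in> borel_measurable borel" "\<And>z. z \<notin> box l u \<Longrightarrow> f z = 0" "\<And>z. cmod (f z) \<le> M"
      by (rule bounded_on_boxE[OF f]) (rule that)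
    show ?thesis
    proof (rule Bochner_Integration.integrable_bound)
      show "integrable rho (\<lambda>x. cmod (w x) * M)" using wi by simp
      show "(\<lambda>x. v x * f x) \<in> borel_measurable rho" by (intro borel_measurable_times v borel_imp_rho M)
      show "AE x in rho. norm (v x * f x) \<le> norm (cmod (w x) * M)"
        using b[OF f M(4)] M(1) by (intro AE_I2) (simp add: abs_mult)
    qed
  qed
  \<comment> \<open>Where w is 0 the quotient is 0, so f is the conjugate phase of v on the box and
    0 elsewhere.\<close>
  define f where "f x = cnj (w x / of_real (cmod (w x)))" for x
  have f: "bounded_on_box l u f"
  proof (rule bounded_on_boxI)
    have "(\<lambda>x. w x / of_real (cmod (w x))) \<in> borel_measurable borel"
      by (intro borel_measurable_divide wm measurable_compose[OF measurable_compose[OF wm borel_measurable_norm] of_real_measurable])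
    then show "f \<in> borel_measurable borel" unfolding f_def
      by (rule measurable_compose[OF _ borel_measurable_continuous_onI]) (intro continuous_intros)
    show "cmod (f x) \<le> 1" for x by (simp add: f_def norm_divide)
  qed (simp add: f_def w_def)
  from l f have "(\<integral>x. v x * f x \<partial>rho) = 0"
  proof (induction rule: bounded_on_box_induct)
    case (test g)
    then show ?case by (rule zero)
  next
    case (add f g)
    then show ?case by (simp add: distrib_left vf)
  next
    case (cmult c f)
    then show ?case by (simp add: mult.left_commute)
  next
    case (lim F f M)
    have "(\<lambda>n. \<integral>x. v x * F n x \<partial>rho) \<longlonglongrightarrow> (\<integral>x. v x * f x \<partial>rho)"
    proof (rule integral_dominated_convergence[where w="\<lambda>x. cmod (w x) * M"])
      show "integrable rho (\<lambda>x. cmod (w x) * M)" using wi by simp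
      show "(\<lambda>x. v x * f x) \<in> borel_measurable rho" "(\<lambda>x. v x * F n x) \<in> borel_measurable rho" for n
        using vf[OF lim(1)] vf[OF lim(2)] by (simp_all add: borel_measurable_integrable)
      show "AE x in rho. (\<lambda>n. v x * F n x) \<longlonglongrightarrow> v x * f x" by (intro AE_I2 tendsto_intros lim(4))
      show "AE x in rho. norm (v x * F n x) \<le> cmod (w x) * M" for n by (intro AE_I2 b[OF lim(1,3)])
    qed
    then show ?case using lim(5) by (simp add: LIMSEQ_const_iff)
  qed
  moreover have "v x * f x = of_real (cmod (w x))" for x
  proof (cases "x \<in> box l u \<and> v x \<noteq> 0")
    case True
    then have "v x * f x = (v x * cnj (v x)) / of_real (cmod (v x))" by (simp add: f_def w_def)
    also have "\<dots> = of_real ((cmod (v x))\<^sup>2 / cmod (v x))" by (simp add: complex_norm_square[symmetric])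
    finally show ?thesis using True by (simp add: w_def power2_eq_square)
  qed (auto simp: f_def w_def)
  ultimately have "complex_of_real (\<integral>x. cmod (w x) \<partial>rho) = 0" by (simp add: integral_complex_of_real)
  then have "AE x in rho. cmod (w x) = 0"
    using integral_nonneg_eq_0_iff_AE[OF wi] by simp
  then show ?thesis by eventually_elim (auto simp: w_def indicator_def split: if_splits)
qed

section \<open>Atoms\<close>

lemma rho_cbox:
  assumes "p1 \<le> q1" "p2 \<le> q2" "0 < \<alpha>" "\<alpha> \<le> \<beta>"
  shows "emeasure rho (cbox (p1, p2, \<alpha>) (q1, q2, \<beta>)) = ennreal ((q1 - p1) * (q2 - p2) * ln (\<beta> / \<alpha>))"
proof -
  let ?R = "cbox (p1, p2, \<alpha>) (q1, q2, \<beta>) :: point set"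
  have RG: "?R \<subseteq> G" using assms(3) by (intro cbox_subset_G) simp
  have Rs: "?R \<in> sets rho" using RG by (simp add: sets_rhoI)
  have I: "(\<integral>\<^sup>+c. ennreal (1 / c) * indicator {\<alpha>..\<beta>} c \<partial>lborel) = ennreal (ln (\<beta> / \<alpha>))"
  proof -
    have "(\<integral>\<^sup>+c. ennreal (1 / c) * indicator {\<alpha>..\<beta>} c \<partial>lborel) = ennreal (ln \<beta> - ln \<alpha>)"
      by (rule nn_integral_FTC_Icc) (use assms in \<open>auto intro!: derivative_eq_intros borel_measurable_divide simp: divide_inverse\<close>)
    then show ?thesis using assms by (simp add: ln_div)
  qed
  have "emeasure rho ?R = (\<integral>\<^sup>+z. indicator ?R z \<partial>rho)" using Rs by simp
  also have "\<dots> = (\<integral>\<^sup>+z. ennreal (wt z) * indicator ?R z \<partial>lborel)"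
    by (rule nn_integral_rho_wt) (rule borel_imp_rho, simp)
  also have "\<dots> = (\<integral>\<^sup>+c. \<integral>\<^sup>+y. \<integral>\<^sup>+x. ennreal (wt (x, y, c)) * indicator ?R (x, y, c) \<partial>lborel \<partial>lborel \<partial>lborel)"
    by (rule nn_integral_lborel_point) (intro borel_measurable_times_ennreal measurable_compose[OF wt_measurable measurable_ennreal], simp)
  also have "\<dots> = (\<integral>\<^sup>+c. \<integral>\<^sup>+y. \<integral>\<^sup>+x. (ennreal (1 / c) * indicator {\<alpha>..\<beta>} c) * (indicator {p2..q2} y * indicator {p1..q1} x) \<partial>lborel \<partial>lborel \<partial>lborel)"
  proof (intro nn_integral_cong)
    fix c y x
    show "ennreal (wt (x, y, c)) * indicator ?R (x, y, c) = (ennreal (1 / c) * indicator {\<alpha>..\<beta>} c) * (indicator {p2..q2} y * indicator {p1..q1} x)"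
    proof (cases "(x, y, c) \<in> ?R")
      case True
      then show ?thesis using assms(3) by (auto simp: mem_cbox_point wt_triple)
    qed (auto simp: mem_cbox_point indicator_def)
  qed
  also have "\<dots> = (\<integral>\<^sup>+c. (ennreal (1 / c) * indicator {\<alpha>..\<beta>} c) * (ennreal (q2 - p2) * ennreal (q1 - p1)) \<partial>lborel)"
    using assms by (simp add: nn_integral_cmult nn_integral_multc)
  also have "\<dots> = ennreal (ln (\<beta> / \<alpha>)) * (ennreal (q2 - p2) * ennreal (q1 - p1))"
    by (subst nn_integral_multc) (auto simp: I)
  also have "\<dots> = ennreal ((q1 - p1) * (q2 - p2) * ln (\<beta> / \<alpha>))"
    using assms by (simp add: ennreal_mult'[symmetric] mult.commute mult.left_commute)
  finally show ?thesis .
qed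

text \<open>Atoms live on closed parallelepipeds while the monotone class argument works on open
  boxes; the faces form a null set.\<close>

lemma AE_cbox_box: "AE z in rho. z \<in> cbox l u \<longrightarrow> z \<in> box l u"
proof -
  have "emeasure lborel (cbox l u - box l u) = emeasure lborel (cbox l u) - emeasure lborel (box l u)"
    using box_subset_cbox[of l u] by (intro emeasure_Diff) (auto simp: emeasure_lborel_box_finite[unfolded infinity_ennreal_def] less_top)
  also have "\<dots> = 0" by (simp add: emeasure_lborel_cbox_eq emeasure_lborel_box_eq)
  finally have "cbox l u - box l u \<in> null_sets lborel" by (intro null_setsI) auto
  then have "AE z in lborel. z \<notin> cbox l u - box l u" by (rule AE_not_in)
  then show ?thesis unfolding AE_rho by eventually_elim simp
qed

lemma norm_le_coordinates: "norm (v::point) \<le> \<bar>fst v\<bar> + \<bar>fst (snd v)\<bar> + \<bar>snd (snd v)\<bar>"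
proof -
  have "norm v \<le> norm (fst v) + norm (snd v)" using norm_Pair_le[of "fst v" "snd v"] by simp
  also have "norm (snd v) \<le> norm (fst (snd v)) + norm (snd (snd v))" using norm_Pair_le[of "fst (snd v)" "snd (snd v)"] by simp
  finally show ?thesis by simp
qed

lemma coordinates_le_norm:
  "\<bar>fst (v::point)\<bar> \<le> norm v" "\<bar>fst (snd v)\<bar> \<le> norm v" "\<bar>snd (snd v)\<bar> \<le> norm v"
proof -
  have f: "norm (fst v) \<le> norm v" and s: "norm (snd v) \<le> norm v"
    using norm_fst_le[of "fst v" "snd v"] norm_snd_le[of "snd v" "fst v"] by simp_all
  have "norm (fst (snd v)) \<le> norm (snd v)" "norm (snd (snd v)) \<le> norm (snd v)"
    using norm_fst_le[of "fst (snd v)" "snd (snd v)"] norm_snd_le[of "snd (snd v)" "fst (snd v)"] by simp_all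
  then show "\<bar>fst v\<bar> \<le> norm v" "\<bar>fst (snd v)\<bar> \<le> norm v" "\<bar>snd (snd v)\<bar> \<le> norm v" using f s by simp_all
qed

section \<open>Regularity of the kernel and geometry of Calderon-Zygmund sets\<close>

context
  fixes i j :: nat
  assumes ij: "i \<in> {0, 1, 2}" "j \<in> {0, 1, 2}"
begin

text \<open>Mean value along the segment from c to z, which stays in G because s is below the height
  of c. Apart from the height of x, the derivative has size at most 10 s P^-4 + 72 s P^-4 with P
  \<ge> |x - c| / 2, and 82 * 16 = 1312.\<close>

lemma kern_difference:
  assumes x: "x \<in> G" and c: "c \<in> G" and s: "0 < s" "s < snd (snd c)"
    and z: "norm (z - c) \<le> s" and far: "2 * s \<le> norm (x - c)"
  shows "cmod (kern i j x z - kern i j x c) \<le> snd (snd x) * (1312 * s / norm (x - c) ^ 4)"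
proof -
  define w where "w = z - c"
  define g where "g t = snd (snd (c + t *\<^sub>R w)) * green_xz (cdir i) (cdir j) x (c + t *\<^sub>R w)" for t
  define g' where "g' t = snd (snd w) * green_xz (cdir i) (cdir j) x (c + t *\<^sub>R w)
      + green_xzz (cdir i) (cdir j) w x (c + t *\<^sub>R w) * snd (snd (c + t *\<^sub>R w))" for t
  have near: "norm (t *\<^sub>R w) \<le> s" if "t \<in> {0..1}" for t
  proof -
    have "norm (t *\<^sub>R w) \<le> 1 * norm w" using that by (simp add: mult_left_le_one_le)
    then show ?thesis using z by (simp add: w_def)
  qed
  have inG: "c + t *\<^sub>R w \<in> G" if "t \<in> {0..1}" for t
    using near[OF that] coordinates_le_norm(3)[of "t *\<^sub>R w"] s by (auto simp: G_iff)
  have P: "norm (x - c) / 2 \<le> norm (x - (c + t *\<^sub>R w))" if "t \<in> {0..1}" for t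
    using norm_triangle_ineq[of "x - (c + t *\<^sub>R w)" "t *\<^sub>R w"] near[OF that] far by simp
  have xc: "0 < norm (x - c)" using far s by linarith
  have ne: "x \<noteq> c + t *\<^sub>R w" if "t \<in> {0..1}" for t
  proof
    assume "x = c + t *\<^sub>R w"
    then have "norm (x - (c + t *\<^sub>R w)) = 0" by simp
    then show False using P[OF that] xc by simp
  qed
  have d: "(g has_real_derivative g' t) (at t)" if t: "t \<in> {0..1}" for t
    unfolding g_def g'_def
    by (rule DERIV_mult[OF _ green_xzz_derivative[OF x inG[OF t] ne[OF t]], THEN DERIV_cong])
      (auto intro!: derivative_eq_intros)
  have b: "\<bar>g' t\<bar> \<le> 1312 * s / norm (x - c) ^ 4" if t: "t \<in> {0..1}" for t
  proof -
    let ?z = "c + t *\<^sub>R w"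
    define P' where "P' = norm (x - ?z)"
    define Q where "Q = norm (x - reflect ?z)"
    have PQ: "0 < P'" "P' \<le> Q" "snd (snd ?z) \<le> Q" "0 < snd (snd ?z)"
      using ne[OF t] reflect_norm_le[OF x inG[OF t]] inG[OF t] by (auto simp: P'_def Q_def G_iff)
    have ws: "norm w \<le> s" using z by (simp add: w_def)
    have n1: "norm (cdir i) = 1" "norm (cdir j) = 1" using norm_cdir ij by auto
    have "\<bar>snd (snd w) * green_xz (cdir i) (cdir j) x ?z\<bar> \<le> s * (10 / (P' ^ 3 * Q))"
      unfolding abs_mult using green_xz_bound[OF x inG[OF t] ne[OF t], of "cdir i" "cdir j"] coordinates_le_norm(3)[of w] ws s n1
      by (intro mult_mono) (auto simp: P'_def Q_def)
    also have "\<dots> \<le> s * (10 / (P' ^ 3 * P'))"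
      using PQ s by (intro mult_left_mono divide_left_mono mult_pos_pos) auto
    finally have 1: "\<bar>snd (snd w) * green_xz (cdir i) (cdir j) x ?z\<bar> \<le> 10 * s / P' ^ 4"
      by (simp add: eval_nat_numeral ac_simps)
    have "\<bar>green_xzz (cdir i) (cdir j) w x ?z * snd (snd ?z)\<bar> \<le> (72 * norm w / (P' ^ 4 * Q)) * Q"
      unfolding abs_mult using green_xzz_bound[OF x inG[OF t] ne[OF t], of "cdir i" "cdir j" w] PQ n1
      by (intro mult_mono) (auto simp: P'_def Q_def)
    also have "\<dots> = 72 * norm w / P' ^ 4" using PQ by simp
    also have "\<dots> \<le> 72 * s / P' ^ 4" using ws PQ by (intro divide_right_mono) auto
    finally have "\<bar>g' t\<bar> \<le> 10 * s / P' ^ 4 + 72 * s / P' ^ 4"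
      unfolding g'_def using 1 by linarith
    also have "\<dots> = 82 * s / P' ^ 4" by (simp add: add_divide_distrib[symmetric])
    also have "\<dots> \<le> 82 * s / (norm (x - c) / 2) ^ 4"
      using P[OF t] xc PQ s by (intro divide_left_mono power_mono mult_pos_pos zero_less_power) (auto simp: P'_def)
    also have "\<dots> = 1312 * s / norm (x - c) ^ 4" by (simp add: power_divide)
    finally show ?thesis .
  qed
  have "norm (g 1 - g 0) \<le> 1312 * s / norm (x - c) ^ 4 * norm (1 - 0 :: real)"
  proof (rule differentiable_bound[where S="{0..1}" and f'="\<lambda>t h. g' t * h"])
    fix t :: real assume t: "t \<in> {0..1}"
    show "(g has_derivative (\<lambda>h. g' t * h)) (at t within {0..1})"
      using d[OF t] unfolding has_field_derivative_def by (rule has_derivative_at_withinI)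
    show "onorm (\<lambda>h. g' t * h) \<le> 1312 * s / norm (x - c) ^ 4"
    proof (rule onorm_le)
      fix h show "norm (g' t * h) \<le> 1312 * s / norm (x - c) ^ 4 * norm h"
        unfolding real_norm_def abs_mult by (rule mult_right_mono[OF b[OF t]]) simp
    qed
  qed auto
  then have gb: "\<bar>g 1 - g 0\<bar> \<le> 1312 * s / norm (x - c) ^ 4" by simp
  have "kern i j x z - kern i j x c = of_real (snd (snd x) * (g 1 - g 0))"
  proof -
    have g1: "g 1 = snd (snd z) * green_xz (cdir i) (cdir j) x z" by (simp add: g_def w_def)
    have g0: "g 0 = snd (snd c) * green_xz (cdir i) (cdir j) x c" by (simp add: g_def)
    show ?thesis unfolding kern_def g1 g0 of_real_diff[symmetric] by (simp only: right_diff_distrib mult.assoc)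
  qed
  then have "cmod (kern i j x z - kern i j x c) = snd (snd x) * \<bar>g 1 - g 0\<bar>"
    using x by (simp only: norm_of_real abs_mult) (simp add: G_iff)
  also have "\<dots> \<le> snd (snd x) * (1312 * s / norm (x - c) ^ 4)"
    using x by (intro mult_left_mono gb) (simp add: G_iff)
  finally show ?thesis .
qed

lemma kern_far_integral:
  obtains C where "0 < C"
    "\<And>z s. z \<in> G \<Longrightarrow> 0 < s \<Longrightarrow>
       (\<integral>\<^sup>+x. ennreal (10 * snd (snd z) / norm (x - z) ^ 4) * indicator (- ball z s) x \<partial>lborel) \<le> ennreal (C * snd (snd z) / s)"
proof -
  obtain C where C: "C > 0" "\<forall>(z::point) s. 0 < s \<longrightarrow>
     (\<integral>\<^sup>+x. ennreal (1 / norm (x - z) ^ 4) * indicator (- ball z s) x \<partial>lborel) \<le> ennreal (C / s)"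
    using nn_integral_inverse_norm_4 by (elim exE conjE)
  show ?thesis
  proof (rule that[of "10 * C"])
    fix z :: point and s :: real assume z: "z \<in> G" and s: "0 < s"
    have a: "0 < snd (snd z)" using z by (simp add: G_iff)
    have "(\<integral>\<^sup>+x. ennreal (10 * snd (snd z) / norm (x - z) ^ 4) * indicator (- ball z s) x \<partial>lborel)
        = (\<integral>\<^sup>+x. ennreal (10 * snd (snd z)) * (ennreal (1 / norm (x - z) ^ 4) * indicator (- ball z s) x) \<partial>lborel)"
      using a by (simp add: ennreal_mult'[symmetric] mult.assoc[symmetric])
    also have "\<dots> = ennreal (10 * snd (snd z)) * (\<integral>\<^sup>+x. ennreal (1 / norm (x - z) ^ 4) * indicator (- ball z s) x \<partial>lborel)"
      by (intro nn_integral_cmult borel_measurable_times_ennreal borel_measurable_indicator) simp_all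
    also have "\<dots> \<le> ennreal (10 * snd (snd z)) * ennreal (C / s)"
      using C(2) s by (intro mult_left_mono) auto
    also have "\<dots> = ennreal (10 * snd (snd z) * (C / s))" by (rule ennreal_mult'[symmetric]) (use a in simp)
    also have "10 * snd (snd z) * (C / s) = 10 * C * snd (snd z) / s" by simp
    finally show "(\<integral>\<^sup>+x. ennreal (10 * snd (snd z) / norm (x - z) ^ 4) * indicator (- ball z s) x \<partial>lborel) \<le> ennreal (10 * C * snd (snd z) / s)" .
  qed (use C in simp)
qed

end

text \<open>Two regimes. For small r the set R lies in a Euclidean ball of radius s comparable with
  a r, and the double ball is still at heights of order a. Otherwise R is enlarged to a
  parallelepiped S, sideways by half of its largest height and vertically by the factor 2, so that
  points off S are far from each z in R on the scale of the height of z.\<close>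

lemma CZ_set_geometry:
  obtains \<kappa> where "0 \<le> \<kappa>"
    "\<And>R. CZ_set R \<Longrightarrow> \<exists>l u. R = cbox l u \<and> 0 < snd (snd l) \<and> 0 < measure rho R \<and>
       ((\<exists>S. S \<in> sets borel \<and> S \<subseteq> G \<and> R \<subseteq> S \<and> emeasure rho S \<le> ennreal (\<kappa> * measure rho R) \<and>
           (\<forall>x\<in>G. x \<notin> S \<longrightarrow> (\<forall>z\<in>R. snd (snd z) / 2 \<le> norm (x - z)))) \<or>
        (\<exists>c s. c \<in> G \<and> 0 < s \<and> s < snd (snd c) \<and> R \<subseteq> cball c s \<and> cball c (2 * s) \<subseteq> G \<and>
           emeasure rho (cball c (2 * s)) \<le> ennreal (\<kappa> * measure rho R)))"
proof -
  obtain \<mu> where \<mu>: "\<mu> > 0" "\<forall>(z::point) s. 0 \<le> s \<longrightarrow> emeasure lborel (cball z s) \<le> ennreal (\<mu> * s ^ 3)"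
    using emeasure_ball_le by (elim exE conjE)
  \<comment> \<open>The Euclidean radius of R in units of a r: L < e^8 a r from the sides and 2 a r
    from the height.\<close>
  define k :: real where "k = exp 8 + 2"
  have k: "0 < k" "2 < k" by (simp_all add: k_def add_pos_pos)
  \<comment> \<open>Chosen so that s = k a r satisfies 2 s < a / 2 for r < \<open>r0\<close>, which
    keeps the double ball at heights at least a / 2.\<close>
  define r0 :: real where "r0 = 1 / (4 * k)"
  have r0: "0 < r0" "r0 < 1" "2 * k * r0 = 1 / 2" using k by (simp_all add: r0_def)
  \<comment> \<open>The constant in a e^r \<le> \<open>c1\<close> L: for \<open>r0\<close> \<le> r <
    1 it comes from e^2 a r \<le> L and e^r \<le> 3; for r \<ge> 1 already a e^(2r) \<le> L.\<close>
  define c1 where "c1 = max (3 / (exp 2 * r0)) 1"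
  have c1: "1 \<le> c1" "3 / (exp 2 * r0) \<le> c1" by (simp_all add: c1_def)
  \<comment> \<open>The base of S has side L + a e^r \<le> (1 + \<open>c1\<close>) L, and ln 4 + 2 r
    \<le> (1 + 1 / \<open>r0\<close>) 2 r. For \<open>\<kappa>2\<close>, the ball of radius 2 k a r
    has \<rho>-measure at most (2 / a) \<mu> (2 k a r)^3, which is compared with 2 r (e^2 a
    r)^2.\<close>
  define \<kappa>1 where "\<kappa>1 = (1 + c1)\<^sup>2 * (1 + 1 / r0)"
  define \<kappa>2 where "\<kappa>2 = 8 * \<mu> * k ^ 3 / (exp 2)\<^sup>2"
  have \<kappa>: "0 \<le> \<kappa>1" "0 \<le> \<kappa>2" using r0 \<mu> k by (simp_all add: \<kappa>1_def \<kappa>2_def)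
  show ?thesis
  proof (rule that[of "max \<kappa>1 \<kappa>2"])
    show "0 \<le> max \<kappa>1 \<kappa>2" using \<kappa> by simp
    fix R assume "CZ_set R"
    then obtain b1 b2 L r a :: real where L: "0 < L" and r: "0 < r" and a: "0 < a"
      and cond: "if r < 1 then exp 2 * a * r \<le> L \<and> L < exp 8 * a * r else a * exp (2 * r) \<le> L \<and> L < a * exp (8 * r)"
      and R: "R = {b1 - L / 2..b1 + L / 2} \<times> {b2 - L / 2..b2 + L / 2} \<times> {a * exp (- r)..a * exp r}"
      unfolding CZ_set_def by (elim exE conjE) (rule that)
    define l where "l = (b1 - L / 2, b2 - L / 2, a * exp (- r))"
    define u where "u = (b1 + L / 2, b2 + L / 2, a * exp r)"
    have Rlu: "R = cbox l u" unfolding R l_def u_def by (simp add: cbox_Pair_eq)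
    have l3: "0 < snd (snd l)" using a by (simp add: l_def)
    have er: "exp (- r) \<le> exp r" using r by simp
    have "emeasure rho R = ennreal (L * L * ln (a * exp r / (a * exp (- r))))"
      unfolding Rlu l_def u_def using L a er by (subst rho_cbox) auto
    also have "ln (a * exp r / (a * exp (- r))) = 2 * r"
    proof -
      have "a * exp r / (a * exp (- r)) = exp r / exp (- r)" using a by simp
      also have "\<dots> = exp (r - - r)" by (simp only: exp_diff)
      finally show ?thesis by simp
    qed
    finally have eR: "emeasure rho R = ennreal (L\<^sup>2 * (2 * r))" by (simp add: power2_eq_square)
    then have V: "measure rho R = L\<^sup>2 * (2 * r)" using r by (simp add: measure_def)
    have V0: "0 < measure rho R" unfolding V using L r by simp
    have coords: "\<bar>fst z - b1\<bar> \<le> L / 2" "\<bar>fst (snd z) - b2\<bar> \<le> L / 2" "a * exp (- r) \<le> snd (snd z)" "snd (snd z) \<le> a * exp r"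
      if "z \<in> R" for z using that unfolding Rlu l_def u_def mem_cbox_point fst_conv snd_conv by linarith+
    have disj: "(\<exists>S. S \<in> sets borel \<and> S \<subseteq> G \<and> R \<subseteq> S \<and> emeasure rho S \<le> ennreal (max \<kappa>1 \<kappa>2 * measure rho R) \<and>
           (\<forall>x\<in>G. x \<notin> S \<longrightarrow> (\<forall>z\<in>R. snd (snd z) / 2 \<le> norm (x - z)))) \<or>
        (\<exists>c s. c \<in> G \<and> 0 < s \<and> s < snd (snd c) \<and> R \<subseteq> cball c s \<and> cball c (2 * s) \<subseteq> G \<and>
           emeasure rho (cball c (2 * s)) \<le> ennreal (max \<kappa>1 \<kappa>2 * measure rho R))"
    proof (cases "r < r0")
      case True
      then have r1: "r < 1" using r0 by simp
      then have Lr: "exp 2 * a * r \<le> L" "L < exp 8 * a * r" using cond by auto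
      define c where "c = (b1, b2, a)"
      define s where "s = k * a * r"
      have s: "0 < s" using k a r by (simp add: s_def)
      have s2: "2 * s < a / 2"
      proof -
        have "2 * s = a * (2 * k * r)" by (simp add: s_def)
        also have "\<dots> < a * (2 * k * r0)" using a k True by simp
        finally show ?thesis using r0(3) by simp
      qed
      have cG: "c \<in> G" using a by (simp add: c_def G_iff)
      have sub: "R \<subseteq> cball c s"
      proof
        fix z assume z: "z \<in> R"
        have "exp r \<le> 1 + 2 * r"
        proof -
          have "exp r \<le> 1 + r + r\<^sup>2" using r r1 by (intro exp_bound) auto
          also have "r\<^sup>2 \<le> r * 1" unfolding power2_eq_square using r r1 by (intro mult_left_mono) auto
          finally show ?thesis by simp
        qed
        then have "a * exp r \<le> a * (1 + 2 * r)" using a by (intro mult_left_mono) auto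
        then have e1: "snd (snd z) - a \<le> 2 * a * r" using coords(4)[OF z] by (simp add: algebra_simps)
        have "a * (1 + - r) \<le> a * exp (- r)" using a exp_ge_add_one_self[of "- r"] by (intro mult_left_mono) auto
        then have e2: "a - snd (snd z) \<le> 2 * a * r" using coords(3)[OF z] mult_pos_pos[OF a r] by (simp add: algebra_simps)
        have "norm (z - c) \<le> L / 2 + L / 2 + 2 * a * r"
        proof -
          have "norm (z - c) \<le> \<bar>fst z - b1\<bar> + \<bar>fst (snd z) - b2\<bar> + \<bar>snd (snd z) - a\<bar>"
            using norm_le_coordinates[of "z - c"] by (simp add: c_def)
          then show ?thesis using coords(1,2)[OF z] e1 e2 by linarith
        qed
        also have "\<dots> \<le> s" using Lr(2) by (simp add: s_def k_def algebra_simps)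
        finally show "z \<in> cball c s" by (simp add: dist_norm norm_minus_commute)
      qed
      have half: "a / 2 \<le> snd (snd x)" if "x \<in> cball c (2 * s)" for x
      proof -
        have "norm (x - c) \<le> 2 * s" using that by (simp add: dist_norm norm_minus_commute)
        then have "\<bar>snd (snd (x - c))\<bar> \<le> 2 * s" using coordinates_le_norm(3)[of "x - c"] by simp
        then show ?thesis using s2 by (simp add: c_def)
      qed
      have subG: "cball c (2 * s) \<subseteq> G"
      proof
        fix x assume "x \<in> cball c (2 * s)"
        from half[OF this] show "x \<in> G" using a by (simp add: G_iff)
      qed
      have "emeasure rho (cball c (2 * s)) = (\<integral>\<^sup>+x. indicator (cball c (2 * s)) x \<partial>rho)"
        using subG by (intro nn_integral_indicator[symmetric]) (simp add: sets_rhoI)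
      also have "\<dots> = (\<integral>\<^sup>+x. ennreal (wt x) * indicator (cball c (2 * s)) x \<partial>lborel)"
        by (rule nn_integral_rho_wt) (rule borel_imp_rho, rule borel_measurable_indicator, simp)
      also have "\<dots> \<le> (\<integral>\<^sup>+x. ennreal (2 / a) * indicator (cball c (2 * s)) x \<partial>lborel)"
      proof (rule nn_integral_mono)
        fix x
        show "ennreal (wt x) * indicator (cball c (2 * s)) x \<le> ennreal (2 / a) * indicator (cball c (2 * s)) x"
        proof (cases "x \<in> cball c (2 * s)")
          case True
          have xG: "x \<in> G" using subG True by (rule subsetD)
          have "wt x \<le> 1 / (a / 2)"
            unfolding wt_G[OF xG] using half[OF True] a by (intro divide_left_mono mult_pos_pos) linarith+
          then show ?thesis using True by (simp add: ennreal_leI)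
        qed simp
      qed
      also have "\<dots> = ennreal (2 / a) * emeasure lborel (cball c (2 * s))" by (rule nn_integral_cmult_indicator) simp
      also have "\<dots> \<le> ennreal (2 / a) * ennreal (\<mu> * (2 * s) ^ 3)" using s by (intro mult_left_mono \<mu>(2)[rule_format]) simp_all
      also have "\<dots> = ennreal (2 / a * (\<mu> * (2 * s) ^ 3))" by (rule ennreal_mult'[symmetric]) (use a in simp)
      also have "2 / a * (\<mu> * (2 * s) ^ 3) = \<kappa>2 * ((exp 2 * a * r)\<^sup>2 * (2 * r))"
        using a by (simp add: \<kappa>2_def s_def power_mult_distrib) (simp add: field_simps power2_eq_square power3_eq_cube)
      also have "ennreal (\<kappa>2 * ((exp 2 * a * r)\<^sup>2 * (2 * r))) \<le> ennreal (max \<kappa>1 \<kappa>2 * measure rho R)"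
        unfolding V using Lr(1) \<kappa> a r by (intro ennreal_leI mult_mono power_mono) auto
      finally show ?thesis using s s2 a sub subG cG by (intro disjI2 exI[of _ c] exI[of _ s]) (simp add: c_def)
    next
      case False
      then have rr: "r0 \<le> r" by simp
      have La: "a * exp r \<le> c1 * L"
      proof (cases "r < 1")
        case True
        have e3: "exp r \<le> 3" using exp_le exp_le_cancel_iff[of r 1] True by linarith
        have "exp 2 * a * r0 \<le> exp 2 * a * r" using a rr by (intro mult_left_mono) auto
        also have "\<dots> \<le> L" using cond True by simp
        finally have "exp 2 * a * r0 \<le> L" .
        then have "a \<le> L / (exp 2 * r0)" using r0 by (simp add: field_simps)
        then have "a * exp r \<le> L / (exp 2 * r0) * 3" using e3 a by (intro mult_mono) auto
        also have "\<dots> = 3 / (exp 2 * r0) * L" by simp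
        also have "\<dots> \<le> c1 * L" using c1 L by (intro mult_right_mono) auto
        finally show ?thesis .
      next
        case False
        have "a * exp r \<le> a * exp (2 * r)" using a r by simp
        also have "\<dots> \<le> 1 * L" using cond False by simp
        also have "\<dots> \<le> c1 * L" using c1 L by (intro mult_right_mono) auto
        finally show ?thesis .
      qed
      \<comment> \<open>2 h is the largest height in R, so h bounds half the height of every point
        of R.\<close>
      define h where "h = a * exp r / 2"
      have h: "0 < h" using a by (simp add: h_def)
      define S where "S = cbox (b1 - L / 2 - h, b2 - L / 2 - h, a * exp (- r) / 2) (b1 + L / 2 + h, b2 + L / 2 + h, 2 * (a * exp r))"
      have SG: "S \<subseteq> G" unfolding S_def using a by (intro cbox_subset_G) simp
      have ern: "a * exp (- r) / 2 \<le> 2 * (a * exp r)"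
      proof -
        have "a * exp (- r) \<le> a * exp r" "0 < a * exp r" using a er by (auto intro: mult_left_mono)
        then show ?thesis by linarith
      qed
      have RS: "R \<subseteq> S"
      proof
        fix z assume z: "z \<in> R"
        have "0 < a * exp (- r)" "0 < a * exp r" using a by simp_all
        then show "z \<in> S" using coords[OF z] h unfolding S_def mem_cbox_point abs_le_iff fst_conv snd_conv by linarith
      qed
      have "emeasure rho S = ennreal ((L + 2 * h) * (L + 2 * h) * ln (2 * (a * exp r) / (a * exp (- r) / 2)))"
        unfolding S_def using L h a ern by (subst rho_cbox) (auto simp: algebra_simps)
      also have "ln (2 * (a * exp r) / (a * exp (- r) / 2)) = ln 4 + 2 * r"
      proof -
        have E: "exp (2 * r) = exp r * exp r" by (simp only: mult_2 exp_add)
        have "2 * (a * exp r) / (a * exp (- r) / 2) = 4 * exp (2 * r)"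
          unfolding E using a by (simp add: exp_minus field_simps)
        then show ?thesis by (simp add: ln_mult)
      qed
      also have "ennreal ((L + 2 * h) * (L + 2 * h) * (ln 4 + 2 * r)) \<le> ennreal (max \<kappa>1 \<kappa>2 * measure rho R)"
      proof (rule ennreal_leI)
        have "ln 4 \<le> (2::real)"
        proof -
          have "ln (4::real) = 2 * ln 2" using ln_realpow[of 2 2] by simp
          then show ?thesis using ln_2_less_1 by simp
        qed
        moreover have "2 \<le> 2 * r / r0" using rr r0(1) by (simp add: pos_le_divide_eq)
        ultimately have 1: "ln 4 + 2 * r \<le> (1 + 1 / r0) * (2 * r)" by (simp add: algebra_simps)
        have 2: "L + 2 * h \<le> (1 + c1) * L" using La by (simp add: h_def algebra_simps)
        have "(L + 2 * h) * (L + 2 * h) * (ln 4 + 2 * r) \<le> ((1 + c1) * L) * ((1 + c1) * L) * ((1 + 1 / r0) * (2 * r))"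
          using 1 2 L h r c1 by (intro mult_mono) auto
        also have "\<dots> = \<kappa>1 * measure rho R" by (simp add: V \<kappa>1_def power2_eq_square)
        also have "\<dots> \<le> max \<kappa>1 \<kappa>2 * measure rho R" using V0 by (intro mult_right_mono) auto
        finally show "(L + 2 * h) * (L + 2 * h) * (ln 4 + 2 * r) \<le> max \<kappa>1 \<kappa>2 * measure rho R" .
      qed
      finally have eS: "emeasure rho S \<le> ennreal (max \<kappa>1 \<kappa>2 * measure rho R)" .
      have far: "snd (snd z) / 2 \<le> norm (x - z)" if x: "x \<in> G" "x \<notin> S" and z: "z \<in> R" for x z
      proof (rule ccontr)
        assume n: "\<not> snd (snd z) / 2 \<le> norm (x - z)"
        have zh: "snd (snd z) / 2 \<le> h" using coords(4)[OF z] by (simp add: h_def)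
        have n3: "\<bar>fst x - fst z\<bar> < snd (snd z) / 2" "\<bar>fst (snd x) - fst (snd z)\<bar> < snd (snd z) / 2"
          "\<bar>snd (snd x) - snd (snd z)\<bar> < snd (snd z) / 2"
          using coordinates_le_norm[of "x - z"] n by simp_all
        have "0 < a * exp r" using a by simp
        then have "x \<in> S" using n3 coords[OF z] zh unfolding S_def mem_cbox_point fst_conv snd_conv by linarith
        then show False using x by blast
      qed
      have "S \<in> sets borel" by (simp add: S_def)
      then show ?thesis using eS SG RS far by (intro disjI1 exI[of _ S]) simp
    qed
    show "\<exists>l u. R = cbox l u \<and> 0 < snd (snd l) \<and> 0 < measure rho R \<and>
       ((\<exists>S. S \<in> sets borel \<and> S \<subseteq> G \<and> R \<subseteq> S \<and> emeasure rho S \<le> ennreal (max \<kappa>1 \<kappa>2 * measure rho R) \<and>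
           (\<forall>x\<in>G. x \<notin> S \<longrightarrow> (\<forall>z\<in>R. snd (snd z) / 2 \<le> norm (x - z)))) \<or>
        (\<exists>c s. c \<in> G \<and> 0 < s \<and> s < snd (snd c) \<and> R \<subseteq> cball c s \<and> cball c (2 * s) \<subseteq> G \<and>
           emeasure rho (cball c (2 * s)) \<le> ennreal (max \<kappa>1 \<kappa>2 * measure rho R)))"
      using Rlu l3 V0 disj by (intro exI[of _ l] exI[of _ u] conjI)
  qed
qed

text \<open>Tonelli: for each z of height b the kernel is integrated over the x at distance at least
  b / 2, which gives C b / (b / 2) = 2 C, and the L^1 norm of f is at most 1.\<close>

lemma nn_integral_kern_far:
  assumes ij: "i \<in> {0, 1, 2}" "j \<in> {0, 1, 2}"
  obtains D where "0 \<le> D"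
    "\<And>l u f V S. 0 < snd (snd l) \<Longrightarrow> bounded_on_box l u f \<Longrightarrow> 0 < V \<Longrightarrow> (\<And>z. cmod (f z) \<le> 1 / V) \<Longrightarrow>
      measure rho (box l u) = V \<Longrightarrow>
      (\<And>x z. x \<in> G \<Longrightarrow> x \<notin> S \<Longrightarrow> z \<in> cbox l u \<Longrightarrow> snd (snd z) / 2 \<le> norm (x - z)) \<Longrightarrow>
      (\<integral>\<^sup>+x. indicator (- S) x * ennreal (cmod (\<integral>z. f z * kern i j x z \<partial>rho)) \<partial>rho) \<le> ennreal D"
proof -
  obtain C where C: "0 < C" "\<And>z s. z \<in> G \<Longrightarrow> 0 < s \<Longrightarrow>
       (\<integral>\<^sup>+x. ennreal (10 * snd (snd z) / norm (x - z) ^ 4) * indicator (- ball z s) x \<partial>lborel) \<le> ennreal (C * snd (snd z) / s)"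
    by (rule kern_far_integral[OF ij]) (rule that)
  show ?thesis
  proof (rule that[of "2 * C"])
    show "0 \<le> 2 * C" using C by simp
    fix l u :: point and f :: "point \<Rightarrow> complex" and V :: real and S
    assume l: "0 < snd (snd l)" and f: "bounded_on_box l u f" and V: "0 < V" and fV: "\<And>z. cmod (f z) \<le> 1 / V"
      and mV: "measure rho (box l u) = V"
      and far: "\<And>x z. x \<in> G \<Longrightarrow> x \<notin> S \<Longrightarrow> z \<in> cbox l u \<Longrightarrow> snd (snd z) / 2 \<le> norm (x - z)"
    have f0: "f z = 0" if "z \<notin> box l u" for z using f that by (simp add: bounded_on_box_def)
    have fm: "f \<in> borel_measurable borel" using f by (simp add: bounded_on_box_def)
    have BG: "z \<in> G" if "z \<in> cbox l u" for z using cbox_subset_G[OF l, of u] that by blast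
    \<comment> \<open>S is an arbitrary set, so membership in it is replaced by a closed condition
      on pairs, which makes the integrand jointly measurable.\<close>
    define A where "A = {p :: point \<times> point. snd (snd (snd p)) / 2 \<le> norm (fst p - snd p)}"
    define k where "k p = ennreal (wt (snd p) * cmod (f (snd p))) *
       (ennreal (10 * snd (snd (snd p)) / norm (fst p - snd p) ^ 4) * indicator A p)" for p :: "point \<times> point"
    have km: "k \<in> borel_measurable borel"
    proof -
      have s: "(snd :: point \<times> point \<Rightarrow> point) \<in> borel \<rightarrow>\<^sub>M borel"
        by (intro borel_measurable_continuous_onI continuous_intros)
      have "closed A" unfolding A_def by (intro closed_Collect_le continuous_intros) simp
      then have A: "A \<in> sets borel" by simp
      have m1: "(\<lambda>p. 10 * snd (snd (snd p)) / norm (fst p - snd p) ^ 4 :: real) \<in> borel_measurable (borel :: (point \<times> point) measure)"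
        by (intro borel_measurable_divide borel_measurable_continuous_onI continuous_intros)
      have m2: "(\<lambda>p. wt (snd p) * cmod (f (snd p))) \<in> borel_measurable (borel :: (point \<times> point) measure)"
        by (intro borel_measurable_times measurable_compose[OF s wt_measurable]
            measurable_compose[OF measurable_compose[OF s fm] borel_measurable_norm])
      show ?thesis unfolding k_def
        by (intro borel_measurable_times_ennreal measurable_compose[OF m1 measurable_ennreal] measurable_compose[OF m2 measurable_ennreal]
            borel_measurable_indicator A)
    qed
    have km': "k \<in> borel_measurable (lborel \<Otimes>\<^sub>M lborel)" using km by (simp add: lborel_prod)
    define H where "H x = (\<integral>\<^sup>+z. k (x, z) \<partial>lborel)" for x
    have Hm: "H \<in> borel_measurable borel"
      unfolding H_def using lborel.borel_measurable_nn_integral_fst[OF km'] by simp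
    have pt: "indicator (- S) x * ennreal (cmod (\<integral>z. f z * kern i j x z \<partial>rho)) \<le> ennreal (snd (snd x)) * H x"
      if x: "x \<in> G" for x
    proof (cases "x \<in> S")
      case False
      have xb: "x \<notin> cbox l u"
      proof
        assume "x \<in> cbox l u"
        from far[OF x False this] x show False by (simp add: G_iff)
      qed
      obtain B where B: "\<And>z. z \<in> cbox l u \<Longrightarrow> cmod (kern i j x z) \<le> B"
        by (rule kern_bounded_on_compact[OF ij compact_cbox cbox_subset_G[OF l] x xb]) (rule that)
      have B': "cmod (kern i j x z) \<le> B" if "z \<in> box l u" for z using that box_subset_cbox[of l u] by (intro B) blast
      have int: "integrable rho (\<lambda>z. f z * kern i j x z)"
        by (rule bounded_on_box_integrable[OF l f kern_measurable B'])
      have "ennreal (cmod (\<integral>z. f z * kern i j x z \<partial>rho)) \<le> (\<integral>\<^sup>+z. ennreal (cmod (f z * kern i j x z)) \<partial>rho)"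
        by (rule integral_norm_bound_ennreal[OF int])
      also have "\<dots> = (\<integral>\<^sup>+z. ennreal (wt z) * ennreal (cmod (f z * kern i j x z)) \<partial>lborel)"
        using borel_measurable_integrable[OF int] by (intro nn_integral_rho_wt) simp
      also have "\<dots> \<le> (\<integral>\<^sup>+z. ennreal (snd (snd x)) * k (x, z) \<partial>lborel)"
      proof (rule nn_integral_mono)
        fix z
        show "ennreal (wt z) * ennreal (cmod (f z * kern i j x z)) \<le> ennreal (snd (snd x)) * k (x, z)"
        proof (cases "z \<in> box l u")
          case True
          then have zc: "z \<in> cbox l u" using box_subset_cbox[of l u] by blast
          have zG: "z \<in> G" by (rule BG[OF zc])
          have zA: "(x, z) \<in> A" using far[OF x False zc] by (simp add: A_def)
          have "x \<noteq> z" using zc xb by blast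
          then have kb: "cmod (kern i j x z) \<le> 10 * snd (snd x) * snd (snd z) / norm (x - z) ^ 4"
            by (rule kern_bound(1)[OF ij x zG])
          have "wt z * cmod (f z * kern i j x z) \<le> wt z * (cmod (f z) * (10 * snd (snd x) * snd (snd z) / norm (x - z) ^ 4))"
            unfolding norm_mult using kb by (intro mult_left_mono) auto
          also have "\<dots> = snd (snd x) * ((wt z * cmod (f z)) * (10 * snd (snd z) / norm (x - z) ^ 4))" by simp
          finally have "ennreal (wt z * cmod (f z * kern i j x z)) \<le> ennreal (snd (snd x) * ((wt z * cmod (f z)) * (10 * snd (snd z) / norm (x - z) ^ 4)))"
            by (rule ennreal_leI)
          also have "ennreal (snd (snd x) * ((wt z * cmod (f z)) * (10 * snd (snd z) / norm (x - z) ^ 4)))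
              = ennreal (snd (snd x)) * (ennreal (wt z * cmod (f z)) * ennreal (10 * snd (snd z) / norm (x - z) ^ 4))"
            using x by (subst ennreal_mult', simp add: G_iff, subst ennreal_mult', simp_all)
          finally show ?thesis using zA by (simp add: k_def ennreal_mult')
        qed (simp add: f0)
      qed
      also have "\<dots> = ennreal (snd (snd x)) * H x"
        unfolding H_def using measurable_compose[OF _ km, of "\<lambda>z. (x, z)" lborel]
        by (intro nn_integral_cmult) (simp add: borel_measurable_continuous_onI continuous_intros)
      finally show ?thesis using False by simp
    qed simp
    have Hr: "(\<lambda>x. ennreal (snd (snd x)) * H x) \<in> borel_measurable borel"
      by (intro borel_measurable_times_ennreal measurable_compose[OF height_measurable measurable_ennreal] Hm)
    have "(\<integral>\<^sup>+x. indicator (- S) x * ennreal (cmod (\<integral>z. f z * kern i j x z \<partial>rho)) \<partial>rho)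
        \<le> (\<integral>\<^sup>+x. ennreal (snd (snd x)) * H x \<partial>rho)"
      by (intro nn_integral_mono pt) simp
    also have "\<dots> = (\<integral>\<^sup>+x. ennreal (wt x) * (ennreal (snd (snd x)) * H x) \<partial>lborel)"
      by (rule nn_integral_rho_wt[OF borel_imp_rho[OF Hr]])
    also have "\<dots> \<le> (\<integral>\<^sup>+x. H x \<partial>lborel)"
    proof (rule nn_integral_mono)
      fix x
      show "ennreal (wt x) * (ennreal (snd (snd x)) * H x) \<le> H x"
      proof (cases "x \<in> G")
        case True
        then have "ennreal (wt x) * ennreal (snd (snd x)) = 1"
          by (simp add: ennreal_mult'[symmetric] wt_G G_iff)
        then show ?thesis by (simp add: mult.assoc[symmetric])
      qed (simp add: wt_def)
    qed
    also have "\<dots> = (\<integral>\<^sup>+z. \<integral>\<^sup>+x. k (x, z) \<partial>lborel \<partial>lborel)"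
      unfolding H_def using lborel_pair.Fubini[OF km'] by simp
    also have "\<dots> \<le> (\<integral>\<^sup>+z. ennreal (2 * C) * ennreal (wt z * cmod (f z)) \<partial>lborel)"
    proof (rule nn_integral_mono)
      fix z
      show "(\<integral>\<^sup>+x. k (x, z) \<partial>lborel) \<le> ennreal (2 * C) * ennreal (wt z * cmod (f z))"
      proof (cases "z \<in> box l u")
        case True
        then have zG: "z \<in> G" using box_subset_cbox[of l u] by (intro BG) blast
        then have a: "0 < snd (snd z)" by (simp add: G_iff)
        have "(\<integral>\<^sup>+x. k (x, z) \<partial>lborel) = (\<integral>\<^sup>+x. ennreal (wt z * cmod (f z)) *
            (ennreal (10 * snd (snd z) / norm (x - z) ^ 4) * indicator (- ball z (snd (snd z) / 2)) x) \<partial>lborel)"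
          by (rule nn_integral_cong) (auto simp: k_def A_def indicator_def dist_norm norm_minus_commute not_less)
        also have "\<dots> = ennreal (wt z * cmod (f z)) * (\<integral>\<^sup>+x. ennreal (10 * snd (snd z) / norm (x - z) ^ 4) * indicator (- ball z (snd (snd z) / 2)) x \<partial>lborel)"
        proof (rule nn_integral_cmult)
          have "(\<lambda>x. 10 * snd (snd z) / norm (x - z) ^ 4) \<in> borel_measurable borel"
            by (intro borel_measurable_divide borel_measurable_continuous_onI continuous_intros)
          then show "(\<lambda>x. ennreal (10 * snd (snd z) / norm (x - z) ^ 4) * indicator (- ball z (snd (snd z) / 2)) x) \<in> borel_measurable lborel"
            by (intro borel_measurable_times_ennreal borel_measurable_indicator) simp_all
        qed
        also have "\<dots> \<le> ennreal (wt z * cmod (f z)) * ennreal (C * snd (snd z) / (snd (snd z) / 2))"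
          using a by (intro mult_left_mono C(2)[OF zG]) simp_all
        also have "C * snd (snd z) / (snd (snd z) / 2) = 2 * C" using a by simp
        finally show ?thesis by (simp add: mult.commute)
      qed (simp add: k_def f0)
    qed
    also have "\<dots> = ennreal (2 * C) * (\<integral>\<^sup>+z. ennreal (wt z * cmod (f z)) \<partial>lborel)"
      using fm by (intro nn_integral_cmult measurable_compose[OF _ measurable_ennreal]) simp
    also have "(\<integral>\<^sup>+z. ennreal (wt z * cmod (f z)) \<partial>lborel) = (\<integral>\<^sup>+z. ennreal (cmod (f z)) \<partial>rho)"
    proof -
      have "(\<lambda>z. ennreal (cmod (f z))) \<in> borel_measurable rho"
        by (intro borel_imp_rho measurable_compose[OF measurable_compose[OF fm borel_measurable_norm] measurable_ennreal])
      from nn_integral_rho_wt[OF this] show ?thesis by (simp add: ennreal_mult')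
    qed
    also have "\<dots> \<le> (\<integral>\<^sup>+z. ennreal (1 / V) * indicator (box l u) z \<partial>rho)"
    proof (rule nn_integral_mono)
      fix z show "ennreal (cmod (f z)) \<le> ennreal (1 / V) * indicator (box l u) z"
        using fV[of z] f0[of z] by (cases "z \<in> box l u") (auto intro: ennreal_leI)
    qed
    also have "\<dots> = ennreal (1 / V) * emeasure rho (box l u)"
      using BG box_subset_cbox[of l u] by (intro nn_integral_cmult_indicator sets_rhoI) auto
    also have "emeasure rho (box l u) = ennreal V"
      using V mV by (subst emeasure_eq_ennreal_measure) (auto simp: measure_def)
    also have "ennreal (1 / V) * ennreal V = 1" using V by (simp add: ennreal_mult'[symmetric])
    finally show "(\<integral>\<^sup>+x. indicator (- S) x * ennreal (cmod (\<integral>z. f z * kern i j x z \<partial>rho)) \<partial>rho) \<le> ennreal (2 * C)"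
      by (simp add: mult_left_mono)
  qed
qed

text \<open>The mean value zero allows subtracting \<open>kern i j x c\<close>. The bound 1312 s |x
  - c|^-4 integrated off the ball of radius 2 s gives 1312 s C / (2 s) = 656 C, independently of
  s.\<close>

lemma nn_integral_kern_cancel:
  assumes ij: "i \<in> {0, 1, 2}" "j \<in> {0, 1, 2}"
  obtains D where "0 \<le> D"
    "\<And>l u f V c s. 0 < snd (snd l) \<Longrightarrow> bounded_on_box l u f \<Longrightarrow> 0 < V \<Longrightarrow> (\<And>z. cmod (f z) \<le> 1 / V) \<Longrightarrow>
      measure rho (box l u) = V \<Longrightarrow> (\<integral>z. f z \<partial>rho) = 0 \<Longrightarrow> c \<in> G \<Longrightarrow> 0 < s \<Longrightarrow> s < snd (snd c) \<Longrightarrow>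
      cbox l u \<subseteq> cball c s \<Longrightarrow>
      (\<integral>\<^sup>+x. indicator (- cball c (2 * s)) x * ennreal (cmod (\<integral>z. f z * kern i j x z \<partial>rho)) \<partial>rho) \<le> ennreal D"
proof -
  obtain C where C: "C > 0" "\<forall>(z::point) s. 0 < s \<longrightarrow>
     (\<integral>\<^sup>+x. ennreal (1 / norm (x - z) ^ 4) * indicator (- ball z s) x \<partial>lborel) \<le> ennreal (C / s)"
    using nn_integral_inverse_norm_4 by (elim exE conjE)
  show ?thesis
  proof (rule that[of "656 * C"])
    show "0 \<le> 656 * C" using C by simp
    fix l u c :: point and f :: "point \<Rightarrow> complex" and V s :: real
    assume l: "0 < snd (snd l)" and f: "bounded_on_box l u f" and V: "0 < V" and fV: "\<And>z. cmod (f z) \<le> 1 / V"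
      and mV: "measure rho (box l u) = V" and mean: "(\<integral>z. f z \<partial>rho) = 0"
      and c: "c \<in> G" and s: "0 < s" "s < snd (snd c)" and sub: "cbox l u \<subseteq> cball c s"
    have f0: "f z = 0" if "z \<notin> box l u" for z using f that by (simp add: bounded_on_box_def)
    define E where "E x = 1312 * s / norm (x - c) ^ 4" for x
    have pt: "cmod (\<integral>z. f z * kern i j x z \<partial>rho) \<le> snd (snd x) * E x" if x: "x \<in> G" "x \<notin> cball c (2 * s)" for x
    proof -
      have far: "2 * s \<le> norm (x - c)" using x(2) by (simp add: dist_norm norm_minus_commute)
      have xb: "x \<notin> cbox l u" using x(2) sub s by auto
      obtain B where B: "\<And>z. z \<in> cbox l u \<Longrightarrow> cmod (kern i j x z) \<le> B"
        by (rule kern_bounded_on_compact[OF ij compact_cbox cbox_subset_G[OF l] x(1) xb]) (rule that)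
      have B': "cmod (kern i j x z) \<le> B" if "z \<in> box l u" for z using that box_subset_cbox[of l u] by (intro B) blast
      have int: "integrable rho (\<lambda>z. f z * kern i j x z)"
        by (rule bounded_on_box_integrable[OF l f kern_measurable B'])
      have int0: "integrable rho (\<lambda>z. f z * kern i j x c)"
        by (rule bounded_on_box_integrable[OF l f]) auto
      have "(\<integral>z. f z * kern i j x z \<partial>rho) = (\<integral>z. f z * kern i j x z \<partial>rho) - (\<integral>z. f z * kern i j x c \<partial>rho)"
        by (simp add: mean)
      also have "\<dots> = (\<integral>z. f z * kern i j x z - f z * kern i j x c \<partial>rho)"
        using int int0 by simp
      finally have eq: "(\<integral>z. f z * kern i j x z \<partial>rho) = (\<integral>z. f z * kern i j x z - f z * kern i j x c \<partial>rho)" .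
      have E0: "0 \<le> snd (snd x) * E x" using x s by (simp add: E_def G_iff)
      have "cmod (\<integral>z. f z * kern i j x z \<partial>rho) \<le> (\<integral>z. (1 / V * (snd (snd x) * E x)) * indicator (box l u) z \<partial>rho)"
        unfolding eq
      proof (rule Bochner_Integration.integral_norm_bound_integral)
        show "integrable rho (\<lambda>z. f z * kern i j x z - f z * kern i j x c)" using int int0 by simp
        show "integrable rho (\<lambda>z. (1 / V * (snd (snd x) * E x)) * indicator (box l u) z)"
          by (intro integrable_mult_right box_rho_finite l)
        fix z
        show "cmod (f z * kern i j x z - f z * kern i j x c) \<le> (1 / V * (snd (snd x) * E x)) * indicator (box l u) z"
        proof (cases "z \<in> box l u")
          case True
          then have "z \<in> cball c s" using sub box_subset_cbox[of l u] by blast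
          then have zs: "norm (z - c) \<le> s" by (simp add: dist_norm norm_minus_commute)
          have "cmod (f z * kern i j x z - f z * kern i j x c) = cmod (f z) * cmod (kern i j x z - kern i j x c)"
            by (simp only: norm_mult[symmetric] right_diff_distrib)
          also have "\<dots> \<le> 1 / V * (snd (snd x) * E x)"
            unfolding E_def using V by (intro mult_mono fV kern_difference[OF ij x(1) c s zs far]) auto
          finally show ?thesis using True by simp
        qed (simp add: f0)
      qed
      also have "\<dots> = (1 / V * (snd (snd x) * E x)) * V"
      proof -
        have "box l u \<subseteq> G" using cbox_subset_G[OF l, of u] box_subset_cbox[of l u] by (rule order_trans[rotated])
        then have "(\<integral>z. indicator (box l u) z \<partial>rho) = V" using mV by (simp add: Int_absorb2)
        then show ?thesis by (simp only: integral_mult_right_zero)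
      qed
      finally show ?thesis using V by simp
    qed
    have Em: "(\<lambda>x. ennreal (snd (snd x) * E x) * indicator (- ball c (2 * s)) x) \<in> borel_measurable borel"
    proof -
      have "(\<lambda>x. snd (snd x) * E x) \<in> borel_measurable borel"
        unfolding E_def by (intro borel_measurable_times borel_measurable_divide height_measurable borel_measurable_continuous_onI continuous_intros)
      then show ?thesis by (intro borel_measurable_times_ennreal measurable_compose[OF _ measurable_ennreal] borel_measurable_indicator) simp_all
    qed
    have "(\<integral>\<^sup>+x. indicator (- cball c (2 * s)) x * ennreal (cmod (\<integral>z. f z * kern i j x z \<partial>rho)) \<partial>rho)
       \<le> (\<integral>\<^sup>+x. ennreal (snd (snd x) * E x) * indicator (- ball c (2 * s)) x \<partial>rho)"
    proof (rule nn_integral_mono)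
      fix x assume "x \<in> space rho"
      then have x: "x \<in> G" by simp
      show "indicator (- cball c (2 * s)) x * ennreal (cmod (\<integral>z. f z * kern i j x z \<partial>rho)) \<le> ennreal (snd (snd x) * E x) * indicator (- ball c (2 * s)) x"
      proof (cases "x \<in> cball c (2 * s)")
        case False
        then have "x \<notin> ball c (2 * s)" by simp
        then show ?thesis using False pt[OF x False] by (simp add: ennreal_leI del: mem_ball mem_cball)
      qed simp
    qed
    also have "\<dots> = (\<integral>\<^sup>+x. ennreal (wt x) * (ennreal (snd (snd x) * E x) * indicator (- ball c (2 * s)) x) \<partial>lborel)"
      by (rule nn_integral_rho_wt[OF borel_imp_rho[OF Em]])
    also have "\<dots> \<le> (\<integral>\<^sup>+x. ennreal (1312 * s) * (ennreal (1 / norm (x - c) ^ 4) * indicator (- ball c (2 * s)) x) \<partial>lborel)"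
    proof (rule nn_integral_mono)
      fix x
      show "ennreal (wt x) * (ennreal (snd (snd x) * E x) * indicator (- ball c (2 * s)) x) \<le> ennreal (1312 * s) * (ennreal (1 / norm (x - c) ^ 4) * indicator (- ball c (2 * s)) x)"
      proof (cases "x \<in> G")
        case True
        then have "wt x * (snd (snd x) * E x) = (1312 * s) * (1 / norm (x - c) ^ 4)"
          by (simp add: wt_G E_def G_iff)
        then have "ennreal (wt x) * ennreal (snd (snd x) * E x) = ennreal (1312 * s) * ennreal (1 / norm (x - c) ^ 4)"
          using s ennreal_mult'[OF wt_nonneg, of x "snd (snd x) * E x"] ennreal_mult'[of "1312 * s" "1 / norm (x - c) ^ 4"]
          by simp
        then show ?thesis by (simp add: mult.assoc[symmetric])
      qed (simp add: wt_def)
    qed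
    also have "\<dots> = ennreal (1312 * s) * (\<integral>\<^sup>+x. ennreal (1 / norm (x - c) ^ 4) * indicator (- ball c (2 * s)) x \<partial>lborel)"
      by (intro nn_integral_cmult borel_measurable_times_ennreal borel_measurable_indicator; simp)
    also have "\<dots> \<le> ennreal (1312 * s) * ennreal (C / (2 * s))"
      using C(2) s by (intro mult_left_mono) auto
    also have "\<dots> = ennreal (1312 * s * (C / (2 * s)))" by (rule ennreal_mult'[symmetric]) (use s in simp)
    also have "1312 * s * (C / (2 * s)) = 656 * C" using s by simp
    finally show "(\<integral>\<^sup>+x. indicator (- cball c (2 * s)) x * ennreal (cmod (\<integral>z. f z * kern i j x z \<partial>rho)) \<partial>rho) \<le> ennreal (656 * C)" .
  qed
qed

section \<open>Atomic decompositions\<close>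

context
  fixes i j :: nat and T :: "(point \<Rightarrow> complex) \<Rightarrow> point \<Rightarrow> complex"
  assumes ij: "i \<in> {0, 1, 2}" "j \<in> {0, 1, 2}" and ext: "L2_extension_Riesz2 i j T"
begin

text \<open>On S the weighted arithmetic-geometric mean bounds |T f| by half of |T f|^2 V + 1 / V.
  The first term integrates to at most C0, because the squared L^2 norm of f is at most 1 / V, and
  the second to \<rho>(S) / V \<le> \<kappa>. Off S the kernel formula and the hypothesis on D
  apply.\<close>

lemma T_localized_bound:
  assumes C0: "0 \<le> C0" "\<And>f. f \<in> Lp 2 \<Longrightarrow> sq_int (T f) \<le> C0 * sq_int f"
    and l: "0 < snd (snd l)" and f: "bounded_on_box l u f" and V: "0 < V" "measure rho (box l u) = V"
    and fV: "\<And>z. cmod (f z) \<le> 1 / V"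
    and S: "S \<in> sets borel" "S \<subseteq> G" "cbox l u \<subseteq> S" "emeasure rho S \<le> ennreal (\<kappa> * V)" "0 \<le> \<kappa>"
    and D: "0 \<le> D" "(\<integral>\<^sup>+x. indicator (- S) x * ennreal (cmod (\<integral>z. f z * kern i j x z \<partial>rho)) \<partial>rho) \<le> ennreal D"
  shows "(\<integral>\<^sup>+x. ennreal (cmod (T f x)) \<partial>rho) \<le> ennreal ((C0 + \<kappa>) / 2 + D)"
proof -
  have fL: "f \<in> Lp 2" by (rule bounded_on_box_Lp2[OF l f])
  have TL: "T f \<in> Lp 2" by (rule T_Lp2[OF ij ext fL])
  then have Tm: "T f \<in> borel_measurable rho" and Ti: "integrable rho (\<lambda>x. (cmod (T f x))\<^sup>2)" by (simp_all add: Lp2_iff)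
  have f0: "f z = 0" if "z \<notin> box l u" for z using f that by (simp add: bounded_on_box_def)
  have BG: "box l u \<subseteq> G" using cbox_subset_G[OF l, of u] box_subset_cbox[of l u] by (rule order_trans[rotated])
  have Srho: "S \<in> sets rho" using S(1,2) by (rule sets_rhoI)
  have Sfin: "emeasure rho S < \<infinity>" using S(4) by (rule le_less_trans) simp
  have mS: "measure rho S \<le> \<kappa> * V"
    using S(4,5) V(1) Sfin by (simp add: emeasure_eq_ennreal_measure less_top[symmetric])
  have iS: "integrable rho (indicator S :: point \<Rightarrow> real)" using Srho Sfin by (intro integrable_real_indicator)
  define g where "g x = ((cmod (T f x))\<^sup>2 * V + indicator S x / V) / 2" for x
  have gi: "integrable rho g" unfolding g_def using Ti iS by simp
  have g0: "0 \<le> g x" for x using V(1) by (simp add: g_def)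
  have sqf: "sq_int f \<le> 1 / V"
  proof -
    have "sq_int f \<le> (\<integral>z. (1 / V)\<^sup>2 * indicator (box l u) z \<partial>rho)"
      unfolding sq_int_def
    proof (rule integral_mono)
      show "integrable rho (\<lambda>z. (cmod (f z))\<^sup>2)" using fL by (simp add: Lp2_iff)
      show "integrable rho (\<lambda>z. (1 / V)\<^sup>2 * indicator (box l u) z)" by (intro integrable_mult_right box_rho_finite l)
      fix z
      show "(cmod (f z))\<^sup>2 \<le> (1 / V)\<^sup>2 * indicator (box l u) z"
        using power_mono[OF fV[of z], of 2] f0[of z] by (cases "z \<in> box l u") simp_all
    qed
    also have "\<dots> = (1 / V)\<^sup>2 * (\<integral>z. indicator (box l u) z \<partial>rho)" by (rule integral_mult_right_zero)
    also have "(\<integral>z. indicator (box l u) z \<partial>rho) = V" using V(2) BG by (simp add: Int_absorb2)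
    also have "(1 / V)\<^sup>2 * V = 1 / V" using V(1) by (simp add: power2_eq_square)
    finally show ?thesis .
  qed
  have "(\<integral>x. g x \<partial>rho) = (sq_int (T f) * V + measure rho S / V) / 2"
    unfolding g_def sq_int_def using Ti iS S(2) by (simp add: Int_absorb2)
  also have "\<dots> \<le> (C0 + \<kappa>) / 2"
  proof -
    have "sq_int (T f) \<le> C0 * (1 / V)" using C0(2)[OF fL] mult_left_mono[OF sqf C0(1)] by linarith
    then have "sq_int (T f) * V \<le> C0" using V(1) by (simp add: field_simps)
    moreover have "measure rho S / V \<le> \<kappa>" using mS V(1) by (simp add: field_simps)
    ultimately show ?thesis by (intro divide_right_mono add_mono) simp_all
  qed
  finally have gle: "(\<integral>x. g x \<partial>rho) \<le> (C0 + \<kappa>) / 2" .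
  have near: "ennreal (cmod (T f x)) * indicator S x \<le> ennreal (g x)" for x
  proof (cases "x \<in> S")
    case True
    have "cmod (T f x * 1) \<le> ((cmod (T f x))\<^sup>2 / (1 / V) + (cmod 1)\<^sup>2 * (1 / V)) / 2"
      using V(1) by (intro cmod_mult_le) simp
    then show ?thesis using True by (simp add: g_def ennreal_leI)
  qed simp
  have m1: "(\<lambda>x. ennreal (cmod (T f x)) * indicator S x) \<in> borel_measurable rho"
    using Srho by (intro borel_measurable_times_ennreal measurable_compose[OF measurable_compose[OF Tm borel_measurable_norm] measurable_ennreal] borel_measurable_indicator)
  have "- S \<inter> G \<in> sets rho" using S(1) by (intro sets_rhoI) auto
  then have m2: "(\<lambda>x. ennreal (cmod (T f x)) * indicator (- S \<inter> G) x) \<in> borel_measurable rho"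
    by (intro borel_measurable_times_ennreal measurable_compose[OF measurable_compose[OF Tm borel_measurable_norm] measurable_ennreal] borel_measurable_indicator)
  have "(\<integral>\<^sup>+x. ennreal (cmod (T f x)) \<partial>rho)
      = (\<integral>\<^sup>+x. ennreal (cmod (T f x)) * indicator S x + ennreal (cmod (T f x)) * indicator (- S \<inter> G) x \<partial>rho)"
    by (rule nn_integral_cong) (auto simp: indicator_def)
  also have "\<dots> = (\<integral>\<^sup>+x. ennreal (cmod (T f x)) * indicator S x \<partial>rho) + (\<integral>\<^sup>+x. ennreal (cmod (T f x)) * indicator (- S \<inter> G) x \<partial>rho)"
    by (rule nn_integral_add[OF m1 m2])
  also have "\<dots> \<le> ennreal ((C0 + \<kappa>) / 2) + ennreal D"
  proof (rule add_mono)
    have "(\<integral>\<^sup>+x. ennreal (cmod (T f x)) * indicator S x \<partial>rho) \<le> (\<integral>\<^sup>+x. ennreal (g x) \<partial>rho)"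
      by (rule nn_integral_mono) (rule near)
    also have "\<dots> = ennreal (\<integral>x. g x \<partial>rho)" by (rule nn_integral_eq_integral[OF gi]) (simp add: g0)
    also have "\<dots> \<le> ennreal ((C0 + \<kappa>) / 2)" by (rule ennreal_leI[OF gle])
    finally show "(\<integral>\<^sup>+x. ennreal (cmod (T f x)) * indicator S x \<partial>rho) \<le> ennreal ((C0 + \<kappa>) / 2)" .
    have "AE x in rho. ennreal (cmod (T f x)) * indicator (- S \<inter> G) x
        \<le> indicator (- S) x * ennreal (cmod (\<integral>z. f z * kern i j x z \<partial>rho))"
      using T_off_support[OF ij ext l f]
    proof eventually_elim
      case (elim x)
      show ?case
      proof (cases "x \<in> S")
        case False
        then have "x \<notin> cbox l u" using S(3) by blast
        then have "cmod (T f x) = cmod (\<integral>z. f z * kern i j x z \<partial>rho)" using elim by simp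
        then show ?thesis using False by (simp add: indicator_def)
      qed simp
    qed
    then have "(\<integral>\<^sup>+x. ennreal (cmod (T f x)) * indicator (- S \<inter> G) x \<partial>rho)
        \<le> (\<integral>\<^sup>+x. indicator (- S) x * ennreal (cmod (\<integral>z. f z * kern i j x z \<partial>rho)) \<partial>rho)"
      by (rule nn_integral_mono_AE)
    then show "(\<integral>\<^sup>+x. ennreal (cmod (T f x)) * indicator (- S \<inter> G) x \<partial>rho) \<le> ennreal D" using D(2) by (rule order_trans)
  qed
  also have "\<dots> = ennreal ((C0 + \<kappa>) / 2 + D)" using C0(1) S(5) D(1) by simp
  finally show ?thesis .
qed

text \<open>The partial sums converge to f in L^1, while \<open>T\<close> is continuous in L^2 only.
  The series H of the images converges in L^1 by the uniform bound on atoms; what has to be shown is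
  that H and \<open>T f\<close> have the same pairings on each exhausting box.\<close>

lemma T_decomposition:
  assumes K: "0 \<le> K" "\<And>A. atom A \<Longrightarrow> A \<in> Lp 2 \<and> integrable rho (T A) \<and> (\<integral>x. cmod (T A x) \<partial>rho) \<le> K"
    and f: "f \<in> Lp 1" "f \<in> Lp 2" and dec: "atomic_decomp f lam A"
  shows "integrable rho (T f)" "(\<integral>x. cmod (T f x) \<partial>rho) \<le> K * (\<Sum>k. cmod (lam k))"
proof -
  have at: "atom (A k)" for k using dec by (simp add: atomic_decomp_def)
  have sl: "summable (\<lambda>k. cmod (lam k))" using dec by (simp add: atomic_decomp_def)
  have lim: "(\<lambda>n. Lp_norm 1 (\<lambda>x. f x - (\<Sum>k<n. lam k * A k x))) \<longlonglongrightarrow> 0" using dec by (simp add: atomic_decomp_def)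
  have A1: "integrable rho (A k)" for k using at[of k] by (simp add: atom_def Lp1_iff)
  have A2: "A k \<in> Lp 2" and TA: "integrable rho (T (A k))" and TAK: "(\<integral>x. cmod (T (A k) x) \<partial>rho) \<le> K" for k
    using K(2)[OF at[of k]] by blast+
  define h where "h k x = lam k * T (A k) x" for k x
  have hi: "integrable rho (h k)" for k unfolding h_def by (rule integrable_mult_right[OF TA])
  have hn: "(\<integral>x. cmod (h k x) \<partial>rho) \<le> K * cmod (lam k)" for k
  proof -
    have "(\<integral>x. cmod (h k x) \<partial>rho) = cmod (lam k) * (\<integral>x. cmod (T (A k) x) \<partial>rho)" by (simp add: h_def norm_mult)
    also have "\<dots> \<le> cmod (lam k) * K" by (intro mult_left_mono TAK) simp
    finally show ?thesis by (simp add: mult.commute)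
  qed
  have hn0: "0 \<le> (\<integral>x. cmod (h k x) \<partial>rho)" for k by (rule Bochner_Integration.integral_nonneg) simp
  have hs: "summable (\<lambda>k. \<integral>x. cmod (h k x) \<partial>rho)"
    by (rule summable_comparison_test'[OF summable_mult[OF sl, of K], of 0]) (use hn hn0 in simp)
  have AEs: "AE x in rho. summable (\<lambda>k. cmod (h k x))"
  proof -
    have hm: "(\<lambda>x. ennreal (cmod (h k x))) \<in> borel_measurable rho" for k
      using borel_measurable_integrable[OF hi[of k]] by simp
    have "(\<integral>\<^sup>+x. (\<Sum>k. ennreal (cmod (h k x))) \<partial>rho) = (\<Sum>k. \<integral>\<^sup>+x. ennreal (cmod (h k x)) \<partial>rho)"
      by (rule nn_integral_suminf[OF hm])
    also have "\<dots> = (\<Sum>k. ennreal (\<integral>x. cmod (h k x) \<partial>rho))"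
      using nn_integral_eq_integral[OF integrable_norm[OF hi]] by simp
    also have "\<dots> = ennreal (\<Sum>k. \<integral>x. cmod (h k x) \<partial>rho)" by (rule suminf_ennreal2[OF hn0 hs])
    finally have "(\<integral>\<^sup>+x. (\<Sum>k. ennreal (cmod (h k x))) \<partial>rho) \<noteq> \<infinity>" by simp
    then have "AE x in rho. (\<Sum>k. ennreal (cmod (h k x))) \<noteq> \<infinity>"
      by (rule nn_integral_noteq_infinite[rotated]) (use hm in measurable)
    then show ?thesis
      by eventually_elim (rule summable_suminf_not_top, simp_all)
  qed
  define H where "H x = (\<Sum>k. h k x)" for x
  have Hi: "integrable rho H" unfolding H_def by (rule integrable_suminf[OF hi AEs hs])
  have Hn: "(\<integral>x. cmod (H x) \<partial>rho) \<le> K * (\<Sum>k. cmod (lam k))"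
  proof -
    have ni: "integrable rho (\<lambda>x. cmod (h k x))" for k by (rule integrable_norm[OF hi])
    have AEs': "AE x in rho. summable (\<lambda>k. norm (cmod (h k x)))" using AEs by simp
    have hs': "summable (\<lambda>k. \<integral>x. norm (cmod (h k x)) \<partial>rho)" using hs by simp
    have "(\<integral>x. cmod (H x) \<partial>rho) \<le> (\<integral>x. (\<Sum>k. cmod (h k x)) \<partial>rho)"
    proof (rule integral_mono_AE)
      show "integrable rho (\<lambda>x. cmod (H x))" by (rule integrable_norm[OF Hi])
      show "integrable rho (\<lambda>x. \<Sum>k. cmod (h k x))" by (rule integrable_suminf[OF ni AEs' hs'])
      show "AE x in rho. cmod (H x) \<le> (\<Sum>k. cmod (h k x))"
        using AEs unfolding H_def by eventually_elim (rule summable_norm)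
    qed
    also have "\<dots> = (\<Sum>k. \<integral>x. cmod (h k x) \<partial>rho)" by (rule integral_suminf[OF ni AEs' hs'])
    also have "\<dots> \<le> (\<Sum>k. K * cmod (lam k))" by (rule suminf_le[OF hn hs summable_mult[OF sl]])
    also have "\<dots> = K * (\<Sum>k. cmod (lam k))" by (rule suminf_mult[OF sl])
    finally show ?thesis .
  qed
  have pair: "(\<integral>x. (T f x - H x) * \<phi> x \<partial>rho) = 0"
    if \<phi>: "\<phi> \<in> test_functions" and b: "bounded_on_box l u \<phi>" and l: "0 < snd (snd l)" for l u \<phi>
  proof -
    have \<phi>L: "\<phi> \<in> Lp 2" by (rule bounded_on_box_Lp2[OF l b])
    obtain M where M: "0 \<le> M" "\<phi> \<in> borel_measurable borel" "\<And>z. z \<notin> box l u \<Longrightarrow> \<phi> z = 0" "\<And>z. cmod (\<phi> z) \<le> M"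
      by (rule bounded_on_boxE[OF b]) (rule that)
    obtain C where C: "0 \<le> C" "\<And>z. z \<in> G \<Longrightarrow> cmod (Riesz2 j i \<phi> z) \<le> C" by (rule Riesz2_test_bounded[OF \<phi> ij]) (rule that)
    let ?V = "Riesz2 j i \<phi>"
    have \<phi>m: "\<phi> \<in> borel_measurable rho" by (rule borel_imp_rho[OF M(2)])
    have AL1: "A k \<in> Lp 1" for k using A1 by (simp add: Lp1_iff)
    have AV: "(\<integral>x. T (A k) x * \<phi> x \<partial>rho) = (\<integral>z. A k z * ?V z \<partial>rho)" "integrable rho (\<lambda>z. A k z * ?V z)" for k
      using T_adjoint[OF ij ext \<phi> \<phi>L AL1 A2] by blast+
    have fV: "(\<integral>x. T f x * \<phi> x \<partial>rho) = (\<integral>z. f z * ?V z \<partial>rho)" "integrable rho (\<lambda>z. f z * ?V z)"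
      using T_adjoint[OF ij ext \<phi> \<phi>L f] by blast+
    define F where "F n x = (\<Sum>k<n. lam k * A k x)" for n x
    have FV: "integrable rho (\<lambda>z. F n z * ?V z)" "(\<integral>z. F n z * ?V z \<partial>rho) = (\<Sum>k<n. lam k * (\<integral>x. T (A k) x * \<phi> x \<partial>rho))" for n
    proof -
      have e: "F n z * ?V z = (\<Sum>k<n. lam k * (A k z * ?V z))" for z by (simp add: F_def sum_distrib_right mult.assoc)
      show "integrable rho (\<lambda>z. F n z * ?V z)" unfolding e
        by (intro Bochner_Integration.integrable_sum integrable_mult_right AV(2))
      have "(\<integral>z. F n z * ?V z \<partial>rho) = (\<Sum>k<n. \<integral>z. lam k * (A k z * ?V z) \<partial>rho)" unfolding e
        by (intro Bochner_Integration.integral_sum integrable_mult_right AV(2))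
      then show "(\<integral>z. F n z * ?V z \<partial>rho) = (\<Sum>k<n. lam k * (\<integral>x. T (A k) x * \<phi> x \<partial>rho))" by (simp add: AV(1))
    qed
    have FL: "integrable rho (F n)" for n
      unfolding F_def by (intro Bochner_Integration.integrable_sum integrable_mult_right A1)
    \<comment> \<open>The transposed transform of \<phi> is bounded by C, so L^1 convergence of the
      partial sums is enough here.\<close>
    have "(\<lambda>n. (\<integral>z. F n z * ?V z \<partial>rho) - (\<integral>z. f z * ?V z \<partial>rho)) \<longlonglongrightarrow> 0"
    proof (rule Lim_null_comparison[OF always_eventually])
      show "(\<lambda>n. C * Lp_norm 1 (\<lambda>x. f x - F n x)) \<longlonglongrightarrow> 0"
        using tendsto_mult_right_zero[OF lim, of C] by (simp add: F_def)
      show "\<forall>n. norm ((\<integral>z. F n z * ?V z \<partial>rho) - (\<integral>z. f z * ?V z \<partial>rho)) \<le> C * Lp_norm 1 (\<lambda>x. f x - F n x)"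
      proof
        fix n
        have d: "integrable rho (\<lambda>x. f x - F n x)" using f(1) FL by (simp add: Lp1_iff)
        have "(\<integral>z. F n z * ?V z \<partial>rho) - (\<integral>z. f z * ?V z \<partial>rho) = (\<integral>z. F n z * ?V z - f z * ?V z \<partial>rho)"
          using FV(1) fV(2) by simp
        also have "cmod \<dots> \<le> (\<integral>z. C * cmod (f z - F n z) \<partial>rho)"
        proof (rule Bochner_Integration.integral_norm_bound_integral)
          show "integrable rho (\<lambda>z. F n z * ?V z - f z * ?V z)" using FV(1) fV(2) by simp
          show "integrable rho (\<lambda>z. C * cmod (f z - F n z))" by (intro integrable_mult_right integrable_norm d)
          fix z assume z: "z \<in> space rho"
          have "F n z * ?V z - f z * ?V z = - ((f z - F n z) * ?V z)" by (simp add: algebra_simps)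
          then have "cmod (F n z * ?V z - f z * ?V z) = cmod (f z - F n z) * cmod (?V z)" by (simp only: norm_minus_cancel norm_mult)
          also have "\<dots> \<le> cmod (f z - F n z) * C" using z by (intro mult_left_mono C(2)) simp_all
          finally show "cmod (F n z * ?V z - f z * ?V z) \<le> C * cmod (f z - F n z)" by (simp add: mult.commute)
        qed
        also have "\<dots> = C * Lp_norm 1 (\<lambda>x. f x - F n x)" by (simp add: Lp1_norm)
        finally show "norm ((\<integral>z. F n z * ?V z \<partial>rho) - (\<integral>z. f z * ?V z \<partial>rho)) \<le> C * Lp_norm 1 (\<lambda>x. f x - F n x)" .
      qed
    qed
    then have l1: "(\<lambda>n. \<Sum>k<n. lam k * (\<integral>x. T (A k) x * \<phi> x \<partial>rho)) \<longlonglongrightarrow> (\<integral>x. T f x * \<phi> x \<partial>rho)"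
      by (simp add: LIM_zero_iff FV(2) fV(1))
    have h\<phi>: "integrable rho (\<lambda>x. g x * \<phi> x)" "(\<integral>x. cmod (g x * \<phi> x) \<partial>rho) \<le> M * (\<integral>x. cmod (g x) \<partial>rho)" if g: "integrable rho g" for g :: "point \<Rightarrow> complex"
    proof -
      have le: "cmod (g x * \<phi> x) \<le> M * cmod (g x)" for x
        using mult_left_mono[OF M(4)[of x], of "cmod (g x)"] by (simp add: norm_mult mult.commute)
      show i: "integrable rho (\<lambda>x. g x * \<phi> x)"
      proof (rule Bochner_Integration.integrable_bound)
        show "integrable rho (\<lambda>x. M * cmod (g x))" by (intro integrable_mult_right integrable_norm g)
        show "(\<lambda>x. g x * \<phi> x) \<in> borel_measurable rho" by (intro borel_measurable_times borel_measurable_integrable[OF g] \<phi>m)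
        show "AE x in rho. norm (g x * \<phi> x) \<le> norm (M * cmod (g x))" using le M(1) by (intro AE_I2) (simp add: abs_mult)
      qed
      have "(\<integral>x. cmod (g x * \<phi> x) \<partial>rho) \<le> (\<integral>x. M * cmod (g x) \<partial>rho)"
        using le by (intro integral_mono integrable_norm i integrable_mult_right g)
      then show "(\<integral>x. cmod (g x * \<phi> x) \<partial>rho) \<le> M * (\<integral>x. cmod (g x) \<partial>rho)" by simp
    qed
    have s2: "summable (\<lambda>k. \<integral>x. norm (h k x * \<phi> x) \<partial>rho)"
      by (rule summable_comparison_test'[OF summable_mult[OF hs, of M], of 0])
        (use h\<phi>(2)[OF hi] in \<open>simp add: Bochner_Integration.integral_nonneg\<close>)
    have AE2: "AE x in rho. summable (\<lambda>k. norm (h k x * \<phi> x))"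
      using AEs by eventually_elim (simp add: norm_mult summable_mult2)
    \<comment> \<open>Here the boundedness of \<phi> itself lets the series H be integrated term by
      term.\<close>
    have "(\<integral>x. (\<Sum>k. h k x * \<phi> x) \<partial>rho) = (\<Sum>k. \<integral>x. h k x * \<phi> x \<partial>rho)"
      by (rule integral_suminf[OF h\<phi>(1)[OF hi] AE2 s2])
    moreover have "summable (\<lambda>k. \<integral>x. h k x * \<phi> x \<partial>rho)"
      by (rule summable_integral[OF h\<phi>(1)[OF hi] AE2 s2])
    ultimately have "(\<lambda>k. \<integral>x. h k x * \<phi> x \<partial>rho) sums (\<integral>x. (\<Sum>k. h k x * \<phi> x) \<partial>rho)"
      by (simp add: summable_sums)
    moreover have "(\<integral>x. (\<Sum>k. h k x * \<phi> x) \<partial>rho) = (\<integral>x. H x * \<phi> x \<partial>rho)"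
    proof (rule integral_cong_AE)
      show "AE x in rho. (\<Sum>k. h k x * \<phi> x) = H x * \<phi> x"
        using AEs unfolding H_def by eventually_elim (rule suminf_mult2[symmetric], rule summable_norm_cancel)
      show "(\<lambda>x. \<Sum>k. h k x * \<phi> x) \<in> borel_measurable rho"
        by (rule borel_measurable_integrable[OF integrable_suminf[OF h\<phi>(1)[OF hi] AE2 s2]])
      show "(\<lambda>x. H x * \<phi> x) \<in> borel_measurable rho" by (rule borel_measurable_integrable[OF h\<phi>(1)[OF Hi]])
    qed
    moreover have "(\<integral>x. h k x * \<phi> x \<partial>rho) = lam k * (\<integral>x. T (A k) x * \<phi> x \<partial>rho)" for k
      by (simp add: h_def mult.assoc)
    ultimately have l2: "(\<lambda>n. \<Sum>k<n. lam k * (\<integral>x. T (A k) x * \<phi> x \<partial>rho)) \<longlonglongrightarrow> (\<integral>x. H x * \<phi> x \<partial>rho)"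
      by (simp add: sums_def)
    have "(\<integral>x. T f x * \<phi> x \<partial>rho) = (\<integral>x. H x * \<phi> x \<partial>rho)" using l1 l2 by (rule LIMSEQ_unique)
    moreover have "(\<integral>x. (T f x - H x) * \<phi> x \<partial>rho) = (\<integral>x. T f x * \<phi> x \<partial>rho) - (\<integral>x. H x * \<phi> x \<partial>rho)"
      unfolding left_diff_distrib
      by (intro Bochner_Integration.integral_diff Lp2_mult_integrable T_Lp2[OF ij ext] f \<phi>L h\<phi>(1)[OF Hi])
    ultimately show ?thesis by simp
  qed
  have Tm: "T f \<in> borel_measurable rho" using T_Lp2[OF ij ext f(2)] by (simp add: Lp2_iff)
  have vm: "(\<lambda>x. T f x - H x) \<in> borel_measurable rho" by (intro borel_measurable_diff Tm borel_measurable_integrable[OF Hi])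
  have "AE x in rho. x \<in> box (exl n) (exu n) \<longrightarrow> T f x - H x = 0" for n
  proof (rule AE_zero_on_box[OF exl_pos vm])
    have I: "bounded_on_box (exl n) (exu n) (indicator (box (exl n) (exu n)))"
      by (rule bounded_on_boxI[where M=1]) (simp_all add: indicator_def)
    have "integrable rho (\<lambda>x. T f x * indicator (box (exl n) (exu n)) x)"
      by (rule Lp2_mult_integrable[OF T_Lp2[OF ij ext f(2)] bounded_on_box_Lp2[OF exl_pos I]])
    moreover have "integrable rho (\<lambda>x. H x * indicator (box (exl n) (exu n)) x)"
    proof (rule Bochner_Integration.integrable_bound[OF Hi])
      show "(\<lambda>x. H x * indicator (box (exl n) (exu n)) x) \<in> borel_measurable rho"
        using I by (intro borel_measurable_times borel_measurable_integrable[OF Hi] borel_imp_rho) (simp add: bounded_on_box_def)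
    qed (simp add: indicator_def)
    ultimately have "integrable rho (\<lambda>x. T f x * indicator (box (exl n) (exu n)) x - H x * indicator (box (exl n) (exu n)) x)"
      by (rule Bochner_Integration.integrable_diff)
    moreover have "T f x * indicator (box (exl n) (exu n)) x - H x * indicator (box (exl n) (exu n)) x = indicator (box (exl n) (exu n)) x *\<^sub>R (T f x - H x)" for x
      by (simp add: indicator_def)
    ultimately show "integrable rho (\<lambda>x. indicator (box (exl n) (exu n)) x *\<^sub>R (T f x - H x))" by simp
  qed (rule pair[OF _ _ exl_pos])
  then have "AE x in rho. \<forall>n. x \<in> box (exl n) (exu n) \<longrightarrow> T f x - H x = 0"
    by (intro AE_all_countable[THEN iffD2] allI)
  moreover have "AE x in rho. x \<in> G" by (rule AE_I2) simp
  ultimately have eq: "AE x in rho. H x = T f x"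
  proof eventually_elim
    case (elim x)
    obtain n where "x \<in> box (exl n) (exu n)" using eventually_happens[OF ex_box_eventually[OF elim(2)]] by auto
    then have "T f x - H x = 0" using elim(1) by blast
    then show ?case by simp
  qed
  show "integrable rho (T f)" by (rule integrable_cong_AE_imp[OF Hi Tm eq])
  have "(\<integral>x. cmod (T f x) \<partial>rho) = (\<integral>x. cmod (H x) \<partial>rho)"
    using eq borel_measurable_integrable[OF Hi] Tm by (intro integral_cong_AE) (auto elim!: eventually_mono)
  then show "(\<integral>x. cmod (T f x) \<partial>rho) \<le> K * (\<Sum>k. cmod (lam k))" using Hn by simp
qed

end

context
  fixes i j :: nat and T :: "(point \<Rightarrow> complex) \<Rightarrow> point \<Rightarrow> complex"
  assumes ij: "i \<in> {0, 1, 2}" "j \<in> {0, 1, 2}" and ext: "L2_extension_Riesz2 i j T"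
begin

text \<open>Both geometric cases feed the same localized estimate, with S the parallelepiped in one
  and the double ball in the other; the larger of the two kernel constants serves both.\<close>

lemma T_atoms:
  obtains K where "0 \<le> K" "\<And>A. atom A \<Longrightarrow> A \<in> Lp 2 \<and> integrable rho (T A) \<and> (\<integral>x. cmod (T A x) \<partial>rho) \<le> K"
proof -
  obtain C0 where C0: "0 \<le> C0" "\<And>f. f \<in> Lp 2 \<Longrightarrow> sq_int (T f) \<le> C0 * sq_int f" by (rule T_sq_bound[OF ij ext]) (rule that)
  obtain \<kappa> where \<kappa>: "0 \<le> \<kappa>"
    and geo: "\<And>R. CZ_set R \<Longrightarrow> \<exists>l u. R = cbox l u \<and> 0 < snd (snd l) \<and> 0 < measure rho R \<and>
       ((\<exists>S. S \<in> sets borel \<and> S \<subseteq> G \<and> R \<subseteq> S \<and> emeasure rho S \<le> ennreal (\<kappa> * measure rho R) \<and>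
           (\<forall>x\<in>G. x \<notin> S \<longrightarrow> (\<forall>z\<in>R. snd (snd z) / 2 \<le> norm (x - z)))) \<or>
        (\<exists>c s. c \<in> G \<and> 0 < s \<and> s < snd (snd c) \<and> R \<subseteq> cball c s \<and> cball c (2 * s) \<subseteq> G \<and>
           emeasure rho (cball c (2 * s)) \<le> ennreal (\<kappa> * measure rho R)))"
    by (rule CZ_set_geometry) (rule that)
  show ?thesis
  proof (rule nn_integral_kern_far[OF ij], rule nn_integral_kern_cancel[OF ij])
    fix D1 D2 :: real
    assume D1: "0 \<le> D1" and far:
      "\<And>l u f V S. 0 < snd (snd l) \<Longrightarrow> bounded_on_box l u f \<Longrightarrow> 0 < V \<Longrightarrow> (\<And>z. cmod (f z) \<le> 1 / V) \<Longrightarrow>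
        measure rho (box l u) = V \<Longrightarrow>
        (\<And>x z. x \<in> G \<Longrightarrow> x \<notin> S \<Longrightarrow> z \<in> cbox l u \<Longrightarrow> snd (snd z) / 2 \<le> norm (x - z)) \<Longrightarrow>
        (\<integral>\<^sup>+x. indicator (- S) x * ennreal (cmod (\<integral>z. f z * kern i j x z \<partial>rho)) \<partial>rho) \<le> ennreal D1"
    assume D2: "0 \<le> D2" and cancel:
      "\<And>l u f V c s. 0 < snd (snd l) \<Longrightarrow> bounded_on_box l u f \<Longrightarrow> 0 < V \<Longrightarrow> (\<And>z. cmod (f z) \<le> 1 / V) \<Longrightarrow>
        measure rho (box l u) = V \<Longrightarrow> (\<integral>z. f z \<partial>rho) = 0 \<Longrightarrow> c \<in> G \<Longrightarrow> 0 < s \<Longrightarrow> s < snd (snd c) \<Longrightarrow>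
        cbox l u \<subseteq> cball c s \<Longrightarrow>
        (\<integral>\<^sup>+x. indicator (- cball c (2 * s)) x * ennreal (cmod (\<integral>z. f z * kern i j x z \<partial>rho)) \<partial>rho) \<le> ennreal D2"
    show ?thesis
    proof (rule that[of "(C0 + \<kappa>) / 2 + max D1 D2"])
      show "0 \<le> (C0 + \<kappa>) / 2 + max D1 D2" using C0(1) \<kappa> D1 by simp
      fix A assume A: "atom A"
      then have AL: "A \<in> Lp 1" and mean: "(\<integral>x. A x \<partial>rho) = 0" by (simp_all add: atom_def)
      obtain R where R: "CZ_set R" "AE x in rho. x \<notin> R \<longrightarrow> A x = 0" "AE x in rho. cmod (A x) \<le> 1 / measure rho R"
        using A unfolding atom_def by blast
      have Am: "A \<in> borel_measurable rho" using AL by (simp add: Lp_def)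
      define V where "V = measure rho R"
      obtain l u where lu: "R = cbox l u" "0 < snd (snd l)" "0 < V" and
        cases: "(\<exists>S. S \<in> sets borel \<and> S \<subseteq> G \<and> R \<subseteq> S \<and> emeasure rho S \<le> ennreal (\<kappa> * V) \<and>
             (\<forall>x\<in>G. x \<notin> S \<longrightarrow> (\<forall>z\<in>R. snd (snd z) / 2 \<le> norm (x - z)))) \<or>
          (\<exists>c s. c \<in> G \<and> 0 < s \<and> s < snd (snd c) \<and> R \<subseteq> cball c s \<and> cball c (2 * s) \<subseteq> G \<and>
             emeasure rho (cball c (2 * s)) \<le> ennreal (\<kappa> * V))"
        using geo[OF R(1), folded V_def] by (elim exE conjE) (rule that)
      have CG: "cbox l u \<subseteq> G" by (rule cbox_subset_G[OF lu(2)])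
      have BG: "box l u \<subseteq> G" using CG box_subset_cbox[of l u] by (rule order_trans[rotated])
      have mV: "measure rho (box l u) = V"
        unfolding V_def lu(1)
      proof (rule measure_eq_AE)
        show "AE x in rho. (x \<in> box l u) = (x \<in> cbox l u)"
          using AE_cbox_box[of l u] by eventually_elim (use box_subset_cbox[of l u] in blast)
        show "box l u \<in> sets rho" "cbox l u \<in> sets rho" using BG CG by (simp_all add: sets_rhoI)
      qed
      \<comment> \<open>The conditions on an atom hold almost everywhere only; f is a representative
        that is Borel, vanishes off the open box and obeys the bound everywhere.\<close>
      define g where "g z = indicator (box l u) z *\<^sub>R A z" for z
      define f where "f z = (if cmod (g z) \<le> 1 / V then g z else 0)" for z
      have gm: "g \<in> borel_measurable borel"
        unfolding g_def by (rule rho_measurable_indicator[OF Am _ BG]) simp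
      have fm: "f \<in> borel_measurable borel"
      proof -
        have "{z. cmod (g z) \<le> 1 / V} \<in> sets borel"
          using borel_measurable_le[OF measurable_compose[OF gm borel_measurable_norm] borel_measurable_const[of "1 / V"]] by simp
        then show ?thesis unfolding f_def using gm by (intro measurable_If) (simp_all add: pred_def)
      qed
      have fV: "cmod (f z) \<le> 1 / V" for z using lu(3) by (simp add: f_def)
      have fb: "bounded_on_box l u f"
        by (rule bounded_on_boxI[OF fm _ fV]) (simp add: f_def g_def)
      have fL: "f \<in> Lp 2" by (rule bounded_on_box_Lp2[OF lu(2) fb])
      have eq: "AE x in rho. f x = A x"
        using R(2,3) AE_cbox_box[of l u]
      proof eventually_elim
        case (elim x)
        then show ?case by (cases "x \<in> box l u") (auto simp: f_def g_def V_def lu(1))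
      qed
      have "integrable rho (\<lambda>x. (cmod (A x))\<^sup>2)"
      proof (rule integrable_cong_AE_imp)
        show "integrable rho (\<lambda>x. (cmod (f x))\<^sup>2)" using fL by (simp add: Lp2_iff)
        show "(\<lambda>x. (cmod (A x))\<^sup>2) \<in> borel_measurable rho" using Am by simp
        show "AE x in rho. (cmod (f x))\<^sup>2 = (cmod (A x))\<^sup>2" using eq by eventually_elim simp
      qed
      then have AL2: "A \<in> Lp 2" using Am by (simp add: Lp2_iff)
      have f0: "(\<integral>x. f x \<partial>rho) = 0"
        using integral_cong_AE[OF borel_imp_rho[OF fm] Am eq] mean by simp
      note loc = T_localized_bound[OF ij ext C0 lu(2) fb lu(3) mV fV]
      have nn: "(\<integral>\<^sup>+x. ennreal (cmod (T f x)) \<partial>rho) \<le> ennreal ((C0 + \<kappa>) / 2 + max D1 D2)"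
        using cases
      proof (elim disjE exE conjE)
        fix S assume S: "S \<in> sets borel" "S \<subseteq> G" "R \<subseteq> S" "emeasure rho S \<le> ennreal (\<kappa> * V)"
          "\<forall>x\<in>G. x \<notin> S \<longrightarrow> (\<forall>z\<in>R. snd (snd z) / 2 \<le> norm (x - z))"
        have "(\<integral>\<^sup>+x. indicator (- S) x * ennreal (cmod (\<integral>z. f z * kern i j x z \<partial>rho)) \<partial>rho) \<le> ennreal D1"
          by (rule far[OF lu(2) fb lu(3) fV mV]) (use S(5) lu(1) in simp)
        also have "\<dots> \<le> ennreal (max D1 D2)" by (rule ennreal_leI) simp
        finally show ?thesis using D1 S \<kappa> lu(1) by (intro loc[of S]) simp_all
      next
        fix c s assume c: "c \<in> G" "0 < s" "s < snd (snd c)" "R \<subseteq> cball c s" "cball c (2 * s) \<subseteq> G"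
             "emeasure rho (cball c (2 * s)) \<le> ennreal (\<kappa> * V)"
        have "(\<integral>\<^sup>+x. indicator (- cball c (2 * s)) x * ennreal (cmod (\<integral>z. f z * kern i j x z \<partial>rho)) \<partial>rho) \<le> ennreal D2"
          by (rule cancel[OF lu(2) fb lu(3) fV mV f0 c(1,2,3)]) (use c(4) lu(1) in simp)
        also have "\<dots> \<le> ennreal (max D1 D2)" by (rule ennreal_leI) simp
        finally have I: "(\<integral>\<^sup>+x. indicator (- cball c (2 * s)) x * ennreal (cmod (\<integral>z. f z * kern i j x z \<partial>rho)) \<partial>rho) \<le> ennreal (max D1 D2)" .
        have "cball c s \<subseteq> cball c (2 * s)" using c(2) by (intro subset_cball) simp
        then have "cbox l u \<subseteq> cball c (2 * s)" using c(4) lu(1) by (metis order_trans)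
        then show ?thesis using D1 c(5,6) \<kappa> I by (intro loc[of "cball c (2 * s)"]) simp_all
      qed
      have TfL: "T f \<in> Lp 2" "T A \<in> Lp 2" using T_Lp2[OF ij ext] fL AL2 by simp_all
      have "(\<integral>\<^sup>+x. ennreal (cmod (T A x)) \<partial>rho) = (\<integral>\<^sup>+x. ennreal (cmod (T f x)) \<partial>rho)"
        by (rule nn_integral_cong_AE) (use T_cong[OF ij ext fL AL2 eq] in \<open>auto elim!: eventually_mono\<close>)
      with nn have nA: "(\<integral>\<^sup>+x. ennreal (cmod (T A x)) \<partial>rho) \<le> ennreal ((C0 + \<kappa>) / 2 + max D1 D2)" by simp
      have TAi: "integrable rho (T A)"
      proof (rule integrableI_bounded)
        show "T A \<in> borel_measurable rho" using TfL(2) by (simp add: Lp2_iff)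
        show "(\<integral>\<^sup>+x. ennreal (norm (T A x)) \<partial>rho) < \<infinity>" using nA by (rule le_less_trans) simp
      qed
      have "ennreal (\<integral>x. cmod (T A x) \<partial>rho) \<le> ennreal ((C0 + \<kappa>) / 2 + max D1 D2)"
        using nn_integral_eq_integral[OF integrable_norm[OF TAi]] nA by simp
      then have "(\<integral>x. cmod (T A x) \<partial>rho) \<le> (C0 + \<kappa>) / 2 + max D1 D2"
        using C0(1) \<kappa> D1 by (subst (asm) ennreal_le_iff) simp_all
      then show "A \<in> Lp 2 \<and> integrable rho (T A) \<and> (\<integral>x. cmod (T A x) \<partial>rho) \<le> (C0 + \<kappa>) / 2 + max D1 D2"
        using AL2 TAi by simp
    qed
  qed
qed

text \<open>The bound holds with the same K for every atomic decomposition of f, so it passes to the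
  infimum.\<close>

lemma T_bounded_H1_L1: "bounded_H1_L1 T"
proof -
  obtain K where K: "0 \<le> K" "\<And>A. atom A \<Longrightarrow> A \<in> Lp 2 \<and> integrable rho (T A) \<and> (\<integral>x. cmod (T A x) \<partial>rho) \<le> K"
    by (rule T_atoms) (rule that)
  show ?thesis unfolding bounded_H1_L1_def
  \<comment> \<open>K may be 0; adding 1 permits division.\<close>
  proof (intro exI[of _ "K + 1"] ballI)
    fix f assume f: "f \<in> H1 \<inter> Lp 2"
    then have f1: "f \<in> Lp 1" and f2: "f \<in> Lp 2" and ex: "\<exists>l A. atomic_decomp f l A" by (simp_all add: H1_def)
    obtain l0 A0 where d0: "atomic_decomp f l0 A0" using ex by blast
    have Ti: "integrable rho (T f)" by (rule T_decomposition(1)[OF ij ext K f1 f2 d0])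
    have "(\<integral>x. cmod (T f x) \<partial>rho) / (K + 1) \<le> H1_norm f"
      unfolding H1_norm_def
    proof (rule cInf_greatest)
      show "{(\<Sum>j. cmod (l j)) | l A. atomic_decomp f l A} \<noteq> {}" using d0 by blast
      fix y assume "y \<in> {(\<Sum>j. cmod (l j)) | l A. atomic_decomp f l A}"
      then obtain l A where y: "y = (\<Sum>j. cmod (l j))" and d: "atomic_decomp f l A" by blast
      have y0: "0 \<le> y" unfolding y using d by (intro suminf_nonneg) (simp_all add: atomic_decomp_def)
      have "(\<integral>x. cmod (T f x) \<partial>rho) \<le> K * y" unfolding y by (rule T_decomposition(2)[OF ij ext K f1 f2 d])
      also have "\<dots> \<le> (K + 1) * y" using y0 by (intro mult_right_mono) simp_all
      finally show "(\<integral>x. cmod (T f x) \<partial>rho) / (K + 1) \<le> y" using K(1) by (simp add: divide_le_eq mult.commute)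
    qed
    then show "T f \<in> Lp 1 \<and> Lp_norm 1 (T f) \<le> (K + 1) * H1_norm f"
      using K(1) Ti by (simp add: Lp1_iff Lp1_norm divide_le_eq mult.commute)
  qed
qed

end

theorem mainTheorem4:
  fixes i j :: nat and T :: "(point \<Rightarrow> complex) \<Rightarrow> point \<Rightarrow> complex"
  assumes "i \<in> {0, 1, 2}" and "j \<in> {0, 1, 2}"
    and "L2_extension_Riesz2 i j T"
  shows "bounded_H1_L1 T"
  using assms by (rule T_bounded_H1_L1)

end
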